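(* Let $M$ be an $\mathcal A_t$-module. (1) $M$ is exceptional if and only if $M$ is indecomposable, thin and $\mathrm{rk}(M)=1$. (2) $M$ is $2$-spherical if and only if $M$ is indecomposable, thin and $\mathrm{rk}(M)=0$.
   Context: Let $k$ be an algebraically closed field and $t\ge1$ an integer. $\mathcal A_t$ is the finite-dimensional $k$-algebra given by the quiver with vertices $1,\dots,t$ and arrows $\alpha_i\colon i\to i+1$, $\beta_i\colon i+1\to i$ for $1\le i\le t-1$, bound by the relations $\beta_1\alpha_1=0$ at vertex $1$ and $\alpha_{i-1}\beta_{i-1}=\beta_i\alpha_i$ at the vertices $i=2,\dots,t-1$ (arrows are composed from right to left; there is no relation at vertex $t$). It has finite global dimension (at most $2$). Modules are finite-dimensional left modules, i.e. representations of this bound quiver; $M_i$ denotes the vector space of $M$ at vertex $i$ and $\underline{\dim}(M)=(\dim M_1,\dots,\dim M_t)$. The rank of $M$ is $\mathrm{rk}\,M=\dim M_t$. $M$ is thin if all entries of $\underline{\dim}(M)$ are $0$ or $1$. $D^b(\mathcal A_t)$ is the bounded derived category of finite-dimensional modules and $\mathsf S$ its Serre functor (the derived Nakayama functor). For objects $A,B$ write $\mathrm{Hom}^\bullet(A,B)=\bigoplus_{i\in\mathbb Z}\mathrm{Hom}(A,B[i])[-i]$. An object $M$ is exceptional if $\mathrm{Hom}^\bullet(M,M)=k$ (concentrated in degree $0$), and $e$-spherical if $\mathsf S(M)\cong M[e]$ and $\mathrm{Hom}^\bullet(M,M)=k\oplus k[-e]$. *)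

theory Defs
  imports
    "Jordan_Normal_Form.Matrix"
    "HOL-Computational_Algebra.Polynomial"
    "HOL-Library.FuncSet"
begin

section \<open>Modules over the bound quiver algebra\<close>

text \<open>
  A finite-dimensional representation is given in coordinates: the space at vertex \<open>i\<close> is
  \<open>k^(dimv M i)\<close>, and the arrows act by matrices on column vectors, \<open>\<alpha>\<^sub>i : i \<rightarrow> i+1\<close> by
  \<open>arrA M i\<close> and \<open>\<beta>\<^sub>i : i+1 \<rightarrow> i\<close> by \<open>arrB M i\<close>.  Outside the vertices \<open>1, \<dots>, t\<close> all
  spaces are \<open>0\<close>.  Hence a matrix indexed by a vertex (or by an arrow) that does not exist is the
  unique matrix of its shape, and equality of functions \<open>nat \<Rightarrow> 'k mat\<close> is equality of
  morphisms.
\<close>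

record 'k rep =
  dimv :: "nat \<Rightarrow> nat"
  arrA :: "nat \<Rightarrow> 'k mat"
  arrB :: "nat \<Rightarrow> 'k mat"

definition is_module :: "nat \<Rightarrow> 'k::field rep \<Rightarrow> bool" where
  "is_module t M \<longleftrightarrow>
     (\<forall>i. i \<notin> {1..t} \<longrightarrow> dimv M i = 0) \<and>
     (\<forall>i. arrA M i \<in> carrier_mat (dimv M (i + 1)) (dimv M i)) \<and>
     (\<forall>i. arrB M i \<in> carrier_mat (dimv M i) (dimv M (i + 1))) \<and>
     (2 \<le> t \<longrightarrow> arrB M 1 * arrA M 1 = 0\<^sub>m (dimv M 1) (dimv M 1)) \<and>
     (\<forall>i. 2 \<le> i \<and> i \<le> t - 1 \<longrightarrow> arrA M (i - 1) * arrB M (i - 1) = arrB M i * arrA M i)"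

type_synonym 'k hom = "nat \<Rightarrow> 'k mat"

definition is_hom :: "nat \<Rightarrow> 'k::field rep \<Rightarrow> 'k rep \<Rightarrow> 'k hom \<Rightarrow> bool" where
  "is_hom t M N f \<longleftrightarrow>
     (\<forall>i. f i \<in> carrier_mat (dimv N i) (dimv M i)) \<and>
     (\<forall>i. 1 \<le> i \<and> i < t \<longrightarrow>
        f (i + 1) * arrA M i = arrA N i * f i \<and>
        f i * arrB M i = arrB N i * f (i + 1))"

definition homs :: "nat \<Rightarrow> 'k::field rep \<Rightarrow> 'k rep \<Rightarrow> 'k hom set" where
  "homs t M N = {f. is_hom t M N f}"

definition hom_id :: "'k::field rep \<Rightarrow> 'k hom" where
  "hom_id M = (\<lambda>i. 1\<^sub>m (dimv M i))"

definition hom_comp :: "'k::field hom \<Rightarrow> 'k hom \<Rightarrow> 'k hom"  (infixl "\<circ>\<^sub>h" 70) where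
  "g \<circ>\<^sub>h f = (\<lambda>i. g i * f i)"

definition hom_add :: "'k::field hom \<Rightarrow> 'k hom \<Rightarrow> 'k hom"  (infixl "+\<^sub>h" 65) where
  "f +\<^sub>h g = (\<lambda>i. f i + g i)"

definition hom_smult :: "'k::field \<Rightarrow> 'k hom \<Rightarrow> 'k hom"  (infixr "\<cdot>\<^sub>h" 75) where
  "c \<cdot>\<^sub>h f = (\<lambda>i. c \<cdot>\<^sub>m f i)"

definition hom_zero :: "'k::field rep \<Rightarrow> 'k rep \<Rightarrow> 'k hom" where
  "hom_zero M N = (\<lambda>i. 0\<^sub>m (dimv N i) (dimv M i))"

definition zero_rep :: "'k::field rep" where
  "zero_rep = \<lparr>dimv = (\<lambda>i. 0), arrA = (\<lambda>i. 0\<^sub>m 0 0), arrB = (\<lambda>i. 0\<^sub>m 0 0)\<rparr>"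

definition is_zero_rep :: "'k::field rep \<Rightarrow> bool" where
  "is_zero_rep M \<longleftrightarrow> (\<forall>i. dimv M i = 0)"

definition rep_iso :: "nat \<Rightarrow> 'k::field rep \<Rightarrow> 'k rep \<Rightarrow> bool" where
  "rep_iso t M N \<longleftrightarrow>
     (\<exists>f g. is_hom t M N f \<and> is_hom t N M g \<and> g \<circ>\<^sub>h f = hom_id M \<and> f \<circ>\<^sub>h g = hom_id N)"

definition direct_sum :: "'k::field rep \<Rightarrow> 'k rep \<Rightarrow> 'k rep" where
  "direct_sum M N =
     \<lparr>dimv = (\<lambda>i. dimv M i + dimv N i),
      arrA = (\<lambda>i. four_block_mat (arrA M i) (0\<^sub>m (dimv M (i + 1)) (dimv N i))
                                 (0\<^sub>m (dimv N (i + 1)) (dimv M i)) (arrA N i)),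
      arrB = (\<lambda>i. four_block_mat (arrB M i) (0\<^sub>m (dimv M i) (dimv N (i + 1)))
                                 (0\<^sub>m (dimv N i) (dimv M (i + 1))) (arrB N i))\<rparr>"

definition indecomposable :: "nat \<Rightarrow> 'k::field rep \<Rightarrow> bool" where
  "indecomposable t M \<longleftrightarrow>
     \<not> is_zero_rep M \<and>
     \<not> (\<exists>M1 M2. is_module t M1 \<and> is_module t M2 \<and> \<not> is_zero_rep M1 \<and> \<not> is_zero_rep M2 \<and>
          rep_iso t M (direct_sum M1 M2))"

definition thin :: "nat \<Rightarrow> 'k::field rep \<Rightarrow> bool" where
  "thin t M \<longleftrightarrow> (\<forall>i\<in>{1..t}. dimv M i \<in> {0, 1})"

definition rk :: "nat \<Rightarrow> 'k::field rep \<Rightarrow> nat" where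
  "rk t M = dimv M t"

definition epi :: "'k::field rep \<Rightarrow> 'k rep \<Rightarrow> 'k hom \<Rightarrow> bool" where
  "epi M N g \<longleftrightarrow>
     (\<forall>i. \<forall>y\<in>carrier_vec (dimv N i). \<exists>x\<in>carrier_vec (dimv M i). g i *\<^sub>v x = y)"

definition projective :: "nat \<Rightarrow> 'k::field rep \<Rightarrow> bool" where
  "projective t P \<longleftrightarrow> is_module t P \<and>
     (\<forall>M N g f. is_module t M \<and> is_module t N \<and> is_hom t M N g \<and> epi M N g \<and> is_hom t P N f \<longrightarrow>
        (\<exists>h. is_hom t P M h \<and> g \<circ>\<^sub>h h = f))"


section \<open>Bounded complexes\<close>

record 'k cpx =
  obj :: "int \<Rightarrow> 'k rep"
  dif :: "int \<Rightarrow> 'k hom"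

definition is_cpx :: "nat \<Rightarrow> 'k::field cpx \<Rightarrow> bool" where
  "is_cpx t X \<longleftrightarrow>
     (\<forall>n. is_module t (obj X n)) \<and>
     (\<forall>n. is_hom t (obj X n) (obj X (n + 1)) (dif X n)) \<and>
     (\<forall>n. dif X (n + 1) \<circ>\<^sub>h dif X n = hom_zero (obj X n) (obj X (n + 2))) \<and>
     (\<exists>a b. \<forall>n. n < a \<or> b < n \<longrightarrow> is_zero_rep (obj X n))"

definition stalk :: "'k::field rep \<Rightarrow> 'k cpx" where
  "stalk M =
     (let X = (\<lambda>n::int. if n = 0 then M else zero_rep)
      in \<lparr>obj = X, dif = (\<lambda>n. hom_zero (X n) (X (n + 1)))\<rparr>)"

definition shift :: "int \<Rightarrow> 'k::field cpx \<Rightarrow> 'k cpx" where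
  "shift m X =
     \<lparr>obj = (\<lambda>n. obj X (n + m)), dif = (\<lambda>n. ((-1) powi m) \<cdot>\<^sub>h dif X (n + m))\<rparr>"

type_synonym 'k chom = "int \<Rightarrow> 'k hom"

definition is_chom :: "nat \<Rightarrow> 'k::field cpx \<Rightarrow> 'k cpx \<Rightarrow> 'k chom \<Rightarrow> bool" where
  "is_chom t X Y f \<longleftrightarrow>
     (\<forall>n. is_hom t (obj X n) (obj Y n) (f n)) \<and>
     (\<forall>n. f (n + 1) \<circ>\<^sub>h dif X n = dif Y n \<circ>\<^sub>h f n)"

definition chom_id :: "'k::field cpx \<Rightarrow> 'k chom" where
  "chom_id X = (\<lambda>n. hom_id (obj X n))"

definition chom_comp :: "'k::field chom \<Rightarrow> 'k chom \<Rightarrow> 'k chom"  (infixl "\<circ>\<^sub>c" 70) where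
  "g \<circ>\<^sub>c f = (\<lambda>n. g n \<circ>\<^sub>h f n)"

definition homotopic :: "nat \<Rightarrow> 'k::field cpx \<Rightarrow> 'k cpx \<Rightarrow> 'k chom \<Rightarrow> 'k chom \<Rightarrow> bool" where
  "homotopic t X Y f g \<longleftrightarrow>
     (\<exists>h. (\<forall>n. is_hom t (obj X n) (obj Y (n - 1)) (h n)) \<and>
          (\<forall>n. f n = g n +\<^sub>h (dif Y (n - 1) \<circ>\<^sub>h h n +\<^sub>h h (n + 1) \<circ>\<^sub>h dif X n)))"

definition cocycles :: "'k::field cpx \<Rightarrow> int \<Rightarrow> nat \<Rightarrow> 'k vec set" where
  "cocycles X n i =
     {x \<in> carrier_vec (dimv (obj X n) i). dif X n i *\<^sub>v x = 0\<^sub>v (dimv (obj X (n + 1)) i)}"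

definition coboundaries :: "'k::field cpx \<Rightarrow> int \<Rightarrow> nat \<Rightarrow> 'k vec set" where
  "coboundaries X n i =
     (\<lambda>x. dif X (n - 1) i *\<^sub>v x) ` carrier_vec (dimv (obj X (n - 1)) i)"

text \<open>
  The last two conjuncts say that the map \<open>H\<^sup>n(X)\<^sub>i \<rightarrow> H\<^sup>n(Y)\<^sub>i\<close> induced by \<open>f\<close> on
  cocycles modulo coboundaries is injective and surjective.
\<close>

definition quasi_iso :: "nat \<Rightarrow> 'k::field cpx \<Rightarrow> 'k cpx \<Rightarrow> 'k chom \<Rightarrow> bool" where
  "quasi_iso t X Y f \<longleftrightarrow> is_chom t X Y f \<and>
     (\<forall>n i. \<forall>x\<in>cocycles X n i. f n i *\<^sub>v x \<in> coboundaries Y n i \<longrightarrow> x \<in> coboundaries X n i) \<and>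
     (\<forall>n i. \<forall>y\<in>cocycles Y n i. \<exists>x\<in>cocycles X n i. \<exists>b\<in>coboundaries Y n i. y = f n i *\<^sub>v x + b)"


section \<open>The bounded derived category\<close>

text \<open>
  The bounded derived category is the localization of the homotopy category of bounded complexes
  at the quasi-isomorphisms.  A morphism \<open>X \<rightarrow> Y\<close> is represented by a roof \<open>(Z, s, f)\<close>
  with a quasi-isomorphism \<open>s : Z \<rightarrow> X\<close> and a chain map \<open>f : Z \<rightarrow> Y\<close>, standing for
  \<open>f s\<^sup>-\<^sup>1\<close>, and two roofs represent the same morphism iff they become homotopic on a
  common refinement.
\<close>

type_synonym 'k droof = "'k cpx \<times> 'k chom \<times> 'k chom"

definition is_roof :: "nat \<Rightarrow> 'k::field cpx \<Rightarrow> 'k cpx \<Rightarrow> 'k droof \<Rightarrow> bool" where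
  "is_roof t X Y r \<longleftrightarrow>
     (case r of (Z, s, f) \<Rightarrow> is_cpx t Z \<and> quasi_iso t Z X s \<and> is_chom t Z Y f)"

definition roof_eq :: "nat \<Rightarrow> 'k::field cpx \<Rightarrow> 'k cpx \<Rightarrow> 'k droof \<Rightarrow> 'k droof \<Rightarrow> bool" where
  "roof_eq t X Y r r' \<longleftrightarrow>
     (case r of (Z, s, f) \<Rightarrow> case r' of (Z', s', f') \<Rightarrow>
       \<exists>W a b. is_cpx t W \<and> is_chom t W Z a \<and> is_chom t W Z' b \<and>
         quasi_iso t W X (s \<circ>\<^sub>c a) \<and>
         homotopic t W X (s \<circ>\<^sub>c a) (s' \<circ>\<^sub>c b) \<and>
         homotopic t W Y (f \<circ>\<^sub>c a) (f' \<circ>\<^sub>c b))"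

definition roof_id :: "'k::field cpx \<Rightarrow> 'k droof" where
  "roof_id X = (X, chom_id X, chom_id X)"

text \<open>\<open>roof_comp t Y r r' q\<close>: the roof \<open>q\<close> represents \<open>r'\<close> after \<open>r\<close>, where \<open>r\<close> ends at \<open>Y\<close>.\<close>

definition roof_comp :: "nat \<Rightarrow> 'k::field cpx \<Rightarrow> 'k droof \<Rightarrow> 'k droof \<Rightarrow> 'k droof \<Rightarrow> bool" where
  "roof_comp t Y r r' q \<longleftrightarrow>
     (case r of (Z, s, f) \<Rightarrow> case r' of (Z', s', g) \<Rightarrow>
       \<exists>U u v. is_cpx t U \<and> quasi_iso t U Z u \<and> is_chom t U Z' v \<and>
         homotopic t U Y (f \<circ>\<^sub>c u) (s' \<circ>\<^sub>c v) \<and>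
         q = (U, s \<circ>\<^sub>c u, g \<circ>\<^sub>c v))"

definition D_iso :: "nat \<Rightarrow> 'k::field cpx \<Rightarrow> 'k cpx \<Rightarrow> bool" where
  "D_iso t X Y \<longleftrightarrow>
     (\<exists>r r'. is_roof t X Y r \<and> is_roof t Y X r' \<and>
        (\<exists>q. roof_comp t Y r r' q \<and> roof_eq t X X q (roof_id X)) \<and>
        (\<exists>q. roof_comp t X r' r q \<and> roof_eq t Y Y q (roof_id Y)))"

definition lin_comb :: "'k::field cpx \<Rightarrow> 'k cpx \<Rightarrow> 'k vec \<Rightarrow> 'k chom list \<Rightarrow> 'k chom" where
  "lin_comb X Y c fs =
     (\<lambda>n i. mat (dimv (obj Y n) i) (dimv (obj X n) i)
              (\<lambda>p. \<Sum>l<length fs. c $ l * (fs ! l) n i $$ p))"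

text \<open>
  The space of morphisms \<open>X \<rightarrow> Y\<close> in the derived category is isomorphic to \<open>k\<^sup>m\<close>.
  Linear combinations of morphisms are formed on a common denominator, and finitely many
  morphisms always have one; so a linear map from \<open>k\<^sup>m\<close> to this space is
  \<open>c \<mapsto> (c\<^sub>0 f\<^sub>0 + \<dots> + c\<^sub>m\<^sub>-\<^sub>1 f\<^sub>m\<^sub>-\<^sub>1) s\<^sup>-\<^sup>1\<close> for some \<open>Z\<close>, \<open>s\<close> and
  \<open>f\<^sub>0, \<dots>, f\<^sub>m\<^sub>-\<^sub>1\<close>, and the definition requires it to be bijective.
\<close>

definition D_hom_dim :: "nat \<Rightarrow> 'k::field cpx \<Rightarrow> 'k cpx \<Rightarrow> nat \<Rightarrow> bool" where
  "D_hom_dim t X Y m \<longleftrightarrow>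
     (\<exists>Z s fs. is_cpx t Z \<and> quasi_iso t Z X s \<and> length fs = m \<and>
        (\<forall>f\<in>set fs. is_chom t Z Y f) \<and>
        (\<forall>r. is_roof t X Y r \<longrightarrow>
           (\<exists>!c. c \<in> carrier_vec m \<and> roof_eq t X Y r (Z, s, lin_comb Z Y c fs))))"

text \<open>
  \<open>Hom\<^sup>\<bullet>(X, Y)\<close> is isomorphic to the graded vector space having \<open>k\<^sup>h\<^sup>(\<^sup>i\<^sup>)\<close> in degree \<open>i\<close>.
\<close>

definition graded_Hom_is :: "nat \<Rightarrow> 'k::field cpx \<Rightarrow> 'k cpx \<Rightarrow> (int \<Rightarrow> nat) \<Rightarrow> bool" where
  "graded_Hom_is t X Y h \<longleftrightarrow> (\<forall>i. D_hom_dim t X (shift i Y) (h i))"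


section \<open>The algebra as a bimodule over itself\<close>

text \<open>
  \<open>Ae t j\<close> is the left module \<open>A e\<^sub>j\<close> of (classes of) paths starting at \<open>j\<close>.  Modulo the
  relations, the paths from \<open>j\<close> to \<open>i\<close> have as a basis the shortest such path
  followed by \<open>c\<close> loops at \<open>i\<close>, for \<open>c < min j i\<close>; this is the basis vector with index
  \<open>c\<close> at vertex \<open>i\<close>.  The loops are powers of \<open>\<alpha>\<^sub>i\<^sub>-\<^sub>1 \<beta>\<^sub>i\<^sub>-\<^sub>1\<close>, which equals
  \<open>\<beta>\<^sub>i \<alpha>\<^sub>i\<close> for \<open>2 \<le> i < t\<close>.  An arrow leading away from \<open>j\<close> prolongs the shortest path;
  an arrow leading back towards \<open>j\<close> creates one more loop.  The theorem \<open>Ae_free\<close> below says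
  that this is the module freely generated by \<open>e\<^sub>j\<close>.
\<close>

definition Ae :: "nat \<Rightarrow> nat \<Rightarrow> 'k::field rep" where
  "Ae t j =
     (let d = (\<lambda>i. if i \<in> {1..t} then min j i else 0)
      in \<lparr>dimv = d,
          arrA = (\<lambda>i. mat (d (i + 1)) (d i)
                   (\<lambda>(r, c). if r = (if j \<le> i then c else c + 1) then 1 else 0)),
          arrB = (\<lambda>i. mat (d i) (d (i + 1))
                   (\<lambda>(r, c). if r = (if j \<le> i then c + 1 else c) then 1 else 0))\<rparr>)"

definition idem :: "nat \<Rightarrow> 'k::field vec" where
  "idem j = unit_vec j 0"

lemma Ae_sel: "dimv (Ae t j) i = (if i \<in> {1..t} then min j i else 0)"
  by (simp add: Ae_def Let_def)

lemma A_Ae_unit: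
  assumes "1 \<le> i" "i < t" "1 \<le> j" "c < min j i"
  shows "arrA (Ae t j) i *\<^sub>v unit_vec (min j i) c
         = (unit_vec (min j (Suc i)) (if j \<le> i then c else Suc c) :: 'k::field vec)"
  using assms by (intro eq_vecI) (auto simp: Ae_def Let_def)

lemma B_Ae_unit:
  assumes "1 \<le> i" "i < t" "1 \<le> j" "c < min j (Suc i)"
  shows "arrB (Ae t j) i *\<^sub>v unit_vec (min j (Suc i)) c
         = (if (if j \<le> i then Suc c else c) < min j i
            then unit_vec (min j i) (if j \<le> i then Suc c else c) else 0\<^sub>v (min j i) :: 'k::field vec)"
  using assms by (intro eq_vecI) (auto simp: Ae_def Let_def)

lemma mat_eq_unit:
  fixes X Y :: "'k::field mat"
  assumes "X \<in> carrier_mat a b" "Y \<in> carrier_mat a b"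
    "\<And>c. c < b \<Longrightarrow> X *\<^sub>v unit_vec b c = Y *\<^sub>v unit_vec b c"
  shows "X = Y"
proof (rule eq_matI)
  fix r c assume "r < dim_row Y" "c < dim_col Y"
  then have rc: "r < a" "c < b" using assms by auto
  have "(X *\<^sub>v unit_vec b c) $ r = (Y *\<^sub>v unit_vec b c) $ r" using assms(3) rc by simp
  then show "X $$ (r, c) = Y $$ (r, c)" using assms(1,2) rc by simp
qed (use assms in auto)

lemma mult_mat_zero_vec:
  "X \<in> carrier_mat a b \<Longrightarrow> X *\<^sub>v 0\<^sub>v b = (0\<^sub>v a :: 'k::field vec)"
  by (rule eq_vecI) auto

lemma is_module_Ae:
  assumes j: "1 \<le> j"
  shows "is_module t (Ae t j :: 'k::field rep)"
proof -
  let ?P = "Ae t j :: 'k rep"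
  have A: "arrA ?P i \<in> carrier_mat (dimv ?P (Suc i)) (dimv ?P i)"
    and B: "arrB ?P i \<in> carrier_mat (dimv ?P i) (dimv ?P (Suc i))" for i
    by (simp_all add: Ae_def Let_def)
  have u: "unit_vec (min j i) c \<in> carrier_vec (dimv ?P i)" if "1 \<le> i" "i \<le> t" for i c
    using that by (simp add: Ae_sel)
  have z: "arrA ?P i *\<^sub>v 0\<^sub>v (min j i) = 0\<^sub>v (min j (Suc i))"
    if "1 \<le> i" "i < t" for i
    using mult_mat_zero_vec[OF A[of i]] that by (simp add: Ae_sel)
  have r1: "arrB ?P 1 * arrA ?P 1 = 0\<^sub>m (dimv ?P 1) (dimv ?P 1)" if t: "2 \<le> t"
  proof (rule mat_eq_unit)
    show "arrB ?P 1 * arrA ?P 1 \<in> carrier_mat (dimv ?P 1) (dimv ?P 1)"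
      using mult_carrier_mat[OF B A] .
    fix c assume "c < dimv ?P 1"
    then have c: "c = 0" by (simp add: Ae_sel split: if_splits)
    have "unit_vec (min j 1) c \<in> carrier_vec (dimv ?P 1)" using t by (intro u) auto
    then have "(arrB ?P 1 * arrA ?P 1) *\<^sub>v unit_vec (min j 1) c
        = arrB ?P 1 *\<^sub>v (arrA ?P 1 *\<^sub>v unit_vec (min j 1) c)"
      by (rule assoc_mult_mat_vec[OF B A])
    also have "arrA ?P 1 *\<^sub>v unit_vec (min j 1) c
        = unit_vec (min j (Suc 1)) (if j \<le> 1 then 0 else 1)"
      unfolding c by (subst A_Ae_unit) (use t j in auto)
    also have "arrB ?P 1 *\<^sub>v \<dots> = 0\<^sub>v (dimv ?P 1)"
      using t j B_Ae_unit[where ?'k='k, of 1 t j "if j \<le> 1 then 0 else 1"] by (auto simp: Ae_sel)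
    finally have "(arrB ?P 1 * arrA ?P 1) *\<^sub>v unit_vec (min j 1) c = 0\<^sub>v (dimv ?P 1)" .
    then show "(arrB ?P 1 * arrA ?P 1) *\<^sub>v unit_vec (dimv ?P 1) c
        = 0\<^sub>m (dimv ?P 1) (dimv ?P 1) *\<^sub>v unit_vec (dimv ?P 1) c"
      using t by (auto simp: Ae_sel)
  qed simp
  have r2: "arrA ?P (i - 1) * arrB ?P (i - 1) = arrB ?P i * arrA ?P i"
    if i: "2 \<le> i" "i \<le> t - 1" for i
  proof -
    define l where "l = i - 1"
    have l: "i = Suc l" "1 \<le> l" "l < t" "1 \<le> i" "i < t" using i by (auto simp: l_def)
    have "arrA ?P l * arrB ?P l = arrB ?P i * arrA ?P i"
    proof (rule mat_eq_unit)
      show "arrA ?P l * arrB ?P l \<in> carrier_mat (dimv ?P i) (dimv ?P i)"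
        unfolding l(1) using mult_carrier_mat[OF A B] .
      show "arrB ?P i * arrA ?P i \<in> carrier_mat (dimv ?P i) (dimv ?P i)"
        using mult_carrier_mat[OF B A] .
      fix c assume "c < dimv ?P i"
      then have c: "c < min j i" using l by (simp add: Ae_sel split: if_splits)
      have d: "dimv ?P i = min j i" using l by (simp add: Ae_sel)
      let ?r = "if Suc c < min j i then unit_vec (min j i) (Suc c) else (0\<^sub>v (min j i) :: 'k vec)"
      have "(arrA ?P l * arrB ?P l) *\<^sub>v unit_vec (min j i) c
          = arrA ?P l *\<^sub>v (arrB ?P l *\<^sub>v unit_vec (min j (Suc l)) c)"
        using assoc_mult_mat_vec[OF A B u] l by simp
      also have "\<dots> = ?r"
        using B_Ae_unit[where ?'k='k, OF l(2,3) j, of c] A_Ae_unit[where ?'k='k, OF l(2,3) j] z[OF l(2,3)] c l(1)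
        by (auto split: if_splits)
      also have "\<dots> = arrB ?P i *\<^sub>v (arrA ?P i *\<^sub>v unit_vec (min j i) c)"
        using A_Ae_unit[where ?'k='k, OF l(4,5) j c] B_Ae_unit[where ?'k='k, OF l(4,5) j] c by (auto split: if_splits)
      also have "\<dots> = (arrB ?P i * arrA ?P i) *\<^sub>v unit_vec (min j i) c"
        using assoc_mult_mat_vec[OF B A u] l by simp
      finally show "(arrA ?P l * arrB ?P l) *\<^sub>v unit_vec (dimv ?P i) c
          = (arrB ?P i * arrA ?P i) *\<^sub>v unit_vec (dimv ?P i) c"
        by (simp add: d)
    qed
    then show ?thesis by (simp add: l_def)
  qed
  show ?thesis
    unfolding is_module_def using r1 r2 A B by (auto simp: Ae_sel)
qed

text \<open>
  \<open>bv M j m i c\<close> is the result of applying to \<open>m\<close>, a vector at vertex \<open>j\<close>, the path that is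
  the basis vector with index \<open>c\<close> of \<open>A e\<^sub>j\<close> at vertex \<open>i\<close>.
\<close>

definition lp :: "'k::field rep \<Rightarrow> nat \<Rightarrow> 'k vec \<Rightarrow> 'k vec" where
  "lp M i v = arrA M (i - 1) *\<^sub>v (arrB M (i - 1) *\<^sub>v v)"

fun pup :: "'k::field rep \<Rightarrow> nat \<Rightarrow> 'k vec \<Rightarrow> nat \<Rightarrow> 'k vec" where
  "pup M j m 0 = m"
| "pup M j m (Suc n) = arrA M (j + n) *\<^sub>v pup M j m n"

fun pdn :: "'k::field rep \<Rightarrow> nat \<Rightarrow> 'k vec \<Rightarrow> nat \<Rightarrow> 'k vec" where
  "pdn M j m 0 = m"
| "pdn M j m (Suc n) = arrB M (j - Suc n) *\<^sub>v pdn M j m n"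

definition sp :: "'k::field rep \<Rightarrow> nat \<Rightarrow> 'k vec \<Rightarrow> nat \<Rightarrow> 'k vec" where
  "sp M j m i = (if j \<le> i then pup M j m (i - j) else pdn M j m (j - i))"

definition bv :: "'k::field rep \<Rightarrow> nat \<Rightarrow> 'k vec \<Rightarrow> nat \<Rightarrow> nat \<Rightarrow> 'k vec" where
  "bv M j m i c = (lp M i ^^ c) (sp M j m i)"

locale rep_mod =
  fixes t :: nat and M :: "'k::field rep"
  assumes M: "is_module t M"
begin

lemma A_c[simp]: "arrA M i \<in> carrier_mat (dimv M (Suc i)) (dimv M i)"
  and B_c[simp]: "arrB M i \<in> carrier_mat (dimv M i) (dimv M (Suc i))"
  using M by (auto simp: is_module_def)

lemma Av[simp]: "v \<in> carrier_vec (dimv M i) \<Longrightarrow> arrA M i *\<^sub>v v \<in> carrier_vec (dimv M (Suc i))"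
  and Bv[simp]: "v \<in> carrier_vec (dimv M (Suc i)) \<Longrightarrow> arrB M i *\<^sub>v v \<in> carrier_vec (dimv M i)"
  by (auto intro!: mult_mat_vec_carrier[OF A_c] mult_mat_vec_carrier[OF B_c])

lemma lp_c: "1 \<le> i \<Longrightarrow> v \<in> carrier_vec (dimv M i) \<Longrightarrow> lp M i v \<in> carrier_vec (dimv M i)"
  using Av[of _ "i - 1"] Bv[of _ "i - 1"] by (simp add: lp_def)

lemma lpn_c: "1 \<le> i \<Longrightarrow> v \<in> carrier_vec (dimv M i) \<Longrightarrow> (lp M i ^^ c) v \<in> carrier_vec (dimv M i)"
  by (induction c) (auto intro: lp_c[simplified])

lemma BA:
  assumes "1 \<le> i" "i < t" "v \<in> carrier_vec (dimv M i)"
  shows "arrB M i *\<^sub>v (arrA M i *\<^sub>v v) = lp M i v"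
proof (cases "i = 1")
  case True
  have z: "dimv M 0 = 0" using M by (auto simp: is_module_def)
  have "arrB M i *\<^sub>v (arrA M i *\<^sub>v v) = (arrB M 1 * arrA M 1) *\<^sub>v v"
    using True assms by (simp add: assoc_mult_mat_vec[OF B_c A_c])
  also have "\<dots> = 0\<^sub>v (dimv M 1)"
    using M True assms by (auto simp: is_module_def)
  also have "\<dots> = lp M i v"
  proof (rule eq_vecI)
    have a: "arrA M 0 \<in> carrier_mat (dimv M 1) 0" using A_c[of 0] z by simp
    then show "dim_vec (0\<^sub>v (dimv M 1)) = dim_vec (lp M i v)" using True by (simp add: lp_def)
    fix r assume "r < dim_vec (lp M i v)"
    then have "r < dimv M 1" using a True by (simp add: lp_def)
    then show "0\<^sub>v (dimv M 1) $ r = lp M i v $ r" using a True B_c[of 0] z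
      by (simp add: lp_def scalar_prod_def)
  qed
  finally show ?thesis .
next
  case False
  then have i: "2 \<le> i" "i \<le> t - 1" "Suc (i - 1) = i" using assms by auto
  have "arrB M i *\<^sub>v (arrA M i *\<^sub>v v) = (arrB M i * arrA M i) *\<^sub>v v"
    using assms by (simp add: assoc_mult_mat_vec[OF B_c A_c])
  also have "arrB M i * arrA M i = arrA M (i - 1) * arrB M (i - 1)"
    using M i by (auto simp: is_module_def)
  also have "\<dots> *\<^sub>v v = lp M i v"
    using assms i A_c[of "i - 1"] B_c[of "i - 1"] unfolding lp_def
    by (metis assoc_mult_mat_vec)
  finally show ?thesis .
qed

lemma Alp:
  assumes "1 \<le> i" "i < t" "v \<in> carrier_vec (dimv M i)"
  shows "arrA M i *\<^sub>v (lp M i v) = lp M (Suc i) (arrA M i *\<^sub>v v)"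
  using BA[OF assms] by (simp add: lp_def)

lemma Blp:
  assumes "1 \<le> i" "i < t" "v \<in> carrier_vec (dimv M (Suc i))"
  shows "arrB M i *\<^sub>v (lp M (Suc i) v) = lp M i (arrB M i *\<^sub>v v)"
  using BA[OF assms(1,2) Bv[OF assms(3)]] by (simp add: lp_def)

lemma Alpn:
  assumes "1 \<le> i" "i < t" "v \<in> carrier_vec (dimv M i)"
  shows "arrA M i *\<^sub>v ((lp M i ^^ c) v) = (lp M (Suc i) ^^ c) (arrA M i *\<^sub>v v)"
  using assms by (induction c) (auto simp: Alp lpn_c)

lemma Blpn:
  assumes "1 \<le> i" "i < t" "v \<in> carrier_vec (dimv M (Suc i))"
  shows "arrB M i *\<^sub>v ((lp M (Suc i) ^^ c) v) = (lp M i ^^ c) (arrB M i *\<^sub>v v)"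
  using assms by (induction c) (auto simp: Blp lpn_c)

lemma lp_0: "1 \<le> i \<Longrightarrow> lp M i (0\<^sub>v (dimv M i)) = 0\<^sub>v (dimv M i)"
  using mult_mat_zero_vec[OF A_c[of "i - 1"]] mult_mat_zero_vec[OF B_c[of "i - 1"]]
  by (simp add: lp_def)

lemma lpn_0: "1 \<le> i \<Longrightarrow> (lp M i ^^ c) (0\<^sub>v (dimv M i)) = 0\<^sub>v (dimv M i)"
  by (induction c) (auto simp: lp_0[simplified])

lemma lp_nil:
  assumes "1 \<le> i" "i \<le> t" "v \<in> carrier_vec (dimv M i)"
  shows "(lp M i ^^ i) v = 0\<^sub>v (dimv M i)"
  using assms
proof (induction i arbitrary: v rule: nat_induct_at_least[of 1])
  case base
  have z: "dimv M 0 = 0" using M by (auto simp: is_module_def)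
  have a: "arrA M 0 \<in> carrier_mat (dimv M 1) 0" using A_c[of 0] z by simp
  then show ?case using B_c[of 0] z
    by (auto intro!: eq_vecI simp: lp_def scalar_prod_def)
next
  case (Suc i)
  have "(lp M (Suc i) ^^ Suc i) v = (lp M (Suc i) ^^ i) (arrA M i *\<^sub>v (arrB M i *\<^sub>v v))"
    by (simp add: funpow_swap1 lp_def)
  also have "\<dots> = arrA M i *\<^sub>v ((lp M i ^^ i) (arrB M i *\<^sub>v v))"
    using Suc.hyps Suc.prems by (simp add: Alpn)
  also have "\<dots> = 0\<^sub>v (dimv M (Suc i))"
    using Suc mult_mat_zero_vec[OF A_c[of i]] by (simp add: Suc.IH)
  finally show ?case .
qed

context
  fixes j :: nat and m :: "'k vec"
  assumes j: "1 \<le> j" "j \<le> t" and m: "m \<in> carrier_vec (dimv M j)"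
begin

lemma pup_c: "pup M j m n \<in> carrier_vec (dimv M (j + n))"
  using m by (induction n) auto

lemma pdn_c: "n \<le> j \<Longrightarrow> pdn M j m n \<in> carrier_vec (dimv M (j - n))"
proof (induction n)
  case (Suc n)
  then have "Suc (j - Suc n) = j - n" by simp
  with Suc Bv[of "pdn M j m n" "j - Suc n"] show ?case by simp
qed (use m in simp)

lemma sp_c: "sp M j m i \<in> carrier_vec (dimv M i)"
  using pup_c[of "i - j"] pdn_c[of "j - i"] by (auto simp: sp_def)

lemma bv_c: "1 \<le> i \<Longrightarrow> bv M j m i c \<in> carrier_vec (dimv M i)"
  by (simp add: bv_def lpn_c sp_c)

lemma A_sp: "j \<le> i \<Longrightarrow> arrA M i *\<^sub>v sp M j m i = sp M j m (Suc i)"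
  by (simp add: sp_def Suc_diff_le)

lemma B_sp: "i < j \<Longrightarrow> arrB M i *\<^sub>v sp M j m (Suc i) = sp M j m i"
proof -
  assume i: "i < j"
  then have *: "j - i = Suc (j - Suc i)" "j - Suc (j - Suc i) = i" by auto
  show ?thesis
  proof (cases "j = Suc i")
    case True then show ?thesis by (simp add: sp_def)
  next
    case False
    then show ?thesis using i *(2) by (simp add: sp_def *(1))
  qed
qed

lemma A_bv:
  assumes "1 \<le> i" "i < t"
  shows "arrA M i *\<^sub>v bv M j m i c = bv M j m (Suc i) (if j \<le> i then c else Suc c)"
proof (cases "j \<le> i")
  case True
  then show ?thesis using assms by (simp add: bv_def Alpn sp_c A_sp)
next
  case False
  then have "arrA M i *\<^sub>v sp M j m i = lp M (Suc i) (sp M j m (Suc i))"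
    using B_sp[of i] by (simp add: lp_def)
  then show ?thesis using assms False by (simp add: bv_def Alpn sp_c funpow_swap1)
qed

lemma B_bv:
  assumes "1 \<le> i" "i < t"
  shows "arrB M i *\<^sub>v bv M j m (Suc i) c = bv M j m i (if j \<le> i then Suc c else c)"
proof (cases "j \<le> i")
  case False
  then show ?thesis using assms by (simp add: bv_def Blpn sp_c B_sp)
next
  case True
  then have "arrB M i *\<^sub>v sp M j m (Suc i) = lp M i (sp M j m i)"
    using A_sp[of i] assms BA[OF assms sp_c] by simp
  then show ?thesis using assms True by (simp add: bv_def Blpn sp_c funpow_swap1)
qed

lemma bv_nil_min: "1 \<le> i \<Longrightarrow> i \<le> t \<Longrightarrow> bv M j m i (min j i) = 0\<^sub>v (dimv M i)"
proof (cases "j \<le> i")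
  case True
  assume "i \<le> t"
  with True show ?thesis
  proof (induction i rule: dec_induct)
    case base then show ?case using j m by (simp add: bv_def lp_nil sp_c)
  next
    case (step i)
    then have "bv M j m (Suc i) j = arrA M i *\<^sub>v bv M j m i j"
      using A_bv[of i j] j by simp
    with step show ?case using mult_mat_zero_vec[OF A_c[of i]] by (simp add: min_absorb1)
  qed
qed (simp add: bv_def lp_nil sp_c)

lemma bv_nil:
  assumes "1 \<le> i" "i \<le> t" "min j i \<le> c"
  shows "bv M j m i c = 0\<^sub>v (dimv M i)"
proof -
  obtain d where c: "c = d + min j i" using assms(3) by (metis add.commute le_Suc_ex)
  show ?thesis using bv_nil_min[OF assms(1,2)] assms(1,2)
    by (simp only: c bv_def funpow_add o_apply lpn_0)
qed

end
end

theorem Ae_free: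
  fixes M :: "'k::field rep"
  assumes M: "is_module t M" and j: "j \<in> {1..t}" and m: "m \<in> carrier_vec (dimv M j)"
  shows "\<exists>!f. is_hom t (Ae t j) M f \<and> f j *\<^sub>v idem j = m"
proof -
  interpret rep_mod t M by unfold_locales (rule M)
  interpret P: rep_mod t "Ae t j :: 'k rep" by unfold_locales (use is_module_Ae j in auto)
  have j': "1 \<le> j" "j \<le> t" using j by auto
  let ?P = "Ae t j :: 'k rep"
  let ?d = "\<lambda>i. dimv ?P i"
  define f :: "'k hom" where
    "f = (\<lambda>i. mat (dimv M i) (?d i) (\<lambda>(r, c). bv M j m i c $ r))"
  have fc: "f i \<in> carrier_mat (dimv M i) (?d i)" for i by (simp add: f_def)
  have d: "1 \<le> i \<Longrightarrow> i \<le> t \<Longrightarrow> ?d i = min j i" for i by (simp add: Ae_sel)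
  have fu: "f i *\<^sub>v unit_vec (min j i) c = bv M j m i c" if "1 \<le> i" "i \<le> t" "c < min j i" for i c
    using that bv_c[OF j' m that(1), of c] by (intro eq_vecI) (auto simp: f_def Ae_sel)
  have f0: "f i *\<^sub>v 0\<^sub>v (min j i) = 0\<^sub>v (dimv M i)" if "1 \<le> i" "i \<le> t" for i
    using fc[of i] d[OF that] by auto
  have hom: "is_hom t ?P M f"
    unfolding is_hom_def
  proof (intro conjI allI impI; (elim conjE)?)
    fix i assume i: "1 \<le> i" "i < t"
    then have i': "1 \<le> Suc i" "Suc i \<le> t" "i \<le> t" by auto
    show "f (i + 1) * arrA ?P i = arrA M i * f i"
    proof (rule mat_eq_unit[where a = "dimv M (Suc i)" and b = "?d i"])
      show "f (i + 1) * arrA ?P i \<in> carrier_mat (dimv M (Suc i)) (?d i)"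
        using mult_carrier_mat[OF fc P.A_c] by simp
      show "arrA M i * f i \<in> carrier_mat (dimv M (Suc i)) (?d i)"
        using mult_carrier_mat[OF A_c fc] by simp
      fix c assume "c < ?d i"
      then have c: "c < min j i" using d i by simp
      have "(f (i + 1) * arrA ?P i) *\<^sub>v unit_vec (?d i) c
          = f (Suc i) *\<^sub>v (arrA ?P i *\<^sub>v unit_vec (?d i) c)"
        using assoc_mult_mat_vec[OF fc P.A_c, of "unit_vec (?d i) c" "i"] by simp
      also have "\<dots> = f (Suc i) *\<^sub>v unit_vec (min j (Suc i)) (if j \<le> i then c else Suc c)"
        by (simp only: d[OF i(1) i'(3)] A_Ae_unit[where ?'k='k, OF i j'(1) c])
      also have "\<dots> = bv M j m (Suc i) (if j \<le> i then c else Suc c)"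
        using c by (intro fu i') auto
      also have "\<dots> = arrA M i *\<^sub>v bv M j m i c"
        using A_bv[OF j' m i] by simp
      also have "\<dots> = arrA M i *\<^sub>v (f i *\<^sub>v unit_vec (?d i) c)"
        using fu[OF i(1) i'(3) c] d i by simp
      also have "\<dots> = (arrA M i * f i) *\<^sub>v unit_vec (?d i) c"
        using assoc_mult_mat_vec[OF A_c fc, of "unit_vec (?d i) c" "i"] by simp
      finally show "(f (i + 1) * arrA ?P i) *\<^sub>v unit_vec (?d i) c
          = (arrA M i * f i) *\<^sub>v unit_vec (?d i) c" .
    qed
    show "f i * arrB ?P i = arrB M i * f (i + 1)"
    proof (rule mat_eq_unit[where a = "dimv M i" and b = "?d (Suc i)"])
      show "f i * arrB ?P i \<in> carrier_mat (dimv M i) (?d (Suc i))"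
        using mult_carrier_mat[OF fc P.B_c] by simp
      show "arrB M i * f (i + 1) \<in> carrier_mat (dimv M i) (?d (Suc i))"
        using mult_carrier_mat[OF B_c fc] by simp
      fix c assume "c < ?d (Suc i)"
      then have c: "c < min j (Suc i)" using d i by simp
      let ?c = "if j \<le> i then Suc c else c"
      have "(f i * arrB ?P i) *\<^sub>v unit_vec (?d (Suc i)) c
          = f i *\<^sub>v (arrB ?P i *\<^sub>v unit_vec (?d (Suc i)) c)"
        using assoc_mult_mat_vec[OF fc P.B_c, of "unit_vec (?d (Suc i)) c" "i"] by simp
      also have "\<dots> = f i *\<^sub>v (if ?c < min j i then unit_vec (min j i) ?c else 0\<^sub>v (min j i))"
        by (simp only: d[OF i'(1,2)] B_Ae_unit[where ?'k='k, OF i j'(1) c])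
      also have "\<dots> = bv M j m i ?c"
        using fu[OF i(1) i'(3), of ?c] f0[OF i(1) i'(3)] bv_nil[OF j' m i(1) i'(3), of ?c]
        by (cases "?c < min j i") (auto simp del: if_split_asm)
      also have "\<dots> = arrB M i *\<^sub>v bv M j m (Suc i) c"
        using B_bv[OF j' m i] by simp
      also have "\<dots> = arrB M i *\<^sub>v (f (Suc i) *\<^sub>v unit_vec (?d (Suc i)) c)"
        using fu[OF i'(1,2) c] d i by simp
      also have "\<dots> = (arrB M i * f (i + 1)) *\<^sub>v unit_vec (?d (Suc i)) c"
        using assoc_mult_mat_vec[OF B_c fc, of "unit_vec (?d (Suc i)) c" "i"] by simp
      finally show "(f i * arrB ?P i) *\<^sub>v unit_vec (?d (Suc i)) c
          = (arrB M i * f (i + 1)) *\<^sub>v unit_vec (?d (Suc i)) c" .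
    qed
  qed (rule fc)
  have fm: "f j *\<^sub>v idem j = m"
    using fu[OF j', of 0] j' by (simp add: idem_def bv_def sp_def)
  have uniq: "g = f" if g: "is_hom t ?P M g" "g j *\<^sub>v idem j = m" for g
  proof
    have gc: "g i \<in> carrier_mat (dimv M i) (?d i)" for i using g by (auto simp: is_hom_def)
    have gA: "g (Suc i) *\<^sub>v (arrA ?P i *\<^sub>v v) = arrA M i *\<^sub>v (g i *\<^sub>v v)"
      if "1 \<le> i" "i < t" "v \<in> carrier_vec (?d i)" for i v
      using g(1) that assoc_mult_mat_vec[OF gc P.A_c that(3)] assoc_mult_mat_vec[OF A_c gc that(3)]
      by (auto simp: is_hom_def)
    have gB: "g i *\<^sub>v (arrB ?P i *\<^sub>v v) = arrB M i *\<^sub>v (g (Suc i) *\<^sub>v v)"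
      if "1 \<le> i" "i < t" "v \<in> carrier_vec (?d (Suc i))" for i v
      using g(1) that assoc_mult_mat_vec[OF gc P.B_c that(3)] assoc_mult_mat_vec[OF B_c gc that(3)]
      by (auto simp: is_hom_def)
    have sp_up: "g i *\<^sub>v unit_vec (min j i) 0 = sp M j m i" if "j \<le> i" "i \<le> t" for i
      using that
    proof (induction i rule: dec_induct)
      case base then show ?case using g(2) by (simp add: idem_def sp_def)
    next
      case (step i)
      have i: "1 \<le> i" "i < t" using step j' by auto
      have u: "unit_vec (min j (Suc i)) 0 = arrA ?P i *\<^sub>v unit_vec (min j i) 0"
        by (subst A_Ae_unit[where ?'k='k, OF i j'(1)]) (use i j' step in simp_all)
      show ?case unfolding u using step i d[of i] A_sp[OF j' m step(1)]
        by (simp add: gA)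
    qed
    have sp_dn: "g i *\<^sub>v unit_vec (min j i) 0 = sp M j m i" if "i \<le> j" "1 \<le> i" for i
      using that
    proof (induction i rule: inc_induct)
      case base then show ?case using g(2) by (simp add: idem_def sp_def)
    next
      case (step i)
      have i: "1 \<le> i" "i < t" using step j' by auto
      have u: "unit_vec (min j i) 0 = arrB ?P i *\<^sub>v unit_vec (min j (Suc i)) 0"
        by (subst B_Ae_unit[where ?'k='k, OF i j'(1)]) (use i j' step in simp_all)
      show ?case unfolding u using step i d[of "Suc i"] B_sp[OF j' m, of i]
        by (simp add: gB)
    qed
    have gu: "g i *\<^sub>v unit_vec (min j i) c = bv M j m i c"
      if "1 \<le> i" "i \<le> t" "c < min j i" for i c
      using that(3)
    proof (induction c)
      case 0 then show ?case using that sp_up[of i] sp_dn[of i]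
        by (cases "j \<le> i") (auto simp: bv_def min_absorb1 min_absorb2)
    next
      case (Suc c)
      define l where "l = i - 1"
      have l: "1 \<le> l" "l < t" "i = Suc l" using that Suc.prems by (auto simp: l_def)
      have u: "unit_vec (min j i) (Suc c) = arrA ?P l *\<^sub>v (arrB ?P l *\<^sub>v unit_vec (min j i) c)"
      proof -
        have c: "c < min j (Suc l)" using Suc.prems l by simp
        have q: "(if j \<le> l then Suc c else c) < min j l" using Suc.prems l by auto
        show ?thesis
          using B_Ae_unit[where ?'k='k, OF l(1,2) j'(1) c] q A_Ae_unit[where ?'k='k, OF l(1,2) j'(1) q] l(3)
          by (auto split: if_splits)
      qed
      have uc: "unit_vec (min j i) c \<in> carrier_vec (?d (Suc l))" using d that l by simp
      have "g i *\<^sub>v unit_vec (min j i) (Suc c) = arrA M l *\<^sub>v (arrB M l *\<^sub>v (g i *\<^sub>v unit_vec (min j i) c))"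
        unfolding u using gA[OF l(1,2) P.Bv[OF uc]] gB[OF l(1,2) uc] l(3) by simp
      also have "\<dots> = lp M i (bv M j m i c)"
        using Suc by (simp add: lp_def l(3))
      finally show ?case by (simp add: bv_def)
    qed
    fix i
    show "g i = f i"
    proof (rule mat_eq_unit[OF gc fc])
      fix c assume "c < ?d i"
      then have "1 \<le> i" "i \<le> t" "c < min j i" by (auto simp: Ae_sel split: if_splits)
      then show "g i *\<^sub>v unit_vec (?d i) c = f i *\<^sub>v unit_vec (?d i) c"
        using gu fu d by simp
    qed
  qed
  show ?thesis using hom fm uniq by blast
qed

text \<open>
  Right multiplication \<open>A e\<^sub>j \<rightarrow> A e\<^sub>j\<^sub>'\<close> by an element \<open>x\<close> of \<open>e\<^sub>j A e\<^sub>j\<^sub>'\<close>, that is,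
  the left module map sending \<open>e\<^sub>j\<close> to \<open>x\<close>.
\<close>

definition rmult :: "nat \<Rightarrow> nat \<Rightarrow> nat \<Rightarrow> 'k::field vec \<Rightarrow> 'k hom" where
  "rmult t j j' x = (THE f. is_hom t (Ae t j) (Ae t j') f \<and> f j *\<^sub>v idem j = x)"

text \<open>\<open>rmultA t j\<close> is \<open>A e\<^sub>j\<^sub>+\<^sub>1 \<rightarrow> A e\<^sub>j\<close>, \<open>y \<mapsto> y \<alpha>\<^sub>j\<close>, and \<open>rmultB t j\<close> is \<open>A e\<^sub>j \<rightarrow> A e\<^sub>j\<^sub>+\<^sub>1\<close>, \<open>y \<mapsto> y \<beta>\<^sub>j\<close>.\<close>

definition rmultA :: "nat \<Rightarrow> nat \<Rightarrow> 'k::field hom" where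
  "rmultA t j = rmult t (j + 1) j (arrA (Ae t j) j *\<^sub>v idem j)"

definition rmultB :: "nat \<Rightarrow> nat \<Rightarrow> 'k::field hom" where
  "rmultB t j = rmult t j (j + 1) (arrB (Ae t (j + 1)) j *\<^sub>v idem (j + 1))"


section \<open>The Serre functor\<close>

definition dual_homs :: "nat \<Rightarrow> 'k::field rep \<Rightarrow> 'k rep \<Rightarrow> ('k hom \<Rightarrow> 'k) set" where
  "dual_homs t M N =
     {\<phi> \<in> extensional (homs t M N).
        (\<forall>f\<in>homs t M N. \<forall>g\<in>homs t M N. \<phi> (f +\<^sub>h g) = \<phi> f + \<phi> g) \<and>
        (\<forall>c. \<forall>f\<in>homs t M N. \<phi> (c \<cdot>\<^sub>h f) = c * \<phi> f)}"

text \<open>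
  \<open>nakayama_via t M N \<tau>\<close>: the family \<open>\<tau>\<close> is an isomorphism of left modules from \<open>N\<close> to
  \<open>\<nu> M = D Hom\<^sub>A(M, A)\<close>.  The space of \<open>\<nu> M\<close> at vertex \<open>j\<close> is the dual of
  \<open>Hom\<^sub>A(M, A) e\<^sub>j = Hom\<^sub>A(M, A e\<^sub>j)\<close>, and \<open>a\<close> in \<open>e\<^sub>j\<^sub>' A e\<^sub>j\<close> acts by
  \<open>(a \<phi>)(h) = \<phi>(h a)\<close> for \<open>h : M \<rightarrow> A e\<^sub>j\<^sub>'\<close>.
\<close>

definition nakayama_via ::
    "nat \<Rightarrow> 'k::field rep \<Rightarrow> 'k rep \<Rightarrow> (nat \<Rightarrow> 'k vec \<Rightarrow> 'k hom \<Rightarrow> 'k) \<Rightarrow> bool" where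
  "nakayama_via t M N \<tau> \<longleftrightarrow> is_module t N \<and>
     (\<forall>j\<in>{1..t}.
        bij_betw (\<tau> j) (carrier_vec (dimv N j)) (dual_homs t M (Ae t j)) \<and>
        (\<forall>h\<in>homs t M (Ae t j). \<forall>v\<in>carrier_vec (dimv N j).
           (\<forall>w\<in>carrier_vec (dimv N j). \<tau> j (v + w) h = \<tau> j v h + \<tau> j w h) \<and>
           (\<forall>c. \<tau> j (c \<cdot>\<^sub>v v) h = c * \<tau> j v h))) \<and>
     (\<forall>j. 1 \<le> j \<and> j < t \<longrightarrow>
        (\<forall>v\<in>carrier_vec (dimv N j). \<forall>h\<in>homs t M (Ae t (j + 1)).
           \<tau> (j + 1) (arrA N j *\<^sub>v v) h = \<tau> j v (rmultA t j \<circ>\<^sub>h h)) \<and>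
        (\<forall>v\<in>carrier_vec (dimv N (j + 1)). \<forall>h\<in>homs t M (Ae t j).
           \<tau> j (arrB N j *\<^sub>v v) h = \<tau> (j + 1) v (rmultB t j \<circ>\<^sub>h h)))"

text \<open>\<open>N\<close> is isomorphic, as a complex, to \<open>\<nu>\<close> applied degreewise to \<open>P\<close>.\<close>

definition nakayama_cpx :: "nat \<Rightarrow> 'k::field cpx \<Rightarrow> 'k cpx \<Rightarrow> bool" where
  "nakayama_cpx t P N \<longleftrightarrow> is_cpx t N \<and>
     (\<exists>\<tau>. (\<forall>n. nakayama_via t (obj P n) (obj N n) (\<tau> n)) \<and>
          (\<forall>n. \<forall>j\<in>{1..t}. \<forall>v\<in>carrier_vec (dimv (obj N n) j). \<forall>h\<in>homs t (obj P (n + 1)) (Ae t j).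
             \<tau> (n + 1) j (dif N n j *\<^sub>v v) h = \<tau> n j v (h \<circ>\<^sub>h dif P n)))"

definition proj_resolution :: "nat \<Rightarrow> 'k::field cpx \<Rightarrow> 'k cpx \<Rightarrow> bool" where
  "proj_resolution t X P \<longleftrightarrow> is_cpx t P \<and> (\<forall>n. projective t (obj P n)) \<and> (\<exists>q. quasi_iso t P X q)"

text \<open>
  The derived Nakayama functor \<open>X \<mapsto> \<nu> P\<close>, \<open>P\<close> a bounded projective resolution of \<open>X\<close>,
  is defined up to isomorphism only; \<open>is_serre t X Y\<close> says that \<open>Y\<close> is isomorphic in the
  derived category to its value at \<open>X\<close>.
\<close>

definition is_serre :: "nat \<Rightarrow> 'k::field cpx \<Rightarrow> 'k cpx \<Rightarrow> bool" where
  "is_serre t X Y \<longleftrightarrow>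
     (\<exists>P N. proj_resolution t X P \<and> nakayama_cpx t P N \<and> D_iso t N Y)"

definition exceptional :: "nat \<Rightarrow> 'k::field cpx \<Rightarrow> bool" where
  "exceptional t X \<longleftrightarrow> graded_Hom_is t X X (\<lambda>i. if i = 0 then 1 else 0)"

definition spherical :: "nat \<Rightarrow> int \<Rightarrow> 'k::field cpx \<Rightarrow> bool" where
  "spherical t e X \<longleftrightarrow> is_serre t X (shift e X) \<and>
     graded_Hom_is t X X (\<lambda>i. (if i = 0 then 1 else 0) + (if i = e then 1 else 0))"

end

theory Submission
  imports Defs "HOL-Library.Function_Algebras" "HOL-Library.Product_Lexorder"
begin

text \<open>
  Replacing every vertex and every arrow by a free module gives a projective resolution of length two
  of any module \<open>M\<close>.  Maps out of it are families of matrices, so the Euler characteristic of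
  \<open>Ext(M, M)\<close> is \<open>\<chi> = \<Sum>\<^sub>i\<^sub><\<^sub>t (dim M\<^sub>i\<^sub>+\<^sub>1 - dim M\<^sub>i)\<^sup>2\<close> with \<open>M\<^sub>0 = 0\<close>, and the trace pairing
  identifies the dual of \<open>Ext\<^sup>2(M, M)\<close> with the endomorphisms of \<open>M\<close> vanishing at vertex \<open>t\<close>.
  If \<open>End(M) = k\<close>, then \<open>Ext\<^sup>2(M, M)\<close> is therefore zero or one-dimensional according to whether
  \<open>M\<^sub>t\<close> is nonzero or zero, and \<open>\<chi> = 1\<close> or \<open>\<chi> = 2\<close> forces \<open>M\<close> to be thin.  Conversely an endomorphism
  of a thin module splits it by eigenvalues, so thin indecomposables have \<open>End(M) = k\<close>, and
  \<open>\<chi> \<ge> 1\<close>, respectively \<open>\<chi> \<ge> 2\<close>, forces \<open>Ext\<^sup>1(M, M) = 0\<close>.  If \<open>M\<^sub>t = 0\<close>, the Nakayama functor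
  takes the resolution to a complex with cohomology \<open>M\<close> in degree \<open>-2\<close> only, whence the Serre
  functor acts on \<open>M\<close> as the shift by two.
\<close>

section \<open>Matrices as operators on functions\<close>

text \<open>Morphisms of the derived category are roofs over arbitrary complexes, so the resolution
  helps only once roofs are reduced to it: a chain map from a bounded complex of free modules lifts
  through any quasi-isomorphism, uniquely up to homotopy. Roofs thus become homotopy classes of
  chain maps and, into a shifted stalk complex, cocycles modulo boundaries. That the dual of Ext^2
  consists of endomorphisms vanishing at \<open>t\<close> reflects the one missing relation: there
  is a relation for each vertex i < t, its differential exchanges the summands of \<alpha>_i and
  \<beta>_i, and nothing pairs with vertex \<open>t\<close>. When M_t = 0 this defect is invisible,
  which is why the Nakayama complex then has cohomology in one degree only. Exactness of both
  complexes is shown by solving for preimages recursively along the quiver; indexing paths from the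
  socle turns the arrows into identities and index shifts, so that each recursion runs through
  vectors of M alone.\<close>

definition scl :: "'k::field \<Rightarrow> ('b \<Rightarrow> 'k) \<Rightarrow> 'b \<Rightarrow> 'k" where
  "scl c x = (\<lambda>b. c * x b)"

text \<open>A coordinate space is represented by the functions supported in a finite set
  \<open>B\<close>, padded by zero elsewhere. Sums and linear maps are then total, and the carrier
  conditions on vectors shrink to membership in \<open>fs\<close>.\<close>

definition fs :: "'b set \<Rightarrow> ('b \<Rightarrow> 'k::field) set" where
  "fs B = {x. \<forall>b. b \<notin> B \<longrightarrow> x b = 0}"

definition lin :: "(('a \<Rightarrow> 'k::field) \<Rightarrow> ('b \<Rightarrow> 'k)) \<Rightarrow> bool" where
  "lin T \<longleftrightarrow> (\<forall>x y. T (x + y) = T x + T y) \<and> (\<forall>c x. T (scl c x) = scl c (T x))"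

definition dlt :: "'b \<Rightarrow> 'b \<Rightarrow> 'k::field" where
  "dlt a = (\<lambda>b. if b = a then 1 else 0)"

text \<open>The action is defined on all functions: entries beyond the columns are ignored and the
  result is zero beyond the rows. Composition laws therefore need no condition on the
  argument.\<close>

definition mv :: "'k::field mat \<Rightarrow> (nat \<Rightarrow> 'k) \<Rightarrow> nat \<Rightarrow> 'k" where
  "mv A x = (\<lambda>r. if r < dim_row A then \<Sum>s<dim_col A. A $$ (r, s) * x s else 0)"

interpretation fnv: vector_space "scl :: 'k::field \<Rightarrow> ('b \<Rightarrow> 'k) \<Rightarrow> _"
  by unfold_locales (auto simp: scl_def fun_eq_iff algebra_simps)

lemma scl_apply [simp]: "scl c x b = c * x b" by (simp add: scl_def)

lemma lin_add: "lin T \<Longrightarrow> T (x + y) = T x + T y"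
  and lin_scl: "lin T \<Longrightarrow> T (scl c x) = scl c (T x)" by (auto simp: lin_def)

lemma lin_zero: "T 0 = 0" if "lin T"
proof -
  have "T 0 + T 0 = T 0" unfolding lin_add[OF that, symmetric] by (simp only: add_0)
  then show ?thesis by (rule add_left_imp_eq[of "T 0", OF trans]) (simp only: add_0_right)
qed

lemma lin_uminus: "lin T \<Longrightarrow> T (- x) = - T x"
proof -
  assume T: "lin T"
  have "T (- x) + T x = T (- x + x)" by (rule lin_add[OF T, symmetric])
  also have "\<dots> = 0" by (simp only: left_minus lin_zero[OF T])
  finally show "T (- x) = - T x" by (simp only: eq_neg_iff_add_eq_0)
qed

lemma lin_diff: "T (x - y) = T x - T y" if "lin T"
proof -
  have "T x = T (x - y) + T y" unfolding lin_add[OF that, symmetric] by simp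
  then show ?thesis by (metis add_diff_cancel_right')
qed

lemma lin_sum: "lin T \<Longrightarrow> T (\<Sum>a\<in>S. f a) = (\<Sum>a\<in>S. T (f a))"
  by (induction S rule: infinite_finite_induct) (auto simp: lin_add lin_zero)

lemma sum_fun_apply: "(\<Sum>a\<in>S. f a) b = (\<Sum>a\<in>S. f a b)"
  by (induction S rule: infinite_finite_induct) auto

lemma fs_zero [simp]: "0 \<in> fs B"
  and fs_add: "x \<in> fs B \<Longrightarrow> y \<in> fs B \<Longrightarrow> x + y \<in> fs B"
  and fs_diff: "x \<in> fs B \<Longrightarrow> y \<in> fs B \<Longrightarrow> x - y \<in> fs B"
  and fs_uminus: "x \<in> fs B \<Longrightarrow> - x \<in> fs B"
  and fs_scl: "x \<in> fs B \<Longrightarrow> scl c x \<in> fs B"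
  by (auto simp: fs_def fun_Compl_def)

lemma fs_sum: "(\<And>a. a \<in> S \<Longrightarrow> f a \<in> fs B) \<Longrightarrow> (\<Sum>a\<in>S. f a) \<in> fs B"
  by (induction S rule: infinite_finite_induct) (auto intro: fs_add)

lemma fs_dlt: "b \<in> B \<Longrightarrow> dlt b \<in> fs B" by (auto simp: fs_def dlt_def)

lemma fs_empty [simp]: "fs {} = {0}" by (auto simp: fs_def)

lemma fs_expand:
  assumes "finite B" "x \<in> fs B"
  shows "x = (\<Sum>b\<in>B. scl (x b) (dlt b))"
proof
  fix a
  have "(\<Sum>b\<in>B. x b * dlt b a) = (\<Sum>b\<in>B. if b = a then x b else 0)"
    by (rule sum.cong) (auto simp: dlt_def)
  then show "x a = (\<Sum>b\<in>B. scl (x b) (dlt b)) a"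
    using assms by (auto simp: sum_fun_apply fs_def)
qed

lemma lin_eqI:
  assumes "lin S" "lin T" "finite B" "\<And>b. b \<in> B \<Longrightarrow> S (dlt b) = T (dlt b)" "x \<in> fs B"
  shows "S x = T x"
  by (subst (1 2) fs_expand[OF assms(3,5)]) (simp add: lin_sum lin_scl assms)

lemma lin_comp: "lin S \<Longrightarrow> lin T \<Longrightarrow> lin (\<lambda>x. S (T x))" by (auto simp: lin_def)
lemma lin_mv [simp]: "lin (mv A)"
  by (auto simp: lin_def mv_def fun_eq_iff algebra_simps sum.distrib sum_distrib_left)

lemmas mv_lin = lin_add[OF lin_mv] lin_scl[OF lin_mv] lin_zero[OF lin_mv] lin_uminus[OF lin_mv]
  lin_diff[OF lin_mv]

lemma mv_fs: "A \<in> carrier_mat n m \<Longrightarrow> mv A x \<in> fs {..<n}" by (auto simp: fs_def mv_def)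

lemma mv_zero_dim: "A \<in> carrier_mat n 0 \<Longrightarrow> mv A x = 0" "A \<in> carrier_mat 0 n \<Longrightarrow> mv A x = 0"
  by (auto simp: mv_def fun_eq_iff)

lemma mv_mult:
  assumes "A \<in> carrier_mat n m" "B \<in> carrier_mat m l"
  shows "mv (A * B) x = mv A (mv B x)"
proof
  fix r
  show "mv (A * B) x r = mv A (mv B x) r"
  proof (cases "r < n")
    case True
    have "mv (A * B) x r = (\<Sum>s<l. (\<Sum>q<m. A $$ (r, q) * B $$ (q, s)) * x s)"
      using assms True by (simp add: mv_def scalar_prod_def atLeast0LessThan)
    also have "\<dots> = (\<Sum>q<m. \<Sum>s<l. A $$ (r, q) * (B $$ (q, s) * x s))"
      unfolding sum_distrib_right by (subst sum.swap) (simp add: mult.assoc)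
    also have "\<dots> = mv A (mv B x) r"
      using assms True by (simp add: mv_def sum_distrib_left)
    finally show ?thesis .
  qed (use assms in \<open>simp add: mv_def\<close>)
qed

lemma mv_plus:
  assumes "A \<in> carrier_mat n m" "B \<in> carrier_mat n m"
  shows "mv (A + B) x = mv A x + mv B x"
  using assms by (auto simp: mv_def fun_eq_iff algebra_simps sum.distrib)

lemma mv_smult: "mv (c \<cdot>\<^sub>m A) x = scl c (mv A x)"
  by (auto simp: mv_def fun_eq_iff algebra_simps sum_distrib_left)

lemma mv_0 [simp]: "mv (0\<^sub>m n m) x = 0"
  by (auto simp: mv_def fun_eq_iff)

lemma mv_1: "mv (1\<^sub>m n) x = (\<lambda>r. if r < n then x r else 0)"
proof
  fix r
  have "(\<Sum>s<n. (1\<^sub>m n) $$ (r, s) * x s) = (\<Sum>s<n. if s = r then x s else 0)" if "r < n"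
    using that by (intro sum.cong) auto
  then show "mv (1\<^sub>m n) x r = (if r < n then x r else 0)"
    by (auto simp: mv_def)
qed

lemma mv_1_id: "x \<in> fs {..<n} \<Longrightarrow> mv (1\<^sub>m n) x = x"
  by (auto simp: mv_1 fun_eq_iff fs_def)

lemma mv_dlt: "A \<in> carrier_mat n m \<Longrightarrow> r < n \<Longrightarrow> s < m \<Longrightarrow> mv A (dlt s) r = A $$ (r, s)"
  by (auto simp: mv_def dlt_def sum.delta if_distrib cong: if_cong)

lemma mv_inj_fs:
  assumes "A \<in> carrier_mat n m" "B \<in> carrier_mat n m"
    "\<And>x. x \<in> fs {..<m} \<Longrightarrow> mv A x = mv B x"
  shows "A = B"
proof (rule eq_matI)
  fix r s assume "r < dim_row B" "s < dim_col B"
  then show "A $$ (r, s) = B $$ (r, s)"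
    using assms(1,2) assms(3)[of "dlt s"] mv_dlt[of A n m r s] mv_dlt[of B n m r s]
    by (auto simp: fs_dlt)
qed (use assms in auto)

lemma mv_inj:
  assumes "A \<in> carrier_mat n m" "B \<in> carrier_mat n m"
  shows "A = B \<longleftrightarrow> (\<forall>x. mv A x = mv B x)"
  using mv_inj_fs[OF assms] by auto

section \<open>Passage between coordinate vectors and functions\<close>

definition fv :: "'k::field vec \<Rightarrow> nat \<Rightarrow> 'k" where
  "fv v = (\<lambda>r. if r < dim_vec v then v $ r else 0)"

lemma fv_fs: "v \<in> carrier_vec n \<Longrightarrow> fv v \<in> fs {..<n}" by (auto simp: fv_def fs_def)

lemma fv_vec: "x \<in> fs {..<n} \<Longrightarrow> fv (vec n x) = x" by (auto simp: fv_def fs_def fun_eq_iff)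

lemma vec_fv: "v \<in> carrier_vec n \<Longrightarrow> vec n (fv v) = v" by (auto simp: fv_def)

lemma fv_inj: "v \<in> carrier_vec n \<Longrightarrow> w \<in> carrier_vec n \<Longrightarrow> fv v = fv w \<longleftrightarrow> v = w"
  by (metis vec_fv)

lemma fv_0 [simp]: "fv (0\<^sub>v n) = 0" by (auto simp: fv_def)
lemma fv_add: "v \<in> carrier_vec n \<Longrightarrow> w \<in> carrier_vec n \<Longrightarrow> fv (v + w) = fv v + fv w"
  by (auto simp: fv_def fun_eq_iff)
lemma fv_smult: "fv (c \<cdot>\<^sub>v v) = scl c (fv v)"
  by (auto simp: fv_def fun_eq_iff)
lemma fv_mult:
  "A \<in> carrier_mat n m \<Longrightarrow> v \<in> carrier_vec m \<Longrightarrow> fv (A *\<^sub>v v) = mv A (fv v)"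
  by (auto simp: fv_def mv_def fun_eq_iff scalar_prod_def atLeast0LessThan intro!: sum.cong)

lemma fv_image: "fv ` carrier_vec n = fs {..<n}"
proof safe
  fix x :: "nat \<Rightarrow> 'a" assume "x \<in> fs {..<n}"
  then show "x \<in> fv ` carrier_vec n" by (intro image_eqI[of _ _ "vec n x"]) (auto simp: fv_vec)
qed (rule fv_fs)

section \<open>Modules and homomorphisms\<close>

lemma module_dim0: "is_module t M \<Longrightarrow> i \<notin> {1..t} \<Longrightarrow> dimv M i = 0"
  and module_A: "is_module t M \<Longrightarrow> arrA M i \<in> carrier_mat (dimv M (Suc i)) (dimv M i)"
  and module_B: "is_module t M \<Longrightarrow> arrB M i \<in> carrier_mat (dimv M i) (dimv M (Suc i))"
  by (auto simp: is_module_def)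

text \<open>The relation at vertex 1 fits the general pattern: M_0 = 0, so the composite through
  vertex 0 is zero, as is \<open>arrB M 1 * arrA M 1\<close>. This spares a separate case whenever
  the relation is applied.\<close>

lemma module_rel:
  assumes "is_module t M" "1 \<le> i" "i < t"
  shows "mv (arrA M (i - 1)) (mv (arrB M (i - 1)) x) = mv (arrB M i) (mv (arrA M i) x)"
proof (cases "i = 1")
  case True
  have "arrA M 0 \<in> carrier_mat (dimv M 1) 0"
    using module_A[OF assms(1), of 0] module_dim0[OF assms(1), of 0] by simp
  moreover have "mv (arrB M 1) (mv (arrA M 1) x) = 0"
    using assms True mv_mult[OF module_B module_A, OF assms(1) assms(1), of 1 x]
    by (simp add: is_module_def)
  ultimately show ?thesis using True by (simp add: mv_zero_dim)
next
  case False
  then have i: "2 \<le> i" "i \<le> t - 1" "Suc (i - 1) = i" using assms by auto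
  then have "arrA M (i - 1) * arrB M (i - 1) = arrB M i * arrA M i"
    using assms(1) by (auto simp: is_module_def)
  then show ?thesis
    using mv_mult[OF module_A module_B, OF assms(1) assms(1), of "i - 1" x]
      mv_mult[OF module_B module_A, OF assms(1) assms(1), of i x] by simp
qed

lemma is_moduleI:
  assumes "\<And>i. i \<notin> {1..t} \<Longrightarrow> dimv M i = 0"
    "\<And>i. arrA M i \<in> carrier_mat (dimv M (Suc i)) (dimv M i)"
    "\<And>i. arrB M i \<in> carrier_mat (dimv M i) (dimv M (Suc i))"
    "\<And>x. 2 \<le> t \<Longrightarrow> mv (arrB M 1) (mv (arrA M 1) x) = 0"
    "\<And>i x. 2 \<le> i \<Longrightarrow> i < t \<Longrightarrow>
      mv (arrA M (i - 1)) (mv (arrB M (i - 1)) x) = mv (arrB M i) (mv (arrA M i) x)"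
  shows "is_module t M"
  unfolding is_module_def
proof (intro conjI allI impI)
  show "arrB M 1 * arrA M 1 = 0\<^sub>m (dimv M 1) (dimv M 1)" if "2 \<le> t"
    by (rule mv_inj[THEN iffD2, OF mult_carrier_mat[OF assms(3) assms(2)]])
      (use assms(4) that in \<open>auto simp: mv_mult[OF assms(3) assms(2)]\<close>)
  fix i assume i: "2 \<le> i \<and> i \<le> t - 1"
  then have s: "Suc (i - 1) = i" "i < t" by auto
  show "arrA M (i - 1) * arrB M (i - 1) = arrB M i * arrA M i"
    by (rule mv_inj[THEN iffD2, OF mult_carrier_mat[OF assms(2,3)[of "i - 1", unfolded s]]
          mult_carrier_mat[OF assms(3) assms(2)]])
      (use assms(5) i s mv_mult[OF assms(2,3)[of "i - 1", unfolded s]] mv_mult[OF assms(3) assms(2)]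
        in auto)
qed (use assms in auto)

lemma hom_c: "is_hom t M N f \<Longrightarrow> f i \<in> carrier_mat (dimv N i) (dimv M i)"
  by (simp add: is_hom_def)

lemma hom_fs: "is_hom t M N f \<Longrightarrow> mv (f i) x \<in> fs {..<dimv N i}"
  by (rule mv_fs[OF hom_c])

lemma is_hom_iff:
  assumes "is_module t M" "is_module t N"
  shows "is_hom t M N f \<longleftrightarrow> (\<forall>i. f i \<in> carrier_mat (dimv N i) (dimv M i)) \<and>
    (\<forall>i x. 1 \<le> i \<and> i < t \<longrightarrow>
       mv (f (Suc i)) (mv (arrA M i) x) = mv (arrA N i) (mv (f i) x) \<and>
       mv (f i) (mv (arrB M i) x) = mv (arrB N i) (mv (f (Suc i)) x))" (is "_ = ?R")
proof (cases "\<forall>i. f i \<in> carrier_mat (dimv N i) (dimv M i)")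
  case True
  then have c: "f i \<in> carrier_mat (dimv N i) (dimv M i)" for i by auto
  note A = module_A[OF assms(1)] module_A[OF assms(2)] and B = module_B[OF assms(1)] module_B[OF assms(2)]
  have "f (i + 1) * arrA M i = arrA N i * f i \<longleftrightarrow>
      (\<forall>x. mv (f (Suc i)) (mv (arrA M i) x) = mv (arrA N i) (mv (f i) x))" for i
    using mv_inj[OF mult_carrier_mat[OF c A(1)] mult_carrier_mat[OF A(2) c]]
    by (simp add: mv_mult[OF c A(1)] mv_mult[OF A(2) c])
  moreover have "f i * arrB M i = arrB N i * f (i + 1) \<longleftrightarrow>
      (\<forall>x. mv (f i) (mv (arrB M i) x) = mv (arrB N i) (mv (f (Suc i)) x))" for i
    using mv_inj[OF mult_carrier_mat[OF c B(1)] mult_carrier_mat[OF B(2) c]]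
    by (simp add: mv_mult[OF c B(1)] mv_mult[OF B(2) c])
  ultimately show ?thesis by (auto simp: is_hom_def)
qed (auto simp: is_hom_def)

lemma hom_A: "is_module t M \<Longrightarrow> is_module t N \<Longrightarrow> is_hom t M N f \<Longrightarrow> 1 \<le> i \<Longrightarrow> i < t \<Longrightarrow>
    mv (f (Suc i)) (mv (arrA M i) x) = mv (arrA N i) (mv (f i) x)"
  and hom_B: "is_module t M \<Longrightarrow> is_module t N \<Longrightarrow> is_hom t M N f \<Longrightarrow> 1 \<le> i \<Longrightarrow> i < t \<Longrightarrow>
    mv (f i) (mv (arrB M i) x) = mv (arrB N i) (mv (f (Suc i)) x)"
  by (auto simp: is_hom_iff)

lemma mv_comp:
  "is_hom t M N f \<Longrightarrow> is_hom t N L g \<Longrightarrow> mv ((g \<circ>\<^sub>h f) i) x = mv (g i) (mv (f i) x)"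
  by (simp add: hom_comp_def mv_mult[OF hom_c hom_c])

lemma mv_hom_add:
  "is_hom t M N f \<Longrightarrow> is_hom t M N g \<Longrightarrow> mv ((f +\<^sub>h g) i) x = mv (f i) x + mv (g i) x"
  by (simp add: hom_add_def mv_plus[OF hom_c hom_c])

lemma mv_hom_smult: "mv ((c \<cdot>\<^sub>h f) i) x = scl c (mv (f i) x)"
  by (simp add: hom_smult_def mv_smult)

lemma mv_hom_id: "x \<in> fs {..<dimv M i} \<Longrightarrow> mv (hom_id M i) x = x"
  by (simp add: hom_id_def mv_1_id)

lemma mv_hom_zero [simp]: "mv (hom_zero M N i) x = 0"
  by (simp add: hom_zero_def)

lemma mv_trunc: "A \<in> carrier_mat n m \<Longrightarrow> mv A (\<lambda>r. if r < m then x r else 0) = mv A x"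
  by (auto simp: mv_def fun_eq_iff intro!: sum.cong)

lemma is_hom_id:
  assumes "is_module t M"
  shows "is_hom t M M (hom_id M)"
proof -
  have "mv (hom_id M (Suc i)) (mv (arrA M i) x) = mv (arrA M i) (mv (hom_id M i) x)"
    "mv (hom_id M i) (mv (arrB M i) x) = mv (arrB M i) (mv (hom_id M (Suc i)) x)" for i x
    unfolding hom_id_def mv_1_id[OF mv_fs[OF module_A[OF assms]]] mv_1_id[OF mv_fs[OF module_B[OF assms]]]
    unfolding mv_1 mv_trunc[OF module_A[OF assms]] mv_trunc[OF module_B[OF assms]] by simp_all
  then show ?thesis unfolding is_hom_iff[OF assms assms] by (simp add: hom_id_def)
qed

lemma is_hom_comp:
  assumes "is_module t M" "is_module t N" "is_module t L" "is_hom t M N f" "is_hom t N L g"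
  shows "is_hom t M L (g \<circ>\<^sub>h f)"
  using assms(4,5) hom_A[OF assms(1,2,4)] hom_A[OF assms(2,3,5)] hom_B[OF assms(1,2,4)] hom_B[OF assms(2,3,5)]
  by (simp add: is_hom_iff[OF assms(1,3)] mv_comp[OF assms(4,5)])
    (auto simp: hom_comp_def intro!: mult_carrier_mat[OF hom_c hom_c])

lemma is_hom_add:
  assumes "is_module t M" "is_module t N" "is_hom t M N f" "is_hom t M N g"
  shows "is_hom t M N (f +\<^sub>h g)"
  using assms(3,4)
  by (simp add: is_hom_iff[OF assms(1,2)] mv_hom_add[OF assms(3,4)] mv_lin)
    (auto simp: hom_add_def)

lemma is_hom_smult:
  assumes "is_module t M" "is_module t N" "is_hom t M N f"
  shows "is_hom t M N (c \<cdot>\<^sub>h f)"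
  using assms(3)
  by (simp add: is_hom_iff[OF assms(1,2)] mv_hom_smult mv_lin)
    (auto simp: hom_smult_def)

lemma is_hom_zero: "is_module t M \<Longrightarrow> is_module t N \<Longrightarrow> is_hom t M N (hom_zero M N)"
  by (simp add: is_hom_iff mv_lin) (simp add: hom_zero_def)

lemma hom_eqI:
  assumes "is_module t M" "is_hom t M N f" "is_hom t M N g"
    "\<And>i x. i \<in> {1..t} \<Longrightarrow> x \<in> fs {..<dimv M i} \<Longrightarrow> mv (f i) x = mv (g i) x"
  shows "f = g"
proof
  fix i
  show "f i = g i"
  proof (cases "i \<in> {1..t}")
    case True then show ?thesis by (intro mv_inj_fs[OF hom_c[OF assms(2)] hom_c[OF assms(3)]] assms(4))
  next
    case False
    then have "dimv M i = 0" using module_dim0[OF assms(1)] by auto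
    then show ?thesis by (intro mv_inj_fs[OF hom_c[OF assms(2)] hom_c[OF assms(3)]]) (simp add: mv_lin)
  qed
qed

section \<open>Complexes and homotopies\<close>

text \<open>The universal property of a module generated freely by vectors \<open>y\<close> at
  vertices \<open>i\<close>, kept apart from any construction: the lifting arguments use only
  existence and uniqueness of a map with prescribed values on generators.\<close>

definition free_gens :: "nat \<Rightarrow> 'k::field rep \<Rightarrow> (nat \<times> (nat \<Rightarrow> 'k)) set \<Rightarrow> bool" where
  "free_gens t P J \<longleftrightarrow> is_module t P \<and>
     (\<forall>i y. (i, y) \<in> J \<longrightarrow> i \<in> {1..t} \<and> y \<in> fs {..<dimv P i}) \<and>
     (\<forall>N c. is_module t N \<longrightarrow> (\<forall>i y. (i, y) \<in> J \<longrightarrow> c i y \<in> fs {..<dimv N i}) \<longrightarrow>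
        (\<exists>f. is_hom t P N f \<and> (\<forall>i y. (i, y) \<in> J \<longrightarrow> mv (f i) y = c i y))) \<and>
     (\<forall>N f g. is_module t N \<longrightarrow> is_hom t P N f \<longrightarrow> is_hom t P N g \<longrightarrow>
        (\<forall>i y. (i, y) \<in> J \<longrightarrow> mv (f i) y = mv (g i) y) \<longrightarrow> f = g)"

definition is_free :: "nat \<Rightarrow> 'k::field rep \<Rightarrow> bool" where
  "is_free t P \<longleftrightarrow> (\<exists>J. free_gens t P J)"

lemma free_gens_module: "free_gens t P J \<Longrightarrow> is_module t P"
  and free_gens_in: "free_gens t P J \<Longrightarrow> (i, y) \<in> J \<Longrightarrow> i \<in> {1..t} \<and> y \<in> fs {..<dimv P i}"
  by (simp_all add: free_gens_def)

lemma free_gens_ex: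
  assumes "free_gens t P J" "is_module t N" "\<And>i y. (i, y) \<in> J \<Longrightarrow> c i y \<in> fs {..<dimv N i}"
  shows "\<exists>f. is_hom t P N f \<and> (\<forall>i y. (i, y) \<in> J \<longrightarrow> mv (f i) y = c i y)"
  using assms(1)[unfolded free_gens_def, THEN conjunct2, THEN conjunct2, THEN conjunct1,
      THEN spec[of _ N], THEN spec[of _ c]] assms(2,3) by simp

lemma free_gens_uniq:
  assumes "free_gens t P J" "is_module t N" "is_hom t P N f" "is_hom t P N g"
    "\<And>i y. (i, y) \<in> J \<Longrightarrow> mv (f i) y = mv (g i) y"
  shows "f = g"
  using assms(1)[unfolded free_gens_def, THEN conjunct2, THEN conjunct2, THEN conjunct2,
      THEN spec[of _ N], THEN spec[of _ f], THEN spec[of _ g]] assms(2-) by simp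

text \<open>Preimages of the values on the generators are chosen one by one; the map they define
  composes with \<open>g\<close> to \<open>f\<close> because both agree on generators.\<close>

lemma free_projective:
  assumes "is_free t P"
  shows "projective t P"
  unfolding projective_def
proof (intro conjI allI impI; (elim conjE)?)
  from assms obtain J where J: "free_gens t P J" by (auto simp: is_free_def)
  note P = free_gens_module[OF J]
  show "is_module t P" by (rule P)
  fix M N :: "'a rep" and g f
  assume h: "is_module t M" "is_module t N" "is_hom t M N g" "epi M N g" "is_hom t P N f"
  have "\<exists>x\<in>fs {..<dimv M i}. mv (g i) x = mv (f i) y" for i y
  proof -
    have v: "vec (dimv N i) (mv (f i) y) \<in> carrier_vec (dimv N i)" by simp
    then obtain x where x: "x \<in> carrier_vec (dimv M i)" "g i *\<^sub>v x = vec (dimv N i) (mv (f i) y)"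
      using h(4) unfolding epi_def by blast
    have "mv (g i) (fv x) = mv (f i) y"
      using fv_mult[OF hom_c[OF h(3)] x(1)] x(2) fv_vec[OF hom_fs[OF h(5)]] by simp
    then show ?thesis using fv_fs[OF x(1)] by auto
  qed
  then obtain c where c: "\<And>i y. c i y \<in> fs {..<dimv M i}" "\<And>i y. mv (g i) (c i y) = mv (f i) y"
    by metis
  obtain e where "is_hom t P M e \<and> (\<forall>i y. (i, y) \<in> J \<longrightarrow> mv (e i) y = c i y)"
    using free_gens_ex[where c = c, OF J h(1) c(1)] by (rule exE)
  then have e: "is_hom t P M e" "\<And>i y. (i, y) \<in> J \<Longrightarrow> mv (e i) y = c i y" by simp_all
  have "g \<circ>\<^sub>h e = f"
    by (rule free_gens_uniq[OF J h(2) is_hom_comp[OF P h(1,2) e(1) h(3)] h(5)])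
      (simp add: mv_comp[OF e(1) h(3)] e(2) c)
  then show "\<exists>h. is_hom t P M h \<and> g \<circ>\<^sub>h h = f" using e(1) by auto
qed

text \<open>If the triangular system for \<open>n1\<close>, \<open>n2\<close> can be solved for each
  element separately, it can be solved by homomorphisms out of a free module, by choosing solutions
  on the generators. With differentials and a quasi-isomorphism as coefficients this is lifting
  against a mapping cone, without constructing the cone.\<close>

lemma free_lift2:
  assumes P: "is_free t P" and N: "is_module t N1" "is_module t N2" and K: "is_module t K1" "is_module t K2"
    and sol: "\<And>i y. i \<in> {1..t} \<Longrightarrow> y \<in> fs {..<dimv P i} \<Longrightarrow>
      \<exists>n1\<in>fs {..<dimv N1 i}. \<exists>n2\<in>fs {..<dimv N2 i}.
        mv (a1 i) n1 = mv (c1 i) y \<and> mv (a2 i) n1 + mv (a3 i) n2 = mv (c2 i) y"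
    and h: "is_hom t N1 K1 a1" "is_hom t N1 K2 a2" "is_hom t N2 K2 a3" "is_hom t P K1 c1" "is_hom t P K2 c2"
  shows "\<exists>f1 f2. is_hom t P N1 f1 \<and> is_hom t P N2 f2 \<and>
    (\<forall>i y. mv (a1 i) (mv (f1 i) y) = mv (c1 i) y) \<and>
    (\<forall>i y. mv (a2 i) (mv (f1 i) y) + mv (a3 i) (mv (f2 i) y) = mv (c2 i) y)"
proof -
  from P obtain J where J: "free_gens t P J" by (auto simp: is_free_def)
  note P = free_gens_module[OF J]
  \<comment> \<open>The condition is vacuous off \<open>J\<close>, which lets the choice functions
    be total.\<close>
  define S where "S = (\<lambda>i y n1 n2. (i, y) \<in> J \<longrightarrow> n1 \<in> fs {..<dimv N1 i} \<and> n2 \<in> fs {..<dimv N2 i} \<and>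
        mv (a1 i) n1 = mv (c1 i) y \<and> mv (a2 i) n1 + mv (a3 i) n2 = mv (c2 i) y)"
  have "\<exists>n1 n2. S i y n1 n2" for i y
    using sol[of i y] free_gens_in[OF J, of i y] unfolding S_def by blast
  then obtain e1 e2 where "S i y (e1 i y) (e2 i y)" for i y by metis
  then have e: "\<And>i y. (i, y) \<in> J \<Longrightarrow> e1 i y \<in> fs {..<dimv N1 i}"
      "\<And>i y. (i, y) \<in> J \<Longrightarrow> e2 i y \<in> fs {..<dimv N2 i}"
      "\<And>i y. (i, y) \<in> J \<Longrightarrow> mv (a1 i) (e1 i y) = mv (c1 i) y"
      "\<And>i y. (i, y) \<in> J \<Longrightarrow> mv (a2 i) (e1 i y) + mv (a3 i) (e2 i y) = mv (c2 i) y"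
    by (simp_all add: S_def)
  obtain f1 where "is_hom t P N1 f1 \<and> (\<forall>i y. (i, y) \<in> J \<longrightarrow> mv (f1 i) y = e1 i y)"
    using free_gens_ex[where c = e1, OF J N(1) e(1)] by (rule exE)
  then have f1: "is_hom t P N1 f1" "\<And>i y. (i, y) \<in> J \<Longrightarrow> mv (f1 i) y = e1 i y" by simp_all
  obtain f2 where "is_hom t P N2 f2 \<and> (\<forall>i y. (i, y) \<in> J \<longrightarrow> mv (f2 i) y = e2 i y)"
    using free_gens_ex[where c = e2, OF J N(2) e(2)] by (rule exE)
  then have f2: "is_hom t P N2 f2" "\<And>i y. (i, y) \<in> J \<Longrightarrow> mv (f2 i) y = e2 i y" by simp_all
  note h1 = is_hom_comp[OF P N(1) K(1) f1(1) h(1)] and h2 = is_hom_comp[OF P N(1) K(2) f1(1) h(2)]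
    and h3 = is_hom_comp[OF P N(2) K(2) f2(1) h(3)]
  have "a1 \<circ>\<^sub>h f1 = c1"
    by (rule free_gens_uniq[OF J K(1) h1 h(4)]) (simp add: mv_comp[OF f1(1) h(1)] f1 e)
  then have 1: "mv (a1 i) (mv (f1 i) y) = mv (c1 i) y" for i y
    using mv_comp[OF f1(1) h(1)] by metis
  have "a2 \<circ>\<^sub>h f1 +\<^sub>h a3 \<circ>\<^sub>h f2 = c2"
    by (rule free_gens_uniq[OF J K(2) is_hom_add[OF P K(2) h2 h3] h(5)])
      (simp add: mv_hom_add[OF h2 h3] mv_comp[OF f1(1) h(2)] mv_comp[OF f2(1) h(3)] f1 f2 e)
  then have 2: "mv (a2 i) (mv (f1 i) y) + mv (a3 i) (mv (f2 i) y) = mv (c2 i) y" for i y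
    using mv_hom_add[OF h2 h3, of i y] by (simp add: mv_comp[OF f1(1) h(2)] mv_comp[OF f2(1) h(3)])
  show ?thesis using f1(1) f2(1) 1 2 by blast
qed

section \<open>Complexes and chain maps on elements\<close>

lemma cpx_mod: "is_cpx t X \<Longrightarrow> is_module t (obj X n)"
  and cpx_dif: "is_cpx t X \<Longrightarrow> is_hom t (obj X n) (obj X (n + 1)) (dif X n)"
  by (auto simp: is_cpx_def)

lemma cpx_dif': "is_cpx t X \<Longrightarrow> is_hom t (obj X (n - 1)) (obj X n) (dif X (n - 1))"
  using cpx_dif[of t X "n - 1"] by simp

lemma cpx_dd: 
  assumes "is_cpx t X"
  shows "mv (dif X (n + 1) i) (mv (dif X n i) x) = 0"
proof -
  have "mv ((dif X (n + 1) \<circ>\<^sub>h dif X n) i) x = 0"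
    using assms by (simp add: is_cpx_def)
  then show ?thesis using mv_comp[OF cpx_dif[OF assms] cpx_dif[OF assms]] by metis
qed

lemma cpx_dd':
  assumes "is_cpx t X"
  shows "mv (dif X n i) (mv (dif X (n - 1) i) x) = 0"
  using cpx_dd[OF assms, of "n - 1"] by simp

lemma chom_hom: "is_chom t X Y f \<Longrightarrow> is_hom t (obj X n) (obj Y n) (f n)"
  by (auto simp: is_chom_def)

lemma is_chom_iff:
  assumes "is_cpx t X" "is_cpx t Y"
  shows "is_chom t X Y f \<longleftrightarrow> (\<forall>n. is_hom t (obj X n) (obj Y n) (f n)) \<and>
    (\<forall>n i x. mv (f (n + 1) i) (mv (dif X n i) x) = mv (dif Y n i) (mv (f n i) x))"
proof (cases "\<forall>n. is_hom t (obj X n) (obj Y n) (f n)")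
  case True
  then have h: "is_hom t (obj X n) (obj Y n) (f n)" for n by auto
  have "f (n + 1) \<circ>\<^sub>h dif X n = dif Y n \<circ>\<^sub>h f n \<longleftrightarrow>
      (\<forall>i x. mv (f (n + 1) i) (mv (dif X n i) x) = mv (dif Y n i) (mv (f n i) x))" for n
  proof
    assume "f (n + 1) \<circ>\<^sub>h dif X n = dif Y n \<circ>\<^sub>h f n"
    then show "\<forall>i x. mv (f (n + 1) i) (mv (dif X n i) x) = mv (dif Y n i) (mv (f n i) x)"
      using mv_comp[OF cpx_dif[OF assms(1), of n] h] mv_comp[OF h cpx_dif[OF assms(2), of n]] by metis
  next
    assume *: "\<forall>i x. mv (f (n + 1) i) (mv (dif X n i) x) = mv (dif Y n i) (mv (f n i) x)"
    show "f (n + 1) \<circ>\<^sub>h dif X n = dif Y n \<circ>\<^sub>h f n"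
      by (rule hom_eqI[OF cpx_mod[OF assms(1)]
            is_hom_comp[OF cpx_mod cpx_mod cpx_mod cpx_dif h, OF assms(1,1,2,1)]
            is_hom_comp[OF cpx_mod cpx_mod cpx_mod h cpx_dif, OF assms(1,2,2,2)]])
        (simp add: * mv_comp[OF cpx_dif[OF assms(1), of n] h] mv_comp[OF h cpx_dif[OF assms(2), of n]])
  qed
  then show ?thesis by (simp add: is_chom_def)
qed (auto simp: is_chom_def)

lemma chom_comm:
  assumes "is_cpx t X" "is_cpx t Y" "is_chom t X Y f"
  shows "mv (f (n + 1) i) (mv (dif X n i) x) = mv (dif Y n i) (mv (f n i) x)"
  using assms by (simp add: is_chom_iff)

lemma chom_comm':
  assumes "is_cpx t X" "is_cpx t Y" "is_chom t X Y f"
  shows "mv (f n i) (mv (dif X (n - 1) i) x) = mv (dif Y (n - 1) i) (mv (f (n - 1) i) x)"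
  using chom_comm[OF assms, of "n - 1"] by simp

lemma mv_chom_comp:
  "is_chom t X Y f \<Longrightarrow> is_chom t Y Z g \<Longrightarrow> mv ((g \<circ>\<^sub>c f) n i) x = mv (g n i) (mv (f n i) x)"
  unfolding chom_comp_def by (rule mv_comp[OF chom_hom chom_hom])

lemma is_chom_comp:
  assumes "is_cpx t X" "is_cpx t Y" "is_cpx t Z" "is_chom t X Y f" "is_chom t Y Z g"
  shows "is_chom t X Z (g \<circ>\<^sub>c f)"
  unfolding is_chom_iff[OF assms(1,3)] mv_chom_comp[OF assms(4,5)]
  using is_hom_comp[OF cpx_mod cpx_mod cpx_mod chom_hom chom_hom, OF assms]
  by (auto simp: chom_comm[OF assms(1,2,4)] chom_comm[OF assms(2,3,5)] chom_comp_def[abs_def])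

lemma is_chom_id: "is_cpx t X \<Longrightarrow> is_chom t X X (chom_id X)"
  unfolding is_chom_iff chom_id_def hom_id_def mv_1_id[OF hom_fs[OF cpx_dif]]
  by (auto simp: mv_1 mv_trunc[OF hom_c[OF cpx_dif]] is_hom_id[OF cpx_mod, unfolded hom_id_def])

lemma chom_comp_id: 
  assumes "is_chom t X Y f"
  shows "f \<circ>\<^sub>c chom_id X = f" "chom_id Y \<circ>\<^sub>c f = f"
proof -
  have "f n i * 1\<^sub>m (dimv (obj X n) i) = f n i" "1\<^sub>m (dimv (obj Y n) i) * f n i = f n i" for n i
    using hom_c[OF chom_hom[OF assms]] by (auto intro: right_mult_one_mat left_mult_one_mat)
  then show "f \<circ>\<^sub>c chom_id X = f" "chom_id Y \<circ>\<^sub>c f = f"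
    by (simp_all add: chom_comp_def hom_comp_def chom_id_def hom_id_def)
qed

lemma chom_comp_assoc:
  assumes "is_chom t X Y f" "is_chom t Y Z g" "is_chom t Z W h"
  shows "h \<circ>\<^sub>c (g \<circ>\<^sub>c f) = (h \<circ>\<^sub>c g) \<circ>\<^sub>c f"
proof -
  have "h n i * (g n i * f n i) = h n i * g n i * f n i" for n i
    using hom_c[OF chom_hom[OF assms(1)]] hom_c[OF chom_hom[OF assms(2)]] hom_c[OF chom_hom[OF assms(3)]]
    by (metis assoc_mult_mat)
  then show ?thesis by (simp add: chom_comp_def hom_comp_def)
qed

section \<open>Homotopies on elements\<close>

definition htpy :: "nat \<Rightarrow> 'k::field cpx \<Rightarrow> 'k cpx \<Rightarrow> 'k chom \<Rightarrow> 'k chom \<Rightarrow> 'k chom \<Rightarrow> bool" where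
  "htpy t X Y f g h \<longleftrightarrow> (\<forall>n. is_hom t (obj X n) (obj Y (n - 1)) (h n)) \<and>
     (\<forall>n i x. mv (f n i) x = mv (g n i) x +
        (mv (dif Y (n - 1) i) (mv (h n i) x) + mv (h (n + 1) i) (mv (dif X n i) x)))"

lemma homotopic_iff:
  assumes "is_cpx t X" "is_cpx t Y" "is_chom t X Y f" "is_chom t X Y g"
  shows "homotopic t X Y f g \<longleftrightarrow> (\<exists>h. htpy t X Y f g h)"
proof -
  have eq: "(\<forall>n. f n = g n +\<^sub>h (dif Y (n - 1) \<circ>\<^sub>h h n +\<^sub>h h (n + 1) \<circ>\<^sub>h dif X n)) \<longleftrightarrow>
    (\<forall>n i x. mv (f n i) x = mv (g n i) x +
        (mv (dif Y (n - 1) i) (mv (h n i) x) + mv (h (n + 1) i) (mv (dif X n i) x)))"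
    if h: "\<And>n. is_hom t (obj X n) (obj Y (n - 1)) (h n)" for h
  proof -
    note m = cpx_mod[OF assms(1)] cpx_mod[OF assms(2)]
    have h': "is_hom t (obj X (n + 1)) (obj Y n) (h (n + 1))" for n using h[of "n + 1"] by simp
    note c1 = is_hom_comp[OF m(1,2,2) h cpx_dif'[OF assms(2)]]
      and c2 = is_hom_comp[OF m(1,1,2) cpx_dif[OF assms(1)] h']
    note c = is_hom_add[OF m c1 c2]
    note c' = is_hom_add[OF m chom_hom[OF assms(4)] c]
    have mv: "mv ((g n +\<^sub>h (dif Y (n - 1) \<circ>\<^sub>h h n +\<^sub>h h (n + 1) \<circ>\<^sub>h dif X n)) i) x = mv (g n i) x +
        (mv (dif Y (n - 1) i) (mv (h n i) x) + mv (h (n + 1) i) (mv (dif X n i) x))" for n i x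
      by (simp add: mv_hom_add[OF chom_hom[OF assms(4)] c] mv_hom_add[OF c1 c2]
         mv_comp[OF h cpx_dif'[OF assms(2)]] mv_comp[OF cpx_dif[OF assms(1)] h'])
    show ?thesis
      unfolding mv[symmetric] using hom_eqI[OF m(1) chom_hom[OF assms(3)] c'] by metis
  qed
  show ?thesis unfolding homotopic_def htpy_def using eq by (intro ex_cong1 conj_cong refl) blast
qed

lemma htpyD:
  assumes "htpy t X Y f g h"
  shows "is_hom t (obj X n) (obj Y (n - 1)) (h n)"
    "mv (f n i) x = mv (g n i) x + (mv (dif Y (n - 1) i) (mv (h n i) x) + mv (h (n + 1) i) (mv (dif X n i) x))"
    "is_hom t (obj X (n + 1)) (obj Y n) (h (n + 1))"
proof -
  from assms have h: "is_hom t (obj X n) (obj Y (n - 1)) (h n)" for n by (simp add: htpy_def)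
  then show "is_hom t (obj X n) (obj Y (n - 1)) (h n)" .
  show "is_hom t (obj X (n + 1)) (obj Y n) (h (n + 1))" using h[of "n + 1"] by simp
qed (use assms in \<open>auto simp: htpy_def\<close>)

lemma homotopic_refl:
  assumes "is_cpx t X" "is_cpx t Y" "is_chom t X Y f"
  shows "homotopic t X Y f f"
  unfolding homotopic_iff[OF assms assms(3)]
  by (rule exI[of _ "\<lambda>n. hom_zero (obj X n) (obj Y (n - 1))"])
    (use cpx_mod[OF assms(1)] cpx_mod[OF assms(2)] in \<open>auto simp: htpy_def is_hom_zero mv_lin\<close>)

lemma homotopic_sym:
  assumes "is_cpx t X" "is_cpx t Y" "is_chom t X Y f" "is_chom t X Y g" "homotopic t X Y f g"
  shows "homotopic t X Y g f"
proof -
  obtain h where h: "htpy t X Y f g h" using assms by (auto simp: homotopic_iff)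
  have "htpy t X Y g f (\<lambda>n. (- 1) \<cdot>\<^sub>h h n)"
    unfolding htpy_def
    using htpyD(1)[OF h] is_hom_smult[OF cpx_mod[OF assms(1)] cpx_mod[OF assms(2)]]
    by (auto simp: mv_hom_smult mv_lin htpyD(2)[OF h] fun_eq_iff)
  then show ?thesis using assms by (auto simp: homotopic_iff)
qed

lemma homotopic_trans:
  assumes "is_cpx t X" "is_cpx t Y" "is_chom t X Y f" "is_chom t X Y g" "is_chom t X Y k"
    "homotopic t X Y f g" "homotopic t X Y g k"
  shows "homotopic t X Y f k"
proof -
  obtain h h' where h: "htpy t X Y f g h" and h': "htpy t X Y g k h'" 
    using assms by (auto simp: homotopic_iff)
  have "htpy t X Y f k (\<lambda>n. h n +\<^sub>h h' n)"
    unfolding htpy_def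
    using is_hom_add[OF cpx_mod[OF assms(1)] cpx_mod[OF assms(2)] htpyD(1)[OF h] htpyD(1)[OF h']]
    by (auto simp: mv_hom_add[OF htpyD(1)[OF h] htpyD(1)[OF h']] mv_lin htpyD(2)[OF h] htpyD(2)[OF h']
        mv_hom_add[OF htpyD(3)[OF h] htpyD(3)[OF h']])
  then show ?thesis using assms by (auto simp: homotopic_iff)
qed

lemma homotopic_comp_left:
  assumes "is_cpx t X" "is_cpx t Y" "is_cpx t Z" "is_chom t X Y f" "is_chom t X Y g" "is_chom t Y Z u"
    "homotopic t X Y f g"
  shows "homotopic t X Z (u \<circ>\<^sub>c f) (u \<circ>\<^sub>c g)"
proof -
  obtain h where h: "htpy t X Y f g h" using assms by (auto simp: homotopic_iff)
  have u: "is_hom t (obj Y (n - 1)) (obj Z (n - 1)) (u (n - 1))" for n using chom_hom[OF assms(6)] .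
  have "htpy t X Z (u \<circ>\<^sub>c f) (u \<circ>\<^sub>c g) (\<lambda>n. u (n - 1) \<circ>\<^sub>h h n)"
    unfolding htpy_def
    using is_hom_comp[OF cpx_mod[OF assms(1)] cpx_mod[OF assms(2)] cpx_mod[OF assms(3)] htpyD(1)[OF h] u]
    by (auto simp: mv_comp[OF htpyD(1)[OF h] u] mv_comp[OF htpyD(3)[OF h] chom_hom[OF assms(6)]]
        mv_chom_comp[OF assms(4,6)] mv_chom_comp[OF assms(5,6)] mv_lin htpyD(2)[OF h]
        chom_comm'[OF assms(2,3,6)])
  then show ?thesis
    using homotopic_iff[OF assms(1,3) is_chom_comp[OF assms(1,2,3,4,6)] is_chom_comp[OF assms(1,2,3,5,6)]] by auto
qed

lemma homotopic_comp_right: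
  assumes "is_cpx t X" "is_cpx t Y" "is_cpx t Z" "is_chom t Y Z f" "is_chom t Y Z g" "is_chom t X Y u"
    "homotopic t Y Z f g"
  shows "homotopic t X Z (f \<circ>\<^sub>c u) (g \<circ>\<^sub>c u)"
proof -
  obtain h where h: "htpy t Y Z f g h" using assms by (auto simp: homotopic_iff)
  have "htpy t X Z (f \<circ>\<^sub>c u) (g \<circ>\<^sub>c u) (\<lambda>n. h n \<circ>\<^sub>h u n)"
    unfolding htpy_def
    using is_hom_comp[OF cpx_mod[OF assms(1)] cpx_mod[OF assms(2)] cpx_mod[OF assms(3)] chom_hom[OF assms(6)] htpyD(1)[OF h]]
    by (auto simp: mv_comp[OF chom_hom[OF assms(6)] htpyD(1)[OF h]] mv_comp[OF chom_hom[OF assms(6)] htpyD(3)[OF h]]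
        mv_chom_comp[OF assms(6,4)] mv_chom_comp[OF assms(6,5)] mv_lin htpyD(2)[OF h]
        chom_comm[OF assms(1,2,6)])
  then show ?thesis
    using homotopic_iff[OF assms(1,3) is_chom_comp[OF assms(1,2,3,6,4)] is_chom_comp[OF assms(1,2,3,6,5)]] by auto
qed

section \<open>Quasi-isomorphisms on elements\<close>

lemma quasi_iso_iff:
  assumes "is_cpx t X" "is_cpx t Y"
  shows "quasi_iso t X Y f \<longleftrightarrow> is_chom t X Y f \<and>
     (\<forall>n i. \<forall>x\<in>fs {..<dimv (obj X n) i}. \<forall>y\<in>fs {..<dimv (obj Y (n - 1)) i}.
        mv (dif X n i) x = 0 \<and> mv (f n i) x = mv (dif Y (n - 1) i) y \<longrightarrow>
        (\<exists>z\<in>fs {..<dimv (obj X (n - 1)) i}. x = mv (dif X (n - 1) i) z)) \<and>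
     (\<forall>n i. \<forall>y\<in>fs {..<dimv (obj Y n) i}. mv (dif Y n i) y = 0 \<longrightarrow>
        (\<exists>x\<in>fs {..<dimv (obj X n) i}. \<exists>b\<in>fs {..<dimv (obj Y (n - 1)) i}.
           mv (dif X n i) x = 0 \<and> y = mv (f n i) x + mv (dif Y (n - 1) i) b))"
proof (cases "is_chom t X Y f")
  case f: True
  have coc: "x \<in> cocycles Z n i \<longleftrightarrow> x \<in> carrier_vec (dimv (obj Z n) i) \<and> mv (dif Z n i) (fv x) = 0"
    if "is_cpx t Z" for Z :: "'a cpx" and n i x
    using fv_mult[OF hom_c[OF cpx_dif[OF that]], of x n i]
      fv_inj[of "dif Z n i *\<^sub>v x" "dimv (obj Z (n + 1)) i" "0\<^sub>v (dimv (obj Z (n + 1)) i)"]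
      mult_mat_vec_carrier[OF hom_c[OF cpx_dif[OF that]], of x n i]
    by (auto simp: cocycles_def)
  have cob: "x \<in> coboundaries Z n i \<longleftrightarrow> x \<in> carrier_vec (dimv (obj Z n) i) \<and>
      (\<exists>z\<in>fs {..<dimv (obj Z (n - 1)) i}. fv x = mv (dif Z (n - 1) i) z)"
    if "is_cpx t Z" for Z :: "'a cpx" and n i x
  proof -
    note d = hom_c[OF cpx_dif'[OF that], of n i]
    have "x = dif Z (n - 1) i *\<^sub>v v \<longleftrightarrow> x \<in> carrier_vec (dimv (obj Z n) i) \<and> fv x = mv (dif Z (n - 1) i) (fv v)"
      if "v \<in> carrier_vec (dimv (obj Z (n - 1)) i)" for v
      using fv_mult[OF d that] mult_mat_vec_carrier[OF d that] fv_inj by metis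
    then show ?thesis
      unfolding coboundaries_def image_iff by (auto simp: fv_image[symmetric])
  qed
  have 1: "(\<forall>x\<in>cocycles X n i. f n i *\<^sub>v x \<in> coboundaries Y n i \<longrightarrow> x \<in> coboundaries X n i) \<longleftrightarrow>
     (\<forall>x\<in>fs {..<dimv (obj X n) i}. \<forall>y\<in>fs {..<dimv (obj Y (n - 1)) i}.
        mv (dif X n i) x = 0 \<and> mv (f n i) x = mv (dif Y (n - 1) i) y \<longrightarrow>
        (\<exists>z\<in>fs {..<dimv (obj X (n - 1)) i}. x = mv (dif X (n - 1) i) z))" for n i
  proof -
    note c = hom_c[OF chom_hom[OF f]]
    show ?thesis
      unfolding fv_image[of "dimv (obj X n) i", symmetric]
      by (auto simp: coc[OF assms(1)] cob[OF assms(1)] cob[OF assms(2)] fv_mult[OF c]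
          mult_mat_vec_carrier[OF c])
  qed
  have 2: "(\<forall>y\<in>cocycles Y n i. \<exists>x\<in>cocycles X n i. \<exists>b\<in>coboundaries Y n i. y = f n i *\<^sub>v x + b) \<longleftrightarrow>
     (\<forall>y\<in>fs {..<dimv (obj Y n) i}. mv (dif Y n i) y = 0 \<longrightarrow>
        (\<exists>x\<in>fs {..<dimv (obj X n) i}. \<exists>b\<in>fs {..<dimv (obj Y (n - 1)) i}.
           mv (dif X n i) x = 0 \<and> y = mv (f n i) x + mv (dif Y (n - 1) i) b))" for n i
  proof -
    note c = hom_c[OF chom_hom[OF f], of n i] and d = hom_c[OF cpx_dif'[OF assms(2)], of n i]
    have "(\<exists>b\<in>coboundaries Y n i. y = f n i *\<^sub>v x + b) \<longleftrightarrow>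
        (\<exists>b\<in>fs {..<dimv (obj Y (n - 1)) i}. fv y = mv (f n i) (fv x) + mv (dif Y (n - 1) i) b)"
      if x: "x \<in> carrier_vec (dimv (obj X n) i)" and y: "y \<in> carrier_vec (dimv (obj Y n) i)" for x y
    proof -
      have *: "fv (f n i *\<^sub>v x + dif Y (n - 1) i *\<^sub>v b) = mv (f n i) (fv x) + mv (dif Y (n - 1) i) (fv b)"
        if "b \<in> carrier_vec (dimv (obj Y (n - 1)) i)" for b
        using fv_add[OF mult_mat_vec_carrier[OF c x] mult_mat_vec_carrier[OF d that]] fv_mult[OF c x] fv_mult[OF d that]
        by simp
      have **: "y = f n i *\<^sub>v x + dif Y (n - 1) i *\<^sub>v b \<longleftrightarrow> fv y = mv (f n i) (fv x) + mv (dif Y (n - 1) i) (fv b)"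
        if "b \<in> carrier_vec (dimv (obj Y (n - 1)) i)" for b
        using *[OF that] fv_inj[OF y add_carrier_vec[OF mult_mat_vec_carrier[OF c x] mult_mat_vec_carrier[OF d that]]]
        by simp
      show ?thesis
        unfolding coboundaries_def fv_image[of "dimv (obj Y (n - 1)) i", symmetric] bex_simps using ** by auto
    qed
    note eq = this
    have "(\<exists>x\<in>cocycles X n i. \<exists>b\<in>coboundaries Y n i. y = f n i *\<^sub>v x + b) \<longleftrightarrow>
       (\<exists>x\<in>fs {..<dimv (obj X n) i}. \<exists>b\<in>fs {..<dimv (obj Y (n - 1)) i}.
           mv (dif X n i) x = 0 \<and> fv y = mv (f n i) x + mv (dif Y (n - 1) i) b)" (is "?L \<longleftrightarrow> ?R")
      if y: "y \<in> carrier_vec (dimv (obj Y n) i)" for y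
    proof -
      have "?L \<longleftrightarrow> (\<exists>x\<in>carrier_vec (dimv (obj X n) i). mv (dif X n i) (fv x) = 0 \<and>
          (\<exists>b\<in>fs {..<dimv (obj Y (n - 1)) i}. fv y = mv (f n i) (fv x) + mv (dif Y (n - 1) i) b))"
        unfolding Bex_def by (rule ex_cong1) (simp add: coc[OF assms(1)] eq[unfolded Bex_def, OF _ y] cong: conj_cong)
      also have "\<dots> \<longleftrightarrow> ?R"
        unfolding fv_image[of "dimv (obj X n) i", symmetric] by simp
      finally show ?thesis .
    qed
    note eq2 = this
    show ?thesis
      unfolding fv_image[of "dimv (obj Y n) i", symmetric] ball_simps
      unfolding Ball_def by (rule all_cong1) (auto simp: coc[OF assms(2)] eq2)
  qed
  show ?thesis unfolding quasi_iso_def 1 2 ..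
qed (auto simp: quasi_iso_def)

section \<open>Maps from free complexes into quasi-isomorphic complexes\<close>

lemma quasi_iso_chom: "quasi_iso t X Y f \<Longrightarrow> is_chom t X Y f"
  by (simp add: quasi_iso_def)

lemma quasi_iso_inj:
  assumes "is_cpx t X" "is_cpx t Y" "quasi_iso t X Y f"
    "x \<in> fs {..<dimv (obj X n) i}" "y \<in> fs {..<dimv (obj Y (n - 1)) i}"
    "mv (dif X n i) x = 0" "mv (f n i) x = mv (dif Y (n - 1) i) y"
  obtains z where "z \<in> fs {..<dimv (obj X (n - 1)) i}" "x = mv (dif X (n - 1) i) z"
  using assms(3)[unfolded quasi_iso_iff[OF assms(1,2)], THEN conjunct2, THEN conjunct1, THEN spec[of _ n],
      THEN spec[of _ i], THEN bspec[OF _ assms(4)], THEN bspec[OF _ assms(5)]] assms(6,7) by blast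

lemma quasi_iso_surj:
  assumes "is_cpx t X" "is_cpx t Y" "quasi_iso t X Y f"
    "y \<in> fs {..<dimv (obj Y n) i}" "mv (dif Y n i) y = 0"
  obtains x b where "x \<in> fs {..<dimv (obj X n) i}" "b \<in> fs {..<dimv (obj Y (n - 1)) i}"
    "mv (dif X n i) x = 0" "y = mv (f n i) x + mv (dif Y (n - 1) i) b"
  using assms(3)[unfolded quasi_iso_iff[OF assms(1,2)], THEN conjunct2, THEN conjunct2, THEN spec[of _ n],
      THEN spec[of _ i], THEN bspec[OF _ assms(4)]] assms(5) by blast

text \<open>On a cocycle the two maps differ by the coboundary
  \<open>mv (dif Y (n - 1) i) (mv (h n i) x)\<close>, so they induce the same map on
  cohomology.\<close>

lemma quasi_iso_homotopic:
  assumes X: "is_cpx t X" and Y: "is_cpx t Y" and f: "quasi_iso t X Y f" and g: "is_chom t X Y g"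
    and fg: "homotopic t X Y f g"
  shows "quasi_iso t X Y g"
proof -
  note cf = quasi_iso_chom[OF f]
  obtain h where h: "htpy t X Y f g h" using fg by (auto simp: homotopic_iff[OF X Y cf g])
  have eq: "mv (f n i) x = mv (g n i) x + mv (dif Y (n - 1) i) (mv (h n i) x)"
    if "mv (dif X n i) x = 0" for n i x
    using htpyD(2)[OF h, of n i x] that by (simp add: mv_lin)
  note hf = hom_fs[OF htpyD(1)[OF h]]
  show ?thesis
    unfolding quasi_iso_iff[OF X Y]
  proof (intro conjI allI ballI impI g)
    fix n i x y
    assume x: "x \<in> fs {..<dimv (obj X n) i}" and y: "y \<in> fs {..<dimv (obj Y (n - 1)) i}"
      and a: "mv (dif X n i) x = 0 \<and> mv (g n i) x = mv (dif Y (n - 1) i) y"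
    have "mv (f n i) x = mv (dif Y (n - 1) i) (y + mv (h n i) x)"
      using eq[of n i x] a by (simp add: mv_lin)
    from quasi_iso_inj[OF X Y f x fs_add[OF y hf] _ this] a
    show "\<exists>z\<in>fs {..<dimv (obj X (n - 1)) i}. x = mv (dif X (n - 1) i) z" by blast
  next
    fix n i y
    assume "y \<in> fs {..<dimv (obj Y n) i}" "mv (dif Y n i) y = 0"
    then obtain x b where *: "x \<in> fs {..<dimv (obj X n) i}" "b \<in> fs {..<dimv (obj Y (n - 1)) i}"
      "mv (dif X n i) x = 0" "y = mv (f n i) x + mv (dif Y (n - 1) i) b"
      using quasi_iso_surj[OF X Y f] by blast
    show "\<exists>x\<in>fs {..<dimv (obj X n) i}. \<exists>b\<in>fs {..<dimv (obj Y (n - 1)) i}.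
        mv (dif X n i) x = 0 \<and> y = mv (g n i) x + mv (dif Y (n - 1) i) b"
      by (rule bexI[OF _ *(1)], rule bexI[OF _ fs_add[OF *(2) hf]])
        (use *(3,4) eq[OF *(3)] in \<open>simp add: mv_lin\<close>)
  qed
qed

text \<open>Dependent choice downwards along the integers: beyond the bound \<open>b\<close> the
  prescribed values \<open>z\<close> serve, below it each value is chosen from its upper neighbour.
  The invariant \<open>A\<close> is what makes the next choice possible.\<close>

lemma int_descend:
  fixes b :: int
  assumes z: "\<And>n. b < n \<Longrightarrow> A n (z n)" "\<And>n. b < n \<Longrightarrow> R n (z (n + 1)) (z n)"
    and step: "\<And>n x. A (n + 1) x \<Longrightarrow> \<exists>y. A n y \<and> R n x y"
  shows "\<exists>F. \<forall>n. A n (F n) \<and> R n (F (n + 1)) (F n)"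
proof -
  have "\<exists>G. \<forall>k. A (b + 1 - int k) (G k) \<and> (G 0 = z (b + 1) \<or> k \<noteq> 0) \<and> R (b - int k) (G k) (G (Suc k))"
  proof -
    have "\<exists>G. \<forall>k. (A (b + 1 - int k) (G k) \<and> (k = 0 \<longrightarrow> G k = z (b + 1))) \<and> R (b - int k) (G k) (G (Suc k))"
    proof (rule dependent_nat_choice)
      show "\<exists>x. A (b + 1 - int 0) x \<and> (0 = (0::nat) \<longrightarrow> x = z (b + 1))" using z(1)[of "b + 1"] by auto
      fix x k assume "A (b + 1 - int k) x \<and> (k = 0 \<longrightarrow> x = z (b + 1))"
      then show "\<exists>y. (A (b + 1 - int (Suc k)) y \<and> (Suc k = 0 \<longrightarrow> y = z (b + 1))) \<and> R (b - int k) x y"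
        using step[of "b - int k" x] by (auto simp: algebra_simps)
    qed
    then show ?thesis by blast
  qed
  then obtain G where G: "\<And>k. A (b + 1 - int k) (G k)" "G 0 = z (b + 1)" "\<And>k. R (b - int k) (G k) (G (Suc k))"
    by blast
  \<comment> \<open>The seam is at \<open>b + 1\<close>, where \<open>G 0\<close> and
    \<open>z\<close> agree, so \<open>R\<close> holds across it.\<close>
  define F where "F n = (if b + 1 < n then z n else G (nat (b + 1 - n)))" for n
  have "A n (F n) \<and> R n (F (n + 1)) (F n)" for n
  proof (cases "b < n")
    case True
    then have "F n = z n" "F (n + 1) = z (n + 1)" using G(2) by (cases "n = b + 1"; auto simp: F_def)+
    then show ?thesis using z[OF True] by simp
  next
    case False
    define k where "k = nat (b - n)"
    have k: "n = b - int k" using False by (simp add: k_def)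
    have "nat (1 + int k) = Suc k" by arith
    then have F: "F (n + 1) = G k" "F n = G (Suc k)" by (simp_all add: F_def k)
    show ?thesis unfolding F using G(1)[of "Suc k"] G(3)[of k] by (simp add: k algebra_simps)
  qed
  then show ?thesis by blast
qed

lemma zero_rep_mv:
  assumes "is_zero_rep P" "is_hom t P N f"
  shows "mv (f i) x = 0"
  using mv_zero_dim(1)[of "f i" "dimv N i"] hom_c[OF assms(2), of i] assms(1) by (simp add: is_zero_rep_def)

locale free_lifting =
  fixes t :: nat and P Z X :: "'k::field cpx" and s :: "'k chom"
  assumes P: "is_cpx t P" and Z: "is_cpx t Z" and X: "is_cpx t X"
    and free: "\<And>n. is_free t (obj P n)" and s: "quasi_iso t Z X s"
begin

lemmas cs = quasi_iso_chom[OF s]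
lemmas PM = cpx_mod[OF P] and ZM = cpx_mod[OF Z] and XM = cpx_mod[OF X]
lemmas dP = cpx_dif[OF P] and dZ = cpx_dif[OF Z] and dX = cpx_dif[OF X]
lemmas sh = chom_hom[OF cs]

lemma bound: obtains b where "\<And>n. b < n \<Longrightarrow> is_zero_rep (obj P n)"
  using P unfolding is_cpx_def by blast

text \<open>The lift and the homotopy to \<open>f\<close> are constructed together from the top
  degree downwards, as pairs \<open>(p, q)\<close>; one step amounts to the acyclicity of the
  mapping cone of \<open>s\<close>.\<close>

lemma lift_ex:
  assumes f: "is_chom t P X f"
  shows "\<exists>g. is_chom t P Z g \<and> homotopic t P X (s \<circ>\<^sub>c g) f"
proof -
  obtain b where b: "\<And>n. b < n \<Longrightarrow> is_zero_rep (obj P n)" using bound by blast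
  \<comment> \<open>\<open>A\<close> holds the two compatibilities that remain after composing with
    the differential of \<open>P\<close>. They are the conditions under which the equations
    \<open>R\<close> in degree \<open>n - 1\<close> can be solved.\<close>
  define A where "A n pq \<longleftrightarrow> is_hom t (obj P n) (obj Z n) (fst pq) \<and> is_hom t (obj P n) (obj X (n - 1)) (snd pq) \<and>
    (\<forall>i y. mv (dif Z n i) (mv (fst pq i) (mv (dif P (n - 1) i) y)) = 0) \<and>
    (\<forall>i y. mv (s n i) (mv (fst pq i) (mv (dif P (n - 1) i) y)) =
       mv (dif X (n - 1) i) (mv (f (n - 1) i) y - mv (snd pq i) (mv (dif P (n - 1) i) y)))" for n pq
  define R where "R n pq pq' \<longleftrightarrow>
    (\<forall>i y. mv (dif Z n i) (mv (fst pq' i) y) = mv (fst pq i) (mv (dif P n i) y)) \<and>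
    (\<forall>i y. mv (s n i) (mv (fst pq' i) y) + mv (dif X (n - 1) i) (mv (snd pq' i) y) =
       mv (f n i) y - mv (snd pq i) (mv (dif P n i) y))" for n and pq pq' :: "'k hom \<times> 'k hom"
  note f0 = chom_hom[OF f]
  define z where "z n = (hom_zero (obj P n) (obj Z n), hom_zero (obj P n) (obj X (n - 1)))" for n
  have "\<exists>F. \<forall>n. A n (F n) \<and> R n (F (n + 1)) (F n)"
  proof (rule int_descend)
    fix n assume n: "b < n"
    have "mv (dif P n i) y = 0" for i y using zero_rep_mv[OF b[OF n] dP] .
    moreover have "mv (f n i) y = 0" for i y using zero_rep_mv[OF b[OF n] f0] .
    ultimately show "R n (z (n + 1)) (z n)" by (simp add: R_def z_def mv_lin)
    have "mv (dif X (n - 1) i) (mv (f (n - 1) i) y) = 0" for i y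
      using chom_comm'[OF P X f, of n i y] zero_rep_mv[OF b[OF n] f0] by simp
    then show "A n (z n)" by (simp add: A_def z_def is_hom_zero PM ZM XM mv_lin)
  next
    fix n pq assume A: "A (n + 1) pq"
    obtain p q where pq: "pq = (p, q)" by (cases pq)
    have p: "is_hom t (obj P (n + 1)) (obj Z (n + 1)) p" and q: "is_hom t (obj P (n + 1)) (obj X n) q"
      and A1: "\<And>i y. mv (dif Z (n + 1) i) (mv (p i) (mv (dif P n i) y)) = 0"
      and A2: "\<And>i y. mv (s (n + 1) i) (mv (p i) (mv (dif P n i) y)) =
         mv (dif X n i) (mv (f n i) y - mv (q i) (mv (dif P n i) y))"
      using A by (simp_all add: A_def pq)
    note pd = is_hom_comp[OF PM PM ZM dP p] and qd = is_hom_comp[OF PM PM XM dP q]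
    note c2 = is_hom_add[OF PM XM f0 is_hom_smult[OF PM XM qd, of "-1"]]
    have e2: "mv ((f n +\<^sub>h (- 1) \<cdot>\<^sub>h (q \<circ>\<^sub>h dif P n)) i) y = mv (f n i) y - mv (q i) (mv (dif P n i) y)" for i y
      by (simp add: mv_hom_add[OF f0 is_hom_smult[OF PM XM qd]] mv_hom_smult mv_comp[OF dP q] fun_eq_iff)
    have "\<exists>f1 f2. is_hom t (obj P n) (obj Z n) f1 \<and> is_hom t (obj P n) (obj X (n - 1)) f2 \<and>
      (\<forall>i y. mv (dif Z n i) (mv (f1 i) y) = mv ((p \<circ>\<^sub>h dif P n) i) y) \<and>
      (\<forall>i y. mv (s n i) (mv (f1 i) y) + mv (dif X (n - 1) i) (mv (f2 i) y)
         = mv ((f n +\<^sub>h (- 1) \<cdot>\<^sub>h (q \<circ>\<^sub>h dif P n)) i) y)"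
    proof (rule free_lift2[OF free ZM XM ZM XM _ dZ sh cpx_dif'[OF X] pd c2], unfold e2 mv_comp[OF dP p])
      fix i y
      have m: "mv (p i) (mv (dif P n i) y) \<in> fs {..<dimv (obj Z (n + 1)) i}" using hom_fs[OF p] .
      have m2: "mv (f n i) y - mv (q i) (mv (dif P n i) y) \<in> fs {..<dimv (obj X n) i}"
        using fs_diff[OF hom_fs[OF f0] hom_fs[OF q]] .
      \<comment> \<open>\<open>s\<close> takes the required differential to a coboundary, so
        injectivity on cohomology yields \<open>w\<close>. What is left over in \<open>X\<close> is
        then a cocycle, which surjectivity on cohomology absorbs into \<open>x\<close> and
        \<open>c\<close>; the pair \<open>w + x\<close>, \<open>c\<close> solves both
        equations.\<close>
      obtain w where w: "w \<in> fs {..<dimv (obj Z n) i}" "mv (p i) (mv (dif P n i) y) = mv (dif Z n i) w"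
        using quasi_iso_inj[OF Z X s m, of "mv (f n i) y - mv (q i) (mv (dif P n i) y)"] m2 A1 A2 by auto
      have "mv (dif X n i) (mv (f n i) y - mv (q i) (mv (dif P n i) y) - mv (s n i) w) = 0"
        using A2[of i y] w(2) chom_comm[OF Z X cs, of n i w] by (simp add: mv_lin)
      then obtain x c where x: "x \<in> fs {..<dimv (obj Z n) i}" "c \<in> fs {..<dimv (obj X (n - 1)) i}"
        "mv (dif Z n i) x = 0"
        "mv (f n i) y - mv (q i) (mv (dif P n i) y) - mv (s n i) w = mv (s n i) x + mv (dif X (n - 1) i) c"
        using quasi_iso_surj[OF Z X s fs_diff[OF m2 hom_fs[OF sh]]] by blast
      show "\<exists>n1\<in>fs {..<dimv (obj Z n) i}. \<exists>n2\<in>fs {..<dimv (obj X (n - 1)) i}.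
            mv (dif Z n i) n1 = mv (p i) (mv (dif P n i) y) \<and>
            mv (s n i) n1 + mv (dif X (n - 1) i) n2 = mv (f n i) y - mv (q i) (mv (dif P n i) y)"
        by (rule bexI[OF _ fs_add[OF w(1) x(1)]], rule bexI[OF _ x(2)])
          (use x(3,4) w(2) in \<open>simp add: mv_lin algebra_simps\<close>)
    qed
    then obtain f1 f2 where f12: "is_hom t (obj P n) (obj Z n) f1" "is_hom t (obj P n) (obj X (n - 1)) f2"
      and e: "\<And>i y. mv (dif Z n i) (mv (f1 i) y) = mv (p i) (mv (dif P n i) y)"
      "\<And>i y. mv (s n i) (mv (f1 i) y) + mv (dif X (n - 1) i) (mv (f2 i) y)
         = mv (f n i) y - mv (q i) (mv (dif P n i) y)"
      unfolding e2 mv_comp[OF dP p] by blast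
    have "R n pq (f1, f2)" by (simp add: R_def e pq)
    moreover have "A n (f1, f2)"
    proof -
      have "mv (s n i) (mv (f1 i) (mv (dif P (n - 1) i) y)) =
          mv (dif X (n - 1) i) (mv (f (n - 1) i) y - mv (f2 i) (mv (dif P (n - 1) i) y))" for i y
        using e(2)[of i "mv (dif P (n - 1) i) y"] chom_comm'[OF P X f, of n i y]
        by (simp add: mv_lin cpx_dd'[OF P] eq_diff_eq)
      then show ?thesis
        by (simp add: A_def f12 e(1) cpx_dd'[OF P] mv_lin)
    qed
    ultimately show "\<exists>y. A n y \<and> R n pq y" by blast
  qed
  then obtain F where F: "\<And>n. A n (F n)" "\<And>n. R n (F (n + 1)) (F n)" by blast
  have g: "is_chom t P Z (\<lambda>n. fst (F n))"
    unfolding is_chom_iff[OF P Z] using F by (simp add: A_def R_def)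
  have "htpy t P X f (s \<circ>\<^sub>c (\<lambda>n. fst (F n))) (\<lambda>n. snd (F n))"
    unfolding htpy_def mv_chom_comp[OF g cs]
  proof (intro conjI allI)
    fix n i x
    show "mv (f n i) x = mv (s n i) (mv (fst (F n) i) x) + (mv (dif X (n - 1) i) (mv (snd (F n) i) x) +
        mv (snd (F (n + 1)) i) (mv (dif P n i) x))"
      using F(2)[of n] unfolding R_def add.assoc[symmetric] by simp
  qed (use F(1) in \<open>simp add: A_def\<close>)
  then have "homotopic t P X f (s \<circ>\<^sub>c (\<lambda>n. fst (F n)))"
    using homotopic_iff[OF P X f is_chom_comp[OF P Z X g cs]] by blast
  then show ?thesis using g homotopic_sym[OF P X f is_chom_comp[OF P Z X g cs]] by blast
qed

text \<open>The homotopy \<open>k\<close> between \<open>g\<close> and \<open>g'\<close> is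
  constructed together with a second-order homotopy \<open>l\<close>, which measures how far
  \<open>s\<close> after \<open>k\<close> is from the given homotopy \<open>h\<close>. Again each
  step is a triangular system solved on elements.\<close>

lemma lift_uniq:
  assumes g: "is_chom t P Z g" and g': "is_chom t P Z g'"
    and hom: "homotopic t P X (s \<circ>\<^sub>c g) (s \<circ>\<^sub>c g')"
  shows "homotopic t P Z g g'"
proof -
  obtain b where b: "\<And>n. b < n \<Longrightarrow> is_zero_rep (obj P n)" using bound by blast
  obtain h where h: "htpy t P X (s \<circ>\<^sub>c g) (s \<circ>\<^sub>c g') h"
    using hom homotopic_iff[OF P X is_chom_comp[OF P Z X g cs] is_chom_comp[OF P Z X g' cs]] by blast
  note h0 = htpyD(1)[OF h] and h1 = htpyD(3)[OF h]
  define d where "d n i y = mv (g n i) y - mv (g' n i) y" for n i y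
  have sd: "mv (s n i) (d n i y) = mv (dif X (n - 1) i) (mv (h n i) y) + mv (h (n + 1) i) (mv (dif P n i) y)" for n i y
    using htpyD(2)[OF h, of n i y] by (simp add: d_def mv_lin mv_chom_comp[OF g cs] mv_chom_comp[OF g' cs])
  have dd: "mv (dif Z n i) (d n i y) = d (n + 1) i (mv (dif P n i) y)" for n i y
    by (simp add: d_def mv_lin chom_comm[OF P Z g] chom_comm[OF P Z g'])
  have d_lin: "d n i 0 = 0" for n i by (simp add: d_def mv_lin)
  have dfs: "d n i y \<in> fs {..<dimv (obj Z n) i}" for n i y
    unfolding d_def using fs_diff[OF hom_fs[OF chom_hom[OF g]] hom_fs[OF chom_hom[OF g']]] .
  define A where "A n kl \<longleftrightarrow> is_hom t (obj P n) (obj Z (n - 1)) (fst kl) \<and>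
    is_hom t (obj P n) (obj X (n - 2)) (snd kl) \<and>
    (\<forall>i y. mv (dif Z (n - 1) i) (mv (fst kl i) (mv (dif P (n - 1) i) y)) = d n i (mv (dif P (n - 1) i) y)) \<and>
    (\<forall>i y. mv (h n i) (mv (dif P (n - 1) i) y) - mv (s (n - 1) i) (mv (fst kl i) (mv (dif P (n - 1) i) y))
       = mv (dif X (n - 2) i) (mv (snd kl i) (mv (dif P (n - 1) i) y)))" for n kl
  define R where "R n kl kl' \<longleftrightarrow>
    (\<forall>i y. mv (dif Z (n - 1) i) (mv (fst kl' i) y) + mv (fst kl i) (mv (dif P n i) y) = d n i y) \<and>
    (\<forall>i y. mv (h n i) y - mv (s (n - 1) i) (mv (fst kl' i) y) =
       mv (dif X (n - 2) i) (mv (snd kl' i) y) - mv (snd kl i) (mv (dif P n i) y))"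
    for n and kl kl' :: "'k hom \<times> 'k hom"
  define z where "z n = (hom_zero (obj P n) (obj Z (n - 1)), hom_zero (obj P n) (obj X (n - 2)))" for n
  have "\<exists>F. \<forall>n. A n (F n) \<and> R n (F (n + 1)) (F n)"
  proof (rule int_descend)
    fix n assume n: "b < n"
    have 0: "mv (dif P n i) y = 0" "mv (g n i) y = 0" "mv (g' n i) y = 0" "mv (h n i) y = 0" for i y
      by (rule zero_rep_mv[OF b[OF n]] , rule dP chom_hom[OF g] chom_hom[OF g'] h0)+
    then show "R n (z (n + 1)) (z n)" by (simp add: R_def z_def mv_lin d_def)
    show "A n (z n)" by (simp add: A_def z_def is_hom_zero PM ZM XM mv_lin 0 d_def)
  next
    fix n kl assume A: "A (n + 1) kl"
    obtain k l where kl: "kl = (k, l)" by (cases kl)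
    have k: "is_hom t (obj P (n + 1)) (obj Z n) k" and l: "is_hom t (obj P (n + 1)) (obj X (n - 1)) l"
      and A1: "\<And>i y. mv (dif Z n i) (mv (k i) (mv (dif P n i) y)) = d (n + 1) i (mv (dif P n i) y)"
      and A2: "\<And>i y. mv (h (n + 1) i) (mv (dif P n i) y) - mv (s n i) (mv (k i) (mv (dif P n i) y))
       = mv (dif X (n - 1) i) (mv (l i) (mv (dif P n i) y))"
      using A by (simp_all add: A_def kl)
    note kd = is_hom_comp[OF PM PM ZM dP k] and ld = is_hom_comp[OF PM PM XM dP l]
    note c1' = is_hom_add[OF PM ZM chom_hom[OF g'] kd]
    note c1 = is_hom_add[OF PM ZM chom_hom[OF g] is_hom_smult[OF PM ZM c1', of "-1"]]
    note c2 = is_hom_add[OF PM XM h0 ld]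
    define C1 where "C1 = g n +\<^sub>h (- 1) \<cdot>\<^sub>h (g' n +\<^sub>h k \<circ>\<^sub>h dif P n)"
    define C2 where "C2 = h n +\<^sub>h l \<circ>\<^sub>h dif P n"
    have e1: "mv (C1 i) y = d n i y - mv (k i) (mv (dif P n i) y)" for i y
      by (simp add: C1_def mv_hom_add[OF chom_hom[OF g] is_hom_smult[OF PM ZM c1']] mv_hom_smult
          mv_hom_add[OF chom_hom[OF g'] kd] mv_comp[OF dP k] d_def fun_eq_iff)
    have e2: "mv (C2 i) y = mv (h n i) y + mv (l i) (mv (dif P n i) y)" for i y
      by (simp add: C2_def mv_hom_add[OF h0 ld] mv_comp[OF dP l])
    have "\<exists>f1 f2. is_hom t (obj P n) (obj Z (n - 1)) f1 \<and> is_hom t (obj P n) (obj X (n - 1 - 1)) f2 \<and>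
      (\<forall>i y. mv (dif Z (n - 1) i) (mv (f1 i) y) = mv (C1 i) y) \<and>
      (\<forall>i y. mv (s (n - 1) i) (mv (f1 i) y) + mv (dif X (n - 1 - 1) i) (mv (f2 i) y) = mv (C2 i) y)"
    proof (rule free_lift2[OF free ZM XM ZM XM _ cpx_dif'[OF Z] sh cpx_dif'[OF X]
          c1[folded C1_def] c2[folded C2_def]], unfold e1 e2)
      fix i y
      have m: "d n i y - mv (k i) (mv (dif P n i) y) \<in> fs {..<dimv (obj Z n) i}"
        using fs_diff[OF dfs hom_fs[OF k]] .
      have m2: "mv (h n i) y + mv (l i) (mv (dif P n i) y) \<in> fs {..<dimv (obj X (n - 1)) i}"
        using fs_add[OF hom_fs[OF h0] hom_fs[OF l]] .
      have z0: "mv (dif Z n i) (d n i y - mv (k i) (mv (dif P n i) y)) = 0"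
        by (simp add: mv_lin dd A1)
      have sz: "mv (s n i) (d n i y - mv (k i) (mv (dif P n i) y)) =
          mv (dif X (n - 1) i) (mv (h n i) y + mv (l i) (mv (dif P n i) y))"
        using A2[of i y] by (simp add: mv_lin sd algebra_simps)
      obtain w where w: "w \<in> fs {..<dimv (obj Z (n - 1)) i}"
          "d n i y - mv (k i) (mv (dif P n i) y) = mv (dif Z (n - 1) i) w"
        using quasi_iso_inj[OF Z X s m m2 z0 sz] by blast
      have "mv (dif X (n - 1) i) (mv (h n i) y + mv (l i) (mv (dif P n i) y) - mv (s (n - 1) i) w) = 0"
        using sz w(2) chom_comm'[OF Z X cs, of n i w] by (simp add: mv_lin)
      then obtain x c where x: "x \<in> fs {..<dimv (obj Z (n - 1)) i}" "c \<in> fs {..<dimv (obj X (n - 1 - 1)) i}"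
        "mv (dif Z (n - 1) i) x = 0"
        "mv (h n i) y + mv (l i) (mv (dif P n i) y) - mv (s (n - 1) i) w
          = mv (s (n - 1) i) x + mv (dif X (n - 1 - 1) i) c"
        using quasi_iso_surj[OF Z X s fs_diff[OF m2 hom_fs[OF sh]]] by blast
      show "\<exists>n1\<in>fs {..<dimv (obj Z (n - 1)) i}. \<exists>n2\<in>fs {..<dimv (obj X (n - 1 - 1)) i}.
            mv (dif Z (n - 1) i) n1 = d n i y - mv (k i) (mv (dif P n i) y) \<and>
            mv (s (n - 1) i) n1 + mv (dif X (n - 1 - 1) i) n2 = mv (h n i) y + mv (l i) (mv (dif P n i) y)"
        by (rule bexI[OF _ fs_add[OF w(1) x(1)]], rule bexI[OF _ x(2)])
          (use x(3,4) w(2) in \<open>simp add: mv_lin algebra_simps\<close>)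
    qed
    then obtain f1 f2 where f12: "is_hom t (obj P n) (obj Z (n - 1)) f1" "is_hom t (obj P n) (obj X (n - 2)) f2"
      and e: "\<And>i y. mv (dif Z (n - 1) i) (mv (f1 i) y) = d n i y - mv (k i) (mv (dif P n i) y)"
      "\<And>i y. mv (s (n - 1) i) (mv (f1 i) y) + mv (dif X (n - 2) i) (mv (f2 i) y)
         = mv (h n i) y + mv (l i) (mv (dif P n i) y)"
      unfolding e1 e2 by auto
    have R: "R n kl (f1, f2)"
      using e(2) by (simp add: R_def e(1) kl algebra_simps diff_eq_eq)
    moreover have "A n (f1, f2)"
    proof -
      have "mv (h n i) (mv (dif P (n - 1) i) y) - mv (s (n - 1) i) (mv (f1 i) (mv (dif P (n - 1) i) y))
          = mv (dif X (n - 2) i) (mv (f2 i) (mv (dif P (n - 1) i) y))" for i y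
      proof -
        have "mv (h n i) (mv (dif P (n - 1) i) y) = mv (s (n - 1) i) (mv (f1 i) (mv (dif P (n - 1) i) y))
          + mv (dif X (n - 2) i) (mv (f2 i) (mv (dif P (n - 1) i) y))"
          unfolding e(2) by (simp add: cpx_dd'[OF P] mv_lin)
        then show ?thesis by simp
      qed
      then show ?thesis by (simp add: A_def f12 e(1) cpx_dd'[OF P] mv_lin)
    qed
    ultimately show "\<exists>y. A n y \<and> R n kl y" by blast
  qed
  then obtain F where F: "\<And>n. A n (F n)" "\<And>n. R n (F (n + 1)) (F n)" by blast
  have "htpy t P Z g g' (\<lambda>n. fst (F n))"
    unfolding htpy_def
  proof (intro conjI allI)
    fix n i x
    show "mv (g n i) x = mv (g' n i) x + (mv (dif Z (n - 1) i) (mv (fst (F n) i) x) +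
        mv (fst (F (n + 1)) i) (mv (dif P n i) x))"
      using F(2)[of n] unfolding R_def d_def by simp
  qed (use F(1) in \<open>simp add: A_def\<close>)
  then show ?thesis using homotopic_iff[OF P Z g g'] by blast
qed

end

section \<open>Morphisms in the derived category\<close>

text \<open>Not evident from the definition, which demands a quasi-isomorphism only of
  \<open>s \<circ>\<^sub>c a\<close>; homotopy invariance of quasi-isomorphisms transfers this to
  the other leg.\<close>

lemma roof_eq_sym:
  assumes X: "is_cpx t X" and Y: "is_cpx t Y" and r: "is_roof t X Y (Z, s, f)" and r': "is_roof t X Y (Z', s', f')"
    and e: "roof_eq t X Y (Z, s, f) (Z', s', f')"
  shows "roof_eq t X Y (Z', s', f') (Z, s, f)"
proof -
  from r r' have Z: "is_cpx t Z" "quasi_iso t Z X s" "is_chom t Z Y f"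
    and Z': "is_cpx t Z'" "quasi_iso t Z' X s'" "is_chom t Z' Y f'" by (auto simp: is_roof_def)
  from e obtain W a b where W: "is_cpx t W" "is_chom t W Z a" "is_chom t W Z' b"
    "quasi_iso t W X (s \<circ>\<^sub>c a)" "homotopic t W X (s \<circ>\<^sub>c a) (s' \<circ>\<^sub>c b)" "homotopic t W Y (f \<circ>\<^sub>c a) (f' \<circ>\<^sub>c b)"
    unfolding roof_eq_def by auto
  note sa = is_chom_comp[OF W(1) Z(1) X W(2) quasi_iso_chom[OF Z(2)]]
    and sb = is_chom_comp[OF W(1) Z'(1) X W(3) quasi_iso_chom[OF Z'(2)]]
    and fa = is_chom_comp[OF W(1) Z(1) Y W(2) Z(3)] and fb = is_chom_comp[OF W(1) Z'(1) Y W(3) Z'(3)]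
  have "quasi_iso t W X (s' \<circ>\<^sub>c b)" by (rule quasi_iso_homotopic[OF W(1) X W(4) sb W(5)])
  moreover have "homotopic t W X (s' \<circ>\<^sub>c b) (s \<circ>\<^sub>c a)" by (rule homotopic_sym[OF W(1) X sa sb W(5)])
  moreover have "homotopic t W Y (f' \<circ>\<^sub>c b) (f \<circ>\<^sub>c a)" by (rule homotopic_sym[OF W(1) Y fa fb W(6)])
  ultimately show ?thesis unfolding roof_eq_def using W by auto
qed

text \<open>The map and its formal inverse are the roofs with \<open>Y\<close> at the top and
  \<open>f\<close> as one leg, the identity as the other; \<open>Y\<close> also serves as the
  refinement in every comparison.\<close>

lemma D_iso_quasi_iso:
  assumes X: "is_cpx t X" and Y: "is_cpx t Y" and f: "quasi_iso t Y X f"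
  shows "D_iso t X Y"
proof -
  note cf = quasi_iso_chom[OF f] and iY = is_chom_id[OF Y] and iX = is_chom_id[OF X]
  have qi: "quasi_iso t Z Z (chom_id Z)" if Z: "is_cpx t Z" for Z :: "'a cpx"
    unfolding quasi_iso_iff[OF Z Z]
  proof (intro conjI allI ballI impI is_chom_id[OF Z])
    fix n i x y
    assume "x \<in> fs {..<dimv (obj Z n) i}" "y \<in> fs {..<dimv (obj Z (n - 1)) i}"
      "mv (dif Z n i) x = 0 \<and> mv (chom_id Z n i) x = mv (dif Z (n - 1) i) y"
    then show "\<exists>z\<in>fs {..<dimv (obj Z (n - 1)) i}. x = mv (dif Z (n - 1) i) z"
      by (auto simp: chom_id_def mv_hom_id)
  next
    fix n i y
    assume "y \<in> fs {..<dimv (obj Z n) i}" "mv (dif Z n i) y = 0"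
    then show "\<exists>x\<in>fs {..<dimv (obj Z n) i}. \<exists>b\<in>fs {..<dimv (obj Z (n - 1)) i}.
           mv (dif Z n i) x = 0 \<and> y = mv (chom_id Z n i) x + mv (dif Z (n - 1) i) b"
      by (intro bexI[of _ y] bexI[of _ 0]) (auto simp: chom_id_def mv_hom_id mv_lin)
  qed
  define r where "r = (Y, f, chom_id Y)"
  define r' where "r' = (Y, chom_id Y, f)"
  have 1: "is_roof t X Y r" "is_roof t Y X r'" using X Y f qi[OF Y] cf iY by (auto simp: r_def r'_def is_roof_def)
  have "roof_comp t Y r r' (Y, f \<circ>\<^sub>c chom_id Y, f \<circ>\<^sub>c chom_id Y)"
    unfolding roof_comp_def r_def r'_def using Y qi[OF Y] iY homotopic_refl[OF Y Y iY]
    by (auto intro!: exI[of _ Y] exI[of _ "chom_id Y"] simp: chom_comp_id[OF iY])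
  moreover have "roof_eq t X X (Y, f \<circ>\<^sub>c chom_id Y, f \<circ>\<^sub>c chom_id Y) (roof_id X)"
    unfolding roof_eq_def roof_id_def case_prod_conv chom_comp_id[OF cf]
    by (rule exI[of _ Y], rule exI[of _ "chom_id Y"], rule exI[of _ f])
      (simp add: Y f cf iY homotopic_refl[OF Y X cf] chom_comp_id[OF cf])
  moreover have "roof_comp t X r' r (Y, chom_id Y \<circ>\<^sub>c chom_id Y, chom_id Y \<circ>\<^sub>c chom_id Y)"
    unfolding roof_comp_def r_def r'_def using Y qi[OF Y] iY homotopic_refl[OF Y X cf]
    by (auto intro!: exI[of _ Y] exI[of _ "chom_id Y"] simp: chom_comp_id[OF cf])
  moreover have "roof_eq t Y Y (Y, chom_id Y \<circ>\<^sub>c chom_id Y, chom_id Y \<circ>\<^sub>c chom_id Y) (roof_id Y)"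
    unfolding roof_eq_def roof_id_def using Y qi[OF Y] iY homotopic_refl[OF Y Y iY]
    by (auto intro!: exI[of _ Y] exI[of _ "chom_id Y"] simp: chom_comp_id[OF iY])
  ultimately show ?thesis unfolding D_iso_def using 1 by blast
qed

lemma mv_lin_comb:
  assumes "\<forall>f\<in>set hl. is_chom t X Y f"
  shows "mv (lin_comb X Y c hl n i) x = (\<Sum>l<length hl. scl (c $ l) (mv ((hl ! l) n i) x))"
proof
  fix r
  let ?d = "dimv (obj X n) i" and ?e = "dimv (obj Y n) i"
  have m: "(hl ! l) n i \<in> carrier_mat ?e ?d" if "l < length hl" for l
    using hom_c[OF chom_hom] assms that by (metis nth_mem)
  show "mv (lin_comb X Y c hl n i) x r = (\<Sum>l<length hl. scl (c $ l) (mv ((hl ! l) n i) x)) r"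
  proof (cases "r < ?e")
    case True
    have "mv (lin_comb X Y c hl n i) x r = (\<Sum>s<?d. (\<Sum>l<length hl. c $ l * (hl ! l) n i $$ (r, s)) * x s)"
      using True by (simp add: mv_def lin_comb_def)
    also have "\<dots> = (\<Sum>l<length hl. \<Sum>s<?d. c $ l * ((hl ! l) n i $$ (r, s) * x s))"
      unfolding sum_distrib_right by (subst sum.swap) (simp add: mult.assoc)
    also have "\<dots> = (\<Sum>l<length hl. scl (c $ l) (mv ((hl ! l) n i) x) r)"
      using True carrier_matD[OF m] by (intro sum.cong) (simp_all add: mv_def sum_distrib_left)
    finally show ?thesis by (simp add: sum_fun_apply)
  next
    case False
    then have "(\<Sum>l<length hl. scl (c $ l) (mv ((hl ! l) n i) x) r) = 0"
      using carrier_matD[OF m] by (intro sum.neutral) (simp add: mv_def)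
    then show ?thesis using False by (simp add: sum_fun_apply mv_def lin_comb_def)
  qed
qed

lemma is_chom_lin_comb:
  assumes X: "is_cpx t X" and Y: "is_cpx t Y" and f: "\<forall>f\<in>set hl. is_chom t X Y f"
  shows "is_chom t X Y (lin_comb X Y c hl)"
proof -
  have c: "lin_comb X Y c hl n i \<in> carrier_mat (dimv (obj Y n) i) (dimv (obj X n) i)" for n i
    by (simp add: lin_comb_def)
  have f': "is_chom t X Y (hl ! l)" if "l < length hl" for l using f that by simp
  have "is_hom t (obj X n) (obj Y n) (lin_comb X Y c hl n)" for n
    unfolding is_hom_iff[OF cpx_mod[OF X] cpx_mod[OF Y]] mv_lin_comb[of hl t X Y, OF f]
    using hom_A[OF cpx_mod[OF X] cpx_mod[OF Y] chom_hom[OF f']]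
      hom_B[OF cpx_mod[OF X] cpx_mod[OF Y] chom_hom[OF f']]
    by (auto simp: lin_sum mv_lin c intro!: sum.cong)
  then show ?thesis
    unfolding is_chom_iff[OF X Y] mv_lin_comb[of hl t X Y, OF f]
    using chom_comm[OF X Y f'] by (auto simp: lin_sum mv_lin intro!: sum.cong)
qed

text \<open>Allows a common denominator \<open>Z\<close> to be replaced by a finer one, in
  particular by the resolution.\<close>

lemma lin_comb_comp:
  assumes X: "is_cpx t X" and Y: "is_cpx t Y" and Z: "is_cpx t Z"
    and f: "\<forall>f\<in>set hl. is_chom t Z Y f" and a: "is_chom t X Z a"
  shows "lin_comb X Y c (map (\<lambda>f. f \<circ>\<^sub>c a) hl) = lin_comb Z Y c hl \<circ>\<^sub>c a"
proof (rule ext)+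
  fix n i
  note l = is_chom_lin_comb[of t Z Y hl c, OF Z Y f]
  have g: "\<forall>g\<in>set (map (\<lambda>f. f \<circ>\<^sub>c a) hl). is_chom t X Y g"
    using is_chom_comp[OF X Z Y a] f by auto
  have f': "is_chom t Z Y (hl ! l)" if "l < length hl" for l using f that by simp
  show "lin_comb X Y c (map (\<lambda>f. f \<circ>\<^sub>c a) hl) n i = (lin_comb Z Y c hl \<circ>\<^sub>c a) n i"
  proof (rule mv_inj_fs)
    show "lin_comb X Y c (map (\<lambda>f. f \<circ>\<^sub>c a) hl) n i \<in> carrier_mat (dimv (obj Y n) i) (dimv (obj X n) i)"
      by (simp add: lin_comb_def)
    show "(lin_comb Z Y c hl \<circ>\<^sub>c a) n i \<in> carrier_mat (dimv (obj Y n) i) (dimv (obj X n) i)"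
      by (rule hom_c[OF chom_hom[OF is_chom_comp[OF X Z Y a l]]])
    fix x
    show "mv (lin_comb X Y c (map (\<lambda>f. f \<circ>\<^sub>c a) hl) n i) x = mv ((lin_comb Z Y c hl \<circ>\<^sub>c a) n i) x"
      unfolding mv_chom_comp[OF a l]
      unfolding mv_lin_comb[of _ t X Y, OF g] mv_lin_comb[of hl t Z Y, OF f]
      by (rule sum.cong) (auto simp: mv_chom_comp[OF a f'])
  qed
qed

locale free_resolution =
  fixes t :: nat and P X :: "'k::field cpx" and \<sigma> :: "'k chom"
  assumes P: "is_cpx t P" and X: "is_cpx t X" and free: "\<And>n. is_free t (obj P n)" and \<sigma>: "quasi_iso t P X \<sigma>"
begin

lemma free_lift: 
  assumes "is_cpx t Z" "quasi_iso t Z X s"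
  shows "free_lifting t P Z X s"
  by unfold_locales (use assms P X free in auto)

text \<open>\<open>P\<close> refines every roof up to homotopy, since \<open>a\<close> lifts
  \<open>\<sigma>\<close> through \<open>s\<close>. Given another refinement \<open>W\<close>, lift
  \<open>\<sigma>\<close> to a map \<open>c\<close> into \<open>W\<close>: by uniqueness of lifts
  the composites of \<open>c\<close> into \<open>Z\<close> and \<open>P\<close> are homotopic to
  \<open>a\<close> and to the identity, so the homotopy over \<open>W\<close> pulls back to
  \<open>P\<close>.\<close>

lemma roof_eq_iff:
  assumes Y: "is_cpx t Y" and r: "is_roof t X Y (Z, s, f)" and a: "is_chom t P Z a"
    and sa: "homotopic t P X (s \<circ>\<^sub>c a) \<sigma>" and g: "is_chom t P Y g"
  shows "roof_eq t X Y (Z, s, f) (P, \<sigma>, g) \<longleftrightarrow> homotopic t P Y (f \<circ>\<^sub>c a) g"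
proof -
  from r have Z: "is_cpx t Z" "quasi_iso t Z X s" "is_chom t Z Y f" by (auto simp: is_roof_def)
  note c\<sigma> = quasi_iso_chom[OF \<sigma>] and cs = quasi_iso_chom[OF Z(2)] and iP = is_chom_id[OF P]
  note csa = is_chom_comp[OF P Z(1) X a cs] and cfa = is_chom_comp[OF P Z(1) Y a Z(3)]
  show ?thesis
  proof
    assume *: "homotopic t P Y (f \<circ>\<^sub>c a) g"
    have "quasi_iso t P X (s \<circ>\<^sub>c a)"
      by (rule quasi_iso_homotopic[OF P X \<sigma> csa homotopic_sym[OF P X csa c\<sigma> sa]])
    then have "is_cpx t P \<and> is_chom t P Z a \<and> is_chom t P P (chom_id P) \<and> quasi_iso t P X (s \<circ>\<^sub>c a) \<and>
       homotopic t P X (s \<circ>\<^sub>c a) (\<sigma> \<circ>\<^sub>c chom_id P) \<and> homotopic t P Y (f \<circ>\<^sub>c a) (g \<circ>\<^sub>c chom_id P)"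
      unfolding chom_comp_id[OF c\<sigma>] chom_comp_id[OF g] using P a sa iP * by simp
    then show "roof_eq t X Y (Z, s, f) (P, \<sigma>, g)"
      unfolding roof_eq_def by blast
  next
    assume "roof_eq t X Y (Z, s, f) (P, \<sigma>, g)"
    then obtain W a' b where W: "is_cpx t W" "is_chom t W Z a'" "is_chom t W P b"
      "quasi_iso t W X (s \<circ>\<^sub>c a')" "homotopic t W X (s \<circ>\<^sub>c a') (\<sigma> \<circ>\<^sub>c b)" "homotopic t W Y (f \<circ>\<^sub>c a') (g \<circ>\<^sub>c b)"
      unfolding roof_eq_def by auto
    note csa' = is_chom_comp[OF W(1) Z(1) X W(2) cs] and csb = is_chom_comp[OF W(1) P X W(3) c\<sigma>]
    obtain c where c: "is_chom t P W c" "homotopic t P X ((s \<circ>\<^sub>c a') \<circ>\<^sub>c c) \<sigma>"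
      using free_lifting.lift_ex[OF free_lift[OF W(1,4)] c\<sigma>] by blast
    note ca = is_chom_comp[OF P W(1) Z(1) c(1) W(2)] and cb = is_chom_comp[OF P W(1) P c(1) W(3)]
    note cc = is_chom_comp[OF P W(1) X c(1) csa']
    have "homotopic t P X (s \<circ>\<^sub>c (a' \<circ>\<^sub>c c)) (s \<circ>\<^sub>c a)"
      unfolding chom_comp_assoc[OF c(1) W(2) cs]
      by (rule homotopic_trans[OF P X cc c\<sigma> csa c(2) homotopic_sym[OF P X csa c\<sigma> sa]])
    then have 1: "homotopic t P Z (a' \<circ>\<^sub>c c) a"
      by (rule free_lifting.lift_uniq[OF free_lift[OF Z(1,2)] ca a])
    have "homotopic t P X ((s \<circ>\<^sub>c a') \<circ>\<^sub>c c) ((\<sigma> \<circ>\<^sub>c b) \<circ>\<^sub>c c)"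
      by (rule homotopic_comp_right[OF P W(1) X csa' csb c(1) W(5)])
    then have "homotopic t P X ((\<sigma> \<circ>\<^sub>c b) \<circ>\<^sub>c c) \<sigma>"
      using homotopic_trans[OF P X is_chom_comp[OF P W(1) X c(1) csb] cc c\<sigma>
          homotopic_sym[OF P X cc is_chom_comp[OF P W(1) X c(1) csb]] c(2)] by blast
    then have "homotopic t P X (\<sigma> \<circ>\<^sub>c (b \<circ>\<^sub>c c)) (\<sigma> \<circ>\<^sub>c chom_id P)"
      unfolding chom_comp_assoc[OF c(1) W(3) c\<sigma>] chom_comp_id[OF c\<sigma>] .
    then have 2: "homotopic t P P (b \<circ>\<^sub>c c) (chom_id P)"
      by (rule free_lifting.lift_uniq[OF free_lift[OF P \<sigma>] cb iP])
    have 3: "homotopic t P Y (f \<circ>\<^sub>c (a' \<circ>\<^sub>c c)) (f \<circ>\<^sub>c a)"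
      by (rule homotopic_comp_left[OF P Z(1) Y ca a Z(3) 1])
    have 4: "homotopic t P Y (g \<circ>\<^sub>c (b \<circ>\<^sub>c c)) g"
      using homotopic_comp_left[OF P P Y cb iP g 2] unfolding chom_comp_id[OF g] .
    have 5: "homotopic t P Y (f \<circ>\<^sub>c (a' \<circ>\<^sub>c c)) (g \<circ>\<^sub>c (b \<circ>\<^sub>c c))"
      unfolding chom_comp_assoc[OF c(1) W(2) Z(3)] chom_comp_assoc[OF c(1) W(3) g]
      by (rule homotopic_comp_right[OF P W(1) Y is_chom_comp[OF W(1) Z(1) Y W(2) Z(3)]
            is_chom_comp[OF W(1) P Y W(3) g] c(1) W(6)])
    note x = is_chom_comp[OF P Z(1) Y ca Z(3)] and y = is_chom_comp[OF P P Y cb g]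
    show "homotopic t P Y (f \<circ>\<^sub>c a) g"
      by (rule homotopic_trans[OF P Y cfa x g homotopic_sym[OF P Y x cfa 3]
            homotopic_trans[OF P Y x y g 5 4]])
  qed
qed

text \<open>One direction pulls the given representatives back along a lift from \<open>P\<close> to
  \<open>Z\<close>; the other takes \<open>P\<close> itself as the common denominator.\<close>

lemma D_hom_dim_iff:
  assumes Y: "is_cpx t Y"
  shows "D_hom_dim t X Y m \<longleftrightarrow> (\<exists>hl. length hl = m \<and> (\<forall>f\<in>set hl. is_chom t P Y f) \<and>
    (\<forall>f. is_chom t P Y f \<longrightarrow> (\<exists>!c. c \<in> carrier_vec m \<and> homotopic t P Y f (lin_comb P Y c hl))))"
proof
  note c\<sigma> = quasi_iso_chom[OF \<sigma>] and iP = is_chom_id[OF P]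
  assume "D_hom_dim t X Y m"
  then obtain Z s hl where Z: "is_cpx t Z" "quasi_iso t Z X s" and hl: "length hl = m"
    "\<forall>f\<in>set hl. is_chom t Z Y f"
    and u: "\<And>r. is_roof t X Y r \<Longrightarrow> \<exists>!c. c \<in> carrier_vec m \<and> roof_eq t X Y r (Z, s, lin_comb Z Y c hl)"
    unfolding D_hom_dim_def by blast
  obtain a where a: "is_chom t P Z a" "homotopic t P X (s \<circ>\<^sub>c a) \<sigma>"
    using free_lifting.lift_ex[OF free_lift[OF Z] c\<sigma>] by blast
  define gs where "gs = map (\<lambda>f. f \<circ>\<^sub>c a) hl"
  have gs: "\<forall>g\<in>set gs. is_chom t P Y g"
    using is_chom_comp[OF P Z(1) Y a(1)] hl(2) by (auto simp: gs_def)
  have "\<exists>!c. c \<in> carrier_vec m \<and> homotopic t P Y f (lin_comb P Y c gs)" if f: "is_chom t P Y f" for f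
  proof -
    have rf: "is_roof t X Y (P, \<sigma>, f)" using P \<sigma> f by (simp add: is_roof_def)
    have "roof_eq t X Y (P, \<sigma>, f) (Z, s, lin_comb Z Y c hl) \<longleftrightarrow> homotopic t P Y f (lin_comb P Y c gs)" for c
    proof -
      note lc = is_chom_lin_comb[of t Z Y hl c, OF Z(1) Y hl(2)]
      have rl: "is_roof t X Y (Z, s, lin_comb Z Y c hl)" using Z lc by (simp add: is_roof_def)
      have "roof_eq t X Y (P, \<sigma>, f) (Z, s, lin_comb Z Y c hl) \<longleftrightarrow> roof_eq t X Y (Z, s, lin_comb Z Y c hl) (P, \<sigma>, f)"
        using roof_eq_sym[OF X Y rf rl] roof_eq_sym[OF X Y rl rf] by blast
      also have "\<dots> \<longleftrightarrow> homotopic t P Y (lin_comb Z Y c hl \<circ>\<^sub>c a) f"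
        by (rule roof_eq_iff[OF Y rl a f])
      also have "lin_comb Z Y c hl \<circ>\<^sub>c a = lin_comb P Y c gs"
        unfolding gs_def by (rule lin_comb_comp[of t P Y Z hl a, OF P Y Z(1) hl(2) a(1), symmetric])
      also have "homotopic t P Y (lin_comb P Y c gs) f \<longleftrightarrow> homotopic t P Y f (lin_comb P Y c gs)"
        using homotopic_sym[OF P Y] is_chom_lin_comb[of t P Y gs c, OF P Y gs] f by blast
      finally show ?thesis .
    qed
    then show ?thesis using u[OF rf] by simp
  qed
  then show "\<exists>hl. length hl = m \<and> (\<forall>f\<in>set hl. is_chom t P Y f) \<and>
    (\<forall>f. is_chom t P Y f \<longrightarrow> (\<exists>!c. c \<in> carrier_vec m \<and> homotopic t P Y f (lin_comb P Y c hl)))"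
    using gs hl(1) by (intro exI[of _ gs]) (auto simp: gs_def)
next
  note c\<sigma> = quasi_iso_chom[OF \<sigma>] and iP = is_chom_id[OF P]
  assume "\<exists>hl. length hl = m \<and> (\<forall>f\<in>set hl. is_chom t P Y f) \<and>
    (\<forall>f. is_chom t P Y f \<longrightarrow> (\<exists>!c. c \<in> carrier_vec m \<and> homotopic t P Y f (lin_comb P Y c hl)))"
  then obtain gs where gs: "length gs = m" "\<forall>f\<in>set gs. is_chom t P Y f"
    "\<And>f. is_chom t P Y f \<Longrightarrow> \<exists>!c. c \<in> carrier_vec m \<and> homotopic t P Y f (lin_comb P Y c gs)" by blast
  have "\<exists>!c. c \<in> carrier_vec m \<and> roof_eq t X Y r (P, \<sigma>, lin_comb P Y c gs)" if r: "is_roof t X Y r" for r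
  proof -
    obtain Z s f where rr: "r = (Z, s, f)" by (cases r)
    from r have Z: "is_cpx t Z" "quasi_iso t Z X s" "is_chom t Z Y f" by (auto simp: is_roof_def rr)
    obtain a where a: "is_chom t P Z a" "homotopic t P X (s \<circ>\<^sub>c a) \<sigma>"
      using free_lifting.lift_ex[OF free_lift[OF Z(1,2)] c\<sigma>] by blast
    have "roof_eq t X Y r (P, \<sigma>, lin_comb P Y c gs) \<longleftrightarrow> homotopic t P Y (f \<circ>\<^sub>c a) (lin_comb P Y c gs)" for c
      unfolding rr
      by (rule roof_eq_iff[OF Y r[unfolded rr] a is_chom_lin_comb[of t P Y gs c, OF P Y gs(2)]])
    then show ?thesis using gs(3)[OF is_chom_comp[OF P Z(1) Y a(1) Z(3)]] by simp
  qed
  then show "D_hom_dim t X Y m" unfolding D_hom_dim_def using P \<sigma> gs(1,2) by blast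
qed

end

section \<open>Stalk complexes\<close>

lemma is_module_zero: "is_module t zero_rep"
  by (rule is_moduleI) (auto simp: zero_rep_def)

text \<open>Shifting by \<open>i\<close> places \<open>M\<close> in degree \<open>- i\<close>; this
  is the source of the negative degrees in all later statements about extensions.\<close>

lemma obj_stalk: "obj (shift i (stalk M)) n = (if n = - i then M else zero_rep)"
  by (auto simp: shift_def stalk_def Let_def)

lemma mv_dif_stalk [simp]: "mv (dif (shift i (stalk M)) n j) x = 0"
  by (auto simp: shift_def stalk_def Let_def mv_hom_smult)

lemma is_cpx_stalk:
  assumes "is_module t M"
  shows "is_cpx t (shift i (stalk M))"
proof -
  let ?X = "shift i (stalk M)"
  have m: "is_module t (obj ?X n)" for n using assms by (simp add: obj_stalk is_module_zero)
  have d: "is_hom t (obj ?X n) (obj ?X (n + 1)) (dif ?X n)" for n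
    unfolding is_hom_iff[OF m m] by (simp add: mv_lin) (auto simp: shift_def stalk_def Let_def hom_zero_def hom_smult_def)
  have d2: "is_hom t (obj ?X (n + 1)) (obj ?X (n + 2)) (dif ?X (n + 1))" for n
    using d[of "n + 1"] by (simp add: add.commute)
  have "dif ?X (n + 1) \<circ>\<^sub>h dif ?X n = hom_zero (obj ?X n) (obj ?X (n + 2))" for n
    by (rule hom_eqI[OF m is_hom_comp[OF m m m d d2] is_hom_zero[OF m m]]) (simp add: mv_comp[OF d d2])
  moreover have "\<exists>a b. \<forall>n. n < a \<or> b < n \<longrightarrow> is_zero_rep (obj ?X n)"
    by (rule exI[of _ "- i"], rule exI[of _ "- i"]) (auto simp: obj_stalk is_zero_rep_def zero_rep_def)
  ultimately show ?thesis using m d by (auto simp: is_cpx_def)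
qed

lemma shift_0: "shift 0 (stalk M) = stalk M"
  by (auto simp: shift_def stalk_def Let_def hom_smult_def hom_zero_def fun_eq_iff)

lemma hom_to_zero: "is_hom t P zero_rep f \<Longrightarrow> mv (f j) x = 0"
  using mv_zero_dim(2)[of "f j" "dimv P j"] hom_c[of t P zero_rep f j] by (simp add: zero_rep_def)

lemma chom_stalk_iff:
  assumes P: "is_cpx t P" and N: "is_module t N"
  shows "is_chom t P (shift i (stalk N)) f \<longleftrightarrow>
    (\<forall>n. n \<noteq> - i \<longrightarrow> is_hom t (obj P n) zero_rep (f n)) \<and> is_hom t (obj P (- i)) N (f (- i)) \<and>
    (\<forall>j x. mv (f (- i) j) (mv (dif P (- i - 1) j) x) = 0)" (is "_ \<longleftrightarrow> ?R")
proof -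
  have 1: "(\<forall>n. is_hom t (obj P n) (obj (shift i (stalk N)) n) (f n)) \<longleftrightarrow>
    (\<forall>n. n \<noteq> - i \<longrightarrow> is_hom t (obj P n) zero_rep (f n)) \<and> is_hom t (obj P (- i)) N (f (- i))" (is "?A \<longleftrightarrow> ?B")
    unfolding obj_stalk by (metis (full_types))
  have 2: "(\<forall>n j x. mv (f (n + 1) j) (mv (dif P n j) x) = 0) \<longleftrightarrow> (\<forall>j x. mv (f (- i) j) (mv (dif P (- i - 1) j) x) = 0)"
    if "?B"
  proof (intro iffI allI)
    fix n j x assume *: "\<forall>j x. mv (f (- i) j) (mv (dif P (- i - 1) j) x) = 0"
    show "mv (f (n + 1) j) (mv (dif P n j) x) = 0"
    proof (cases "n + 1 = - i")
      case True
      then have n: "n = - i - 1" by simp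
      show ?thesis using * by (simp add: n)
    next
      case False
      then show ?thesis using hom_to_zero that by blast
    qed
  next
    fix j x assume "\<forall>n j x. mv (f (n + 1) j) (mv (dif P n j) x) = 0"
    then have "mv (f (- i - 1 + 1) j) (mv (dif P (- i - 1) j) x) = 0" by blast
    then show "mv (f (- i) j) (mv (dif P (- i - 1) j) x) = 0" by simp
  qed
  show ?thesis
    unfolding is_chom_iff[OF P is_cpx_stalk[OF N]] mv_dif_stalk 1 using 2 by blast
qed

lemma homotopic_stalk_iff:
  assumes P: "is_cpx t P" and N: "is_module t N"
    and f: "is_chom t P (shift i (stalk N)) f" and g: "is_chom t P (shift i (stalk N)) g"
  shows "homotopic t P (shift i (stalk N)) f g \<longleftrightarrow> (\<exists>h. is_hom t (obj P (- i + 1)) N h \<and>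
    (\<forall>j x. mv (f (- i) j) x = mv (g (- i) j) x + mv (h j) (mv (dif P (- i) j) x)))"
  unfolding homotopic_iff[OF P is_cpx_stalk[OF N] f g]
proof
  assume "\<exists>h. htpy t P (shift i (stalk N)) f g h"
  then obtain h where h: "htpy t P (shift i (stalk N)) f g h" by blast
  show "\<exists>h. is_hom t (obj P (- i + 1)) N h \<and>
    (\<forall>j x. mv (f (- i) j) x = mv (g (- i) j) x + mv (h j) (mv (dif P (- i) j) x))"
    using htpyD(2)[OF h, of "- i"] htpyD(3)[OF h, of "- i"] by (intro exI[of _ "h (- i + 1)"]) (simp add: obj_stalk)
next
  assume "\<exists>h. is_hom t (obj P (- i + 1)) N h \<and>
    (\<forall>j x. mv (f (- i) j) x = mv (g (- i) j) x + mv (h j) (mv (dif P (- i) j) x))"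
  then obtain h where h: "is_hom t (obj P (- i + 1)) N h"
    "\<And>j x. mv (f (- i) j) x = mv (g (- i) j) x + mv (h j) (mv (dif P (- i) j) x)" by blast
  define H where "H n = (if n = - i + 1 then h else hom_zero (obj P n) zero_rep)" for n
  note fg = f[unfolded chom_stalk_iff[OF P N]] g[unfolded chom_stalk_iff[OF P N]]
  have "htpy t P (shift i (stalk N)) f g H"
    unfolding htpy_def mv_dif_stalk
  proof (intro conjI allI)
    fix n
    show "is_hom t (obj P n) (obj (shift i (stalk N)) (n - 1)) (H n)"
      using h(1) by (auto simp: H_def obj_stalk is_hom_zero cpx_mod[OF P] is_module_zero)
    fix j x
    show "mv (f n j) x = mv (g n j) x + (0 + mv (H (n + 1) j) (mv (dif P n j) x))"
    proof (cases "n = - i")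
      case True
      then show ?thesis using h(2)[of j x] by (simp add: H_def)
    next
      case False
      then have "mv (f n j) x = 0" "mv (g n j) x = 0" using fg hom_to_zero by blast+
      then show ?thesis using False by (simp add: H_def)
    qed
  qed
  then show "\<exists>h. htpy t P (shift i (stalk N)) f g h" by blast
qed

text \<open>The only nonzero component of a chain map from \<open>P\<close> to \<open>N\<close>
  placed in degree \<open>k\<close>. A null-homotopy of it is a map on \<open>obj P (k + 1)\<close>
  composed with the differential.\<close>

definition cocycle_hom :: "nat \<Rightarrow> 'k::field cpx \<Rightarrow> 'k rep \<Rightarrow> int \<Rightarrow> 'k hom \<Rightarrow> bool" where
  "cocycle_hom t P N k \<phi> \<longleftrightarrow> is_hom t (obj P k) N \<phi> \<and> (\<forall>j x. mv (\<phi> j) (mv (dif P (k - 1) j) x) = 0)"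

lemma (in free_resolution) D_hom_dim_stalk:
  assumes N: "is_module t N"
  shows "D_hom_dim t X (shift i (stalk N)) m \<longleftrightarrow>
    (\<exists>\<phi>s. length \<phi>s = m \<and> (\<forall>\<phi>\<in>set \<phi>s. cocycle_hom t P N (- i) \<phi>) \<and>
      (\<forall>\<phi>. cocycle_hom t P N (- i) \<phi> \<longrightarrow> (\<exists>!c. c \<in> carrier_vec m \<and>
        (\<exists>h. is_hom t (obj P (- i + 1)) N h \<and>
          (\<forall>j x. mv (\<phi> j) x = (\<Sum>l<m. scl (c $ l) (mv ((\<phi>s ! l) j) x)) + mv (h j) (mv (dif P (- i) j) x))))))"
proof -
  let ?Y = "shift i (stalk N)"
  note Y = is_cpx_stalk[OF N, of i]
  define E where "E \<phi> = (\<lambda>n. if n = - i then \<phi> else hom_zero (obj P n) zero_rep)" for \<phi> :: "'k hom"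
  have E: "is_chom t P ?Y (E \<phi>) \<longleftrightarrow> cocycle_hom t P N (- i) \<phi>" for \<phi>
    unfolding chom_stalk_iff[OF P N] cocycle_hom_def by (simp add: E_def is_hom_zero cpx_mod[OF P] is_module_zero)
  have E0: "E \<phi> (- i) = \<phi>" for \<phi> by (simp add: E_def)
  have D: "cocycle_hom t P N (- i) (f (- i))" if "is_chom t P ?Y f" for f
    using that unfolding chom_stalk_iff[OF P N] cocycle_hom_def by simp
  have EU: "E (f (- i)) = f" if f: "is_chom t P ?Y f" for f
  proof
    fix n show "E (f (- i)) n = f n"
    proof (cases "n = - i")
      case False
      then have "is_hom t (obj P n) zero_rep (f n)" using f unfolding chom_stalk_iff[OF P N] by blast
      then have "f n = hom_zero (obj P n) zero_rep"
        by (intro hom_eqI[OF cpx_mod[OF P] _ is_hom_zero[OF cpx_mod[OF P] is_module_zero]])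
          (simp_all add: hom_to_zero)
      then show ?thesis using False by (simp add: E_def)
    qed (simp add: E_def)
  qed
  have s: "(\<Sum>l<length hl. scl (c $ l) (mv ((hl ! l) (- i) j) x)) =
      (\<Sum>l<length hl. scl (c $ l) (mv ((map (\<lambda>f. f (- i)) hl ! l) j) x))" for hl :: "'k chom list" and c j x
    by (rule sum.cong) auto
  have H: "homotopic t P ?Y f (lin_comb P ?Y c hl) \<longleftrightarrow> (\<exists>h. is_hom t (obj P (- i + 1)) N h \<and>
          (\<forall>j x. mv (f (- i) j) x = (\<Sum>l<m. scl (c $ l) (mv (((map (\<lambda>f. f (- i)) hl) ! l) j) x)) +
            mv (h j) (mv (dif P (- i) j) x)))"
    if f: "is_chom t P ?Y f" and hl: "length hl = m" "\<forall>f\<in>set hl. is_chom t P ?Y f" for f hl c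
    unfolding homotopic_stalk_iff[OF P N f is_chom_lin_comb[of t P ?Y hl, OF P Y hl(2)]]
      mv_lin_comb[of hl t P ?Y, OF hl(2)] s unfolding hl(1) ..
  show ?thesis
    unfolding D_hom_dim_iff[OF Y]
  proof
    assume "\<exists>hl. length hl = m \<and> (\<forall>f\<in>set hl. is_chom t P ?Y f) \<and>
      (\<forall>f. is_chom t P ?Y f \<longrightarrow> (\<exists>!c. c \<in> carrier_vec m \<and> homotopic t P ?Y f (lin_comb P ?Y c hl)))"
    then obtain hl where hl: "length hl = m" "\<forall>f\<in>set hl. is_chom t P ?Y f"
      "\<And>f. is_chom t P ?Y f \<Longrightarrow> \<exists>!c. c \<in> carrier_vec m \<and> homotopic t P ?Y f (lin_comb P ?Y c hl)" by blast
    show "\<exists>\<phi>s. length \<phi>s = m \<and> (\<forall>\<phi>\<in>set \<phi>s. cocycle_hom t P N (- i) \<phi>) \<and>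
      (\<forall>\<phi>. cocycle_hom t P N (- i) \<phi> \<longrightarrow> (\<exists>!c. c \<in> carrier_vec m \<and>
        (\<exists>h. is_hom t (obj P (- i + 1)) N h \<and>
          (\<forall>j x. mv (\<phi> j) x = (\<Sum>l<m. scl (c $ l) (mv ((\<phi>s ! l) j) x)) + mv (h j) (mv (dif P (- i) j) x)))))"
    proof (intro exI[of _ "map (\<lambda>f. f (- i)) hl"] conjI allI impI)
      fix \<phi> assume "cocycle_hom t P N (- i) \<phi>"
      then have e: "is_chom t P ?Y (E \<phi>)" by (simp add: E)
      show "\<exists>!c. c \<in> carrier_vec m \<and>
        (\<exists>h. is_hom t (obj P (- i + 1)) N h \<and>
          (\<forall>j x. mv (\<phi> j) x = (\<Sum>l<m. scl (c $ l) (mv ((map (\<lambda>f. f (- i)) hl ! l) j) x)) + mv (h j) (mv (dif P (- i) j) x)))"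
        using hl(3)[OF e] unfolding H[OF e hl(1,2)] E0 .
    qed (use hl D in auto)
  next
    assume "\<exists>\<phi>s. length \<phi>s = m \<and> (\<forall>\<phi>\<in>set \<phi>s. cocycle_hom t P N (- i) \<phi>) \<and>
      (\<forall>\<phi>. cocycle_hom t P N (- i) \<phi> \<longrightarrow> (\<exists>!c. c \<in> carrier_vec m \<and>
        (\<exists>h. is_hom t (obj P (- i + 1)) N h \<and>
          (\<forall>j x. mv (\<phi> j) x = (\<Sum>l<m. scl (c $ l) (mv ((\<phi>s ! l) j) x)) + mv (h j) (mv (dif P (- i) j) x)))))"
    then obtain \<phi>s where p: "length \<phi>s = m" "\<And>\<phi>. \<phi> \<in> set \<phi>s \<Longrightarrow> cocycle_hom t P N (- i) \<phi>"
      "\<And>\<phi>. cocycle_hom t P N (- i) \<phi> \<Longrightarrow> (\<exists>!c. c \<in> carrier_vec m \<and>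
        (\<exists>h. is_hom t (obj P (- i + 1)) N h \<and>
          (\<forall>j x. mv (\<phi> j) x = (\<Sum>l<m. scl (c $ l) (mv ((\<phi>s ! l) j) x)) + mv (h j) (mv (dif P (- i) j) x))))"
      by blast
    have m: "map (\<lambda>f. f (- i)) (map E \<phi>s) = \<phi>s" by (simp add: E0 o_def)
    have l: "length (map E \<phi>s) = m" "\<forall>f\<in>set (map E \<phi>s). is_chom t P ?Y f"
      using p(1,2) E by auto
    show "\<exists>hl. length hl = m \<and> (\<forall>f\<in>set hl. is_chom t P ?Y f) \<and>
      (\<forall>f. is_chom t P ?Y f \<longrightarrow> (\<exists>!c. c \<in> carrier_vec m \<and> homotopic t P ?Y f (lin_comb P ?Y c hl)))"
    proof (intro exI[of _ "map E \<phi>s"] conjI allI impI ballI)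
      fix f assume f: "is_chom t P ?Y f"
      show "\<exists>!c. c \<in> carrier_vec m \<and> homotopic t P ?Y f (lin_comb P ?Y c (map E \<phi>s))"
        unfolding H[OF f l] m by (rule p(3)[OF D[OF f]])
    qed (use l in auto)
  qed
qed

section \<open>Modules with an explicit basis\<close>

abbreviation lst :: "'b::linorder set \<Rightarrow> 'b list" where "lst \<equiv> sorted_list_of_set"

text \<open>Representations carry coordinates numbered by \<open>nat\<close>, while computations
  want basis elements with structure, such as a generator paired with a path. \<open>co\<close> and
  \<open>ci\<close> pass between the two along the sorted list of \<open>B\<close>, and
  \<open>opm\<close> is the matrix of an operator given in structured coordinates.\<close>

definition co :: "'b::linorder set \<Rightarrow> (nat \<Rightarrow> 'k::field) \<Rightarrow> 'b \<Rightarrow> 'k" where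
  "co B x = (\<Sum>n<card B. scl (x n) (dlt (lst B ! n)))"

definition ci :: "'b::linorder set \<Rightarrow> ('b \<Rightarrow> 'k::field) \<Rightarrow> nat \<Rightarrow> 'k" where
  "ci B y = (\<lambda>n. if n < card B then y (lst B ! n) else 0)"

definition res :: "'b set \<Rightarrow> ('b \<Rightarrow> 'k::field) \<Rightarrow> 'b \<Rightarrow> 'k" where
  "res B y = (\<lambda>b. if b \<in> B then y b else 0)"

definition opm :: "'c::linorder set \<Rightarrow> 'b::linorder set \<Rightarrow> (('b \<Rightarrow> 'k::field) \<Rightarrow> 'c \<Rightarrow> 'k) \<Rightarrow> 'k mat" where
  "opm C B T = mat (card C) (card B) (\<lambda>(r, c). T (dlt (lst B ! c)) (lst C ! r))"

lemma res_id: "y \<in> fs B \<Longrightarrow> res B y = y"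
  by (auto simp: res_def fs_def fun_eq_iff)

lemma lin_ci: "lin (ci B)" by (auto simp: lin_def ci_def fun_eq_iff)

lemma lin_co: "lin (co B)"
  by (auto simp: lin_def co_def fun_eq_iff sum_fun_apply algebra_simps sum.distrib sum_distrib_left)

lemma ci_fs: "ci B y \<in> fs {..<card B}" by (auto simp: ci_def fs_def)

context
  fixes B :: "'b::linorder set"
  assumes B: "finite B"
begin

lemma lst_in: "n < card B \<Longrightarrow> lst B ! n \<in> B"
  using B nth_mem[of n "lst B"] by simp

lemma co_lst: "n < card B \<Longrightarrow> co B x (lst B ! n) = x n"
proof -
  assume n: "n < card B"
  have d: "distinct (lst B)" "length (lst B) = card B" using B by auto
  have "co B x (lst B ! n) = (\<Sum>k<card B. if k = n then x k else 0)"
    unfolding co_def sum_fun_apply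
    using d n by (intro sum.cong) (auto simp: dlt_def nth_eq_iff_index_eq)
  then show ?thesis using n by simp
qed

lemma co_fs: "co B x \<in> fs B"
  unfolding co_def by (intro fs_sum fs_scl fs_dlt) (auto intro: lst_in)

lemma ci_co: "x \<in> fs {..<card B} \<Longrightarrow> ci B (co B x) = x"
  by (auto simp: ci_def fun_eq_iff co_lst fs_def)

lemma co_ci: "co B (ci B y) = res B y"
proof
  fix b
  show "co B (ci B y) b = res B y b"
  proof (cases "b \<in> B")
    case True
    then have "b \<in> set (lst B)" using B by simp
    then obtain n where "n < length (lst B)" "lst B ! n = b" by (meson in_set_conv_nth)
    then have "n < card B" "b = lst B ! n" by simp_all
    then show ?thesis using True by (simp add: co_lst ci_def res_def)
  next
    case False
    then show ?thesis using co_fs by (auto simp: fs_def res_def)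
  qed
qed

lemma ci_res: "ci B (res B y) = ci B y"
  by (auto simp: ci_def res_def fun_eq_iff lst_in)

lemma ci_inj: "y \<in> fs B \<Longrightarrow> z \<in> fs B \<Longrightarrow> ci B y = ci B z \<longleftrightarrow> y = z"
  by (metis co_ci res_id)

lemma mv_opm: "lin T \<Longrightarrow> mv (opm C B T) x = ci C (T (co B x))"
proof
  fix r assume T: "lin T"
  have "T (co B x) = (\<Sum>n<card B. scl (x n) (T (dlt (lst B ! n))))"
    by (simp add: co_def lin_sum[OF T] lin_scl[OF T])
  then show "mv (opm C B T) x r = ci C (T (co B x)) r"
    by (simp add: mv_def opm_def ci_def sum_fun_apply mult.commute)
qed

end

lemma opm_carrier: "opm C B T \<in> carrier_mat (card C) (card B)" by (simp add: opm_def)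

lemma lst_nat: "lst {..<n::nat} = [0..<n]"
  by (metis lessThan_atLeast0 sorted_list_of_set_range)

lemma ci_nat: "y \<in> fs {..<n::nat} \<Longrightarrow> ci {..<n} y = y"
  by (auto simp: ci_def fs_def fun_eq_iff lst_nat)

lemma co_nat: "y \<in> fs {..<n::nat} \<Longrightarrow> co {..<n} y = y"
  using ci_nat[of y n] co_ci[of "{..<n}" y] res_id[of y "{..<n}"] by simp

section \<open>Paths\<close>

fun upn :: "'k::field rep \<Rightarrow> nat \<Rightarrow> (nat \<Rightarrow> 'k) \<Rightarrow> nat \<Rightarrow> nat \<Rightarrow> 'k" where
  "upn N j v 0 = v"
| "upn N j v (Suc n) = mv (arrA N (j + n)) (upn N j v n)"

fun dnn :: "'k::field rep \<Rightarrow> nat \<Rightarrow> (nat \<Rightarrow> 'k) \<Rightarrow> nat \<Rightarrow> nat \<Rightarrow> 'k" where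
  "dnn N i v 0 = v"
| "dnn N i v (Suc n) = mv (arrB N (i - Suc n)) (dnn N i v n)"

text \<open>
  \<open>pth N j e i\<close> is the action on \<open>N\<close> of the path that descends from \<open>i\<close> to \<open>e + 1\<close> and then
  ascends to \<open>j\<close>.  For \<open>e < min i j\<close> these paths are a basis of \<open>e\<^sub>j A e\<^sub>i\<close>, and in this
  indexing (counted from the socle) \<open>\<alpha>\<close> fixes \<open>e\<close> and \<open>\<beta>\<close> lowers it by one.
\<close>

definition pth :: "'k::field rep \<Rightarrow> nat \<Rightarrow> nat \<Rightarrow> nat \<Rightarrow> (nat \<Rightarrow> 'k) \<Rightarrow> nat \<Rightarrow> 'k" where
  "pth N j e i v = upn N (Suc e) (dnn N i v (i - Suc e)) (j - Suc e)"

lemma upn_lin: "upn N j (v + w) n = upn N j v n + upn N j w n" "upn N j (scl c v) n = scl c (upn N j v n)"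
  by (induction n) (simp_all add: mv_lin)

lemma dnn_lin: "dnn N j (v + w) n = dnn N j v n + dnn N j w n" "dnn N j (scl c v) n = scl c (dnn N j v n)"
  by (induction n) (simp_all add: mv_lin)

lemma lin_pth: "lin (pth N j e i)"
  by (simp add: lin_def pth_def upn_lin dnn_lin)

lemma pth_self: "0 < i \<Longrightarrow> pth N i (i - 1) i v = v" by (simp add: pth_def)

lemma pth_A: "e < j \<Longrightarrow> mv (arrA N j) (pth N j e i v) = pth N (Suc j) e i v"
proof -
  assume "e < j"
  then have "Suc j - Suc e = Suc (j - Suc e)" "Suc e + (j - Suc e) = j" by auto
  then show ?thesis by (simp only: pth_def upn.simps)
qed

lemma pth_B_top:
  assumes "0 < j" "j < i"
  shows "mv (arrB N j) (pth N (Suc j) j i v) = pth N j (j - 1) i v"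
proof -
  have "i - j = Suc (i - Suc j)" "i - Suc (i - Suc j) = j" using assms by auto
  then show ?thesis using assms by (simp add: pth_def)
qed

text \<open>The relations let \<beta>_j move through the ascending part of the path until it meets
  the turning point \<open>e + 1\<close>; there the descent continues by one step, to
  \<open>e\<close>. For \<open>e = 0\<close> that step leaves the quiver, whence the value
  0.\<close>

lemma pth_B:
  assumes N: "is_module t N" and "1 \<le> j" "j < t" "e \<le> j" "e < i"
  shows "mv (arrB N j) (pth N (Suc j) e i v) = (if e = 0 then 0 else pth N j (e - 1) i v)"
  using assms(2-)
proof (induction j arbitrary: e rule: nat_induct_at_least)
  case base
  show ?case
  proof (cases "e = 0")
    case True
    have "mv (arrB N 1) (pth N (Suc 1) 0 i v) = mv (arrB N 1) (mv (arrA N 1) (pth N 1 0 i v))"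
      by (simp add: pth_A)
    also have "\<dots> = mv (arrA N 0) (mv (arrB N 0) (pth N 1 0 i v))"
      using module_rel[OF N, of 1] base by simp
    also have "\<dots> = 0"
      using module_A[OF N, of 0] module_dim0[OF N, of 0] by (simp add: mv_zero_dim)
    finally show ?thesis using True by simp
  next
    case False
    then show ?thesis using base pth_B_top[of 1 i N v] by (simp add: le_Suc_eq)
  qed
next
  case (Suc j)
  show ?case
  proof (cases "e = Suc j")
    case True
    then show ?thesis using Suc pth_B_top[of "Suc j" i N v] by simp
  next
    case False
    then have e: "e \<le> j" using Suc by simp
    have "mv (arrB N (Suc j)) (pth N (Suc (Suc j)) e i v) = mv (arrB N (Suc j)) (mv (arrA N (Suc j)) (pth N (Suc j) e i v))"
      using e by (simp add: pth_A)
    also have "\<dots> = mv (arrA N j) (mv (arrB N j) (pth N (Suc j) e i v))"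
      using module_rel[OF N, of "Suc j"] Suc by simp
    also have "\<dots> = mv (arrA N j) (if e = 0 then 0 else pth N j (e - 1) i v)"
      using Suc e by simp
    also have "\<dots> = (if e = 0 then 0 else pth N (Suc j) (e - 1) i v)"
      using e by (auto simp: mv_lin pth_A)
    finally show ?thesis .
  qed
qed

lemma upn_fs: "is_module t N \<Longrightarrow> v \<in> fs {..<dimv N j} \<Longrightarrow> upn N j v n \<in> fs {..<dimv N (j + n)}"
  using mv_fs[OF module_A] by (cases n) auto

lemma dnn_fs: "is_module t N \<Longrightarrow> v \<in> fs {..<dimv N i} \<Longrightarrow> n \<le> i \<Longrightarrow> dnn N i v n \<in> fs {..<dimv N (i - n)}"
  using mv_fs[OF module_B] by (cases n) auto

lemma pth_fs:
  assumes "is_module t N" "v \<in> fs {..<dimv N i}" "e < i" "e < j"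
  shows "pth N j e i v \<in> fs {..<dimv N j}"
proof -
  have "dnn N i v (i - Suc e) \<in> fs {..<dimv N (Suc e)}"
    using dnn_fs[OF assms(1,2), of "i - Suc e"] assms(3) by simp
  from upn_fs[OF assms(1) this, of "j - Suc e"] show ?thesis
    using assms(4) by (simp add: pth_def)
qed

lemma hom_upn:
  assumes "is_module t M" "is_module t N" "is_hom t M N f" "1 \<le> j" "j + n \<le> t"
  shows "mv (f (j + n)) (upn M j v n) = upn N j (mv (f j) v) n"
  using assms(5) by (induction n) (use hom_A[OF assms(1-3)] assms(4) in auto)

lemma hom_dnn:
  assumes "is_module t M" "is_module t N" "is_hom t M N f" "i \<le> t" "n < i"
  shows "mv (f (i - n)) (dnn M i v n) = dnn N i (mv (f i) v) n"
  using assms(5)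
proof (induction n)
  case (Suc n)
  then have e: "i - n = Suc (i - Suc n)" "1 \<le> i - Suc n" "i - Suc n < t" using assms(4) by auto
  show ?case using hom_B[OF assms(1-3) e(2,3), folded e(1)] Suc by simp
qed simp

lemma hom_pth:
  assumes "is_module t M" "is_module t N" "is_hom t M N f" "i \<le> t" "j \<le> t" "e < i" "e < j"
  shows "mv (f j) (pth M j e i v) = pth N j e i (mv (f i) v)"
proof -
  have 1: "mv (f (Suc e)) (dnn M i v (i - Suc e)) = dnn N i (mv (f i) v) (i - Suc e)"
    using hom_dnn[OF assms(1-4), of "i - Suc e"] assms(6) by simp
  show ?thesis
    unfolding pth_def 1[symmetric]
    using hom_upn[OF assms(1-3), of "Suc e" "j - Suc e"] assms(5,7) by simp
qed

section \<open>Free modules and their Nakayama duals\<close>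

text \<open>
  \<open>Fm t G \<nu>\<close> is the direct sum of the \<open>A e\<^sub>i\<close>, \<open>i = \<nu> g\<close>, over the generators \<open>g\<close>, and \<open>Nm t G \<nu>\<close>
  is the corresponding sum of the injectives \<open>D(e\<^sub>i A)\<close>, in the coordinates dual to the paths.
\<close>

definition FB :: "nat \<Rightarrow> 'g set \<Rightarrow> ('g \<Rightarrow> nat) \<Rightarrow> nat \<Rightarrow> ('g \<times> nat) set" where
  "FB t G \<nu> j = {(g, e). g \<in> G \<and> j \<in> {1..t} \<and> e < \<nu> g \<and> e < j}"

text \<open>The action of \<beta> on \<open>Fm\<close>: the basis vector \<open>(g, Suc e)\<close>
  goes to \<open>(g, e)\<close>, and \<open>(g, 0)\<close> is killed.\<close>

definition sdn :: "('g \<times> nat \<Rightarrow> 'k::field) \<Rightarrow> 'g \<times> nat \<Rightarrow> 'k" where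
  "sdn y = (\<lambda>(g, e). y (g, Suc e))"

text \<open>The action of \<alpha> on \<open>Nm\<close>: the basis vector \<open>(g, e)\<close> goes
  to \<open>(g, Suc e)\<close>, to be read as zero where that index is not in the basis.\<close>

definition sup1 :: "('g \<times> nat \<Rightarrow> 'k::field) \<Rightarrow> 'g \<times> nat \<Rightarrow> 'k" where
  "sup1 y = (\<lambda>(g, e). if e = 0 then 0 else y (g, e - 1))"

definition Fm :: "nat \<Rightarrow> 'g::linorder set \<Rightarrow> ('g \<Rightarrow> nat) \<Rightarrow> 'k::field rep" where
  "Fm t G \<nu> = \<lparr>dimv = (\<lambda>j. card (FB t G \<nu> j)),
     arrA = (\<lambda>j. opm (FB t G \<nu> (Suc j)) (FB t G \<nu> j) (\<lambda>y. y)),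
     arrB = (\<lambda>j. opm (FB t G \<nu> j) (FB t G \<nu> (Suc j)) sdn)\<rparr>"

definition Nm :: "nat \<Rightarrow> 'g::linorder set \<Rightarrow> ('g \<Rightarrow> nat) \<Rightarrow> 'k::field rep" where
  "Nm t G \<nu> = \<lparr>dimv = (\<lambda>j. card (FB t G \<nu> j)),
     arrA = (\<lambda>j. opm (FB t G \<nu> (Suc j)) (FB t G \<nu> j) sup1),
     arrB = (\<lambda>j. opm (FB t G \<nu> j) (FB t G \<nu> (Suc j)) (\<lambda>y. y))\<rparr>"

definition gen :: "nat \<Rightarrow> 'g::linorder set \<Rightarrow> ('g \<Rightarrow> nat) \<Rightarrow> 'g \<Rightarrow> nat \<Rightarrow> 'k::field" where
  "gen t G \<nu> g = ci (FB t G \<nu> (\<nu> g)) (dlt (g, \<nu> g - 1))"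

lemma lin_id: "lin (\<lambda>y. y)" and lin_sdn: "lin sdn" and lin_sup1: "lin sup1"
  by (auto simp: lin_def sdn_def sup1_def fun_eq_iff)

locale gens =
  fixes t :: nat and G :: "'g::linorder set" and \<nu> :: "'g \<Rightarrow> nat"
  assumes G: "finite G" and \<nu>: "\<And>g. g \<in> G \<Longrightarrow> \<nu> g \<in> {1..t}"
begin

abbreviation "B \<equiv> FB t G \<nu>"
abbreviation "F \<equiv> Fm t G \<nu>"
abbreviation "Nk \<equiv> Nm t G \<nu>"

lemma fin: "finite (B j)"
  by (rule finite_subset[of _ "G \<times> {..<j}"]) (auto simp: FB_def G)

lemma B_empty: "j \<notin> {1..t} \<Longrightarrow> B j = {}" by (auto simp: FB_def)

lemma dimF [simp]: "dimv F j = card (B j)" "dimv Nk j = card (B j)" by (simp_all add: Fm_def Nm_def)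

lemma mvF: "mv (arrA F j) x = ci (B (Suc j)) (co (B j) x)"
    "mv (arrB F j) x = ci (B j) (sdn (co (B (Suc j)) x))"
  and mvN: "mv (arrA Nk j) x = ci (B (Suc j)) (sup1 (co (B j) x))"
    "mv (arrB Nk j) x = ci (B j) (co (B (Suc j)) x)"
  by (simp_all add: Fm_def Nm_def mv_opm[OF fin] lin_id lin_sdn lin_sup1)

lemma fsB: "y \<in> fs (B j) \<Longrightarrow> 1 \<le> j \<Longrightarrow> j < t \<Longrightarrow> y \<in> fs (B (Suc j))"
  by (auto simp: fs_def FB_def)

lemma sdn_fs: "y \<in> fs (B (Suc j)) \<Longrightarrow> 1 \<le> j \<Longrightarrow> j < t \<Longrightarrow> sdn y \<in> fs (B j)"
  by (auto simp: fs_def FB_def sdn_def)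

text \<open>\<alpha> preserves the path index and \<beta> lowers it, so both composites in the
  relation are \<open>sdn\<close>. At vertex 1 only index 0 occurs, which \<open>sdn\<close>
  kills.\<close>

lemma F_module: "is_module t F"
proof (rule is_moduleI)
  fix i assume "i \<notin> {1..t}" then show "dimv F i = 0" by (simp add: B_empty)
next
  fix x :: "nat \<Rightarrow> 'a" assume t: "2 \<le> t"
  have "co (B 1) x \<in> fs (B 1)" by (rule co_fs[OF fin])
  then have "sdn (co (B 1) x) = 0" by (auto simp: fs_def FB_def sdn_def fun_eq_iff)
  moreover have "res (B (Suc 1)) (co (B 1) x) = co (B 1) x"
    by (rule res_id[OF fsB[OF co_fs[OF fin]]]) (use t in auto)
  ultimately show "mv (arrB F 1) (mv (arrA F 1) x) = 0"
    by (simp add: mvF co_ci[OF fin] lin_zero[OF lin_ci])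
next
  fix i x assume i: "2 \<le> i" "i < t"
  then obtain k where k: "i = Suc k" "1 \<le> k" "k < t" by (cases i) auto
  have "res (B k) (sdn (co (B i) x)) = sdn (co (B i) x)"
    unfolding k by (rule res_id[OF sdn_fs[OF co_fs[OF fin]]]) (use k in auto)
  moreover have "res (B (Suc i)) (co (B i) x) = co (B i) x"
    by (rule res_id[OF fsB[OF co_fs[OF fin]]]) (use i in auto)
  ultimately show "mv (arrA F (i - 1)) (mv (arrB F (i - 1)) x) = mv (arrB F i) (mv (arrA F i) x)"
    using k by (simp add: mvF co_ci[OF fin])
qed (simp_all add: Fm_def opm_carrier)

text \<open>Here both composites raise the index by one. At vertex 1 the result has index 1 and is
  cut off by \<beta>.\<close>

lemma N_module: "is_module t Nk"
proof (rule is_moduleI)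
  fix i assume "i \<notin> {1..t}" then show "dimv Nk i = 0" by (simp add: B_empty)
next
  fix x :: "nat \<Rightarrow> 'a" assume t: "2 \<le> t"
  have "co (B 1) x \<in> fs (B 1)" by (rule co_fs[OF fin])
  then have "res (B 1) (res (B (Suc 1)) (sup1 (co (B 1) x))) = 0" 
    by (auto simp: fs_def FB_def sup1_def res_def fun_eq_iff)
  then show "mv (arrB Nk 1) (mv (arrA Nk 1) x) = 0"
    using ci_res[OF fin, of 1 "res (B (Suc 1)) (sup1 (co (B 1) x))"]
    by (simp add: mvN co_ci[OF fin] lin_zero[OF lin_ci])
next
  fix i x assume i: "2 \<le> i" "i < t"
  then obtain k where k: "i = Suc k" "1 \<le> k" "k < t" by (cases i) auto
  have "res (B i) (sup1 (res (B k) (co (B i) x))) = res (B i) (res (B (Suc i)) (sup1 (co (B i) x)))"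
    using co_fs[OF fin, of i x] k i by (auto simp: res_def sup1_def FB_def fun_eq_iff fs_def)
  then show "mv (arrA Nk (i - 1)) (mv (arrB Nk (i - 1)) x) = mv (arrB Nk i) (mv (arrA Nk i) x)"
    using k ci_res[OF fin, of i "sup1 (res (B k) (co (B i) x))"]
      ci_res[OF fin, of i "res (B (Suc i)) (sup1 (co (B i) x))"] by (simp add: mvN co_ci[OF fin])
qed (simp_all add: Nm_def opm_carrier)

lemma gen_fs: "gen t G \<nu> g \<in> fs {..<dimv F (\<nu> g)}" by (simp add: gen_def ci_fs)

lemma F_A_dlt: "(g, e) \<in> B j \<Longrightarrow> j < t \<Longrightarrow> mv (arrA F j) (ci (B j) (dlt (g, e))) = ci (B (Suc j)) (dlt (g, e))"
  by (simp add: mvF co_ci[OF fin] res_id fs_dlt)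

lemma F_B_dlt:
  assumes "(g, Suc e) \<in> B (Suc j)"
  shows "mv (arrB F j) (ci (B (Suc j)) (dlt (g, Suc e))) = (ci (B j) (dlt (g, e)) :: nat \<Rightarrow> 'k::field)"
proof -
  have "sdn (dlt (g, Suc e)) = (dlt (g, e) :: _ \<Rightarrow> 'k)" by (auto simp: sdn_def dlt_def fun_eq_iff)
  then show ?thesis using assms by (simp add: mvF co_ci[OF fin] res_id fs_dlt)
qed

text \<open>Identifies the basis with paths applied to generators: the generator at
  \<open>\<nu> g\<close> has index \<open>\<nu> g - 1\<close>, descending to \<open>e + 1\<close>
  lowers the index to \<open>e\<close>, and ascending leaves it unchanged.\<close>

lemma pth_gen:
  assumes "(g, e) \<in> B j"
  shows "pth F j e (\<nu> g) (gen t G \<nu> g) = (ci (B j) (dlt (g, e)) :: nat \<Rightarrow> 'k::field)"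
proof -
  have a: "g \<in> G" "1 \<le> j" "j \<le> t" "e < \<nu> g" "e < j" "\<nu> g \<le> t" using assms \<nu> by (auto simp: FB_def)
  have dn: "dnn F (\<nu> g) (gen t G \<nu> g) n = (ci (B (\<nu> g - n)) (dlt (g, \<nu> g - 1 - n)) :: nat \<Rightarrow> 'k)" if "n < \<nu> g" for n
    using that
  proof (induction n)
    case 0 then show ?case by (simp add: gen_def)
  next
    case (Suc n)
    then have e: "\<nu> g - n = Suc (\<nu> g - Suc n)" "\<nu> g - Suc n = Suc (\<nu> g - 1 - Suc n)" by auto
    have "(g, Suc (\<nu> g - 1 - Suc n)) \<in> B (Suc (\<nu> g - Suc n))" using Suc a by (auto simp: FB_def)
    then have "mv (arrB F (\<nu> g - Suc n)) (ci (B (Suc (\<nu> g - Suc n))) (dlt (g, Suc (\<nu> g - 1 - Suc n))))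
        = (ci (B (\<nu> g - Suc n)) (dlt (g, \<nu> g - 1 - Suc n)) :: _ \<Rightarrow> 'k)" by (rule F_B_dlt)
    then show ?case using Suc e by simp
  qed
  have up: "upn F (Suc e) (ci (B (Suc e)) (dlt (g, e))) n = (ci (B (Suc e + n)) (dlt (g, e)) :: nat \<Rightarrow> 'k)" if "Suc e + n \<le> t" for n
    using that
  proof (induction n)
    case (Suc n)
    then show ?case using F_A_dlt[of g e "Suc e + n"] a by (auto simp: FB_def)
  qed simp
  show ?thesis
    unfolding pth_def using dn[of "\<nu> g - Suc e"] up[of "j - Suc e"] a by simp
qed

definition ext :: "'k::field rep \<Rightarrow> ('g \<Rightarrow> nat \<Rightarrow> 'k) \<Rightarrow> nat \<Rightarrow> ('g \<times> nat \<Rightarrow> 'k) \<Rightarrow> nat \<Rightarrow> 'k" where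
  "ext N n j y = (\<Sum>g\<in>G. \<Sum>e<\<nu> g. scl (y (g, e)) (pth N j e (\<nu> g) (n g)))"

lemma lin_ext: "lin (ext N n j)"
  by (auto simp: lin_def ext_def fun_eq_iff sum_fun_apply algebra_simps sum.distrib sum_distrib_left)

lemma ext_fs:
  assumes "is_module t N" "\<And>g. g \<in> G \<Longrightarrow> n g \<in> fs {..<dimv N (\<nu> g)}" "y \<in> fs (B j)"
  shows "ext N n j y \<in> fs {..<dimv N j}"
  unfolding ext_def
proof (intro fs_sum)
  fix g e assume g: "g \<in> G" and e: "e \<in> {..<\<nu> g}"
  show "scl (y (g, e)) (pth N j e (\<nu> g) (n g)) \<in> fs {..<dimv N j}"
  proof (cases "e < j")
    case True
    then show ?thesis by (intro fs_scl pth_fs[OF assms(1) assms(2)[OF g]]) (use e in auto)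
  next
    case False
    then have "y (g, e) = 0" using assms(3) by (auto simp: fs_def FB_def)
    then show ?thesis by (simp add: scl_def fs_def)
  qed
qed

text \<open>The map sends the basis vector \<open>(g, e)\<close> to the path \<open>e\<close>
  applied to \<open>n g\<close>. It commutes with the arrows because paths in \<open>N\<close>
  transform under \<alpha> and \<beta> as the basis of \<open>F\<close> does (\<open>pth_A\<close>,
  \<open>pth_B\<close>).\<close>

lemma ext_hom:
  fixes N :: "'k::field rep"
  assumes N: "is_module t N" and n: "\<And>g. g \<in> G \<Longrightarrow> n g \<in> fs {..<dimv N (\<nu> g)}"
  shows "\<exists>f. is_hom t F N f \<and> (\<forall>g\<in>G. mv (f (\<nu> g)) (gen t G \<nu> g) = n g)"
proof -
  define f where "f j = opm {..<dimv N j} (B j) (ext N n j)" for j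
  have mvf: "mv (f j) x = ext N n j (co (B j) x)" for j x
    unfolding f_def mv_opm[OF fin lin_ext] by (rule ci_nat[OF ext_fs[OF N n co_fs[OF fin]]])
  have "is_hom t F N f"
    unfolding is_hom_iff[OF F_module N]
  proof (intro conjI allI impI; (elim conjE)?)
    fix i show "f i \<in> carrier_mat (dimv N i) (dimv F i)"
      using opm_carrier[of "{..<dimv N i}" "B i" "ext N n i"] by (simp add: f_def)
  next
    fix j and x :: "nat \<Rightarrow> 'k" assume j: "1 \<le> j" "j < t"
    define y where "y = co (B j) x"
    have y: "y \<in> fs (B j)" unfolding y_def by (rule co_fs[OF fin])
    have "mv (f (Suc j)) (mv (arrA F j) x) = ext N n (Suc j) y"
      by (simp add: mvf mvF co_ci[OF fin] y_def[symmetric] res_id fsB[OF y j])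
    also have "\<dots> = mv (arrA N j) (ext N n j y)"
      unfolding ext_def lin_sum[OF lin_mv] mv_lin
    proof (intro sum.cong refl)
      fix g e assume "g \<in> G" "e \<in> {..<\<nu> g}"
      show "scl (y (g, e)) (pth N (Suc j) e (\<nu> g) (n g)) = scl (y (g, e)) (mv (arrA N j) (pth N j e (\<nu> g) (n g)))"
      proof (cases "e < j")
        case False
        then have "y (g, e) = 0" using y by (auto simp: fs_def FB_def)
        then show ?thesis by (simp add: scl_def)
      qed (simp add: pth_A)
    qed
    finally show "mv (f (Suc j)) (mv (arrA F j) x) = mv (arrA N j) (mv (f j) x)"
      by (simp add: mvf y_def)
  next
    fix j and x :: "nat \<Rightarrow> 'k" assume j: "1 \<le> j" "j < t"
    define y where "y = co (B (Suc j)) x"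
    have y: "y \<in> fs (B (Suc j))" unfolding y_def by (rule co_fs[OF fin])
    have "mv (f j) (mv (arrB F j) x) = ext N n j (sdn y)"
      by (simp add: mvf mvF co_ci[OF fin] y_def[symmetric] res_id sdn_fs[OF y j])
    also have "\<dots> = mv (arrB N j) (ext N n (Suc j) y)"
      unfolding ext_def lin_sum[OF lin_mv] mv_lin
    proof (rule sum.cong[OF refl])
      fix g assume g: "g \<in> G"
      then obtain m where m: "\<nu> g = Suc m" using \<nu>[OF g] by (cases "\<nu> g") auto
      \<comment> \<open>Index \<open>\<nu> g\<close> is not in the basis, so after the index shift
        the sum regains its full range with a zero summand.\<close>
      have y0: "y (g, Suc m) = 0" using y m by (auto simp: fs_def FB_def)
      have "(\<Sum>e<\<nu> g. scl (y (g, e)) (mv (arrB N j) (pth N (Suc j) e (\<nu> g) (n g))))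
          = (\<Sum>e<Suc m. scl (y (g, e)) (if e = 0 then 0 else pth N j (e - 1) (\<nu> g) (n g)))"
      proof (rule sum.cong)
        fix e assume e: "e \<in> {..<Suc m}"
        show "scl (y (g, e)) (mv (arrB N j) (pth N (Suc j) e (\<nu> g) (n g)))
          = scl (y (g, e)) (if e = 0 then 0 else pth N j (e - 1) (\<nu> g) (n g))"
        proof (cases "e \<le> j")
          case True
          then show ?thesis using pth_B[OF N j True] e m by simp
        next
          case False
          then have "y (g, e) = 0" using y by (auto simp: fs_def FB_def)
          then show ?thesis by (simp add: scl_def)
        qed
      qed (simp add: m)
      also have "\<dots> = (\<Sum>e<m. scl (y (g, Suc e)) (pth N j e (\<nu> g) (n g)))"
        unfolding sum.lessThan_Suc_shift by (simp add: scl_def zero_fun_def)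
      also have "\<dots> = (\<Sum>e<\<nu> g. scl (sdn y (g, e)) (pth N j e (\<nu> g) (n g)))"
        unfolding m by (simp add: sdn_def y0)
      finally show "(\<Sum>e<\<nu> g. scl (sdn y (g, e)) (pth N j e (\<nu> g) (n g))) =
        (\<Sum>e<\<nu> g. scl (y (g, e)) (mv (arrB N j) (pth N (Suc j) e (\<nu> g) (n g))))" ..
    qed
    finally show "mv (f j) (mv (arrB F j) x) = mv (arrB N j) (mv (f (Suc j)) x)"
      by (simp add: mvf y_def)
  qed
  moreover have "mv (f (\<nu> g)) (gen t G \<nu> g) = n g" if g: "g \<in> G" for g
  proof -
    have v: "0 < \<nu> g" "\<nu> g \<le> t" using \<nu>[OF g] by auto
    have "co (B (\<nu> g)) (gen t G \<nu> g) = (dlt (g, \<nu> g - 1) :: _ \<Rightarrow> 'k)"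
      unfolding gen_def co_ci[OF fin] by (rule res_id[OF fs_dlt]) (use g v in \<open>auto simp: FB_def\<close>)
    then have "mv (f (\<nu> g)) (gen t G \<nu> g) = ext N n (\<nu> g) (dlt (g, \<nu> g - 1))" by (simp add: mvf)
    also have "\<dots> = (\<Sum>g'\<in>G. if g' = g then n g else 0)"
      unfolding ext_def
    proof (rule sum.cong[OF refl])
      fix g' assume "g' \<in> G"
      have "(\<Sum>e<\<nu> g'. scl (dlt (g, \<nu> g - 1) (g', e)) (pth N (\<nu> g) e (\<nu> g') (n g')))
        = (\<Sum>e<\<nu> g'. if e = \<nu> g - 1 then if g' = g then n g else 0 else 0)"
        using v pth_self[of "\<nu> g" N "n g"] by (intro sum.cong) (auto simp: dlt_def scl_def fun_eq_iff)
      also have "\<dots> = (if g' = g then n g else 0)" using v by simp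
      finally show "(\<Sum>e<\<nu> g'. scl (dlt (g, \<nu> g - 1) (g', e)) (pth N (\<nu> g) e (\<nu> g') (n g'))) = \<dots>" .
    qed
    also have "\<dots> = n g" using g G by simp
    finally show ?thesis .
  qed
  ultimately show ?thesis by blast
qed

lemma hom_dlt:
  assumes "is_module t N" "is_hom t F N f" "(g, e) \<in> B j"
  shows "mv (f j) (ci (B j) (dlt (g, e))) = pth N j e (\<nu> g) (mv (f (\<nu> g)) (gen t G \<nu> g))"
  unfolding pth_gen[OF assms(3), symmetric]
  by (rule hom_pth[OF F_module assms(1,2)]) (use assms(3) \<nu> in \<open>auto simp: FB_def\<close>)

lemma hom_uniq:
  fixes N :: "'k::field rep"
  assumes N: "is_module t N" and f: "is_hom t F N f" and f': "is_hom t F N f'"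
    and e: "\<And>g. g \<in> G \<Longrightarrow> mv (f (\<nu> g)) (gen t G \<nu> g) = mv (f' (\<nu> g)) (gen t G \<nu> g)"
  shows "f = f'"
proof (rule hom_eqI[OF F_module f f'])
  fix j and x :: "nat \<Rightarrow> 'k" assume j: "j \<in> {1..t}" and x: "x \<in> fs {..<dimv (F :: 'k rep) j}"
  have "mv (f j) (ci (B j) (co (B j) x)) = mv (f' j) (ci (B j) (co (B j) x))"
  proof (rule lin_eqI[OF _ _ fin _ co_fs[OF fin]])
    show "lin (\<lambda>y. mv (f j) (ci (B j) y))" "lin (\<lambda>y. mv (f' j) (ci (B j) y))"
      by (rule lin_comp[OF lin_mv lin_ci])+
    fix b assume "b \<in> B j"
    then obtain g e where b: "b = (g, e)" "(g, e) \<in> B j" by (cases b) auto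
    then have "g \<in> G" by (auto simp: FB_def)
    then show "mv (f j) (ci (B j) (dlt b)) = mv (f' j) (ci (B j) (dlt b))"
      using hom_dlt[OF N f b(2)] hom_dlt[OF N f' b(2)] e b(1) by simp
  qed
  moreover have "ci (B j) (co (B j) x) = x" using ci_co[OF fin] x by simp
  ultimately show "mv (f j) x = mv (f' j) x" by simp
qed

lemma F_free: "is_free t (F :: 'k::field rep)"
  unfolding is_free_def
proof
  show "free_gens t (F :: 'k rep) ((\<lambda>g. (\<nu> g, gen t G \<nu> g)) ` G)"
    unfolding free_gens_def
  proof (intro conjI allI impI)
    show "is_module t (F :: 'k rep)" by (rule F_module)
    fix i and y :: "nat \<Rightarrow> 'k"
    assume "(i, y) \<in> (\<lambda>g. (\<nu> g, gen t G \<nu> g)) ` G"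
    then show "i \<in> {1..t}" "y \<in> fs {..<dimv (F :: 'k rep) i}" using \<nu> gen_fs by blast+
  next
    fix N :: "'k rep" and c :: "nat \<Rightarrow> (nat \<Rightarrow> 'k) \<Rightarrow> nat \<Rightarrow> 'k"
    assume N: "is_module t N" and c: "\<forall>i (y :: nat \<Rightarrow> 'k). (i, y) \<in> (\<lambda>g. (\<nu> g, gen t G \<nu> g)) ` G \<longrightarrow> c i y \<in> fs {..<dimv N i}"
    obtain f where f: "is_hom t F N f" "\<forall>g\<in>G. mv (f (\<nu> g)) (gen t G \<nu> g) = c (\<nu> g) (gen t G \<nu> g)"
      using ext_hom[OF N, of "\<lambda>g. c (\<nu> g) (gen t G \<nu> g)"] c by blast
    then show "\<exists>f. is_hom t F N f \<and> (\<forall>i y. (i, y) \<in> (\<lambda>g. (\<nu> g, gen t G \<nu> g)) ` G \<longrightarrow> mv (f i) y = c i y)"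
      by blast
  next
    fix N :: "'k rep" and f g
    assume "is_module t N" "is_hom t F N f" "is_hom t F N g"
      "\<forall>i y. (i, y) \<in> (\<lambda>g. (\<nu> g, gen t G \<nu> g)) ` G \<longrightarrow> mv (f i) y = mv (g i) y"
    then show "f = g" by (intro hom_uniq) auto
  qed
qed

end

section \<open>The standard resolution\<close>

type_synonym gidx = "nat \<times> nat \<times> nat"

text \<open>
  Generators of the standard resolution of \<open>M\<close>: \<open>(0, i, r)\<close> is the \<open>r\<close>-th basis vector of \<open>M\<^sub>i\<close>
  in the summand \<open>A e\<^sub>i \<otimes> M\<^sub>i\<close> (degree \<open>0\<close>, and degree \<open>-2\<close> for the relation at \<open>i < t\<close>), and
  \<open>(1, i, r)\<close>, \<open>(2, i, r)\<close> belong to the arrows \<open>\<alpha>\<^sub>i\<close>, \<open>\<beta>\<^sub>i\<close>, that is to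
  \<open>A e\<^sub>i\<^sub>+\<^sub>1 \<otimes> M\<^sub>i\<close> and \<open>A e\<^sub>i \<otimes> M\<^sub>i\<^sub>+\<^sub>1\<close>, in degree \<open>-1\<close>.
\<close>

definition okg :: "nat \<Rightarrow> int \<Rightarrow> nat \<Rightarrow> nat \<Rightarrow> bool" where
  "okg t n \<kappa> i \<longleftrightarrow> n = 0 \<and> \<kappa> = 0 \<and> 1 \<le> i \<and> i \<le> t \<or> n = -1 \<and> (\<kappa> = 1 \<or> \<kappa> = 2) \<and> 1 \<le> i \<and> i < t \<or>
     n = -2 \<and> \<kappa> = 0 \<and> 1 \<le> i \<and> i < t"

definition vtx :: "nat \<Rightarrow> nat \<Rightarrow> nat" where "vtx \<kappa> i = (if \<kappa> = 1 then Suc i else i)"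

definition nu :: "gidx \<Rightarrow> nat" where "nu = (\<lambda>(\<kappa>, i, r). vtx \<kappa> i)"

text \<open>For fixed kind, position and path index the coefficients form a vector of the
  multiplicity space, to which arrows of the module can be applied. The differentials become
  formulas in such rows.\<close>

definition row :: "(gidx \<times> nat \<Rightarrow> 'k) \<Rightarrow> nat \<Rightarrow> nat \<Rightarrow> nat \<Rightarrow> nat \<Rightarrow> 'k" where
  "row y \<kappa> i e = (\<lambda>r. y ((\<kappa>, i, r), e))"

definition plc :: "nat \<Rightarrow> nat \<Rightarrow> nat \<Rightarrow> (nat \<Rightarrow> 'k::field) \<Rightarrow> gidx \<times> nat \<Rightarrow> 'k" where
  "plc \<kappa> i e v = (\<lambda>((\<kappa>', i', r), e'). if \<kappa>' = \<kappa> \<and> i' = i \<and> e' = e then v r else 0)"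

lemma row_eqI: "(\<And>\<kappa> i e. row y \<kappa> i e = row z \<kappa> i e) \<Longrightarrow> y = z"
  by (auto simp: row_def fun_eq_iff)

lemma row_lin [simp]: "row (y + z) \<kappa> i e = row y \<kappa> i e + row z \<kappa> i e" "row (scl c y) \<kappa> i e = scl c (row y \<kappa> i e)"
  "row (y - z) \<kappa> i e = row y \<kappa> i e - row z \<kappa> i e" "row 0 \<kappa> i e = 0"
  by (auto simp: row_def fun_eq_iff)

lemma row_plc: "row (plc \<kappa> i e v) \<kappa>' i' e' = (if \<kappa>' = \<kappa> \<and> i' = i \<and> e' = e then v else 0)"
  by (auto simp: row_def plc_def fun_eq_iff)

lemma lin_plc: "lin (plc \<kappa> i e)"
  by (auto simp: lin_def plc_def fun_eq_iff)

lemma plc_dlt: "plc \<kappa> i e (dlt r) = dlt ((\<kappa>, i, r), e)"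
  by (auto simp: plc_def dlt_def fun_eq_iff)

lemma row_sdn [simp]: "row (sdn y) \<kappa> i e = row y \<kappa> i (Suc e)"
  by (auto simp: row_def sdn_def)

lemma row_sup1 [simp]: "row (sup1 y) \<kappa> i e = (if e = 0 then 0 else row y \<kappa> i (e - 1))"
  by (auto simp: row_def sup1_def fun_eq_iff)

text \<open>Solves X_i = u_i + b_i X_{i+1} for i < T with X_T = 0, carrying later entries down along
  \<beta>; \<open>upw\<close> is the ascending counterpart along \<alpha>. Preimages under the
  differentials are built from these two.\<close>

function dw :: "'k::field rep \<Rightarrow> (nat \<Rightarrow> nat \<Rightarrow> 'k) \<Rightarrow> nat \<Rightarrow> nat \<Rightarrow> nat \<Rightarrow> 'k" where
  "dw M u T i = (if T \<le> i then 0 else u i + mv (arrB M i) (dw M u T (Suc i)))"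
  by auto
termination by (relation "measure (\<lambda>(M, u, T, i). T - i)") auto
declare dw.simps [simp del]

fun upw :: "'k::field rep \<Rightarrow> (nat \<Rightarrow> nat \<Rightarrow> 'k) \<Rightarrow> nat \<Rightarrow> nat \<Rightarrow> 'k" where
  "upw M u 0 = 0"
| "upw M u (Suc i) = u (Suc i) + mv (arrA M i) (upw M u i)"

locale std =
  fixes t :: nat and M :: "'k::field rep"
  assumes M: "is_module t M"
begin

abbreviation a :: "nat \<Rightarrow> (nat \<Rightarrow> 'k) \<Rightarrow> nat \<Rightarrow> 'k" where "a i \<equiv> mv (arrA M i)"
abbreviation b :: "nat \<Rightarrow> (nat \<Rightarrow> 'k) \<Rightarrow> nat \<Rightarrow> 'k" where "b i \<equiv> mv (arrB M i)"
abbreviation d :: "nat \<Rightarrow> nat" where "d \<equiv> dimv M"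

text \<open>Dimension of the tensor factor next to the free module: M at the vertex, or at the
  source of the arrow, hence M_{i+1} only for \<beta>_i.\<close>

definition mlt :: "nat \<Rightarrow> nat \<Rightarrow> nat" where "mlt \<kappa> i = (if \<kappa> = 2 then d (Suc i) else d i)"

definition Gs :: "int \<Rightarrow> gidx set" where
  "Gs n = {(\<kappa>, i, r). okg t n \<kappa> i \<and> r < mlt \<kappa> i}"

abbreviation Bs :: "int \<Rightarrow> nat \<Rightarrow> (gidx \<times> nat) set" where "Bs n \<equiv> FB t (Gs n) nu"

definition okr :: "int \<Rightarrow> nat \<Rightarrow> nat \<Rightarrow> nat \<Rightarrow> nat \<Rightarrow> bool" where
  "okr n j \<kappa> i e \<longleftrightarrow> okg t n \<kappa> i \<and> j \<in> {1..t} \<and> e < vtx \<kappa> i \<and> e < j"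

lemma a_fs: "a i v \<in> fs {..<d (Suc i)}" and b_fs: "b i v \<in> fs {..<d i}"
  using mv_fs[OF module_A[OF M]] mv_fs[OF module_B[OF M]] by auto

lemma d_out: "i \<notin> {1..t} \<Longrightarrow> d i = 0" by (rule module_dim0[OF M])

lemma b_0 [simp]: "b 0 v = 0" using b_fs[of 0 v] d_out[of 0] by simp
lemma a_0 [simp]: "a 0 v = 0"
  using mv_zero_dim(1)[of "arrA M 0" "d 1"] module_A[OF M, of 0] d_out[of 0] by simp

lemmas rel = module_rel[OF M]

lemma gens_Gs: "gens t (Gs n) nu"
proof
  have "Gs n \<subseteq> {..2} \<times> ({..t} \<times> {..<Max (d ` {..Suc t}) + 1})"
  proof
    fix g assume "g \<in> Gs n"
    then obtain \<kappa> i r where g: "g = (\<kappa>, i, r)" "okg t n \<kappa> i" "r < mlt \<kappa> i" by (auto simp: Gs_def)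
    then have i: "\<kappa> \<le> 2" "i \<le> t" by (auto simp: okg_def)
    then have "mlt \<kappa> i \<le> Max (d ` {..Suc t})" by (auto simp: mlt_def)
    then show "g \<in> {..2} \<times> ({..t} \<times> {..<Max (d ` {..Suc t}) + 1})" using g i by auto
  qed
  then show "finite (Gs n)" by (rule finite_subset) auto
  show "nu g \<in> {1..t}" if "g \<in> Gs n" for g
    using that by (auto simp: Gs_def okg_def nu_def vtx_def)
qed

lemmas finB = gens.fin[OF gens_Gs]

lemma fsBs_iff: "y \<in> fs (Bs n j) \<longleftrightarrow>
    (\<forall>\<kappa> i e. (okr n j \<kappa> i e \<longrightarrow> row y \<kappa> i e \<in> fs {..<mlt \<kappa> i}) \<and> (\<not> okr n j \<kappa> i e \<longrightarrow> row y \<kappa> i e = 0))"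
  by (force simp: fs_def FB_def Gs_def okr_def row_def nu_def fun_eq_iff)

lemma row_0: "y \<in> fs (Bs n j) \<Longrightarrow> \<not> okr n j \<kappa> i e \<Longrightarrow> row y \<kappa> i e = 0"
  and row_fs: "y \<in> fs (Bs n j) \<Longrightarrow> row y \<kappa> i e \<in> fs {..<mlt \<kappa> i}"
  by (auto simp: fsBs_iff) (metis fs_zero)

text \<open>For an arrow \<gamma> the differential takes x \<otimes> m to x\<gamma> \<otimes> m - x
  \<otimes> \<gamma>m. Right multiplication by \<alpha>_i lowers the socle index, which explains
  \<open>Suc e\<close>; right multiplication by \<beta>_i preserves it.\<close>

definition p1 :: "(gidx \<times> nat \<Rightarrow> 'k) \<Rightarrow> gidx \<times> nat \<Rightarrow> 'k" where
  "p1 y = (\<lambda>((\<kappa>, i, r), e). if \<kappa> = 0 then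
     (row y 1 i (Suc e) + row y 2 (i - 1) e - a (i - 1) (row y 1 (i - 1) e) - b i (row y 2 i e)) r else 0)"

text \<open>The derivative of \<beta>_i \<alpha>_i - \<alpha>_{i-1} \<beta>_{i-1} with respect to
  its arrows: each arrow in turn becomes the generator of its summand, what stands to its left
  multiplies the free module, and what stands to its right acts on M.\<close>

definition p2 :: "(gidx \<times> nat \<Rightarrow> 'k) \<Rightarrow> gidx \<times> nat \<Rightarrow> 'k" where
  "p2 y = (\<lambda>((\<kappa>, i, r), e). if \<kappa> = 1 then (row y 0 i e - b i (row y 0 (Suc i) e)) r
     else if \<kappa> = 2 then (a i (row y 0 i e) - row y 0 (Suc i) (Suc e)) r else 0)"

definition dop :: "int \<Rightarrow> (gidx \<times> nat \<Rightarrow> 'k) \<Rightarrow> gidx \<times> nat \<Rightarrow> 'k" where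
  "dop n = (if n = -1 then p1 else if n = -2 then p2 else (\<lambda>y. 0))"

definition PP :: "'k cpx" where
  "PP = \<lparr>obj = (\<lambda>n. Fm t (Gs n) nu), dif = (\<lambda>n j. opm (Bs (n + 1) j) (Bs n j) (dop n))\<rparr>"

lemma row_p1: "row (p1 y) \<kappa> i e = (if \<kappa> = 0 then
     row y 1 i (Suc e) + row y 2 (i - 1) e - a (i - 1) (row y 1 (i - 1) e) - b i (row y 2 i e) else 0)"
  by (auto simp: row_def p1_def fun_eq_iff)

lemma row_p2: "row (p2 y) \<kappa> i e = (if \<kappa> = 1 then row y 0 i e - b i (row y 0 (Suc i) e)
     else if \<kappa> = 2 then a i (row y 0 i e) - row y 0 (Suc i) (Suc e) else 0)"
  by (auto simp: row_def p2_def fun_eq_iff)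

lemma lin_dop: "lin (dop n)"
proof -
  have "lin p1" unfolding lin_def
    by (intro conjI allI row_eqI) (simp_all add: row_p1 mv_lin fun_eq_iff algebra_simps)
  moreover have "lin p2" unfolding lin_def
    by (intro conjI allI row_eqI) (simp_all add: row_p2 mv_lin fun_eq_iff algebra_simps)
  moreover have "lin (\<lambda>y. 0)" by (auto simp: lin_def fun_eq_iff)
  ultimately show ?thesis by (auto simp: dop_def)
qed

lemma dop_sdn: "dop n (sdn y) = sdn (dop n y)"
  by (rule row_eqI) (auto simp: dop_def row_p1 row_p2)

lemma dop_fs:
  assumes y: "y \<in> fs (Bs n j)"
  shows "dop n y \<in> fs (Bs (n + 1) j)"
proof -
  note z = row_0[OF y] and f = row_fs[OF y]
  consider "n = -1" | "n = -2" | "n \<noteq> -1" "n \<noteq> -2" by blast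
  then show ?thesis
  proof cases
    case 1
    show ?thesis
      unfolding fsBs_iff
    proof (intro allI conjI impI)
      fix \<kappa> i e
      assume "okr (n + 1) j \<kappa> i e"
      then have i: "\<kappa> = 0" "1 \<le> i" "Suc (i - 1) = i" using 1 by (auto simp: okr_def okg_def)
      show "row (dop n y) \<kappa> i e \<in> fs {..<mlt \<kappa> i}"
        using i f[of 1 i "Suc e"] f[of 2 "i - 1" e] a_fs[of "i - 1"] b_fs[of i] 1
        by (auto simp: dop_def row_p1 mlt_def intro!: fs_add fs_diff)
    next
      fix \<kappa> i e
      assume n: "\<not> okr (n + 1) j \<kappa> i e"
      show "row (dop n y) \<kappa> i e = 0"
      proof (cases "\<kappa> = 0 \<and> i \<noteq> 0")
        case True
        have "row y 1 i (Suc e) = 0" "row y 2 (i - 1) e = 0" "row y 1 (i - 1) e = 0" "row y 2 i e = 0"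
          using n True 1 by (auto intro!: z simp: okr_def okg_def vtx_def)
        then show ?thesis using 1 by (simp add: dop_def row_p1 mv_lin)
      next
        case False
        have "row y 1 0 (Suc e) = 0" "row y 2 0 e = 0" "row y 1 0 e = 0"
          using 1 by (auto intro!: z simp: okr_def okg_def vtx_def)
        then show ?thesis using 1 False by (auto simp: dop_def row_p1 mv_lin)
      qed
    qed
  next
    case 2
    show ?thesis
      unfolding fsBs_iff
    proof (intro allI conjI impI)
      fix \<kappa> i e
      assume "okr (n + 1) j \<kappa> i e"
      then show "row (dop n y) \<kappa> i e \<in> fs {..<mlt \<kappa> i}"
        using f[of 0 i e] f[of 0 "Suc i" "Suc e"] a_fs[of i] b_fs[of i] 2
        by (auto simp: dop_def row_p2 mlt_def okr_def okg_def intro!: fs_add fs_diff)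
    next
      fix \<kappa> i e
      assume n: "\<not> okr (n + 1) j \<kappa> i e"
      have "row (p2 y) 1 i e = 0" if "\<kappa> = 1"
      proof (cases "i = 0")
        case True
        then show ?thesis using 2 z[of 0 0 e] by (simp add: row_p2 okr_def okg_def)
      next
        case False
        have "row y 0 i e = 0" "row y 0 (Suc i) e = 0"
          using n that 2 False by (auto intro!: z simp: okr_def okg_def vtx_def)
        then show ?thesis by (simp add: row_p2 mv_lin)
      qed
      moreover have "row (p2 y) 2 i e = 0" if "\<kappa> = 2"
      proof -
        have "row y 0 i e = 0" "row y 0 (Suc i) (Suc e) = 0"
          using n that 2 by (auto intro!: z simp: okr_def okg_def vtx_def)
        then show ?thesis by (simp add: row_p2 mv_lin)
      qed
      ultimately show "row (dop n y) \<kappa> i e = 0" using 2 by (auto simp: dop_def row_p2)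
    qed
  qed (auto simp: dop_def)
qed

lemma dop_dop:
  assumes y: "y \<in> fs (Bs n j)"
  shows "dop (n + 1) (dop n y) = 0"
proof (cases "n = -2")
  case True
  have z: "p2 y \<in> fs (Bs (-1) j)" using dop_fs[OF y] True by (simp add: dop_def)
  have "p1 (p2 y) = 0"
  proof (rule row_eqI)
    fix \<kappa> i e
    show "row (p1 (p2 y)) \<kappa> i e = row 0 \<kappa> i e"
    proof (cases "\<kappa> = 0 \<and> i \<noteq> 0")
      case False
      have "p1 (p2 y) \<in> fs (Bs 0 j)" using dop_fs[OF z] by (simp add: dop_def)
      then show ?thesis using False by (auto intro!: row_0 simp: okr_def okg_def)
    next
      case k: True
      then have i: "Suc (i - 1) = i" by simp
      \<comment> \<open>All other terms cancel in pairs; what remains is the relation applied to the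
        row at \<open>i\<close>. At vertex \<open>t\<close>, where no relation is imposed, degree -2
        has no row.\<close>
      have "a (i - 1) (b (i - 1) (row y 0 i e)) = b i (a i (row y 0 i e))"
      proof (cases "i < t")
        case True then show ?thesis using k rel[of i] by simp
      next
        case False
        then have "row y 0 i e = 0" using row_0[OF y] \<open>n = -2\<close> by (auto simp: okr_def okg_def)
        then show ?thesis by (simp add: mv_lin)
      qed
      then show ?thesis using k i by (simp add: row_p1 row_p2 mv_lin algebra_simps)
    qed
  qed
  then show ?thesis using True by (simp add: dop_def)
next
  case False
  then have "dop n y = 0 \<or> n = -1" by (auto simp: dop_def)
  then show ?thesis
  proof
    assume "dop n y = 0" then show ?thesis by (simp only: lin_zero[OF lin_dop])
  qed (simp add: dop_def)
qed

lemma mv_PP: "mv (dif PP n j) x = ci (Bs (n + 1) j) (dop n (co (Bs n j) x))"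
  unfolding PP_def by (simp add: mv_opm[OF finB lin_dop])

lemma obj_PP [simp]: "obj PP n = Fm t (Gs n) nu" by (simp add: PP_def)

lemma cpx_PP: "is_cpx t PP"
  unfolding is_cpx_def
proof (intro conjI allI)
  fix n
  have m: "is_module t (obj PP n)" for n using gens.F_module[OF gens_Gs] by simp
  then show "is_module t (obj PP n)" .
  have h: "is_hom t (obj PP n) (obj PP (n + 1)) (dif PP n)" for n
    unfolding is_hom_iff[OF m m]
  proof (intro conjI allI impI; (elim conjE)?)
    fix i show "dif PP n i \<in> carrier_mat (dimv (obj PP (n + 1)) i) (dimv (obj PP n) i)"
      by (simp add: PP_def gens.dimF[OF gens_Gs] opm_carrier)
  next
    fix i and x :: "nat \<Rightarrow> 'k" assume i: "1 \<le> i" "i < t"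
    note g = gens.mvF[OF gens_Gs] co_ci[OF finB] mv_PP
    have y: "co (Bs n i) x \<in> fs (Bs n i)" by (rule co_fs[OF finB])
    show "mv (dif PP n (Suc i)) (mv (arrA (obj PP n) i) x) = mv (arrA (obj PP (n + 1)) i) (mv (dif PP n i) x)"
      by (simp add: g res_id gens.fsB[OF gens_Gs y i] dop_fs[OF y])
    have y': "co (Bs n (Suc i)) x \<in> fs (Bs n (Suc i))" by (rule co_fs[OF finB])
    show "mv (dif PP n i) (mv (arrB (obj PP n) i) x) = mv (arrB (obj PP (n + 1)) i) (mv (dif PP n (Suc i)) x)"
      by (simp add: g res_id gens.sdn_fs[OF gens_Gs y' i] dop_fs[OF y'] dop_sdn)
  qed
  then show "is_hom t (obj PP n) (obj PP (n + 1)) (dif PP n)" .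
  have h2: "is_hom t (obj PP (n + 1)) (obj PP (n + 2)) (dif PP (n + 1))"
    using h[of "n + 1"] by (simp only: add.assoc one_add_one)
  show "dif PP (n + 1) \<circ>\<^sub>h dif PP n = hom_zero (obj PP n) (obj PP (n + 2))"
    by (rule hom_eqI[OF m is_hom_comp[OF m m m h h2] is_hom_zero[OF m m]])
      (simp add: mv_comp[OF h h2] mv_PP co_ci[OF finB] res_id[OF dop_fs[OF co_fs[OF finB]]]
        dop_dop[OF co_fs[OF finB]] lin_zero[OF lin_ci] del: obj_PP)
next
  have "is_zero_rep (obj PP n)" if "n < -2 \<or> 0 < n" for n
  proof -
    have "Gs n = {}" using that by (auto simp: Gs_def okg_def)
    then show ?thesis by (simp add: is_zero_rep_def Fm_def FB_def)
  qed
  then show "\<exists>a b. \<forall>n. n < a \<or> b < n \<longrightarrow> is_zero_rep (obj PP n)" by blast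
qed

lemma free_PP: "is_free t (obj PP n)" using gens.F_free[OF gens_Gs] by simp

section \<open>Exactness of the standard resolution\<close>

lemma p2_inj:
  assumes y: "y \<in> fs (Bs (-2) j)" and 0: "p2 y = 0"
  shows "y = 0"
proof -
  \<comment> \<open>The \<alpha> components suffice: each row is the image of the next one, and the
    row at \<open>t\<close> is zero.\<close>
  have r: "row y 0 i e = b i (row y 0 (Suc i) e)" for i e
    using arg_cong[OF 0, of "\<lambda>y. row y 1 i e"] by (simp add: row_p2)
  have z: "row y 0 i e = 0" if "i \<le> t" for i e
    using that
  proof (induction rule: inc_induct)
    case base then show ?case by (rule row_0[OF y]) (auto simp: okr_def okg_def)
  next
    case (step i)
    show ?case by (simp only: r[of i e] step.IH mv_lin)
  qed
  show ?thesis
  proof (rule row_eqI)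
    fix \<kappa> i e
    show "row y \<kappa> i e = row 0 \<kappa> i e"
      using z[of i e] row_0[OF y, of \<kappa> i e] by (cases "\<kappa> = 0 \<and> i \<le> t") (auto simp: okr_def okg_def)
  qed
qed

lemma dw_unfold: "i < T \<Longrightarrow> dw M u T i = u i + b i (dw M u T (Suc i))"
  and dw_top: "T \<le> i \<Longrightarrow> dw M u T i = 0"
  by (subst dw.simps; simp)+

text \<open>The \<alpha> components of \<open>p2 x = y\<close> determine \<open>x\<close> by
  descending recursion from zero at \<open>t\<close>. The \<beta> components then follow from
  \<open>p1 y = 0\<close>, and they in turn bound the path indices occurring in
  \<open>x\<close>.\<close>

lemma p1_exact:
  assumes y: "y \<in> fs (Bs (-1) j)" and 0: "p1 y = 0" and j: "j \<in> {1..t}"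
  shows "\<exists>x\<in>fs (Bs (-2) j). p2 x = y"
proof -
  define X where "X i e = dw M (\<lambda>i. row y 1 i e) t i" for i e
  have X: "X i e = row y 1 i e + b i (X (Suc i) e)" if "i < t" for i e
    unfolding X_def by (rule dw_unfold[OF that])
  have Xt: "X i e = 0" if "t \<le> i" for i e using dw_top[OF that] by (simp add: X_def)
  have eq: "row y 1 i (Suc e) + row y 2 (i - 1) e = a (i - 1) (row y 1 (i - 1) e) + b i (row y 2 i e)" for i e
    using arg_cong[OF 0, of "\<lambda>y. row y 0 i e"] by (simp add: row_p1 algebra_simps)
  have y0: "row y \<kappa> i e = 0" if "i = 0 \<or> t \<le> i \<or> j \<le> e \<or> vtx \<kappa> i \<le> e" for \<kappa> i e
    using that by (intro row_0[OF y]) (auto simp: okr_def okg_def)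
  \<comment> \<open>The \<beta> components. The step downwards uses \<open>p1 y = 0\<close> at
    \<open>Suc i\<close> and, below \<open>t\<close>, the relation of M there.\<close>
  have delta: "row y 2 i e - a i (X i e) + X (Suc i) (Suc e) = 0" if "i \<le> t" for i e
    using that
  proof (induction rule: inc_induct)
    case base
    have "X t e = 0" "X (Suc t) (Suc e) = 0" "row y 2 t e = 0" by (auto intro!: Xt y0)
    then show ?case by (simp only: mv_lin diff_0_right add_0_right)
  next
    case (step i)
    show ?case
    proof (cases "Suc i = t")
      case True
      have "row y 2 (Suc i) e = 0" "row y 1 (Suc i) (Suc e) = 0" using True by (auto intro!: y0)
      then have "row y 2 i e = a i (row y 1 i e)" using eq[of "Suc i" e] by (simp add: mv_lin)
      then show ?thesis using X[of i e] True Xt[of "Suc i"] by (simp add: mv_lin)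
    next
      case False
      then have s: "Suc i < t" using step by simp
      have w: "row y 2 (Suc i) e = a (Suc i) (X (Suc i) e) - X (Suc (Suc i)) (Suc e)"
        using step.IH by (simp add: fun_eq_iff algebra_simps)
      have "row y 2 i e = a i (row y 1 i e) + b (Suc i) (row y 2 (Suc i) e) - row y 1 (Suc i) (Suc e)"
        using eq[of "Suc i" e] by (simp add: algebra_simps)
      moreover have "a i (X i e) = a i (row y 1 i e) + a i (b i (X (Suc i) e))"
        using X[of i e] s by (simp add: mv_lin)
      moreover have "a i (b i (X (Suc i) e)) = b (Suc i) (a (Suc i) (X (Suc i) e))"
        using rel[of "Suc i"] s by simp
      moreover have "X (Suc i) (Suc e) = row y 1 (Suc i) (Suc e) + b (Suc i) (X (Suc (Suc i)) (Suc e))"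
        by (rule X[OF s])
      ultimately show ?thesis unfolding w by (simp add: mv_lin)
    qed
  qed
  \<comment> \<open>The recursion might produce indices that exceed the basis at a vertex;
    \<open>delta\<close> excludes them, now ascending from vertex 0.\<close>
  have deg: "X (Suc i) e = 0" if "Suc i \<le> e" for i e
    using that
  proof (induction i arbitrary: e)
    case 0
    then obtain e' where "e = Suc e'" by (cases e) auto
    then show ?case using delta[of 0 e'] y0[of 0] by simp
  next
    case (Suc i)
    then obtain e' where e: "e = Suc e'" "Suc i \<le> e'" by (cases e) auto
    show ?case
    proof (cases "Suc i \<le> t")
      case True
      have "X (Suc i) e' = 0" using Suc.IH[OF e(2)] by (simp add: fun_eq_iff)
      then show ?thesis using delta[OF True, of e'] y0[of "Suc i" e' 2] e
        by (simp add: mv_lin vtx_def)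
    qed (simp add: Xt)
  qed
  have degj: "X i e = 0" if "j \<le> e" "i \<le> t" for i e
    using that(2)
  proof (induction rule: inc_induct)
    case (step i)
    have "X (Suc i) e = 0" using step.IH by (simp add: fun_eq_iff)
    moreover have "row y 1 i e = 0" using that(1) by (auto intro!: y0)
    ultimately show ?case using X[OF step(2), of e] by (simp add: mv_lin)
  qed (simp add: Xt)
  have Xf: "X i e \<in> fs {..<d i}" for i e
  proof (cases "i < t")
    case True
    then show ?thesis using row_fs[OF y, of 1 i e] b_fs[of i "X (Suc i) e"] X[OF True] 
      by (auto simp: mlt_def intro!: fs_add)
  qed (simp add: Xt)
  define x where "x = (\<lambda>((\<kappa>, i, r), e). if \<kappa> = (0::nat) \<and> i \<noteq> 0 then X i e r else 0)"
  have rx: "row x \<kappa> i e = (if \<kappa> = 0 \<and> i \<noteq> 0 then X i e else 0)" for \<kappa> i e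
    by (auto simp: x_def row_def fun_eq_iff)
  have "X i e = 0" if "i \<noteq> 0" "\<not> (1 \<le> i \<and> i < t \<and> e < i \<and> e < j)" for i e
    using that deg[of "i - 1" e] degj[of e i] Xt[of i e] by (cases "i < t") auto
  then have "x \<in> fs (Bs (-2) j)"
    unfolding fsBs_iff rx using Xf j by (auto simp: okr_def okg_def vtx_def mlt_def)
  moreover have "p2 x = y"
  proof (rule row_eqI)
    fix \<kappa> i e
    have "row y 1 i e = X i e - b i (X (Suc i) e)" if "i \<noteq> 0"
      using X[of i e] Xt y0[of i] that by (cases "i < t") (simp_all add: mv_lin)
    moreover have "row y 2 i e = a i (X i e) - X (Suc i) (Suc e)" 
      using delta[of i e] Xt y0[of i] by (cases "i < t") (simp_all add: mv_lin algebra_simps)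
    moreover have "row y \<kappa> i e = 0" if "\<kappa> \<noteq> 1" "\<kappa> \<noteq> 2"
      using row_0[OF y, of \<kappa> i e] that by (auto simp: okr_def okg_def)
    ultimately show "row (p2 x) \<kappa> i e = row y \<kappa> i e"
      using y0[of i] by (cases "i = 0") (auto simp: row_p2 rx mv_lin)
  qed
  ultimately show ?thesis by blast
qed

text \<open>Modulo boundaries every element is the trivial path tensored with a vector. A path
  beginning with a descent can hand its first arrow \<beta> to the vector; this is the recursion
  \<open>X\<close> and leaves only ascending paths, those with \<open>e = i - 1\<close>. They hand
  over their arrows \<alpha> one after the other, collected by \<open>v\<close>, until the trivial
  path at \<open>j\<close> is reached.\<close>

lemma p1_reduce:
  assumes x: "x \<in> fs (Bs 0 j)" and j: "j \<in> {1..t}"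
  shows "\<exists>y\<in>fs (Bs (-1) j). \<exists>v\<in>fs {..<d j}. x = p1 y + plc 0 j (j - 1) v"
proof -
  define X where "X i e = dw M (\<lambda>i. row x 0 i e) (Suc t) i" for i e
  have X: "X i e = row x 0 i e + b i (X (Suc i) e)" if "i \<le> t" for i e
    unfolding X_def using that by (intro dw_unfold) simp
  have Xt: "X i e = 0" if "t < i" for i e using dw_top[of "Suc t" i] that by (simp add: X_def)
  have x0: "row x \<kappa> i e = 0" if "\<kappa> \<noteq> 0 \<or> i = 0 \<or> t < i \<or> j \<le> e \<or> i \<le> e" for \<kappa> i e
    using that by (intro row_0[OF x]) (auto simp: okr_def okg_def vtx_def)
  have Xf: "X i e \<in> fs {..<d i}" for i e
  proof (cases "i \<le> t")
    case True
    then show ?thesis using row_fs[OF x, of 0 i e] b_fs[of i "X (Suc i) e"] X[OF True] 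
      by (auto simp: mlt_def intro!: fs_add)
  qed (simp add: Xt)
  define v where "v i = upw M (\<lambda>i. X i (i - 1)) i" for i
  have v0: "v 0 = 0" and v: "v (Suc i) = X (Suc i) i + a i (v i)" for i by (simp_all add: v_def)
  have vf: "v i \<in> fs {..<d i}" for i
    using v0 v Xf[of i "i - 1"] a_fs[of "i - 1" "v (i - 1)"] by (cases i) (auto intro: fs_add)
  \<comment> \<open>The \<alpha> summand at \<open>i\<close> starts at vertex \<open>i + 1\<close>,
    so its ascending path has index \<open>i\<close>. The \<beta> summand records what is moved from
    the summand at \<open>Suc i\<close> to the one at \<open>i\<close>.\<close>
  define y where "y = (\<lambda>((\<kappa>, i, r), e). if 1 \<le> i \<and> i < t \<and> e < j then
      (if \<kappa> = (1::nat) then if e = i then v i r else 0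
       else if \<kappa> = 2 then if e < i then X (Suc i) e r else 0 else 0) else 0)"
  have r1: "row y 1 i e = (if 1 \<le> i \<and> i < t \<and> e < j \<and> e = i then v i else 0)"
    and r2: "row y 2 i e = (if 1 \<le> i \<and> i < t \<and> e < j \<and> e < i then X (Suc i) e else 0)" 
    and r3: "\<kappa> \<noteq> 1 \<Longrightarrow> \<kappa> \<noteq> 2 \<Longrightarrow> row y \<kappa> i e = 0" for i e \<kappa>
    by (auto simp: y_def row_def fun_eq_iff)
  have "y \<in> fs (Bs (-1) j)"
    unfolding fsBs_iff
  proof (intro allI conjI impI)
    fix \<kappa> i e
    show "row y \<kappa> i e \<in> fs {..<mlt \<kappa> i}" if "okr (-1) j \<kappa> i e"
      using that r1 r2 vf Xf by (auto simp: okr_def okg_def mlt_def)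
    show "row y \<kappa> i e = 0" if "\<not> okr (-1) j \<kappa> i e"
      using that r1[of i e] r2[of i e] r3[of \<kappa> i e] j
      by (cases "\<kappa> = 1"; cases "\<kappa> = 2") (auto simp: okr_def okg_def vtx_def)
  qed
  moreover have "x = p1 y + plc 0 j (j - 1) (v j)"
  proof (rule row_eqI)
    fix \<kappa> i e
    show "row x \<kappa> i e = row (p1 y + plc 0 j (j - 1) (v j)) \<kappa> i e"
    proof (cases "\<kappa> = 0 \<and> 1 \<le> i \<and> i \<le> t \<and> e < i \<and> e < j")
      case False
      have "row (p1 y) \<kappa> i e = 0"
      proof (rule row_0)
        show "p1 y \<in> fs (Bs 0 j)" using dop_fs[OF \<open>y \<in> fs (Bs (-1) j)\<close>] by (simp add: dop_def)
        show "\<not> okr 0 j \<kappa> i e" using False by (auto simp: okr_def okg_def vtx_def)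
      qed
      then show ?thesis using False j x0[of \<kappa> i e] by (auto simp: row_plc)
    next
      case True
      then obtain l where i: "i = Suc l" by (cases i) auto
      have bx: "b i (row y 2 i e) = b i (X (Suc i) e)"
        using True Xt[of "Suc i" e] by (cases "i < t") (auto simp: r2 mv_lin)
      show ?thesis
      proof (cases "e = l")
        case False
        then have "row y 2 l e = X i e" "row y 1 i (Suc e) = 0" "row y 1 l e = 0"
          using True i unfolding r1 r2 by auto
        then show ?thesis using True i False bx X[of i e] by (auto simp: row_p1 row_plc mv_lin)
      next
        case e: True
        have "row y 2 l e = 0" using e by (simp add: r2)
        moreover have "row y 1 i (Suc e) = (if i < j then v i else 0)"
          using True i e j unfolding r1 by auto
        moreover have "a l (row y 1 l e) = a l (v l)" using True i e v0 unfolding r1 by (cases "l = 0") (auto simp: mv_lin)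
        moreover have "v i = X i l + a l (v l)" unfolding i by (rule v)
        ultimately show ?thesis using True i bx X[of i e] e
          by (cases "i = j") (auto simp: row_p1 row_plc mv_lin algebra_simps)
      qed
    qed
  qed
  ultimately show ?thesis using vf by blast
qed

end

context std
begin

section \<open>Maps out of the standard resolution\<close>

text \<open>Turns a map out of a free module into the linear maps on multiplicity spaces by which it
  is given on generators; \<open>vtx \<kappa> i - 1\<close> is the index of the trivial
  path.\<close>

definition ev :: "int \<Rightarrow> 'k hom \<Rightarrow> nat \<Rightarrow> nat \<Rightarrow> (nat \<Rightarrow> 'k) \<Rightarrow> nat \<Rightarrow> 'k" where
  "ev n h \<kappa> i v = mv (h (vtx \<kappa> i)) (ci (Bs n (vtx \<kappa> i)) (plc \<kappa> i (vtx \<kappa> i - 1) v))"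

lemma lin_ev: "lin (ev n h \<kappa> i)"
  unfolding ev_def by (rule lin_comp[OF lin_mv lin_comp[OF lin_ci lin_plc]])

lemma ev_fs: "is_hom t (obj PP n) N h \<Longrightarrow> ev n h \<kappa> i v \<in> fs {..<dimv N (vtx \<kappa> i)}"
  unfolding ev_def by (rule hom_fs)

lemma plc_fs: "okr n j \<kappa> i e \<Longrightarrow> v \<in> fs {..<mlt \<kappa> i} \<Longrightarrow> plc \<kappa> i e v \<in> fs (Bs n j)"
  by (auto simp: fsBs_iff row_plc)

lemma okg_gen: "okg t n \<kappa> i \<Longrightarrow> okr n (vtx \<kappa> i) \<kappa> i (vtx \<kappa> i - 1)"
  by (auto simp: okr_def okg_def vtx_def)

lemma hom_plc:
  assumes N: "is_module t N" and h: "is_hom t (obj PP n) N h" and o: "okr n j \<kappa> i e" and v: "v \<in> fs {..<mlt \<kappa> i}"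
  shows "mv (h j) (ci (Bs n j) (plc \<kappa> i e v)) = pth N j e (vtx \<kappa> i) (ev n h \<kappa> i v)"
proof (rule lin_eqI[OF _ _ _ _ v])
  show "lin (\<lambda>v. mv (h j) (ci (Bs n j) (plc \<kappa> i e v)))"
    by (rule lin_comp[OF lin_mv lin_comp[OF lin_ci lin_plc]])
  show "lin (\<lambda>v. pth N j e (vtx \<kappa> i) (ev n h \<kappa> i v))" by (rule lin_comp[OF lin_pth lin_ev])
  fix r assume r: "r \<in> {..<mlt \<kappa> i}"
  then have "((\<kappa>, i, r), e) \<in> Bs n j" using o by (auto simp: FB_def Gs_def okr_def nu_def)
  from gens.hom_dlt[OF gens_Gs N h[unfolded obj_PP] this]
  show "mv (h j) (ci (Bs n j) (plc \<kappa> i e (dlt r))) = pth N j e (vtx \<kappa> i) (ev n h \<kappa> i (dlt r))"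
    by (simp add: plc_dlt ev_def gen_def nu_def)
qed simp

lemma ev_ex:
  assumes N: "is_module t N" and c: "\<And>\<kappa> i r. okg t n \<kappa> i \<Longrightarrow> r < mlt \<kappa> i \<Longrightarrow> c \<kappa> i r \<in> fs {..<dimv N (vtx \<kappa> i)}"
  shows "\<exists>h. is_hom t (obj PP n) N h \<and> (\<forall>\<kappa> i r. okg t n \<kappa> i \<longrightarrow> r < mlt \<kappa> i \<longrightarrow> ev n h \<kappa> i (dlt r) = c \<kappa> i r)"
proof -
  have "\<exists>h. is_hom t (Fm t (Gs n) nu) N h \<and> (\<forall>g\<in>Gs n. mv (h (nu g)) (gen t (Gs n) nu g) = (case g of (\<kappa>, i, r) \<Rightarrow> c \<kappa> i r))"
    by (rule gens.ext_hom[OF gens_Gs N]) (auto simp: Gs_def nu_def c)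
  then obtain h where h: "is_hom t (obj PP n) N h"
    "\<And>g. g \<in> Gs n \<Longrightarrow> mv (h (nu g)) (gen t (Gs n) nu g) = (case g of (\<kappa>, i, r) \<Rightarrow> c \<kappa> i r)" by auto
  have "ev n h \<kappa> i (dlt r) = c \<kappa> i r" if "okg t n \<kappa> i" "r < mlt \<kappa> i" for \<kappa> i r
    using h(2)[of "(\<kappa>, i, r)"] that by (simp add: ev_def gen_def nu_def plc_dlt Gs_def)
  then show ?thesis using h(1) by blast
qed

lemma ev_uniq:
  assumes N: "is_module t N" and h: "is_hom t (obj PP n) N h" "is_hom t (obj PP n) N h'"
    and e: "\<And>\<kappa> i r. okg t n \<kappa> i \<Longrightarrow> r < mlt \<kappa> i \<Longrightarrow> ev n h \<kappa> i (dlt r) = ev n h' \<kappa> i (dlt r)"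
  shows "h = h'"
proof (rule gens.hom_uniq[OF gens_Gs N h[unfolded obj_PP]])
  fix g assume "g \<in> Gs n"
  then obtain \<kappa> i r where "g = (\<kappa>, i, r)" "okg t n \<kappa> i" "r < mlt \<kappa> i" by (auto simp: Gs_def)
  then show "mv (h (nu g)) (gen t (Gs n) nu g) = mv (h' (nu g)) (gen t (Gs n) nu g)"
    using e[of \<kappa> i r] by (simp add: ev_def gen_def nu_def plc_dlt)
qed

lemma ev_eq:
  assumes N: "is_module t N" and h: "is_hom t (obj PP n) N h"
    and L: "lin L" "\<And>r. r < mlt \<kappa> i \<Longrightarrow> ev n h \<kappa> i (dlt r) = L (dlt r)" and v: "v \<in> fs {..<mlt \<kappa> i}"
  shows "ev n h \<kappa> i v = L v"
  by (rule lin_eqI[OF lin_ev L(1) _ _ v]) (use L(2) in auto)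

lemma dif_plc:
  assumes "okr n j \<kappa> i e" "v \<in> fs {..<mlt \<kappa> i}"
  shows "mv (dif PP n j) (ci (Bs n j) (plc \<kappa> i e v)) = ci (Bs (n + 1) j) (dop n (plc \<kappa> i e v))"
  by (simp add: mv_PP co_ci[OF finB] res_id plc_fs[OF assms])

lemma p1_plc1: "1 \<le> i \<Longrightarrow> p1 (plc 1 i i v) = plc 0 i (i - 1) v - plc 0 (Suc i) i (a i v)"
  by (rule row_eqI) (auto simp: row_p1 row_plc mv_lin)

lemma p1_plc2: "1 \<le> i \<Longrightarrow> p1 (plc 2 i (i - 1) v) = plc 0 (Suc i) (i - 1) v - plc 0 i (i - 1) (b i v)"
  by (rule row_eqI) (auto simp: row_p1 row_plc mv_lin)

lemma p2_plc: "1 \<le> i \<Longrightarrow> p2 (plc 0 i (i - 1) v) = plc 1 i (i - 1) v - plc 1 (i - 1) (i - 1) (b (i - 1) v)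
    + plc 2 i (i - 1) (a i v) - (if i = 1 then 0 else plc 2 (i - 1) (i - 2) v)"
  by (rule row_eqI, cases i) (auto simp: row_p2 row_plc mv_lin)

lemma comp_dif:
  assumes "is_module t N" "is_hom t (obj PP (n + 1)) N h"
  shows "is_hom t (obj PP n) N (h \<circ>\<^sub>h dif PP n)"
  by (rule is_hom_comp[OF cpx_mod[OF cpx_PP] cpx_mod[OF cpx_PP] assms(1) cpx_dif[OF cpx_PP] assms(2)])

lemma ev_comp:
  assumes h: "is_hom t (obj PP (n + 1)) N h" and o: "okg t n \<kappa> i" and v: "v \<in> fs {..<mlt \<kappa> i}"
  shows "ev n (h \<circ>\<^sub>h dif PP n) \<kappa> i v = mv (h (vtx \<kappa> i)) (ci (Bs (n + 1) (vtx \<kappa> i)) (dop n (plc \<kappa> i (vtx \<kappa> i - 1) v)))"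
  unfolding ev_def mv_comp[OF cpx_dif[OF cpx_PP] h] dif_plc[OF okg_gen[OF o] v] ..

lemmas ci_lin = lin_add[OF lin_ci] lin_diff[OF lin_ci] lin_zero[OF lin_ci] lin_scl[OF lin_ci]

text \<open>Dual to \<open>p1\<close>: the differential sends a family of maps from M_i to N_i to
  its failure to commute with the arrows. Degree-zero cocycles are therefore homomorphisms.\<close>

lemma ev_d1:
  assumes N: "is_module t N" and h: "is_hom t (obj PP 0) N h" and i: "1 \<le> i" "i < t"
  shows "v \<in> fs {..<d i} \<Longrightarrow> ev (-1) (h \<circ>\<^sub>h dif PP (-1)) 1 i v
      = mv (arrA N i) (ev 0 h 0 i v) - ev 0 h 0 (Suc i) (a i v)"
    and "v \<in> fs {..<d (Suc i)} \<Longrightarrow> ev (-1) (h \<circ>\<^sub>h dif PP (-1)) 2 i v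
      = mv (arrB N i) (ev 0 h 0 (Suc i) v) - ev 0 h 0 i (b i v)"
proof -
  have h': "is_hom t (obj PP (-1 + 1)) N h" using h by simp
  have o: "okg t (-1) 1 i" "okg t (-1) 2 i" using i by (auto simp: okg_def)
  have r: "okr 0 (Suc i) 0 i (i - 1)" "okr 0 (Suc i) 0 (Suc i) i" "okr 0 i 0 (Suc i) (i - 1)" "okr 0 i 0 i (i - 1)"
    using i by (auto simp: okr_def okg_def vtx_def)
  have m: "mlt 0 i = d i" "mlt 0 (Suc i) = d (Suc i)" "mlt 1 i = d i" "mlt 2 i = d (Suc i)" by (auto simp: mlt_def)
  have vx: "vtx 0 i = i" "vtx 0 (Suc i) = Suc i" "vtx 1 i = Suc i" "vtx 2 i = i" by (auto simp: vtx_def)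
  note hp = hom_plc[OF N h]
  {
    assume v: "v \<in> fs {..<d i}"
    have p: "pth N (Suc i) (i - 1) i w = mv (arrA N i) w" for w
      using pth_A[of "i - 1" i N i w] pth_self[of i N w] i by simp
    have "ev (-1) (h \<circ>\<^sub>h dif PP (-1)) 1 i v
      = pth N (Suc i) (i - 1) i (ev 0 h 0 i v) - pth N (Suc i) i (Suc i) (ev 0 h 0 (Suc i) (a i v))"
      using hp[OF r(1), of v] hp[OF r(2), of "a i v"] v a_fs[of i v]
      unfolding ev_comp[OF h' o(1) v[folded m(3)]] m vx
      by (simp add: dop_def p1_plc1[OF i(1), simplified] ci_lin mv_lin)
    then show "ev (-1) (h \<circ>\<^sub>h dif PP (-1)) 1 i v = mv (arrA N i) (ev 0 h 0 i v) - ev 0 h 0 (Suc i) (a i v)"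
      using pth_self[of "Suc i" N] by (simp add: p del: One_nat_def)
  next
    assume v: "v \<in> fs {..<d (Suc i)}"
    have p: "pth N i (i - 1) (Suc i) w = mv (arrB N i) w" for w
      using pth_B_top[of i "Suc i" N w] pth_self[of "Suc i" N w] i by simp
    have "ev (-1) (h \<circ>\<^sub>h dif PP (-1)) 2 i v
      = pth N i (i - 1) (Suc i) (ev 0 h 0 (Suc i) v) - pth N i (i - 1) i (ev 0 h 0 i (b i v))"
      using hp[OF r(3), of v] hp[OF r(4), of "b i v"] v b_fs[of i v]
      unfolding ev_comp[OF h' o(2) v[folded m(4)]] m vx
      by (simp add: dop_def p1_plc2[OF i(1), simplified] ci_lin mv_lin)
    then show "ev (-1) (h \<circ>\<^sub>h dif PP (-1)) 2 i v = mv (arrB N i) (ev 0 h 0 (Suc i) v) - ev 0 h 0 i (b i v)"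
      using pth_self[of i N] i by (simp add: p del: One_nat_def)
  }
qed

text \<open>Dual to \<open>p2\<close>: the relation at \<open>i\<close>, linearized in its arrows.
  At vertex 1 the terms coming from arrows numbered 0 are absent.\<close>

lemma ev_d2:
  assumes N: "is_module t N" and h: "is_hom t (obj PP (-1)) N h" and i: "1 \<le> i" "i < t" and v: "v \<in> fs {..<d i}"
  shows "ev (-2) (h \<circ>\<^sub>h dif PP (-2)) 0 i v
      = mv (arrB N i) (ev (-1) h 1 i v) + ev (-1) h 2 i (a i v) -
        (if i = 1 then 0 else ev (-1) h 1 (i - 1) (b (i - 1) v) + mv (arrA N (i - 1)) (ev (-1) h 2 (i - 1) v))"
proof -
  have h': "is_hom t (obj PP (-2 + 1)) N h" using h by simp
  have o: "okg t (-2) 0 i" using i by (auto simp: okg_def)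
  have m: "mlt 0 i = d i" "mlt 1 i = d i" "mlt 2 i = d (Suc i)" for i by (auto simp: mlt_def)
  have vx: "vtx 0 i = i" "vtx 1 i = Suc i" "vtx 2 i = i" for i by (auto simp: vtx_def)
  note hp = hom_plc[OF N h]
  have r: "okr (-1) i 1 i (i - 1)" "okr (-1) i 2 i (i - 1)" using i by (auto simp: okr_def okg_def vtx_def)
  have p1: "pth N i (i - 1) (Suc i) w = mv (arrB N i) w" for w
    using pth_B_top[of i "Suc i" N w] pth_self[of "Suc i" N w] i by simp
  have 1: "mv (h i) (ci (Bs (-1) i) (plc 1 i (i - 1) v)) = mv (arrB N i) (ev (-1) h 1 i v)"
    using hp[OF r(1), of v] v unfolding m vx p1 by simp
  have 2: "mv (h i) (ci (Bs (-1) i) (plc 2 i (i - 1) (a i v))) = ev (-1) h 2 i (a i v)"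
    using hp[OF r(2), of "a i v"] a_fs[of i v] pth_self[of i N] i unfolding m vx by simp
  have E: "ev (-2) (h \<circ>\<^sub>h dif PP (-2)) 0 i v = mv (h i) (ci (Bs (-1) i) (p2 (plc 0 i (i - 1) v)))"
    using ev_comp[OF h' o v[folded m(1)]] by (simp add: vx dop_def)
  show ?thesis
  proof (cases "i = 1")
    case True
    have z: "plc 1 0 0 (b 0 v) = 0" by (simp add: lin_zero[OF lin_plc])
    show ?thesis
      unfolding E p2_plc[OF i(1)] using 1 2 True z by (simp add: ci_lin mv_lin lin_zero[OF lin_plc])
  next
    case False
    then obtain l where l: "i = Suc l" "1 \<le> l" using i by (cases i) auto
    have r': "okr (-1) i 1 l l" "okr (-1) i 2 l (l - 1)" using i l by (auto simp: okr_def okg_def vtx_def)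
    have p2: "pth N (Suc l) (l - 1) l w = mv (arrA N l) w" for w
      using pth_A[of "l - 1" l N l w] pth_self[of l N w] l by simp
    have 3: "mv (h i) (ci (Bs (-1) i) (plc 1 l l (b l v))) = ev (-1) h 1 l (b l v)"
      using hp[OF r'(1), of "b l v"] b_fs[of l v] pth_self[of i N] i l unfolding m vx by simp
    have 4: "mv (h i) (ci (Bs (-1) i) (plc 2 l (l - 1) v)) = mv (arrA N l) (ev (-1) h 2 l v)"
      using hp[OF r'(2), of v] v l p2 unfolding m vx by simp
    show ?thesis
      unfolding E p2_plc[OF i(1)] using 1 2 3 4 l by (simp add: ci_lin mv_lin)
  qed
qed

section \<open>The augmentation is a quasi-isomorphism\<close>

lemma aug_ex: "\<exists>h. is_hom t (obj PP 0) M h \<and> (\<forall>i v. 1 \<le> i \<and> i \<le> t \<longrightarrow> v \<in> fs {..<d i} \<longrightarrow> ev 0 h 0 i v = v)"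
proof -
  have c: "(if r < d (vtx \<kappa> i) then dlt r else 0) \<in> fs {..<d (vtx \<kappa> i)}" for \<kappa> i r
    by (auto simp: fs_dlt)
  obtain h where h: "is_hom t (obj PP 0) M h"
    "\<And>\<kappa> i r. okg t 0 \<kappa> i \<Longrightarrow> r < mlt \<kappa> i \<Longrightarrow> ev 0 h \<kappa> i (dlt r) = (if r < d (vtx \<kappa> i) then dlt r else 0)"
    using ev_ex[where c = "\<lambda>\<kappa> i r. if r < d (vtx \<kappa> i) then dlt r else 0", OF M c, of 0] by blast
  have "ev 0 h 0 i v = v" if "1 \<le> i" "i \<le> t" "v \<in> fs {..<d i}" for i v
    by (rule ev_eq[OF M h(1), of "\<lambda>v. v"]) (use that in \<open>auto simp: h(2) okg_def mlt_def vtx_def lin_id\<close>)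
  then show ?thesis using h(1) by blast
qed

definition aug :: "'k hom" where
  "aug = (SOME h. is_hom t (obj PP 0) M h \<and> (\<forall>i v. 1 \<le> i \<and> i \<le> t \<longrightarrow> v \<in> fs {..<d i} \<longrightarrow> ev 0 h 0 i v = v))"

lemma aug: "is_hom t (obj PP 0) M aug" "1 \<le> i \<Longrightarrow> i \<le> t \<Longrightarrow> v \<in> fs {..<d i} \<Longrightarrow> ev 0 aug 0 i v = v"
  using someI_ex[OF aug_ex, folded aug_def] by auto

definition \<sigma> :: "'k chom" where
  "\<sigma> n = (if n = 0 then aug else hom_zero (obj PP n) zero_rep)"

lemma ev_zero_hom: "ev n (hom_zero (obj PP n) N) \<kappa> i v = 0" by (simp add: ev_def)

text \<open>By \<open>ev_d1\<close> the composite vanishes on generators, hence everywhere. Serves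
  both for the augmentation and for endomorphisms.\<close>

lemma hom_d1_zero:
  assumes N: "is_module t N" and h: "is_hom t (obj PP 0) N h"
    and A: "\<And>i v. 1 \<le> i \<Longrightarrow> i < t \<Longrightarrow> v \<in> fs {..<d i} \<Longrightarrow> mv (arrA N i) (ev 0 h 0 i v) = ev 0 h 0 (Suc i) (a i v)"
    and B: "\<And>i v. 1 \<le> i \<Longrightarrow> i < t \<Longrightarrow> v \<in> fs {..<d (Suc i)} \<Longrightarrow> mv (arrB N i) (ev 0 h 0 (Suc i) v) = ev 0 h 0 i (b i v)"
  shows "mv (h j) (mv (dif PP (-1) j) x) = 0"
proof -
  have h': "is_hom t (obj PP (-1 + 1)) N h" using h by simp
  have "h \<circ>\<^sub>h dif PP (-1) = hom_zero (obj PP (-1)) N"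
  proof (rule ev_uniq[OF N comp_dif[OF N h'] is_hom_zero[OF cpx_mod[OF cpx_PP] N]])
    fix \<kappa> i r assume "okg t (-1) \<kappa> i" "r < mlt \<kappa> i"
    then consider "\<kappa> = 1" "1 \<le> i" "i < t" "r < d i" | "\<kappa> = 2" "1 \<le> i" "i < t" "r < d (Suc i)"
      by (auto simp: okg_def mlt_def)
    then show "ev (-1) (h \<circ>\<^sub>h dif PP (-1)) \<kappa> i (dlt r) = ev (-1) (hom_zero (obj PP (-1)) N) \<kappa> i (dlt r)"
    proof cases
      case 1 then show ?thesis using ev_d1(1)[OF N h, of i "dlt r"] A[of i "dlt r"] by (simp add: ev_zero_hom fs_dlt del: obj_PP)
    next
      case 2 then show ?thesis using ev_d1(2)[OF N h, of i "dlt r"] B[of i "dlt r"] by (simp add: ev_zero_hom fs_dlt del: obj_PP)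
    qed
  qed
  then have "mv ((h \<circ>\<^sub>h dif PP (-1)) j) x = 0" by simp
  then show ?thesis unfolding mv_comp[OF cpx_dif[OF cpx_PP] h'] .
qed

lemma aug_d: "mv (aug j) (mv (dif PP (-1) j) x) = 0"
  by (rule hom_d1_zero[OF M aug(1)]) (use aug(2) a_fs b_fs in auto)

lemma chom_\<sigma>: "is_chom t PP (shift 0 (stalk M)) \<sigma>"
  unfolding chom_stalk_iff[OF cpx_PP M]
  using aug(1) aug_d by (auto simp: \<sigma>_def is_hom_zero cpx_mod[OF cpx_PP] is_module_zero simp del: obj_PP)

lemma aug_plc: "1 \<le> j \<Longrightarrow> j \<le> t \<Longrightarrow> v \<in> fs {..<d j} \<Longrightarrow> mv (aug j) (ci (Bs 0 j) (plc 0 j (j - 1) v)) = v"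
  using aug(2)[of j v] by (simp add: ev_def vtx_def)

text \<open>Modulo a boundary \<open>x\<close> is the trivial path tensored with some
  \<open>v\<close>, and the augmentation returns this \<open>v\<close>.\<close>

lemma aug_exact:
  assumes x: "x \<in> fs {..<dimv (obj PP 0) j}" and 0: "mv (aug j) x = 0"
  shows "\<exists>z\<in>fs {..<dimv (obj PP (-1)) j}. x = mv (dif PP (-1) j) z"
proof (cases "j \<in> {1..t}")
  case False
  then have "x = 0" using x module_dim0[OF cpx_mod[OF cpx_PP]] by simp
  then show ?thesis by (intro bexI[of _ 0]) (auto simp: mv_lin)
next
  case True
  define X where "X = co (Bs 0 j) x"
  have xX: "x = ci (Bs 0 j) X" using x by (simp add: ci_co[OF finB] X_def gens.dimF[OF gens_Gs])
  obtain y v where y: "y \<in> fs (Bs (-1) j)" and v: "v \<in> fs {..<d j}" and e: "X = p1 y + plc 0 j (j - 1) v"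
    using p1_reduce[OF co_fs[OF finB] True, of x] X_def by blast
  have dy: "mv (dif PP (-1) j) (ci (Bs (-1) j) y) = ci (Bs 0 j) (p1 y)"
    by (simp add: mv_PP co_ci[OF finB] res_id y dop_def)
  have "mv (aug j) x = mv (aug j) (ci (Bs 0 j) (p1 y)) + v"
    using aug_plc[of j v] True v by (simp add: xX e ci_lin mv_lin)
  then have "v = 0" using 0 aug_d[of j "ci (Bs (-1) j) y"] by (simp add: dy)
  then have "x = mv (dif PP (-1) j) (ci (Bs (-1) j) y)" by (simp add: xX e dy lin_zero[OF lin_plc])
  then show ?thesis by (intro bexI[of _ "ci (Bs (-1) j) y"]) (auto simp: ci_fs gens.dimF[OF gens_Gs])
qed

lemma PP_exact:
  assumes x: "x \<in> fs {..<dimv (obj PP n) j}" and 0: "mv (dif PP n j) x = 0" and n: "n \<noteq> 0"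
  shows "\<exists>z\<in>fs {..<dimv (obj PP (n - 1)) j}. x = mv (dif PP (n - 1) j) z"
proof (cases "j \<in> {1..t} \<and> (n = -1 \<or> n = -2)")
  case False
  have "Bs n j = {}" using False n by (auto simp: FB_def Gs_def okg_def)
  then have "x = 0" using x by (simp add: gens.dimF[OF gens_Gs])
  then show ?thesis by (intro bexI[of _ 0]) (auto simp: mv_lin)
next
  case True
  define X where "X = co (Bs n j) x"
  have X: "X \<in> fs (Bs n j)" unfolding X_def by (rule co_fs[OF finB])
  have xX: "x = ci (Bs n j) X" using x by (simp add: ci_co[OF finB] X_def gens.dimF[OF gens_Gs])
  have "ci (Bs (n + 1) j) (dop n X) = ci (Bs (n + 1) j) 0" using 0 by (simp add: mv_PP X_def[symmetric] ci_lin)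
  then have d0: "dop n X = 0" using ci_inj[OF finB dop_fs[OF X] fs_zero] by simp
  show ?thesis
  proof (cases "n = -1")
    case n: True
    obtain y where y: "y \<in> fs (Bs (-2) j)" "p2 y = X"
      using p1_exact[of X j] X d0 True n by (auto simp: dop_def)
    then have "x = mv (dif PP (-2) j) (ci (Bs (-2) j) y)"
      using n by (simp add: mv_PP co_ci[OF finB] res_id dop_def xX)
    then show ?thesis using n by (intro bexI[of _ "ci (Bs (-2) j) y"]) (auto simp: ci_fs gens.dimF[OF gens_Gs])
  next
    case False
    then have n: "n = -2" using True by simp
    have "X = 0" using p2_inj[of X j] X d0 n by (simp add: dop_def)
    then have "x = 0" by (simp add: xX ci_lin)
    then show ?thesis by (intro bexI[of _ 0]) (auto simp: mv_lin)
  qed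
qed

lemma \<sigma>_qi: "quasi_iso t PP (stalk M) \<sigma>"
proof -
  have dz: "dimv (obj (shift 0 (stalk M)) n) i = 0" if "n \<noteq> 0" for n i
    using that by (simp add: obj_stalk zero_rep_def)
  have "quasi_iso t PP (shift 0 (stalk M)) \<sigma>"
    unfolding quasi_iso_iff[OF cpx_PP is_cpx_stalk[OF M]]
  proof (intro conjI allI ballI impI chom_\<sigma>)
    fix n i x y
    assume x: "x \<in> fs {..<dimv (obj PP n) i}"
      and a: "mv (dif PP n i) x = 0 \<and> mv (\<sigma> n i) x = mv (dif (shift 0 (stalk M)) (n - 1) i) y"
    show "\<exists>z\<in>fs {..<dimv (obj PP (n - 1)) i}. x = mv (dif PP (n - 1) i) z"
    proof (cases "n = 0")
      case True
      then show ?thesis using aug_exact[of x i] x a by (simp add: \<sigma>_def del: obj_PP)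
    next
      case False
      then show ?thesis using PP_exact[OF x] a by blast
    qed
  next
    fix n i and y :: "nat \<Rightarrow> 'k"
    assume y: "y \<in> fs {..<dimv (obj (shift 0 (stalk M)) n) i}"
    show "\<exists>x\<in>fs {..<dimv (obj PP n) i}. \<exists>b\<in>fs {..<dimv (obj (shift 0 (stalk M)) (n - 1)) i}.
           mv (dif PP n i) x = 0 \<and> y = mv (\<sigma> n i) x + mv (dif (shift 0 (stalk M)) (n - 1) i) b"
    proof (cases "n = 0 \<and> i \<in> {1..t}")
      case True
      define x where "x = ci (Bs 0 i) (plc 0 i (i - 1) y)"
      have "mv (aug i) x = y" using y True aug_plc[of i y] by (simp add: x_def obj_stalk)
      moreover have "mv (dif PP 0 i) x = 0" by (simp add: mv_PP dop_def ci_lin)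
      moreover have "x \<in> fs {..<dimv (obj PP 0) i}" by (simp add: x_def ci_fs gens.dimF[OF gens_Gs])
      ultimately show ?thesis using True
        by (intro bexI[of _ x] bexI[of _ 0]) (auto simp: \<sigma>_def)
    next
      case False
      then have "y = 0" using y dz[of n i] d_out[of i] by (cases "n = 0") (auto simp: obj_stalk)
      then show ?thesis by (intro bexI[of _ 0]) (auto simp: mv_lin)
    qed
  qed
  then show ?thesis unfolding shift_0 .
qed

lemma cpx_stalk: "is_cpx t (stalk M)" using is_cpx_stalk[OF M, of 0] unfolding shift_0 .

lemma res_PP: "free_resolution t PP (stalk M) \<sigma>"
  by unfold_locales (use cpx_PP cpx_stalk free_PP \<sigma>_qi in auto)

lemma proj_res: "proj_resolution t (stalk M) PP"
  unfolding proj_resolution_def using cpx_PP free_projective[OF free_PP] \<sigma>_qi by blast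

end

section \<open>Dimensions of spaces of functions\<close>

abbreviation fdim :: "('b \<Rightarrow> 'k::field) set \<Rightarrow> nat" where "fdim \<equiv> vector_space.dim scl"
abbreviation fsub :: "('b \<Rightarrow> 'k::field) set \<Rightarrow> bool" where "fsub \<equiv> module.subspace scl"
abbreviation fspan :: "('b \<Rightarrow> 'k::field) set \<Rightarrow> ('b \<Rightarrow> 'k) set" where "fspan \<equiv> module.span scl"

lemma fsubI: "0 \<in> S \<Longrightarrow> (\<And>x y. x \<in> S \<Longrightarrow> y \<in> S \<Longrightarrow> x + y \<in> S) \<Longrightarrow> (\<And>c x. x \<in> S \<Longrightarrow> scl c x \<in> S) \<Longrightarrow> fsub S"
  by (rule fnv.subspaceI)

lemma fsub_fs: "fsub (fs B)"
  by (intro fsubI fs_zero fs_add fs_scl)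

lemma fsub_ker: "fsub S \<Longrightarrow> lin T \<Longrightarrow> fsub {x \<in> S. T x = 0}"
  by (intro fsubI) (auto simp: fnv.subspace_0 fnv.subspace_add fnv.subspace_scale lin_add lin_scl lin_zero fnv.scale_zero_right)

lemma fsub_image: "fsub S \<Longrightarrow> lin T \<Longrightarrow> fsub (T ` S)"
proof (intro fsubI)
  assume S: "fsub S" and T: "lin T"
  show "0 \<in> T ` S" using fnv.subspace_0[OF S] lin_zero[OF T] by force
  fix x y assume "x \<in> T ` S" "y \<in> T ` S"
  then show "x + y \<in> T ` S" using fnv.subspace_add[OF S] lin_add[OF T, symmetric] by auto
next
  fix c x assume S: "fsub S" and T: "lin T" and "x \<in> T ` S"
  then show "scl c x \<in> T ` S" using fnv.subspace_scale[OF S] lin_scl[OF T, symmetric] by auto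
qed

lemma fs_basis:
  assumes B: "finite B"
  shows "(fs B :: ('b \<Rightarrow> 'k::field) set) = fspan (dlt ` B)" "fnv.independent (dlt ` B :: ('b \<Rightarrow> 'k::field) set)"
proof -
  show "(fs B :: ('b \<Rightarrow> 'k) set) = fspan (dlt ` B)"
  proof
    show "(fs B :: ('b \<Rightarrow> 'k) set) \<subseteq> fspan (dlt ` B)"
    proof
      fix x :: "'b \<Rightarrow> 'k" assume "x \<in> fs B"
      then have "x = (\<Sum>b\<in>B. scl (x b) (dlt b))" by (rule fs_expand[OF B])
      also have "\<dots> \<in> fspan (dlt ` B)" by (intro fnv.span_sum fnv.span_scale fnv.span_base) auto
      finally show "x \<in> fspan (dlt ` B)" .
    qed
    show "fspan (dlt ` B) \<subseteq> (fs B :: ('b \<Rightarrow> 'k) set)"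
      by (rule fnv.span_minimal[OF _ fsub_fs]) (auto simp: fs_dlt)
  qed
  have inj: "inj (dlt :: 'b \<Rightarrow> 'b \<Rightarrow> 'k)"
    by (rule injI) (metis dlt_def zero_neq_one)
  show "fnv.independent (dlt ` B :: ('b \<Rightarrow> 'k) set)"
  proof (rule fnv.independent_if_scalars_zero)
    fix f :: "('b \<Rightarrow> 'k) \<Rightarrow> 'k" and v :: "'b \<Rightarrow> 'k" assume 0: "(\<Sum>x\<in>dlt ` B. scl (f x) x) = 0" and "v \<in> dlt ` B"
    then obtain b where b: "b \<in> B" "v = dlt b" by auto
    have "(\<Sum>x\<in>dlt ` B. scl (f x) x) b = (\<Sum>c\<in>B. f (dlt c) * dlt c b)"
      by (subst sum.reindex) (simp_all add: sum_fun_apply inj_on_subset[OF inj subset_UNIV])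
    also have "\<dots> = (\<Sum>c\<in>B. if c = b then f (dlt c) else 0)" by (rule sum.cong) (auto simp: dlt_def)
    finally show "f v = 0" using 0 b B by simp
  qed (use B in auto)
qed

lemma fdim_fs: "finite B \<Longrightarrow> fdim (fs B :: ('b \<Rightarrow> 'k::field) set) = card B"
proof -
  assume B: "finite B"
  have inj: "inj (dlt :: 'b \<Rightarrow> 'b \<Rightarrow> 'k)"
    by (rule injI) (metis dlt_def zero_neq_one)
  have "fdim (fs B :: ('b \<Rightarrow> 'k) set) = card (dlt ` B :: ('b \<Rightarrow> 'k) set)"
    unfolding fs_basis(1)[OF B, where 'k = 'k] by (rule fnv.dim_span_eq_card_independent[OF fs_basis(2)[OF B]])
  then show ?thesis using card_image[OF inj_on_subset[OF inj], of B] by simp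
qed

lemma indep_finite:
  fixes S :: "('b \<Rightarrow> 'k::field) set"
  assumes "finite B" "S \<subseteq> fs B" "fnv.independent S"
  shows "finite S"
  using fnv.independent_span_bound[OF _ assms(3), of "dlt ` B"] assms(1,2) fs_basis(1)[OF assms(1), where 'k = 'k]
  by auto

lemma complement:
  fixes S U :: "('b \<Rightarrow> 'k::field) set"
  assumes B: "finite B" and S: "fsub S" "S \<subseteq> fs B" and U: "fsub U" "U \<subseteq> S"
  obtains K C where "finite K" "finite C" "K \<inter> C = {}" "fnv.independent (K \<union> C)" "fspan K = U" "fspan (K \<union> C) = S"
    "card K = fdim U" "card K + card C = fdim S" "C \<subseteq> S"
proof -
  obtain K where K: "K \<subseteq> U" "fnv.independent K" "U \<subseteq> fspan K" by (rule fnv.maximal_independent_subset)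
  obtain A where A: "K \<subseteq> A" "A \<subseteq> S" "fnv.independent A" "S \<subseteq> fspan A"
    using fnv.maximal_independent_subset_extend[OF _ K(2), of S] K(1) U(2) by blast
  have fA: "finite A" by (rule indep_finite[OF B _ A(3)]) (use A(2) S(2) in auto)
  have KA: "K \<union> (A - K) = A" using A(1) by auto
  show thesis
  proof (rule that[of K "A - K"])
    show "fspan K = U" using fnv.span_minimal[OF K(1) U(1)] K(3) by auto
    show "fspan (K \<union> (A - K)) = S" unfolding KA using fnv.span_minimal[OF A(2) S(1)] A(4) by auto
    show "card K = fdim U" by (rule fnv.basis_card_eq_dim[OF K(1,3,2)])
    have "card A = fdim S" by (rule fnv.basis_card_eq_dim[OF A(2,4,3)])
    then show "card K + card (A - K) = fdim S" using card_Diff_subset[of K A] card_mono[OF fA A(1)] fA A(1)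
      by (simp add: finite_subset)
  qed (use fA A KA finite_subset in auto)
qed

lemma span_disjoint:
  fixes K C :: "('b \<Rightarrow> 'k::field) set"
  assumes K: "finite K" "finite C" "K \<inter> C = {}" "fnv.independent (K \<union> C)" and x: "x \<in> fspan K" "x \<in> fspan C"
  shows "x = 0"
proof -
  obtain f where f: "x = (\<Sum>v\<in>K. scl (f v) v)" using x(1) fnv.span_finite[OF K(1)] by blast
  obtain g where g: "x = (\<Sum>v\<in>C. scl (g v) v)" using x(2) fnv.span_finite[OF K(2)] by blast
  define h where "h v = (if v \<in> K then f v else - g v)" for v
  have "(\<Sum>v\<in>C. scl (h v) v) = (\<Sum>v\<in>C. - scl (g v) v)"
    by (rule sum.cong) (use K(3) in \<open>auto simp: h_def\<close>)
  then have "(\<Sum>v\<in>C. scl (h v) v) = - x" by (simp add: g sum_negf)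
  moreover have "(\<Sum>v\<in>K. scl (h v) v) = x" unfolding f by (rule sum.cong) (auto simp: h_def)
  ultimately have "(\<Sum>v\<in>K \<union> C. scl (h v) v) = 0"
    using sum.union_disjoint[OF K(1-3), of "\<lambda>v. scl (h v) v"] by simp
  then have "h v = 0" if "v \<in> K \<union> C" for v
    using fnv.independentD[OF K(4) _ _ _ that] K(1,2) by auto
  then have "f v = 0" if "v \<in> K" for v using that by (force simp: h_def)
  then show ?thesis by (simp add: f)
qed

lemma lin_linear: "lin T \<Longrightarrow> Vector_Spaces.linear scl scl T"
  by (intro Vector_Spaces.linear.intro module_hom.intro module_hom_axioms.intro fnv.vector_space_axioms
      fnv.module_axioms) (auto simp: lin_def)

lemma rank_nullity:
  fixes S :: "('b \<Rightarrow> 'k::field) set" and T :: "('b \<Rightarrow> 'k) \<Rightarrow> ('c \<Rightarrow> 'k)"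
  assumes B: "finite B" and S: "fsub S" "S \<subseteq> fs B" and T: "lin T"
  shows "fdim S = fdim {x \<in> S. T x = 0} + fdim (T ` S)"
proof -
  interpret vp: vector_space_pair "scl :: 'k \<Rightarrow> ('b \<Rightarrow> 'k) \<Rightarrow> _" "scl :: 'k \<Rightarrow> ('c \<Rightarrow> 'k) \<Rightarrow> _" ..
  note lT = lin_linear[OF T]
  have U: "{x \<in> S. T x = 0} \<subseteq> S" by auto
  obtain K C where K: "finite K" "finite C" "K \<inter> C = {}" "fnv.independent (K \<union> C)" "fspan K = {x \<in> S. T x = 0}" "fspan (K \<union> C) = S"
    "card K = fdim {x \<in> S. T x = 0}" "card K + card C = fdim S" "C \<subseteq> S"
    by (rule complement[OF B S fsub_ker[OF S(1) T] U])
  have iC: "fnv.independent C" using K(4) by (rule fnv.independent_mono) auto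
  have 0: "x = 0" if "x \<in> fspan C" "T x = 0" for x
  proof -
    have "x \<in> S" using that(1) fnv.span_mono[of C "K \<union> C"] K(6) by auto
    then have "x \<in> fspan K" using that(2) K(5) by auto
    then show ?thesis using span_disjoint[OF K(1-4)] that(1) by simp
  qed
  have inj: "inj_on T (fspan C)"
  proof (rule inj_onI)
    fix x y assume "x \<in> fspan C" "y \<in> fspan C" "T x = T y"
    then show "x = y" using 0[of "x - y"] fnv.span_diff[of x C y] lin_diff[OF T, of x y] by simp
  qed
  have "T ` S = fspan (T ` C)"
  proof
    show "T ` S \<subseteq> fspan (T ` C)"
    proof
      fix y assume "y \<in> T ` S"
      then obtain x where x: "x \<in> fspan (K \<union> C)" "y = T x" using K(6) by auto
      then obtain u v where "u \<in> fspan K" "v \<in> fspan C" "x = u + v" unfolding fnv.span_Un by auto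
      moreover from this have "T u = 0" using K(5) by auto
      ultimately have "y = T v" using x(2) by (simp add: lin_add[OF T])
      then show "y \<in> fspan (T ` C)" using vp.linear_span_image[OF lT, of C] \<open>v \<in> fspan C\<close> by simp
    qed
    show "fspan (T ` C) \<subseteq> T ` S"
      by (rule fnv.span_minimal[OF image_mono[OF K(9)] fsub_image[OF S(1) T]])
  qed
  moreover have "fnv.independent (T ` C)" by (rule vp.linear_independent_injective_image[OF lT iC inj])
  ultimately have "fdim (T ` S) = card (T ` C)" by (simp add: fnv.dim_eq_card_independent)
  also have "\<dots> = card C" by (rule card_image[OF inj_on_subset[OF inj fnv.span_superset]])
  finally show ?thesis using K(7,8) by simp
qed

lemma linear_lin: "Vector_Spaces.linear scl scl T \<Longrightarrow> lin T"
  unfolding Vector_Spaces.linear_def module_hom_iff lin_def by blast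

text \<open>A basis of \<open>U\<close> together with \<open>z\<close> is independent, so a linear
  map may be prescribed on it; its values on the unit functions are the coefficients
  \<open>w\<close>. The target is a function space, read at index 0, to stay with the scalar action
  \<open>scl\<close>.\<close>

lemma separation:
  fixes U :: "('b \<Rightarrow> 'k::field) set"
  assumes B: "finite B" and U: "fsub U" "U \<subseteq> fs B" and z: "z \<in> fs B" "z \<notin> U"
  obtains w where "\<And>u. u \<in> U \<Longrightarrow> (\<Sum>b\<in>B. w b * u b) = 0" "(\<Sum>b\<in>B. w b * z b) \<noteq> 0"
proof -
  interpret vp: vector_space_pair "scl :: 'k \<Rightarrow> ('b \<Rightarrow> 'k) \<Rightarrow> _" "scl :: 'k \<Rightarrow> (nat \<Rightarrow> 'k) \<Rightarrow> _" ..
  obtain K where K: "K \<subseteq> U" "fnv.independent K" "U \<subseteq> fspan K" by (rule fnv.maximal_independent_subset)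
  have sK: "fspan K = U" using fnv.span_minimal[OF K(1) U(1)] K(3) by auto
  have "fnv.independent (insert z K)" using fnv.independent_insertI[OF _ K(2)] z(2) sK by simp
  from vp.linear_independent_extend[OF this, of "\<lambda>x. if x = z then dlt 0 else 0"]
  obtain g :: "('b \<Rightarrow> 'k) \<Rightarrow> nat \<Rightarrow> 'k" where g: "\<forall>x\<in>insert z K. g x = (if x = z then dlt 0 else 0)" "Vector_Spaces.linear scl scl g" by blast
  have lg: "lin g" by (rule linear_lin[OF g(2)])
  have e: "g u 0 = (\<Sum>b\<in>B. g (dlt b) 0 * u b)" if "u \<in> fs B" for u
    by (subst fs_expand[OF B that]) (simp add: lin_sum[OF lg] lin_scl[OF lg] sum_fun_apply mult.commute)
  have g0: "g u = 0" if "u \<in> U" for u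
  proof -
    have "U \<subseteq> {x \<in> fspan K. g x = 0}"
      unfolding sK[symmetric] 
    proof (rule fnv.span_minimal)
      show "K \<subseteq> {x \<in> fspan K. g x = 0}" using g(1) K(1) z(2) fnv.span_base by auto
    qed (rule fsub_ker[OF fnv.subspace_span lg])
    then show ?thesis using that by auto
  qed
  have "g z 0 = 1" using g(1) by (simp add: dlt_def)
  show thesis
    by (rule that[of "\<lambda>b. g (dlt b) 0"]) (use e[symmetric] g0 U(2) z(1) \<open>g z 0 = 1\<close> in auto)
qed

text \<open>The list represents a basis of \<open>Z\<close> modulo \<open>U\<close>, phrased by
  unique coefficient vectors to match \<open>D_hom_dim\<close>.\<close>

definition quot_basis :: "('b \<Rightarrow> 'k::field) set \<Rightarrow> ('b \<Rightarrow> 'k) set \<Rightarrow> nat \<Rightarrow> bool" where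
  "quot_basis Z U m \<longleftrightarrow> (\<exists>gs. length gs = m \<and> set gs \<subseteq> Z \<and>
     (\<forall>z\<in>Z. \<exists>!c. c \<in> carrier_vec m \<and> z - (\<Sum>l<m. scl (c $ l) (gs ! l)) \<in> U))"

lemma span_finite': "finite S \<Longrightarrow> x \<in> fspan S \<Longrightarrow> \<exists>u. x = (\<Sum>v\<in>S. scl (u v) v)"
  using fnv.span_finite by blast

lemma quot_basis_ex:
  fixes Z U :: "('b \<Rightarrow> 'k::field) set"
  assumes B: "finite B" and Z: "fsub Z" "Z \<subseteq> fs B" and U: "fsub U" "U \<subseteq> Z"
  shows "quot_basis Z U (fdim Z - fdim U)"
proof -
  obtain K C where K: "finite K" "finite C" "K \<inter> C = {}" "fnv.independent (K \<union> C)" "fspan K = U" "fspan (K \<union> C) = Z"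
    "card K = fdim U" "card K + card C = fdim Z" "C \<subseteq> Z"
    by (rule complement[OF B Z U])
  obtain gs where gs: "set gs = C" "distinct gs" using finite_distinct_list[OF K(2)] by blast
  define m where "m = length gs"
  have m: "m = fdim Z - fdim U" using K(7,8) distinct_card[OF gs(2)] gs(1) by (simp add: m_def)
  have sum: "(\<Sum>v\<in>C. scl (f v) v) = (\<Sum>l<m. scl (f (gs ! l)) (gs ! l))" for f
    using sum.reindex_bij_betw[OF bij_betw_nth[OF gs(2) refl gs(1)[symmetric]], of "\<lambda>v. scl (f v) v"]
    by (simp add: m_def lessThan_def atLeast0LessThan)
  have inC: "(\<Sum>l<m. scl (c l) (gs ! l)) \<in> fspan C" for c
    using gs(1) by (intro fnv.span_sum fnv.span_scale fnv.span_base) (auto simp: m_def)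
  have "\<exists>!c. c \<in> carrier_vec m \<and> z - (\<Sum>l<m. scl (c $ l) (gs ! l)) \<in> U" if "z \<in> Z" for z
  proof -
    from that obtain u v where uv: "u \<in> fspan K" "v \<in> fspan C" "z = u + v" unfolding K(6)[symmetric] fnv.span_Un by auto
    obtain f where "v = (\<Sum>x\<in>C. scl (f x) x)" using span_finite'[OF K(2) uv(2)] by blast
    then have v: "v = (\<Sum>l<m. scl (vec m (\<lambda>l. f (gs ! l)) $ l) (gs ! l))" by (simp add: sum)
    have ex: "z - (\<Sum>l<m. scl (vec m (\<lambda>l. f (gs ! l)) $ l) (gs ! l)) \<in> U"
      unfolding v[symmetric] using uv K(5) by simp
    have un: "c = c'" if c: "c \<in> carrier_vec m" "z - (\<Sum>l<m. scl (c $ l) (gs ! l)) \<in> U"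
      and c': "c' \<in> carrier_vec m" "z - (\<Sum>l<m. scl (c' $ l) (gs ! l)) \<in> U" for c c'
    proof -
      have "(z - (\<Sum>l<m. scl (c' $ l) (gs ! l))) - (z - (\<Sum>l<m. scl (c $ l) (gs ! l))) \<in> U"
        by (rule fnv.subspace_diff[OF U(1) c'(2) c(2)])
      also have "(z - (\<Sum>l<m. scl (c' $ l) (gs ! l))) - (z - (\<Sum>l<m. scl (c $ l) (gs ! l)))
        = (\<Sum>l<m. scl (c $ l - c' $ l) (gs ! l))"
        by (simp add: fnv.scale_left_diff_distrib sum_subtractf)
      finally have "(\<Sum>l<m. scl (c $ l - c' $ l) (gs ! l)) = 0"
        using span_disjoint[OF K(1-4) _ inC] K(5) by simp
      moreover define f where "f v = (let l = (THE l. l < m \<and> gs ! l = v) in c $ l - c' $ l)" for v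
      have fl: "f (gs ! l) = c $ l - c' $ l" if "l < m" for l
      proof -
        have "(THE k. k < m \<and> gs ! k = gs ! l) = l"
          using that gs(2) by (intro the_equality) (auto simp: m_def nth_eq_iff_index_eq)
        then show ?thesis by (simp add: f_def Let_def)
      qed
      ultimately have "(\<Sum>v\<in>C. scl (f v) v) = 0" unfolding sum by (simp add: fl)
      then have "f v = 0" if "v \<in> C" for v
        using fnv.independentD[OF fnv.independent_mono[OF K(4)] K(2) _ _ that] by auto
      then have "c $ l = c' $ l" if "l < m" for l using fl[OF that] that gs(1) by (auto simp: m_def)
      then show ?thesis using c(1) c'(1) by (intro eq_vecI) auto
    qed
    show ?thesis
    proof (rule ex1I)
      show "vec m (\<lambda>l. f (gs ! l)) \<in> carrier_vec m \<and> z - (\<Sum>l<m. scl (vec m (\<lambda>l. f (gs ! l)) $ l) (gs ! l)) \<in> U"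
        using ex by simp
    qed (use un ex in auto)
  qed
  then show ?thesis unfolding quot_basis_def m[symmetric] using gs K(9) by (intro exI[of _ gs]) (auto simp: m_def)
qed

text \<open>Uniqueness of coefficients for the zero vector makes the list independent modulo
  \<open>U\<close>; appended to a basis of \<open>U\<close> it becomes a basis of
  \<open>Z\<close>.\<close>

lemma quot_basis_dim:
  fixes Z U :: "('b \<Rightarrow> 'k::field) set"
  assumes B: "finite B" and Z: "fsub Z" "Z \<subseteq> fs B" and U: "fsub U" "U \<subseteq> Z" and q: "quot_basis Z U m"
  shows "fdim Z = fdim U + m"
proof -
  obtain gs where gs: "length gs = m" "set gs \<subseteq> Z"
    "\<And>z. z \<in> Z \<Longrightarrow> \<exists>!c. c \<in> carrier_vec m \<and> z - (\<Sum>l<m. scl (c $ l) (gs ! l)) \<in> U"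
    using q unfolding quot_basis_def by blast
  have gl: "gs ! l \<in> Z" if "l < m" for l using gs(1,2) that by auto
  have z0: "c l = 0" if "(\<Sum>l<m. scl (c l) (gs ! l)) \<in> U" "l < m" for c l
  proof -
    have "0 - (\<Sum>l<m. scl (vec m (\<lambda>l. - c l) $ l) (gs ! l)) = (\<Sum>l<m. scl (c l) (gs ! l))"
      by (simp add: sum_negf[symmetric])
    then have "vec m (\<lambda>l. - c l) \<in> carrier_vec m \<and> 0 - (\<Sum>l<m. scl (vec m (\<lambda>l. - c l) $ l) (gs ! l)) \<in> U" using that(1) by simp
    moreover have "0\<^sub>v m \<in> carrier_vec m \<and> 0 - (\<Sum>l<m. scl (0\<^sub>v m $ l) (gs ! l)) \<in> U"
      using fnv.subspace_0[OF U(1)] by simp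
    ultimately have "vec m (\<lambda>l. - c l) = 0\<^sub>v m" using gs(3)[OF fnv.subspace_0[OF Z(1)]] by blast
    then have "vec m (\<lambda>l. - c l) $ l = 0" using that(2) by simp
    then show ?thesis using that(2) by simp
  qed
  obtain K where K: "K \<subseteq> U" "fnv.independent K" "U \<subseteq> fspan K" by (rule fnv.maximal_independent_subset)
  have sK: "fspan K = U" using fnv.span_minimal[OF K(1) U(1)] K(3) by auto
  have fK: "finite K" by (rule indep_finite[OF B _ K(2)]) (use K(1) U(2) Z(2) in auto)
  have d: "distinct gs"
    unfolding distinct_conv_nth gs(1)
  proof (intro allI impI)
    fix l k assume lk: "l < m" "k < m" "l \<noteq> k"
    show "gs ! l \<noteq> gs ! k"
    proof
      assume e: "gs ! l = gs ! k"
      \<comment> \<open>Two equal entries would give a second representation of zero, with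
        coefficients 1 and -1.\<close>
      define c where "c q = (if q = l then 1 else if q = k then -1 else 0 :: 'k)" for q
      have "(\<Sum>q<m. scl (c q) (gs ! q)) = (\<Sum>q\<in>{l, k}. scl (c q) (gs ! q))"
        by (rule sum.mono_neutral_right) (use lk in \<open>auto simp: c_def\<close>)
      also have "\<dots> = 0" using lk e by (simp add: c_def)
      finally show False using z0[of c l] lk fnv.subspace_0[OF U(1)] by (simp add: c_def)
    qed
  qed
  have sum: "(\<Sum>v\<in>set gs. scl (f v) v) = (\<Sum>l<m. scl (f (gs ! l)) (gs ! l))" for f
    using sum.reindex_bij_betw[OF bij_betw_nth[OF d refl refl], of "\<lambda>v. scl (f v) v"]
    by (simp add: gs(1) lessThan_def atLeast0LessThan)
  have disj: "K \<inter> set gs = {}"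
  proof (rule ccontr)
    assume "K \<inter> set gs \<noteq> {}"
    then obtain v where v: "v \<in> K" "v \<in> set gs" by auto
    then obtain l where "l < length gs" "gs ! l = v" by (meson in_set_conv_nth)
    then have l: "l < m" "gs ! l \<in> U" using v K(1) gs(1) by auto
    have "(\<Sum>q<m. scl (if q = l then 1 else 0) (gs ! q)) = (\<Sum>q<m. if q = l then gs ! q else 0)"
      by (rule sum.cong) auto
    then have "(\<Sum>q<m. scl (if q = l then 1 else 0) (gs ! q)) \<in> U" using l by simp
    then show False using z0[OF _ l(1)] by fastforce
  qed
  have "fnv.independent (K \<union> set gs)"
  proof (rule fnv.independent_if_scalars_zero)
    fix f v assume 0: "(\<Sum>x\<in>K \<union> set gs. scl (f x) x) = 0" and v: "v \<in> K \<union> set gs"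
    have s: "(\<Sum>x\<in>K. scl (f x) x) + (\<Sum>x\<in>set gs. scl (f x) x) = 0"
      using 0 sum.union_disjoint[OF fK _ disj, of "\<lambda>x. scl (f x) x"] by simp
    have "(\<Sum>x\<in>K. scl (f x) x) \<in> U"
      using K(1) by (intro fnv.subspace_sum[OF U(1)] fnv.subspace_scale[OF U(1)]) auto
    then have "- (\<Sum>x\<in>K. scl (f x) x) \<in> U" by (rule fnv.subspace_neg[OF U(1)])
    also have "- (\<Sum>x\<in>K. scl (f x) x) = (\<Sum>l<m. scl (f (gs ! l)) (gs ! l))"
      using s unfolding sum by (rule minus_unique)
    finally have g0: "f (gs ! l) = 0" if "l < m" for l using z0[of "\<lambda>l. f (gs ! l)"] that by simp
    then have "(\<Sum>x\<in>set gs. scl (f x) x) = 0" unfolding sum by simp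
    then have "(\<Sum>x\<in>K. scl (f x) x) = 0" using s by simp
    then have "f v = 0" if "v \<in> K" using fnv.independentD[OF K(2) fK _ _ that] by auto
    then show "f v = 0" using v g0 gs(1) by (auto simp: in_set_conv_nth)
  qed (use fK in simp)
  moreover have "Z \<subseteq> fspan (K \<union> set gs)"
  proof
    fix z assume "z \<in> Z"
    then obtain c where "z - (\<Sum>l<m. scl (c $ l) (gs ! l)) \<in> fspan K" using gs(3) sK by blast
    moreover have "(\<Sum>l<m. scl (c $ l) (gs ! l)) \<in> fspan (set gs)"
      using gs(1) by (intro fnv.span_sum fnv.span_scale fnv.span_base) auto
    moreover have "z = (z - (\<Sum>l<m. scl (c $ l) (gs ! l))) + (\<Sum>l<m. scl (c $ l) (gs ! l))" by simp
    ultimately show "z \<in> fspan (K \<union> set gs)" unfolding fnv.span_Un by blast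
  qed
  moreover have "K \<union> set gs \<subseteq> Z" using K(1) U(2) gs(2) by auto
  ultimately have "card (K \<union> set gs) = fdim Z" by (intro fnv.basis_card_eq_dim)
  moreover have "card K = fdim U" by (rule fnv.basis_card_eq_dim[OF K(1,3,2)])
  ultimately show ?thesis using card_Un_disjoint[OF fK _ disj] distinct_card[OF d] gs(1) by simp
qed

lemma fdim_mono:
  fixes Z U :: "('b \<Rightarrow> 'k::field) set"
  assumes B: "finite B" and Z: "fsub Z" "Z \<subseteq> fs B" and U: "fsub U" "U \<subseteq> Z"
  shows "fdim U \<le> fdim Z"
proof -
  show ?thesis by (rule complement[OF B Z U]) linarith
qed

context std
begin

section \<open>Cochains\<close>

text \<open>Positions of matrix entries: coordinate \<open>r'\<close> of the value at the generator
  \<open>(\<kappa>, i, r)\<close>. Maps from degree \<open>n\<close> of the resolution to M become a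
  coordinate space to which dimension counting applies.\<close>

definition CI :: "int \<Rightarrow> (gidx \<times> nat) set" where
  "CI n = {((\<kappa>, i, r), r'). okg t n \<kappa> i \<and> r < mlt \<kappa> i \<and> r' < d (vtx \<kappa> i)}"

definition cv :: "int \<Rightarrow> 'k hom \<Rightarrow> gidx \<times> nat \<Rightarrow> 'k" where
  "cv n h = (\<lambda>((\<kappa>, i, r), r'). if okg t n \<kappa> i \<and> r < mlt \<kappa> i then ev n h \<kappa> i (dlt r) r' else 0)"

definition hm :: "int \<Rightarrow> (gidx \<times> nat \<Rightarrow> 'k) \<Rightarrow> 'k hom" where
  "hm n c = (SOME h. is_hom t (obj PP n) M h \<and> cv n h = res (CI n) c)"

text \<open>Degrees follow the resolution, not the cochains: \<open>Dc n\<close> leads from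
  \<open>n\<close> to \<open>n - 1\<close>, and Ext^i is \<open>Zc (- i)\<close> modulo
  \<open>Bc (- i)\<close>.\<close>

definition Dc :: "int \<Rightarrow> (gidx \<times> nat \<Rightarrow> 'k) \<Rightarrow> gidx \<times> nat \<Rightarrow> 'k" where
  "Dc n c = cv (n - 1) (hm n c \<circ>\<^sub>h dif PP (n - 1))"

definition Zc :: "int \<Rightarrow> (gidx \<times> nat \<Rightarrow> 'k) set" where "Zc n = {c \<in> fs (CI n). Dc n c = 0}"
definition Bc :: "int \<Rightarrow> (gidx \<times> nat \<Rightarrow> 'k) set" where "Bc n = Dc (n + 1) ` fs (CI (n + 1))"

lemma finCI: "finite (CI n)"
proof -
  have "CI n \<subseteq> Gs n \<times> {..<Max (d ` {..Suc t}) + 1}"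
  proof
    fix b assume "b \<in> CI n"
    then obtain \<kappa> i r r' where b: "b = ((\<kappa>, i, r), r')" "okg t n \<kappa> i" "r < mlt \<kappa> i" "r' < d (vtx \<kappa> i)" by (auto simp: CI_def)
    then have "vtx \<kappa> i \<le> Suc t" by (auto simp: okg_def vtx_def)
    then have "d (vtx \<kappa> i) \<le> Max (d ` {..Suc t})" by auto
    then show "b \<in> Gs n \<times> {..<Max (d ` {..Suc t}) + 1}" using b by (auto simp: Gs_def)
  qed
  then show ?thesis by (rule finite_subset) (use gens.G[OF gens_Gs] in auto)
qed

lemma cv_fs: "is_hom t (obj PP n) M h \<Longrightarrow> cv n h \<in> fs (CI n)"
proof -
  assume h: "is_hom t (obj PP n) M h"
  have "cv n h b = 0" if b: "b \<notin> CI n" for b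
  proof -
    obtain \<kappa> i r r' where bb: "b = ((\<kappa>, i, r), r')" by (cases b) auto
    show ?thesis
      using b ev_fs[OF h, of \<kappa> i "dlt r"] by (auto simp: cv_def bb CI_def fs_def)
  qed
  then show ?thesis by (simp add: fs_def)
qed

lemma cv_eq_iff: 
  assumes "is_hom t (obj PP n) M h" "is_hom t (obj PP n) M h'"
  shows "cv n h = cv n h' \<longleftrightarrow> h = h'"
proof
  assume e: "cv n h = cv n h'"
  show "h = h'"
  proof (rule ev_uniq[OF M assms])
    fix \<kappa> i r assume "okg t n \<kappa> i" "r < mlt \<kappa> i"
    then show "ev n h \<kappa> i (dlt r) = ev n h' \<kappa> i (dlt r)"
      using fun_cong[OF e, of "((\<kappa>, i, r), _)"] by (auto simp: cv_def)
  qed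
qed simp

lemma hm: "is_hom t (obj PP n) M (hm n c)" "cv n (hm n c) = res (CI n) c"
proof -
  have "\<exists>h. is_hom t (obj PP n) M h \<and> cv n h = res (CI n) c"
  proof -
    have f: "(\<lambda>r'. res (CI n) c ((\<kappa>, i, r), r')) \<in> fs {..<d (vtx \<kappa> i)}" for \<kappa> i r
      by (auto simp: res_def fs_def CI_def)
    obtain h where h: "is_hom t (obj PP n) M h"
      "\<And>\<kappa> i r. okg t n \<kappa> i \<Longrightarrow> r < mlt \<kappa> i \<Longrightarrow> ev n h \<kappa> i (dlt r) = (\<lambda>r'. res (CI n) c ((\<kappa>, i, r), r'))"
      using ev_ex[where c = "\<lambda>\<kappa> i r r'. res (CI n) c ((\<kappa>, i, r), r')", OF M f, of n] by blast
    have "cv n h = res (CI n) c"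
      by (auto simp: cv_def h(2) fun_eq_iff res_def CI_def)
    then show ?thesis using h(1) by blast
  qed
  from someI_ex[OF this, folded hm_def] show "is_hom t (obj PP n) M (hm n c)" "cv n (hm n c) = res (CI n) c" by auto
qed

lemma hm_cv: "is_hom t (obj PP n) M h \<Longrightarrow> hm n (cv n h) = h"
  using cv_eq_iff[OF hm(1)[of n "cv n h"], of h] by (simp add: hm(2) res_id cv_fs del: obj_PP)

lemma Mobj: "is_module t (obj PP n)" by (rule cpx_mod[OF cpx_PP])

lemma cv_add: "is_hom t (obj PP n) M h \<Longrightarrow> is_hom t (obj PP n) M h' \<Longrightarrow> cv n (h +\<^sub>h h') = cv n h + cv n h'"
  by (auto simp: cv_def ev_def mv_hom_add fun_eq_iff del: obj_PP simp del: obj_PP)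

lemma cv_smult: "cv n (c \<cdot>\<^sub>h h) = scl c (cv n h)"
  by (auto simp: cv_def ev_def mv_hom_smult fun_eq_iff)

lemma lin_hm: "lin (\<lambda>c. mv (hm n c j) x)"
  unfolding lin_def
proof (intro conjI allI)
  fix c c'
  have "hm n (c + c') = hm n c +\<^sub>h hm n c'"
    unfolding cv_eq_iff[OF hm(1) is_hom_add[OF Mobj M hm(1) hm(1)], symmetric] cv_add[OF hm(1) hm(1)] hm(2)
    by (auto simp: res_def fun_eq_iff)
  then show "mv (hm n (c + c') j) x = mv (hm n c j) x + mv (hm n c' j) x"
    by (simp only: mv_hom_add[OF hm(1) hm(1)])
next
  fix k c
  have "hm n (scl k c) = k \<cdot>\<^sub>h hm n c"
    unfolding cv_eq_iff[OF hm(1) is_hom_smult[OF Mobj M hm(1)], symmetric] cv_smult hm(2)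
    by (auto simp: res_def fun_eq_iff)
  then show "mv (hm n (scl k c) j) x = scl k (mv (hm n c j) x)"
    by (simp only: mv_hom_smult)
qed

lemma hm_dif: "is_hom t (obj PP (n - 1)) M (hm n c \<circ>\<^sub>h dif PP (n - 1))"
  using comp_dif[OF M, of "n - 1" "hm n c"] hm(1)[of n c] by simp

lemma mv_hm_dif: "mv ((hm n c \<circ>\<^sub>h dif PP (n - 1)) j) x = mv (hm n c j) (mv (dif PP (n - 1) j) x)"
  by (rule mv_comp[OF cpx_dif'[OF cpx_PP] hm(1)])

lemma lin_Dc: "lin (Dc n)"
  unfolding lin_def Dc_def
  by (auto simp: cv_def ev_def mv_hm_dif lin_add[OF lin_hm] lin_scl[OF lin_hm] fun_eq_iff)

lemma Dc_fs: "Dc n c \<in> fs (CI (n - 1))"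
  unfolding Dc_def by (rule cv_fs[OF hm_dif])

lemma Dc_cv: "is_hom t (obj PP n) M h \<Longrightarrow> Dc n (cv n h) = cv (n - 1) (h \<circ>\<^sub>h dif PP (n - 1))"
  by (simp only: Dc_def hm_cv)

lemma cv_zero: "cv n (hom_zero (obj PP n) M) = 0"
  by (auto simp: cv_def ev_def fun_eq_iff)

lemma cocycle_iff: "cocycle_hom t PP M n \<phi> \<longleftrightarrow> is_hom t (obj PP n) M \<phi> \<and> cv n \<phi> \<in> Zc n"
proof (cases "is_hom t (obj PP n) M \<phi>")
  case True
  have "cv n \<phi> \<in> Zc n \<longleftrightarrow> Dc n (cv n \<phi>) = 0" using cv_fs[OF True] by (simp add: Zc_def)
  also have "\<dots> \<longleftrightarrow> cv (n - 1) (\<phi> \<circ>\<^sub>h dif PP (n - 1)) = cv (n - 1) (hom_zero (obj PP (n - 1)) M)"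
    unfolding Dc_cv[OF True] cv_zero ..
  also have "\<dots> \<longleftrightarrow> \<phi> \<circ>\<^sub>h dif PP (n - 1) = hom_zero (obj PP (n - 1)) M"
    using hm_dif[of n "cv n \<phi>"] by (intro cv_eq_iff is_hom_zero[OF Mobj M]) (simp only: hm_cv[OF True])
  also have "\<dots> \<longleftrightarrow> (\<forall>j x. mv (\<phi> j) (mv (dif PP (n - 1) j) x) = 0)"
  proof
    assume e: "\<phi> \<circ>\<^sub>h dif PP (n - 1) = hom_zero (obj PP (n - 1)) M"
    show "\<forall>j x. mv (\<phi> j) (mv (dif PP (n - 1) j) x) = 0"
      unfolding mv_comp[OF cpx_dif'[OF cpx_PP] True, symmetric] e by simp
  next
    assume e: "\<forall>j x. mv (\<phi> j) (mv (dif PP (n - 1) j) x) = 0"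
    show "\<phi> \<circ>\<^sub>h dif PP (n - 1) = hom_zero (obj PP (n - 1)) M"
      by (rule hom_eqI[OF Mobj is_hom_comp[OF Mobj Mobj M cpx_dif'[OF cpx_PP] True] is_hom_zero[OF Mobj M]])
        (simp add: mv_comp[OF cpx_dif'[OF cpx_PP] True] e)
  qed
  finally show ?thesis using True by (simp add: cocycle_hom_def)
qed (simp add: cocycle_hom_def)

text \<open>Rewrites the homotopy condition of \<open>D_hom_dim_stalk\<close> as membership of a
  difference in \<open>Bc\<close>, which turns the dimension of the Hom space into a quotient of
  coordinate spaces.\<close>

lemma boundary_iff:
  assumes \<phi>: "is_hom t (obj PP n) M \<phi>" and ps: "length \<phi>s = m" "\<And>l. l < m \<Longrightarrow> is_hom t (obj PP n) M (\<phi>s ! l)"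
  shows "(\<exists>h. is_hom t (obj PP (n + 1)) M h \<and>
      (\<forall>j x. mv (\<phi> j) x = (\<Sum>l<m. scl (c $ l) (mv ((\<phi>s ! l) j) x)) + mv (h j) (mv (dif PP n j) x))) \<longleftrightarrow>
    cv n \<phi> - (\<Sum>l<m. scl (c $ l) (cv n (\<phi>s ! l))) \<in> Bc n"
proof
  assume "\<exists>h. is_hom t (obj PP (n + 1)) M h \<and>
      (\<forall>j x. mv (\<phi> j) x = (\<Sum>l<m. scl (c $ l) (mv ((\<phi>s ! l) j) x)) + mv (h j) (mv (dif PP n j) x))"
  then obtain h where h: "is_hom t (obj PP (n + 1)) M h"
    "\<And>j x. mv (\<phi> j) x = (\<Sum>l<m. scl (c $ l) (mv ((\<phi>s ! l) j) x)) + mv (h j) (mv (dif PP n j) x)" by blast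
  have "cv n \<phi> = (\<Sum>l<m. scl (c $ l) (cv n (\<phi>s ! l))) + cv n (h \<circ>\<^sub>h dif PP n)"
    unfolding cv_def ev_def h(2) mv_comp[OF cpx_dif[OF cpx_PP] h(1)]
    by (auto simp: fun_eq_iff sum_fun_apply)
  then have "cv n \<phi> - (\<Sum>l<m. scl (c $ l) (cv n (\<phi>s ! l))) = Dc (n + 1) (cv (n + 1) h)"
    using Dc_cv[OF h(1)] by simp
  then show "cv n \<phi> - (\<Sum>l<m. scl (c $ l) (cv n (\<phi>s ! l))) \<in> Bc n"
    unfolding Bc_def using cv_fs[OF h(1)] by blast
next
  assume "cv n \<phi> - (\<Sum>l<m. scl (c $ l) (cv n (\<phi>s ! l))) \<in> Bc n"
  then obtain y where y: "cv n \<phi> - (\<Sum>l<m. scl (c $ l) (cv n (\<phi>s ! l))) = Dc (n + 1) y"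
    unfolding Bc_def by blast
  have hd: "is_hom t (obj PP n) M (hm (n + 1) y \<circ>\<^sub>h dif PP n)" using hm_dif[of "n + 1" y] by simp
  have "cv n \<phi> = (\<Sum>l<m. scl (c $ l) (cv n (\<phi>s ! l))) + cv n (hm (n + 1) y \<circ>\<^sub>h dif PP n)"
    using y by (simp add: Dc_def diff_eq_eq add.commute)
  then have e: "hm n (cv n \<phi>) = hm n ((\<Sum>l<m. scl (c $ l) (cv n (\<phi>s ! l))) + cv n (hm (n + 1) y \<circ>\<^sub>h dif PP n))" by simp
  have "mv (\<phi> j) x = (\<Sum>l<m. scl (c $ l) (mv ((\<phi>s ! l) j) x)) + mv (hm (n + 1) y j) (mv (dif PP n j) x)" for j x
  proof -
    have "mv (\<phi> j) x = mv (hm n ((\<Sum>l<m. scl (c $ l) (cv n (\<phi>s ! l))) + cv n (hm (n + 1) y \<circ>\<^sub>h dif PP n)) j) x"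
      using e hm_cv[OF \<phi>] by simp
    also have "\<dots> = (\<Sum>l<m. scl (c $ l) (mv (hm n (cv n (\<phi>s ! l)) j) x)) + mv (hm n (cv n (hm (n + 1) y \<circ>\<^sub>h dif PP n)) j) x"
      by (simp only: lin_add[OF lin_hm] lin_sum[OF lin_hm] lin_scl[OF lin_hm])
    also have "\<dots> = (\<Sum>l<m. scl (c $ l) (mv ((\<phi>s ! l) j) x)) + mv ((hm (n + 1) y \<circ>\<^sub>h dif PP n) j) x"
      using hm_cv[OF ps(2)] hm_cv[OF hd] by (auto intro!: sum.cong)
    finally show ?thesis unfolding mv_comp[OF cpx_dif[OF cpx_PP] hm(1)] .
  qed
  then show "\<exists>h. is_hom t (obj PP (n + 1)) M h \<and>
      (\<forall>j x. mv (\<phi> j) x = (\<Sum>l<m. scl (c $ l) (mv ((\<phi>s ! l) j) x)) + mv (h j) (mv (dif PP n j) x))"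
    using hm(1) by blast
qed

lemma D_hom_dim_cochain: "D_hom_dim t (stalk M) (shift i (stalk M)) m \<longleftrightarrow> quot_basis (Zc (- i)) (Bc (- i)) m"
  unfolding free_resolution.D_hom_dim_stalk[OF res_PP M]
proof
  assume "\<exists>\<phi>s. length \<phi>s = m \<and> (\<forall>\<phi>\<in>set \<phi>s. cocycle_hom t PP M (- i) \<phi>) \<and>
      (\<forall>\<phi>. cocycle_hom t PP M (- i) \<phi> \<longrightarrow> (\<exists>!c. c \<in> carrier_vec m \<and>
        (\<exists>h. is_hom t (obj PP (- i + 1)) M h \<and>
          (\<forall>j x. mv (\<phi> j) x = (\<Sum>l<m. scl (c $ l) (mv ((\<phi>s ! l) j) x)) + mv (h j) (mv (dif PP (- i) j) x)))))"
  then obtain \<phi>s where p: "length \<phi>s = m" "\<forall>\<phi>\<in>set \<phi>s. cocycle_hom t PP M (- i) \<phi>"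
    and q: "\<And>\<phi>. cocycle_hom t PP M (- i) \<phi> \<Longrightarrow> (\<exists>!c. c \<in> carrier_vec m \<and>
        (\<exists>h. is_hom t (obj PP (- i + 1)) M h \<and>
          (\<forall>j x. mv (\<phi> j) x = (\<Sum>l<m. scl (c $ l) (mv ((\<phi>s ! l) j) x)) + mv (h j) (mv (dif PP (- i) j) x))))" by blast
  have ps: "is_hom t (obj PP (- i)) M (\<phi>s ! l)" if "l < m" for l using p that by (auto simp: cocycle_hom_def)
  show "quot_basis (Zc (- i)) (Bc (- i)) m"
    unfolding quot_basis_def
  proof (intro exI[of _ "map (cv (- i)) \<phi>s"] conjI ballI)
    show "set (map (cv (- i)) \<phi>s) \<subseteq> Zc (- i)" using p(2) by (auto simp: cocycle_iff)
    fix z assume z: "z \<in> Zc (- i)"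
    have zz: "cv (- i) (hm (- i) z) = z" using z by (simp add: hm(2) res_id Zc_def)
    have "cocycle_hom t PP M (- i) (hm (- i) z)" unfolding cocycle_iff zz using z hm(1) by blast
    note q' = q[OF this]
    have "\<exists>!c. c \<in> carrier_vec m \<and> z - (\<Sum>l<m. scl (c $ l) (cv (- i) (\<phi>s ! l))) \<in> Bc (- i)"
      using q' by (simp only: boundary_iff[of "- i" "hm (- i) z" \<phi>s m, OF hm(1) p(1) ps] zz)
    moreover have "(\<Sum>l<m. scl (c $ l) (cv (- i) (\<phi>s ! l))) = (\<Sum>l<m. scl (c $ l) (map (cv (- i)) \<phi>s ! l))" for c
      using p(1) by (intro sum.cong) auto
    ultimately show "\<exists>!c. c \<in> carrier_vec m \<and> z - (\<Sum>l<m. scl (c $ l) (map (cv (- i)) \<phi>s ! l)) \<in> Bc (- i)" by simp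
  qed (use p in simp)
next
  assume "quot_basis (Zc (- i)) (Bc (- i)) m"
  then obtain gs where g: "length gs = m" "set gs \<subseteq> Zc (- i)"
    "\<And>z. z \<in> Zc (- i) \<Longrightarrow> \<exists>!c. c \<in> carrier_vec m \<and> z - (\<Sum>l<m. scl (c $ l) (gs ! l)) \<in> Bc (- i)"
    unfolding quot_basis_def by blast
  have zz: "cv (- i) (hm (- i) z) = z" if "z \<in> Zc (- i)" for z using that by (simp add: hm(2) res_id Zc_def)
  define \<phi>s where "\<phi>s = map (hm (- i)) gs"
  have p: "length \<phi>s = m" "\<And>l. l < m \<Longrightarrow> is_hom t (obj PP (- i)) M (\<phi>s ! l)"
    using g(1) hm(1) by (auto simp: \<phi>s_def)
  have s: "(\<Sum>l<m. scl (c $ l) (cv (- i) (\<phi>s ! l))) = (\<Sum>l<m. scl (c $ l) (gs ! l))" for c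
    using g(1,2) zz nth_mem[of _ gs] by (intro sum.cong) (auto simp: \<phi>s_def subset_iff)
  show "\<exists>\<phi>s. length \<phi>s = m \<and> (\<forall>\<phi>\<in>set \<phi>s. cocycle_hom t PP M (- i) \<phi>) \<and>
      (\<forall>\<phi>. cocycle_hom t PP M (- i) \<phi> \<longrightarrow> (\<exists>!c. c \<in> carrier_vec m \<and>
        (\<exists>h. is_hom t (obj PP (- i + 1)) M h \<and>
          (\<forall>j x. mv (\<phi> j) x = (\<Sum>l<m. scl (c $ l) (mv ((\<phi>s ! l) j) x)) + mv (h j) (mv (dif PP (- i) j) x)))))"
  proof (intro exI[of _ \<phi>s] conjI ballI allI impI)
    fix \<phi> assume "\<phi> \<in> set \<phi>s"
    then show "cocycle_hom t PP M (- i) \<phi>" using g(2) zz hm(1) by (auto simp: \<phi>s_def cocycle_iff simp del: obj_PP)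
  next
    fix \<phi> assume "cocycle_hom t PP M (- i) \<phi>"
    then have c: "is_hom t (obj PP (- i)) M \<phi>" "cv (- i) \<phi> \<in> Zc (- i)" by (auto simp: cocycle_iff)
    show "\<exists>!c. c \<in> carrier_vec m \<and>
        (\<exists>h. is_hom t (obj PP (- i + 1)) M h \<and>
          (\<forall>j x. mv (\<phi> j) x = (\<Sum>l<m. scl (c $ l) (mv ((\<phi>s ! l) j) x)) + mv (h j) (mv (dif PP (- i) j) x)))"
      using g(3)[OF c(2)] by (simp only: boundary_iff[of "- i" \<phi> \<phi>s m, OF c(1) p] s)
  qed (use p in simp)
qed

section \<open>The Euler characteristic\<close>

lemma fsub_Zc: "fsub (Zc n)" unfolding Zc_def by (rule fsub_ker[OF fsub_fs lin_Dc])
lemma fsub_Bc: "fsub (Bc n)" unfolding Bc_def by (rule fsub_image[OF fsub_fs lin_Dc])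
lemma Zc_fs: "Zc n \<subseteq> fs (CI n)" by (auto simp: Zc_def)

lemma Bc_Zc: "Bc n \<subseteq> Zc n"
proof
  fix x assume "x \<in> Bc n"
  then obtain y where x: "x = cv n (hm (n + 1) y \<circ>\<^sub>h dif PP n)" by (auto simp: Bc_def Dc_def)
  have h: "is_hom t (obj PP n) M (hm (n + 1) y \<circ>\<^sub>h dif PP n)" using hm_dif[of "n + 1" y] by simp
  have "cocycle_hom t PP M n (hm (n + 1) y \<circ>\<^sub>h dif PP n)"
    unfolding cocycle_hom_def mv_comp[OF cpx_dif[OF cpx_PP] hm(1)]
    using h by (simp add: cpx_dd'[OF cpx_PP] mv_lin del: obj_PP)
  then show "x \<in> Zc n" unfolding cocycle_iff x by blast
qed

lemma ext_dim: "D_hom_dim t (stalk M) (shift i (stalk M)) m \<longleftrightarrow> fdim (Zc (- i)) = fdim (Bc (- i)) + m"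
  unfolding D_hom_dim_cochain
proof
  show "quot_basis (Zc (- i)) (Bc (- i)) m \<Longrightarrow> fdim (Zc (- i)) = fdim (Bc (- i)) + m"
    by (rule quot_basis_dim[OF finCI fsub_Zc Zc_fs fsub_Bc Bc_Zc])
  show "fdim (Zc (- i)) = fdim (Bc (- i)) + m \<Longrightarrow> quot_basis (Zc (- i)) (Bc (- i)) m"
    using quot_basis_ex[OF finCI fsub_Zc Zc_fs fsub_Bc Bc_Zc, of "- i"] by simp
qed

text \<open>Rank-nullity for \<open>Dc n\<close>, whose image is \<open>Bc (n - 1)\<close>.\<close>

lemma dim_CI: "card (CI n) = fdim (Zc n) + fdim (Bc (n - 1))"
  using rank_nullity[OF finCI[of n] fsub_fs subset_refl lin_Dc[of n]] 
  by (simp add: fdim_fs[OF finCI] Zc_def Bc_def)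

lemma CI_empty: "n \<noteq> 0 \<Longrightarrow> n \<noteq> -1 \<Longrightarrow> n \<noteq> -2 \<Longrightarrow> CI n = {}"
  by (auto simp: CI_def okg_def)

lemma fdim_zero: "fdim {0 :: gidx \<times> nat \<Rightarrow> 'k} = 0"
  using fdim_fs[of "{} :: (gidx \<times> nat) set", where 'k = 'k] by simp

lemma Bc_top: "n \<noteq> -1 \<Longrightarrow> n \<noteq> -2 \<Longrightarrow> fdim (Bc n) = 0"
proof -
  assume n: "n \<noteq> -1" "n \<noteq> -2"
  have "Bc n = {0}"
  proof (cases "n = -3")
    case True
    have "Bc (-3) \<subseteq> fs (CI (-3))" using Bc_Zc[of "-3"] Zc_fs[of "-3"] by blast
    then show ?thesis using fnv.subspace_0[OF fsub_Bc[of "-3"]] True CI_empty[of "-3"] by auto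
  next
    case False
    then have "CI (n + 1) = {}" using n by (intro CI_empty) auto
    then show ?thesis by (simp add: Bc_def lin_zero[OF lin_Dc])
  qed
  then show ?thesis by (simp add: fdim_zero)
qed

lemma Zc_out: "n \<noteq> 0 \<Longrightarrow> n \<noteq> -1 \<Longrightarrow> n \<noteq> -2 \<Longrightarrow> fdim (Zc n) = 0"
  using dim_CI[of n] CI_empty[of n] by simp

lemma card_CI0: "card (CI 0) = (\<Sum>i\<in>{1..t}. d i * d i)"
proof -
  have "CI 0 = (\<lambda>(i, r, r'). ((0, i, r), r')) ` (SIGMA i:{1..t}. {..<d i} \<times> {..<d i})"
    by (auto simp: CI_def okg_def mlt_def vtx_def image_iff)
  then have "card (CI 0) = card (SIGMA i:{1..t}. {..<d i} \<times> {..<d i})"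
    by (simp add: card_image inj_on_def)
  then show ?thesis by (simp add: card_cartesian_product)
qed

lemma card_CI2: "card (CI (-2)) = (\<Sum>i\<in>{1..<t}. d i * d i)"
proof -
  have "CI (-2) = (\<lambda>(i, r, r'). ((0, i, r), r')) ` (SIGMA i:{1..<t}. {..<d i} \<times> {..<d i})"
    by (auto simp: CI_def okg_def mlt_def vtx_def image_iff)
  then have "card (CI (-2)) = card (SIGMA i:{1..<t}. {..<d i} \<times> {..<d i})"
    by (simp add: card_image inj_on_def)
  then show ?thesis by (simp add: card_cartesian_product)
qed

lemma card_CI1: "card (CI (-1)) = (\<Sum>i\<in>{1..<t}. 2 * d i * d (Suc i))"
proof -
  have "CI (-1) = (\<lambda>(i, r, r'). ((1, i, r), r')) ` (SIGMA i:{1..<t}. {..<d i} \<times> {..<d (Suc i)}) \<union>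
      (\<lambda>(i, r, r'). ((2, i, r), r')) ` (SIGMA i:{1..<t}. {..<d (Suc i)} \<times> {..<d i})" (is "_ = ?f ` ?A \<union> ?g ` ?B")
    by (auto simp: CI_def okg_def mlt_def vtx_def image_iff)
  moreover have "card (?f ` ?A \<union> ?g ` ?B) = card (?f ` ?A) + card (?g ` ?B)"
    by (rule card_Un_disjoint) auto
  moreover have "card (?f ` ?A) = card ?A" "card (?g ` ?B) = card ?B" by (simp_all add: card_image inj_on_def)
  ultimately show ?thesis by (simp add: card_cartesian_product sum.distrib[symmetric] mult_2 add_mult_distrib)
      (simp add: mult.commute)
qed

definition \<chi> :: int where "\<chi> = (\<Sum>i<t. (int (d (Suc i)) - int (d i))\<^sup>2)"

text \<open>Counting entries gives d_i^2 per vertex, 2 d_i d_{i+1} per pair of arrows and d_i^2 per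
  relation, i < t. In the alternating sum these regroup into squares of differences; the leftover
  d_1^2 is the term for i = 0, where d_0 = 0.\<close>

lemma euler: "int (fdim (Zc 0)) - (int (fdim (Zc (-1))) - int (fdim (Bc (-1)))) +
    (int (fdim (Zc (-2))) - int (fdim (Bc (-2)))) = \<chi>"
proof -
  have "(\<Sum>i\<in>{1..T}. int (d i) * int (d i)) - (\<Sum>i\<in>{1..<T}. 2 * int (d i) * int (d (Suc i))) +
    (\<Sum>i\<in>{1..<T}. int (d i) * int (d i)) = (\<Sum>i<T. (int (d (Suc i)) - int (d i))\<^sup>2)" for T
  proof (induction T)
    case (Suc T)
    show ?case
    proof (cases "T = 0")
      case True
      then show ?thesis using d_out[of 0] by (simp add: power2_eq_square)
    next
      case False
      then have "{1..<Suc T} = insert T {1..<T}" "{1..Suc T} = insert (Suc T) {1..T}" by auto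
      then show ?thesis using Suc by (simp add: power2_eq_square algebra_simps)
    qed
  qed simp
  from this[of t] have "int (card (CI 0)) - int (card (CI (-1))) + int (card (CI (-2))) = \<chi>"
    unfolding card_CI0 card_CI1 card_CI2 \<chi>_def by simp
  moreover have "card (CI 0) = fdim (Zc 0) + fdim (Bc (-1))" "card (CI (-1)) = fdim (Zc (-1)) + fdim (Bc (-2))"
    "card (CI (-2)) = fdim (Zc (-2))"
    using dim_CI[of 0] dim_CI[of "-1"] dim_CI[of "-2"] Bc_top[of "-3"] by simp_all
  ultimately show ?thesis by simp
qed

section \<open>The second extension group\<close>

text \<open>
  The trace pairing turns a functional \<open>w\<close> on the cochains of degree two into a family
  \<open>u\<^sub>i \<in> End(M\<^sub>i)\<close> with \<open>u\<^sub>t = 0\<close>.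
\<close>

lemma ext2_dual:
  assumes w: "\<And>c. c \<in> Bc (-2) \<Longrightarrow> (\<Sum>b\<in>CI (-2). w b * c b) = 0"
  defines "u \<equiv> \<lambda>i. mat (d i) (d i) (\<lambda>(r, r'). if 1 \<le> i \<and> i < t then w ((0, i, r), r') else 0)"
  shows "is_hom t M M u"
proof -
  have bij: "bij_betw (\<lambda>(i, r, r'). ((0, i, r), r')) (SIGMA i:{1..<t}. {..<d i} \<times> {..<d i}) (CI (-2))"
    by (rule bij_betw_byWitness[of _ "\<lambda>((\<kappa>, i, r), r'). (i, r, r')"])
      (auto simp: CI_def okg_def mlt_def vtx_def)
  \<comment> \<open>The functional is a trace: \<open>w\<close> is read as the matrix
    \<open>u\<close> with row \<open>r\<close> and column \<open>r'\<close>, whereas the cochain has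
    this entry in row \<open>r'\<close> and column \<open>r\<close>. The sum is thus the total trace
    of \<open>u\<close> times the coboundary.\<close>
  have S: "(\<Sum>i\<in>{1..<t}. \<Sum>r<d i. \<Sum>r'<d i. w ((0, i, r), r') * ev (-2) (h \<circ>\<^sub>h dif PP (-2)) 0 i (dlt r) r') = 0"
    if h: "is_hom t (obj PP (-1)) M h" for h
  proof -
    have "cv (-2) (h \<circ>\<^sub>h dif PP (-2)) = Dc (-2 + 1) (cv (-1) h)" using Dc_cv[OF h] by simp
    then have "cv (-2) (h \<circ>\<^sub>h dif PP (-2)) \<in> Bc (-2)" using cv_fs[OF h] unfolding Bc_def by simp
    then have "0 = (\<Sum>b\<in>CI (-2). w b * cv (-2) (h \<circ>\<^sub>h dif PP (-2)) b)" by (simp add: w)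
    also have "\<dots> = (\<Sum>(i, r, r')\<in>(SIGMA i:{1..<t}. {..<d i} \<times> {..<d i}).
        w ((0, i, r), r') * cv (-2) (h \<circ>\<^sub>h dif PP (-2)) ((0, i, r), r'))"
      by (subst sum.reindex_bij_betw[OF bij, symmetric]) (simp add: case_prod_unfold)
    also have "\<dots> = (\<Sum>i\<in>{1..<t}. \<Sum>r<d i. \<Sum>r'<d i. w ((0, i, r), r') * cv (-2) (h \<circ>\<^sub>h dif PP (-2)) ((0, i, r), r'))"
      by (simp add: sum.Sigma sum.cartesian_product)
    also have "\<dots> = (\<Sum>i\<in>{1..<t}. \<Sum>r<d i. \<Sum>r'<d i. w ((0, i, r), r') * ev (-2) (h \<circ>\<^sub>h dif PP (-2)) 0 i (dlt r) r')"
      by (intro sum.cong refl) (simp add: cv_def okg_def mlt_def)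
    finally show ?thesis ..
  qed
  have split: "(\<Sum>i\<in>{1..<t}. (if i = i0 then P else 0) - (if i = Suc i0 then Q else 0)) = P - (if Suc i0 < t then Q else 0)"
    if "1 \<le> i0" "i0 < t" for i0 and P Q :: 'k
    using that by (simp add: sum_subtractf sum.delta)
  have uc: "u i \<in> carrier_mat (d i) (d i)" for i by (simp add: u_def)
  \<comment> \<open>A test cochain that is one matrix unit in the summand of \<beta>_{i0} yields one
    entry of the commutation with \<alpha>_{i0}.\<close>
  have A: "u (i0 + 1) * arrA M i0 = arrA M i0 * u i0" if i0: "1 \<le> i0" "i0 < t" for i0
  proof (rule eq_matI)
    note cA = module_A[OF M, of i0]
    fix r0 s0 assume "r0 < dim_row (arrA M i0 * u i0)" "s0 < dim_col (arrA M i0 * u i0)"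
    then have rs: "r0 < d (Suc i0)" "s0 < d i0" using cA uc[of i0] by auto
    have c: "(if \<kappa> = 2 \<and> i = i0 \<and> r = r0 then dlt s0 else 0 :: nat \<Rightarrow> 'k) \<in> fs {..<d (vtx \<kappa> i)}" for \<kappa> i r
      using rs by (auto simp: vtx_def fs_dlt)
    obtain h where h: "is_hom t (obj PP (-1)) M h" and
      hh: "\<And>\<kappa> i r. okg t (-1) \<kappa> i \<Longrightarrow> r < mlt \<kappa> i \<Longrightarrow>
        ev (-1) h \<kappa> i (dlt r) = (if \<kappa> = 2 \<and> i = i0 \<and> r = r0 then dlt s0 else 0)"
      using ev_ex[where c = "\<lambda>\<kappa> i r. if \<kappa> = 2 \<and> i = i0 \<and> r = r0 then dlt s0 else 0", OF M c, of "-1"] by blast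
    have h1: "ev (-1) h 1 i v = 0" if "1 \<le> i" "i < t" "v \<in> fs {..<d i}" for i v
      by (rule ev_eq[OF M h, of "\<lambda>v. 0"]) (use that hh in \<open>auto simp: okg_def mlt_def lin_def fun_eq_iff\<close>)
    have h2: "ev (-1) h 2 i v = (if i = i0 then scl (v r0) (dlt s0) else 0)" if "1 \<le> i" "i < t" "v \<in> fs {..<d (Suc i)}" for i v
      by (rule ev_eq[OF M h, of "\<lambda>v. if i = i0 then scl (v r0) (dlt s0) else 0"])
        (use that hh in \<open>auto simp: okg_def mlt_def lin_def fun_eq_iff algebra_simps dlt_def\<close>)
    have "(\<Sum>r<d i. \<Sum>r'<d i. w ((0, i, r), r') * ev (-2) (h \<circ>\<^sub>h dif PP (-2)) 0 i (dlt r) r')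
       = (if i = i0 then \<Sum>r<d i0. w ((0, i0, r), s0) * arrA M i0 $$ (r0, r) else 0)
       - (if i = Suc i0 then \<Sum>r'<d (Suc i0). w ((0, Suc i0, r0), r') * arrA M i0 $$ (r', s0) else 0)"
      if i: "i \<in> {1..<t}" for i
    proof -
      have e: "ev (-2) (h \<circ>\<^sub>h dif PP (-2)) 0 i (dlt r) r' = (if i = i0 then arrA M i0 $$ (r0, r) * dlt s0 r' else 0)
          - (if i = Suc i0 then dlt r r0 * arrA M i0 $$ (r', s0) else 0)" if r: "r < d i" "r' < d i" for r r'
      proof -
        have v: "(dlt r :: nat \<Rightarrow> 'k) \<in> fs {..<d i}" using r by (simp add: fs_dlt)
        have A0: "a i0 (dlt r) r0 = arrA M i0 $$ (r0, r)" if "i = i0"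
          using mv_dlt[OF cA rs(1), of r] r that by simp
        have A1: "a i0 (dlt s0) r' = arrA M i0 $$ (r', s0)" if "i = Suc i0"
          using mv_dlt[OF cA _ rs(2), of r'] r that by simp
        have l: "dlt r r0 * a i0 (dlt s0) r' = a i0 (scl (dlt r r0) (dlt s0)) r'" by (simp add: mv_lin)
        show ?thesis
        proof (cases "i = 1")
          case True
          then show ?thesis
            using ev_d2[OF M h, of i "dlt r"] i v h1[of i "dlt r"] h2[of i "a i (dlt r)"] a_fs[of i "dlt r"] A0 i0
            by (auto simp: mv_lin)
        next
          case False
          then have s: "1 \<le> i - 1" "i - 1 < t" "Suc (i - 1) = i" "i - 1 = i0 \<longleftrightarrow> i = Suc i0" using i by auto
          show ?thesis
            using ev_d2[OF M h, of i "dlt r"] i v h1[of i "dlt r"] h2[of i "a i (dlt r)"] a_fs[of i "dlt r"]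
              h1[of "i - 1" "b (i - 1) (dlt r)"] h2[of "i - 1" "dlt r"] b_fs[of "i - 1" "dlt r"] s A0 A1 False l
            by (auto simp: mv_lin)
        qed
      qed
      have "(\<Sum>r<d i. \<Sum>r'<d i. w ((0, i, r), r') * ev (-2) (h \<circ>\<^sub>h dif PP (-2)) 0 i (dlt r) r')
        = (\<Sum>r<d i. \<Sum>r'<d i. (if i = i0 then if r' = s0 then w ((0, i0, r), s0) * arrA M i0 $$ (r0, r) else 0 else 0)
          - (if i = Suc i0 then if r = r0 then w ((0, Suc i0, r0), r') * arrA M i0 $$ (r', s0) else 0 else 0))"
        by (intro sum.cong refl; simp add: e; auto simp: dlt_def)
      also have "\<dots> = (if i = i0 then \<Sum>r<d i0. w ((0, i0, r), s0) * arrA M i0 $$ (r0, r) else 0)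
       - (if i = Suc i0 then \<Sum>r'<d (Suc i0). w ((0, Suc i0, r0), r') * arrA M i0 $$ (r', s0) else 0)"
      proof -
        have "(\<Sum>r<d (Suc i0). \<Sum>r'<d (Suc i0). if r = r0 then w ((0, Suc i0, r0), r') * arrA M i0 $$ (r', s0) else 0)
          = (\<Sum>r'<d (Suc i0). w ((0, Suc i0, r0), r') * arrA M i0 $$ (r', s0))"
          by (subst sum.swap) (use rs in simp)
        then show ?thesis using rs by (auto simp: sum_negf)
      qed
      finally show ?thesis .
    qed
    then have "0 = (\<Sum>i\<in>{1..<t}. (if i = i0 then \<Sum>r<d i0. w ((0, i0, r), s0) * arrA M i0 $$ (r0, r) else 0)
       - (if i = Suc i0 then \<Sum>r'<d (Suc i0). w ((0, Suc i0, r0), r') * arrA M i0 $$ (r', s0) else 0))"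
      using S[OF h] by simp
    then have z: "(\<Sum>r<d i0. w ((0, i0, r), s0) * arrA M i0 $$ (r0, r)) =
        (if Suc i0 < t then \<Sum>r'<d (Suc i0). w ((0, Suc i0, r0), r') * arrA M i0 $$ (r', s0) else 0)"
      unfolding split[OF i0] by simp
    have "(u (i0 + 1) * arrA M i0) $$ (r0, s0) = (\<Sum>q<d (Suc i0). u (Suc i0) $$ (r0, q) * arrA M i0 $$ (q, s0))"
      using rs cA uc[of "Suc i0"] by (simp add: scalar_prod_def atLeast0LessThan)
    \<comment> \<open>For \<open>Suc i0 = t\<close> both sides vanish: there is no relation at
      \<open>t\<close>, and \<open>u t\<close> is zero by definition.\<close>
    also have "\<dots> = (if Suc i0 < t then \<Sum>r'<d (Suc i0). w ((0, Suc i0, r0), r') * arrA M i0 $$ (r', s0) else 0)"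
      using rs by (auto simp: u_def)
    also have "\<dots> = (\<Sum>q<d i0. arrA M i0 $$ (r0, q) * u i0 $$ (q, s0))"
      unfolding z[symmetric] using rs i0 by (intro sum.cong) (auto simp: u_def)
    also have "\<dots> = (arrA M i0 * u i0) $$ (r0, s0)"
      using rs cA uc[of i0] by (simp add: scalar_prod_def atLeast0LessThan)
    finally show "(u (i0 + 1) * arrA M i0) $$ (r0, s0) = (arrA M i0 * u i0) $$ (r0, s0)" .
  qed (use module_A[OF M, of i0] uc[of i0] uc[of "Suc i0"] in auto)
  \<comment> \<open>Conversely, matrix units in the summand of \<alpha>_{i0} test the commutation
    with \<beta>_{i0}.\<close>
  have Bb: "u i0 * arrB M i0 = arrB M i0 * u (i0 + 1)" if i0: "1 \<le> i0" "i0 < t" for i0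
  proof (rule eq_matI)
    note cB = module_B[OF M, of i0]
    fix r0 s0 assume "r0 < dim_row (arrB M i0 * u (i0 + 1))" "s0 < dim_col (arrB M i0 * u (i0 + 1))"
    then have rs: "r0 < d i0" "s0 < d (Suc i0)" using cB uc[of "Suc i0"] by auto
    have c: "(if \<kappa> = 1 \<and> i = i0 \<and> r = r0 then dlt s0 else 0 :: nat \<Rightarrow> 'k) \<in> fs {..<d (vtx \<kappa> i)}" for \<kappa> i r
      using rs by (auto simp: vtx_def fs_dlt)
    obtain h where h: "is_hom t (obj PP (-1)) M h" and
      hh: "\<And>\<kappa> i r. okg t (-1) \<kappa> i \<Longrightarrow> r < mlt \<kappa> i \<Longrightarrow>
        ev (-1) h \<kappa> i (dlt r) = (if \<kappa> = 1 \<and> i = i0 \<and> r = r0 then dlt s0 else 0)"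
      using ev_ex[where c = "\<lambda>\<kappa> i r. if \<kappa> = 1 \<and> i = i0 \<and> r = r0 then dlt s0 else 0", OF M c, of "-1"] by blast
    have h2: "ev (-1) h 2 i v = 0" if "1 \<le> i" "i < t" "v \<in> fs {..<d (Suc i)}" for i v
      by (rule ev_eq[OF M h, of "\<lambda>v. 0"]) (use that hh in \<open>auto simp: okg_def mlt_def lin_def fun_eq_iff\<close>)
    have h1: "ev (-1) h 1 i v = (if i = i0 then scl (v r0) (dlt s0) else 0)" if "1 \<le> i" "i < t" "v \<in> fs {..<d i}" for i v
      by (rule ev_eq[OF M h, of "\<lambda>v. if i = i0 then scl (v r0) (dlt s0) else 0"])
        (use that hh in \<open>auto simp: okg_def mlt_def lin_def fun_eq_iff algebra_simps dlt_def\<close>)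
    have "(\<Sum>r<d i. \<Sum>r'<d i. w ((0, i, r), r') * ev (-2) (h \<circ>\<^sub>h dif PP (-2)) 0 i (dlt r) r')
       = (if i = i0 then \<Sum>r'<d i0. w ((0, i0, r0), r') * arrB M i0 $$ (r', s0) else 0)
       - (if i = Suc i0 then \<Sum>r<d (Suc i0). w ((0, Suc i0, r), s0) * arrB M i0 $$ (r0, r) else 0)"
      if i: "i \<in> {1..<t}" for i
    proof -
      have e: "ev (-2) (h \<circ>\<^sub>h dif PP (-2)) 0 i (dlt r) r' = (if i = i0 then dlt r r0 * arrB M i0 $$ (r', s0) else 0)
          - (if i = Suc i0 then arrB M i0 $$ (r0, r) * dlt s0 r' else 0)" if r: "r < d i" "r' < d i" for r r'
      proof -
        have v: "(dlt r :: nat \<Rightarrow> 'k) \<in> fs {..<d i}" using r by (simp add: fs_dlt)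
        have A0: "b i0 (dlt r) r0 = arrB M i0 $$ (r0, r)" if "i = Suc i0"
          using mv_dlt[OF cB rs(1), of r] r that by simp
        have A1: "b i0 (dlt s0) r' = arrB M i0 $$ (r', s0)" if "i = i0"
          using mv_dlt[OF cB _ rs(2), of r'] r that by simp
        have l: "dlt r r0 * b i0 (dlt s0) r' = b i0 (scl (dlt r r0) (dlt s0)) r'" by (simp add: mv_lin)
        show ?thesis
        proof (cases "i = 1")
          case True
          then show ?thesis
            using ev_d2[OF M h, of i "dlt r"] i v h1[of i "dlt r"] h2[of i "a i (dlt r)"] a_fs[of i "dlt r"] A1 i0 l
            by (auto simp: mv_lin)
        next
          case False
          then have s: "1 \<le> i - 1" "i - 1 < t" "Suc (i - 1) = i" "i - 1 = i0 \<longleftrightarrow> i = Suc i0" using i by auto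
          show ?thesis
            using ev_d2[OF M h, of i "dlt r"] i v h1[of i "dlt r"] h2[of i "a i (dlt r)"] a_fs[of i "dlt r"]
              h1[of "i - 1" "b (i - 1) (dlt r)"] h2[of "i - 1" "dlt r"] b_fs[of "i - 1" "dlt r"] s A0 A1 False l
            by (auto simp: mv_lin)
        qed
      qed
      have "(\<Sum>r<d i. \<Sum>r'<d i. w ((0, i, r), r') * ev (-2) (h \<circ>\<^sub>h dif PP (-2)) 0 i (dlt r) r')
        = (\<Sum>r<d i. \<Sum>r'<d i. (if i = i0 then if r = r0 then w ((0, i0, r0), r') * arrB M i0 $$ (r', s0) else 0 else 0)
          - (if i = Suc i0 then if r' = s0 then w ((0, Suc i0, r), s0) * arrB M i0 $$ (r0, r) else 0 else 0))"
        by (intro sum.cong refl; simp add: e; auto simp: dlt_def)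
      also have "\<dots> = (if i = i0 then \<Sum>r'<d i0. w ((0, i0, r0), r') * arrB M i0 $$ (r', s0) else 0)
       - (if i = Suc i0 then \<Sum>r<d (Suc i0). w ((0, Suc i0, r), s0) * arrB M i0 $$ (r0, r) else 0)"
      proof -
        have "(\<Sum>r<d i0. \<Sum>r'<d i0. if r = r0 then w ((0, i0, r0), r') * arrB M i0 $$ (r', s0) else 0)
          = (\<Sum>r'<d i0. w ((0, i0, r0), r') * arrB M i0 $$ (r', s0))"
          by (subst sum.swap) (use rs in simp)
        then show ?thesis using rs by (auto simp: sum_negf)
      qed
      finally show ?thesis .
    qed
    then have "0 = (\<Sum>i\<in>{1..<t}. (if i = i0 then \<Sum>r'<d i0. w ((0, i0, r0), r') * arrB M i0 $$ (r', s0) else 0)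
       - (if i = Suc i0 then \<Sum>r<d (Suc i0). w ((0, Suc i0, r), s0) * arrB M i0 $$ (r0, r) else 0))"
      using S[OF h] by simp
    then have z: "(\<Sum>r'<d i0. w ((0, i0, r0), r') * arrB M i0 $$ (r', s0)) =
        (if Suc i0 < t then \<Sum>r<d (Suc i0). w ((0, Suc i0, r), s0) * arrB M i0 $$ (r0, r) else 0)"
      unfolding split[OF i0] by simp
    have "(u i0 * arrB M i0) $$ (r0, s0) = (\<Sum>q<d i0. u i0 $$ (r0, q) * arrB M i0 $$ (q, s0))"
      using rs cB uc[of i0] by (simp add: scalar_prod_def atLeast0LessThan)
    also have "\<dots> = (\<Sum>r'<d i0. w ((0, i0, r0), r') * arrB M i0 $$ (r', s0))"
      using rs i0 by (auto simp: u_def)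
    also have "\<dots> = (\<Sum>q<d (Suc i0). arrB M i0 $$ (r0, q) * u (Suc i0) $$ (q, s0))"
      unfolding z using rs by (auto simp: u_def intro!: sum.cong)
    also have "\<dots> = (arrB M i0 * u (i0 + 1)) $$ (r0, s0)"
      using rs cB uc[of "Suc i0"] by (simp add: scalar_prod_def atLeast0LessThan)
    finally show "(u i0 * arrB M i0) $$ (r0, s0) = (arrB M i0 * u (i0 + 1)) $$ (r0, s0)" .
  qed (use module_B[OF M, of i0] uc[of i0] uc[of "Suc i0"] in auto)
  show ?thesis using uc A Bb by (auto simp: is_hom_def)
qed

end

section \<open>The Nakayama functor on free modules\<close>

text \<open>The identity or the shift raising the index by one, truncated to the format. All arrows
  of \<open>Ae\<close> have this shape, and so have right multiplications by arrows.\<close>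

definition shm :: "bool \<Rightarrow> nat \<Rightarrow> nat \<Rightarrow> 'k::field mat" where
  "shm s n m = mat n m (\<lambda>(r, c). if r = (if s then c + 1 else c) then 1 else 0)"

lemma mv_shm: "mv (shm s n m) z r = (if r < n then
    if s then if r = 0 then 0 else if r - 1 < m then z (r - 1) else 0
    else if r < m then z r else 0 else 0)"
proof (cases "r < n")
  case True
  have "mv (shm s n m) z r = (\<Sum>c<m. (if r = (if s then c + 1 else c) then 1 else 0) * z c)"
    using True by (simp add: mv_def shm_def)
  also have "\<dots> = (\<Sum>c<m. if c = (if s then r - 1 else r) then (if s \<and> r = 0 then 0 else z c) else 0)"
    by (rule sum.cong) auto
  finally show ?thesis using True by auto
qed (simp add: mv_def shm_def)

definition dAe :: "nat \<Rightarrow> nat \<Rightarrow> nat \<Rightarrow> nat" where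
  "dAe t j i = (if 1 \<le> i \<and> i \<le> t then min j i else 0)"

lemma dim_Ae0: "dimv (Ae t j) i = dAe t j i"
  by (auto simp: Ae_sel dAe_def)

lemmas dim_Ae = dim_Ae0 dAe_def

lemma arr_Ae: "arrA (Ae t j) i = shm (\<not> j \<le> i) (dAe t j (Suc i)) (dAe t j i)"
  "arrB (Ae t j) i = shm (j \<le> i) (dAe t j i) (dAe t j (Suc i))"
  by (auto simp: Ae_def Let_def shm_def dAe_def)

text \<open>Change from the loop index of \<^const>\<open>Ae\<close> to the index of \<^const>\<open>pth\<close>.\<close>

definition et :: "nat \<Rightarrow> nat \<Rightarrow> (nat \<Rightarrow> 'k::field) \<Rightarrow> nat \<Rightarrow> 'k" where
  "et i j z = (\<lambda>e. if e < min i j then z (min i j - 1 - e) else 0)"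

lemma et_lin: "et i j (x + y) e = et i j x e + et i j y e" "et i j (scl c x) e = c * et i j x e"
  "et i j (x - y) e = et i j x e - et i j y e" "et i j 0 e = 0"
  by (auto simp: et_def)

lemma et_A:
  assumes "1 \<le> i" "i < t" "1 \<le> j" "j \<le> t"
  shows "et (Suc i) j (mv (arrA (Ae t j) i) z) e = et i j z e"
  using assms by (cases "i = j") (auto simp: et_def arr_Ae mv_shm dim_Ae min_def)

lemma et_B:
  assumes "1 \<le> i" "i < t" "1 \<le> j" "j \<le> t"
  shows "et i j (mv (arrB (Ae t j) i) z) e = et (Suc i) j z (Suc e)"
  using assms by (cases "i = j") (auto simp: et_def arr_Ae mv_shm dim_Ae min_def)

text \<open>Right multiplication by \<alpha>_j in the loop coordinates of \<open>Ae\<close>: it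
  creates a loop at vertices \<open>i \<le> j\<close>. Its companion \<open>rB\<close>, for
  \<beta>_j, creates one at the vertices beyond \<open>j\<close>.\<close>

definition rA :: "nat \<Rightarrow> nat \<Rightarrow> nat \<Rightarrow> 'k::field mat" where
  "rA t j i = shm (i \<le> j) (dAe t j i) (dAe t (Suc j) i)"
definition rB :: "nat \<Rightarrow> nat \<Rightarrow> nat \<Rightarrow> 'k::field mat" where
  "rB t j i = shm (\<not> i \<le> j) (dAe t (Suc j) i) (dAe t j i)"

lemma rA_hom:
  assumes "1 \<le> j" "j < t"
  shows "is_hom t (Ae t (Suc j)) (Ae t j) (rA t j)"
proof -
  have m: "is_module t (Ae t (Suc j))" "is_module t (Ae t j)" using assms is_module_Ae by auto
  show ?thesis
    unfolding is_hom_iff[OF m]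
  proof (intro conjI allI impI; (elim conjE)?)
    fix i show "rA t j i \<in> carrier_mat (dimv (Ae t j) i) (dimv (Ae t (Suc j)) i)" by (simp add: rA_def shm_def dim_Ae0)
  next
    fix i and x :: "nat \<Rightarrow> 'a" assume i: "1 \<le> i" "i < t"
    show "mv (rA t j (Suc i)) (mv (arrA (Ae t (Suc j)) i) x) = mv (arrA (Ae t j) i) (mv (rA t j i) x)"
      using i assms by (auto simp: fun_eq_iff rA_def arr_Ae mv_shm dim_Ae min_def)
    show "mv (rA t j i) (mv (arrB (Ae t (Suc j)) i) x) = mv (arrB (Ae t j) i) (mv (rA t j (Suc i)) x)"
      using i assms by (auto simp: fun_eq_iff rA_def arr_Ae mv_shm dim_Ae min_def)
  qed
qed

lemma rB_hom:
  assumes "1 \<le> j" "j < t"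
  shows "is_hom t (Ae t j) (Ae t (Suc j)) (rB t j)"
proof -
  have m: "is_module t (Ae t j)" "is_module t (Ae t (Suc j))" using assms is_module_Ae by auto
  show ?thesis
    unfolding is_hom_iff[OF m]
  proof (intro conjI allI impI; (elim conjE)?)
    fix i show "rB t j i \<in> carrier_mat (dimv (Ae t (Suc j)) i) (dimv (Ae t j) i)" by (simp add: rB_def shm_def dim_Ae0)
  next
    fix i and x :: "nat \<Rightarrow> 'a" assume i: "1 \<le> i" "i < t"
    show "mv (rB t j (Suc i)) (mv (arrA (Ae t j) i) x) = mv (arrA (Ae t (Suc j)) i) (mv (rB t j i) x)"
      using i assms by (auto simp: fun_eq_iff rB_def arr_Ae mv_shm dim_Ae min_def)
    show "mv (rB t j i) (mv (arrB (Ae t j) i) x) = mv (arrB (Ae t (Suc j)) i) (mv (rB t j (Suc i)) x)"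
      using i assms by (auto simp: fun_eq_iff rB_def arr_Ae mv_shm dim_Ae min_def)
  qed
qed

text \<open>\<open>rmultA\<close> is a definite description; by \<open>Ae_free\<close> it suffices
  to compare the images of the idempotent.\<close>

lemma rmultA_eq: 
  assumes j: "1 \<le> j" "j < t"
  shows "rmultA t j = (rA t j :: 'k::field hom)"
proof -
  let ?v = "arrA (Ae t j) j *\<^sub>v idem j :: 'k vec"
  have v: "?v = unit_vec j 0"
    using A_Ae_unit[of j t j 0, where 'k = 'k] j by (simp add: idem_def)
  have "rA t j (Suc j) *\<^sub>v idem (Suc j) = ?v"
    unfolding v using j by (intro eq_vecI) (auto simp: rA_def shm_def dim_Ae idem_def)
  moreover have "\<exists>!f. is_hom t (Ae t (Suc j)) (Ae t j) f \<and> f (Suc j) *\<^sub>v idem (Suc j) = ?v"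
    by (rule Ae_free) (use j is_module_Ae[of j t] v in \<open>auto simp: dim_Ae\<close>)
  ultimately show ?thesis
    unfolding rmultA_def rmult_def using rA_hom[OF j, where 'a = 'k] by (simp add: the1_equality)
qed

lemma rmultB_eq: 
  assumes j: "1 \<le> j" "j < t"
  shows "rmultB t j = (rB t j :: 'k::field hom)"
proof -
  let ?v = "arrB (Ae t (Suc j)) j *\<^sub>v idem (Suc j) :: 'k vec"
  have v: "?v = unit_vec j 0"
    using B_Ae_unit[of j t "Suc j" 0, where 'k = 'k] j by (simp add: idem_def)
  have "rB t j j *\<^sub>v idem j = ?v"
    unfolding v using j by (intro eq_vecI) (auto simp: rB_def shm_def dim_Ae idem_def)
  moreover have "\<exists>!f. is_hom t (Ae t j) (Ae t (Suc j)) f \<and> f j *\<^sub>v idem j = ?v"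
    by (rule Ae_free) (use j is_module_Ae[of "Suc j" t] v in \<open>auto simp: dim_Ae\<close>)
  ultimately show ?thesis
    unfolding rmultB_def rmult_def using rB_hom[OF j, where 'a = 'k] by (simp add: the1_equality)
qed

text \<open>In socle indices right multiplication by \<alpha> is a plain shift and by \<beta>
  (\<open>et_rB\<close>) the identity, without a case distinction on the vertex.\<close>

lemma et_rA:
  assumes "1 \<le> i" "i \<le> t" "1 \<le> j" "j < t"
  shows "et i j (mv (rA t j i) z) e = et i (Suc j) z (Suc e)"
  using assms by (cases "i = Suc j") (auto simp: et_def rA_def mv_shm dim_Ae min_def)

lemma et_rB:
  assumes "1 \<le> i" "i \<le> t" "1 \<le> j" "j < t"
  shows "et i (Suc j) (mv (rB t j i) z) e = et i j z e"
  using assms by (cases "i = Suc j") (auto simp: et_def rB_def mv_shm dim_Ae min_def)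

section \<open>The pairing of \<open>Nk\<close> with maps from \<open>F\<close> to
  \<open>Ae\<close>\<close>

context gens
begin

text \<open>Coordinates of a map from \<open>F\<close> to \<open>Ae t j\<close>: the coefficient of
  the path with index \<open>e\<close> in the image of the generator \<open>g\<close>. They are
  indexed by the basis of \<open>Nk\<close> at \<open>j\<close>, which makes \<open>pair\<close> a
  perfect pairing.\<close>

definition En :: "nat \<Rightarrow> 'k::field hom \<Rightarrow> 'g \<times> nat \<Rightarrow> 'k" where
  "En j h = (\<lambda>(g, e). if g \<in> G then et (\<nu> g) j (mv (h (\<nu> g)) (gen t G \<nu> g)) e else 0)"

definition pair :: "nat \<Rightarrow> ('g \<times> nat \<Rightarrow> 'k::field) \<Rightarrow> 'k hom \<Rightarrow> 'k" where
  "pair j y h = (\<Sum>b\<in>B j. y b * En j h b)"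

text \<open>Restricted to homomorphisms because \<open>dual_homs\<close> consists of extensional
  functions.\<close>

definition tau :: "nat \<Rightarrow> 'k::field vec \<Rightarrow> 'k hom \<Rightarrow> 'k" where
  "tau j v = restrict (pair j (co (B j) (fv v))) (homs t F (Ae t j))"

lemma En_fs: "j \<in> {1..t} \<Longrightarrow> En j h \<in> fs (B j)"
  by (auto simp: fs_def En_def et_def FB_def)

lemma En_add: "is_hom t F N h \<Longrightarrow> is_hom t F N h' \<Longrightarrow> En j (h +\<^sub>h h') = En j h + En j h'"
  by (auto simp: En_def mv_hom_add et_lin fun_eq_iff)

lemma En_smult: "En j (c \<cdot>\<^sub>h h) = scl c (En j h)"
  by (auto simp: En_def mv_hom_smult et_lin fun_eq_iff)

lemma En_ex:
  assumes j: "j \<in> {1..t}"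
  shows "\<exists>h. is_hom t F (Ae t j) h \<and> En j h = res (B j) (z :: _ \<Rightarrow> 'k::field)"
proof -
  define n where "n g = (\<lambda>c. if c < min (\<nu> g) j then z (g, min (\<nu> g) j - 1 - c) else 0)" for g
  have "n g \<in> fs {..<dimv (Ae t j) (\<nu> g)}" if "g \<in> G" for g
    using \<nu>[OF that] by (auto simp: n_def fs_def dim_Ae min_def)
  from ext_hom[OF is_module_Ae this] j obtain h where
    h: "is_hom t F (Ae t j) h" "\<forall>g\<in>G. mv (h (\<nu> g)) (gen t G \<nu> g) = n g" by auto
  have "En j h = res (B j) z"
    using h(2) j by (auto simp: En_def fun_eq_iff res_def et_def n_def FB_def)
  then show ?thesis using h(1) by blast
qed

lemma En_inj:
  assumes j: "j \<in> {1..t}" and h: "is_hom t F (Ae t j) h" "is_hom t F (Ae t j) h'" and e: "En j h = En j h'"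
  shows "h = h'"
proof (rule hom_uniq[OF is_module_Ae h])
  show "1 \<le> j" using j by simp
  fix g assume g: "g \<in> G"
  show "mv (h (\<nu> g)) (gen t G \<nu> g) = mv (h' (\<nu> g)) (gen t G \<nu> g)"
  proof
    fix c
    show "mv (h (\<nu> g)) (gen t G \<nu> g) c = mv (h' (\<nu> g)) (gen t G \<nu> g) c"
    proof (cases "c < min (\<nu> g) j")
      case True
      then have "min (\<nu> g) j - 1 - c < min (\<nu> g) j" "min (\<nu> g) j - 1 - (min (\<nu> g) j - 1 - c) = c" by auto
      then show ?thesis using fun_cong[OF e, of "(g, min (\<nu> g) j - 1 - c)"] g by (simp add: En_def et_def)
    next
      case False
      then have "\<not> c < dAe t j (\<nu> g)" by (auto simp: dAe_def)
      then show ?thesis using hom_fs[OF h(1), of "\<nu> g" "gen t G \<nu> g"] hom_fs[OF h(2), of "\<nu> g" "gen t G \<nu> g"]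
        by (auto simp: fs_def dim_Ae0)
    qed
  qed
qed

definition H :: "nat \<Rightarrow> ('g \<times> nat \<Rightarrow> 'k::field) \<Rightarrow> 'k hom" where
  "H j z = (SOME h. is_hom t F (Ae t j) h \<and> En j h = res (B j) z)"

lemma H: "j \<in> {1..t} \<Longrightarrow> is_hom t F (Ae t j) (H j z)" "j \<in> {1..t} \<Longrightarrow> En j (H j z) = res (B j) z"
  using someI_ex[OF En_ex[of j z], folded H_def] by auto

lemma H_En: "j \<in> {1..t} \<Longrightarrow> is_hom t F (Ae t j) h \<Longrightarrow> H j (En j h) = h"
proof (rule En_inj)
  assume j: "j \<in> {1..t}"
  show "En j (H j (En j h)) = En j h" unfolding H(2)[OF j] by (rule res_id[OF En_fs[OF j]])
qed (simp_all only: H(1))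

lemma pair_dlt: "b \<in> B j \<Longrightarrow> pair j (dlt b) h = En j h b"
  using fin by (simp add: pair_def dlt_def if_distrib[of "\<lambda>x. x * _"] cong: if_cong)

lemma pair_H: "b \<in> B j \<Longrightarrow> j \<in> {1..t} \<Longrightarrow> pair j y (H j (dlt b)) = y b"
  using fin by (simp add: pair_def H res_id fs_dlt) (simp add: dlt_def if_distrib[of "\<lambda>x. _ * x"] cong: if_cong)

lemma pair_lin: "pair j (x + y) h = pair j x h + pair j y h" "pair j (scl c x) h = c * pair j x h"
  "pair j (x - y) h = pair j x h - pair j y h" "pair j 0 h = 0"
  by (auto simp: pair_def sum.distrib[symmetric] sum_subtractf[symmetric] sum_distrib_left algebra_simps)

lemma pair_res: "pair j (res (B j) y) h = pair j y h"
  by (auto simp: pair_def res_def)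

lemma fv_N:
  assumes "v \<in> carrier_vec (dimv Nk j)"
  shows "ci (B j) (co (B j) (fv v)) = fv v"
  using fv_fs[OF assms] by (simp add: ci_co[OF fin])

lemma nakayama: "nakayama_via t (F :: 'k::field rep) Nk tau"
proof -
  have homD: "h \<in> homs t F (Ae t j) \<longleftrightarrow> is_hom t F (Ae t j) h" for h :: "'k hom" and j by (simp add: homs_def)
  have mA: "is_module t (Ae t j :: 'k rep)" if "j \<in> {1..t}" for j using that is_module_Ae by auto
  have bij: "bij_betw (tau j) (carrier_vec (dimv (Nk :: 'k rep) j)) (dual_homs t (F :: 'k rep) (Ae t j))" if j: "j \<in> {1..t}" for j
  proof (rule bij_betwI')
    fix v w :: "'k vec" assume v: "v \<in> carrier_vec (dimv (Nk :: 'k rep) j)" and w: "w \<in> carrier_vec (dimv (Nk :: 'k rep) j)"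
    show "(tau j v = tau j w) = (v = w)"
    proof
      assume e: "tau j v = tau j w"
      have "co (B j) (fv v) b = co (B j) (fv w) b" if b: "b \<in> B j" for b
        using fun_cong[OF e, of "H j (dlt b)"] by (simp add: tau_def homD H(1)[OF j] pair_H[OF b j])
      then have "ci (B j) (co (B j) (fv v)) = ci (B j) (co (B j) (fv w))"
        using lst_in[OF fin] by (auto simp: ci_def fun_eq_iff)
      then show "v = w" unfolding fv_N[OF v] fv_N[OF w] using fv_inj[OF v w] by simp
    qed simp
  next
    fix v :: "'k vec" assume "v \<in> carrier_vec (dimv (Nk :: 'k rep) j)"
    show "tau j v \<in> dual_homs t F (Ae t j)"
      using is_hom_add[OF F_module mA[OF j]] is_hom_smult[OF F_module mA[OF j]]
      by (auto simp: dual_homs_def tau_def homD pair_def En_add En_smult algebra_simps sum.distrib sum_distrib_left)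
  next
    fix \<phi> :: "'k hom \<Rightarrow> 'k" assume p: "\<phi> \<in> dual_homs t F (Ae t j)"
    have padd: "\<phi> (f +\<^sub>h g) = \<phi> f + \<phi> g" if "is_hom t F (Ae t j) f" "is_hom t F (Ae t j) g" for f g
      using p that by (simp add: dual_homs_def homD)
    have pscl: "\<phi> (c \<cdot>\<^sub>h f) = c * \<phi> f" if "is_hom t F (Ae t j) f" for f c
      using p that by (simp add: dual_homs_def homD)
    \<comment> \<open>The scalar functional is viewed as a function on the one-point type, to which
      \<open>lin\<close> applies.\<close>
    define T where "T z = (\<lambda>_ :: unit. \<phi> (H j z))" for z
    have T: "lin T"
      unfolding lin_def
    proof (intro conjI allI)
      fix x y :: "'g \<times> nat \<Rightarrow> 'k"
      have "H j (x + y) = H j x +\<^sub>h H j y"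
        by (rule En_inj[OF j H(1)[OF j] is_hom_add[OF F_module mA[OF j] H(1)[OF j] H(1)[OF j]]])
          (auto simp: En_add[OF H(1)[OF j] H(1)[OF j]] H(2)[OF j] res_def fun_eq_iff)
      then have "\<phi> (H j (x + y)) = \<phi> (H j x) + \<phi> (H j y)" by (simp only: padd[OF H(1)[OF j] H(1)[OF j]])
      then show "T (x + y) = T x + T y" by (simp add: T_def fun_eq_iff)
    next
      fix c :: 'k and x :: "'g \<times> nat \<Rightarrow> 'k"
      have "H j (scl c x) = c \<cdot>\<^sub>h H j x"
        by (rule En_inj[OF j H(1)[OF j] is_hom_smult[OF F_module mA[OF j] H(1)[OF j]]])
          (auto simp: En_smult H(2)[OF j] res_def fun_eq_iff)
      then have "\<phi> (H j (scl c x)) = c * \<phi> (H j x)" by (simp only: pscl[OF H(1)[OF j]])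
      then show "T (scl c x) = scl c (T x)" by (simp add: T_def fun_eq_iff)
    qed
    define y where "y b = \<phi> (H j (dlt b))" for b
    define v where "v = vec (dimv (Nk :: 'k rep) j) (ci (B j) y)"
    have fvv: "fv v = ci (B j) y" unfolding v_def by (rule fv_vec) (simp add: ci_fs)
    have "tau j v = \<phi>"
    proof
      fix h
      show "tau j v h = \<phi> h"
      proof (cases "is_hom t F (Ae t j) h")
        case True
        have Te: "T (En j h) = (\<Sum>b\<in>B j. scl (En j h b) (T (dlt b)))"
          by (subst fs_expand[OF fin En_fs[OF j]]) (simp only: lin_sum[OF T] lin_scl[OF T])
        have "\<phi> h = T (En j h) ()" by (simp add: T_def H_En[OF j True])
        also have "\<dots> = (\<Sum>b\<in>B j. En j h b * y b)"
          unfolding Te by (simp add: sum_fun_apply T_def y_def)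
        also have "\<dots> = pair j y h" by (simp add: pair_def mult.commute)
        finally show ?thesis using True by (simp add: tau_def homD fvv co_ci[OF fin] pair_res)
      next
        case False
        then show ?thesis using p by (simp add: tau_def homD dual_homs_def extensional_def)
      qed
    qed
    then show "\<exists>v\<in>carrier_vec (dimv (Nk :: 'k rep) j). \<phi> = tau j v" by (intro bexI[of _ v]) (auto simp: v_def)
  qed
  have lin: "tau j (v + w) h = tau j v h + tau j w h" "tau j (c \<cdot>\<^sub>v v) h = c * tau j v h"
    if "h \<in> homs t F (Ae t j)" "v \<in> carrier_vec (dimv (Nk :: 'k rep) j)" "w \<in> carrier_vec (dimv (Nk :: 'k rep) j)"
    for j c h and v w :: "'k vec"
    using that by (simp_all add: tau_def fv_add fv_smult lin_add[OF lin_co] lin_scl[OF lin_co] pair_lin)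
  have tA: "tau (j + 1) (arrA Nk j *\<^sub>v v) h = tau j v (rmultA t j \<circ>\<^sub>h h)"
    if j: "1 \<le> j" "j < t" and v: "v \<in> carrier_vec (dimv (Nk :: 'k rep) j)" and h: "h \<in> homs t F (Ae t (j + 1))"
    for j h and v :: "'k vec"
  proof -
    have h': "is_hom t F (Ae t (Suc j)) h" using h by (simp add: homD)
    have m: "is_module t (Ae t (Suc j) :: 'k rep)" "is_module t (Ae t j :: 'k rep)" using mA j by auto
    have rh: "is_hom t F (Ae t j) (rA t j \<circ>\<^sub>h h)" by (rule is_hom_comp[OF F_module m h' rA_hom[OF j]])
    define y where "y = co (B j) (fv v)"
    have y: "y \<in> fs (B j)" unfolding y_def by (rule co_fs[OF fin])
    have "co (B (Suc j)) (fv (arrA Nk j *\<^sub>v v)) = res (B (Suc j)) (sup1 y)"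
      using fv_mult[OF module_A[OF N_module] v] by (simp add: mvN co_ci[OF fin] y_def)
    then have "tau (j + 1) (arrA Nk j *\<^sub>v v) h = pair (Suc j) (sup1 y) h"
      using h by (simp add: tau_def pair_res)
    \<comment> \<open>Adjointness of \<alpha>: raising the index in \<open>y\<close> is compensated
      by taking the coordinate of \<open>h\<close> at \<open>Suc e\<close>. The terms left over on
      either side vanish.\<close>
    also have "\<dots> = (\<Sum>b\<in>(\<lambda>(g, e). (g, Suc e)) ` {(g, e) \<in> B j. Suc e < \<nu> g}. sup1 y b * En (Suc j) h b)"
      unfolding pair_def
    proof (rule sum.mono_neutral_right[OF fin])
      show "(\<lambda>(g, e). (g, Suc e)) ` {(g, e) \<in> B j. Suc e < \<nu> g} \<subseteq> B (Suc j)" using j by (auto simp: FB_def)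
      show "\<forall>b\<in>B (Suc j) - (\<lambda>(g, e). (g, Suc e)) ` {(g, e) \<in> B j. Suc e < \<nu> g}. sup1 y b * En (Suc j) h b = 0"
      proof
        fix b assume b: "b \<in> B (Suc j) - (\<lambda>(g, e). (g, Suc e)) ` {(g, e) \<in> B j. Suc e < \<nu> g}"
        obtain g e where ge: "b = (g, e)" by (cases b)
        have "e = 0"
        proof (rule ccontr)
          assume "e \<noteq> 0"
          then obtain e' where e': "e = Suc e'" by (cases e) auto
          then have "(g, e') \<in> B j" "Suc e' < \<nu> g" using b j by (auto simp: ge FB_def)
          then have "b \<in> (\<lambda>(g, e). (g, Suc e)) ` {(g, e) \<in> B j. Suc e < \<nu> g}" unfolding ge e' by force
          then show False using b by blast
        qed
        then show "sup1 y b * En (Suc j) h b = 0" by (simp add: ge sup1_def)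
      qed
    qed
    also have "\<dots> = (\<Sum>(g, e)\<in>{(g, e) \<in> B j. Suc e < \<nu> g}. y (g, e) * En (Suc j) h (g, Suc e))"
      by (subst sum.reindex) (auto simp: inj_on_def sup1_def intro!: sum.cong)
    also have "\<dots> = (\<Sum>(g, e)\<in>B j. y (g, e) * En (Suc j) h (g, Suc e))"
      by (rule sum.mono_neutral_left[OF fin]) (auto simp: En_def et_def FB_def split: if_splits)
    also have "\<dots> = pair j y (rA t j \<circ>\<^sub>h h)"
      unfolding pair_def
    proof (rule sum.cong[OF refl])
      fix b assume "b \<in> B j"
      then obtain g e where b: "b = (g, e)" "g \<in> G" by (auto simp: FB_def)
      then show "(case b of (g, e) \<Rightarrow> y (g, e) * En (Suc j) h (g, Suc e)) = y b * En j (rA t j \<circ>\<^sub>h h) b"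
        using \<nu>[OF b(2)] j by (simp add: En_def mv_comp[OF h' rA_hom[OF j]] et_rA)
    qed
    finally show ?thesis using rh by (simp add: rmultA_eq[OF j] tau_def y_def homD)
  qed
  have tB: "tau j (arrB Nk j *\<^sub>v v) h = tau (j + 1) v (rmultB t j \<circ>\<^sub>h h)"
    if j: "1 \<le> j" "j < t" and v: "v \<in> carrier_vec (dimv (Nk :: 'k rep) (j + 1))" and h: "h \<in> homs t F (Ae t j)"
    for j h and v :: "'k vec"
  proof -
    have h': "is_hom t F (Ae t j) h" using h by (simp add: homD)
    have m: "is_module t (Ae t j :: 'k rep)" "is_module t (Ae t (Suc j) :: 'k rep)" using mA j by auto
    have rh: "is_hom t F (Ae t (Suc j)) (rB t j \<circ>\<^sub>h h)" by (rule is_hom_comp[OF F_module m h' rB_hom[OF j]])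
    define y where "y = co (B (Suc j)) (fv v)"
    have y: "y \<in> fs (B (Suc j))" unfolding y_def by (rule co_fs[OF fin])
    have v': "v \<in> carrier_vec (dimv Nk (Suc j))" using v by simp
    have "co (B j) (fv (arrB Nk j *\<^sub>v v)) = res (B j) y"
      using fv_mult[OF module_B[OF N_module] v'] by (simp add: mvN co_ci[OF fin] y_def)
    then have "tau j (arrB Nk j *\<^sub>v v) h = pair j y h"
      using h by (simp add: tau_def pair_res)
    \<comment> \<open>The additional indices have \<open>e = j\<close>, where the coordinate
      \<open>En j h\<close> is zero.\<close>
    also have "\<dots> = (\<Sum>b\<in>B (Suc j). y b * En j h b)"
      unfolding pair_def by (rule sum.mono_neutral_left[OF fin]) (use j in \<open>auto simp: En_def et_def FB_def split: if_splits\<close>)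
    also have "\<dots> = pair (Suc j) y (rB t j \<circ>\<^sub>h h)"
      unfolding pair_def
    proof (rule sum.cong[OF refl])
      fix b assume "b \<in> B (Suc j)"
      then obtain g e where b: "b = (g, e)" "g \<in> G" by (auto simp: FB_def)
      then show "y b * En j h b = y b * En (Suc j) (rB t j \<circ>\<^sub>h h) b"
        using \<nu>[OF b(2)] j by (simp add: En_def mv_comp[OF h' rB_hom[OF j]] et_rB)
    qed
    finally show ?thesis using rh by (simp add: rmultB_eq[OF j] tau_def y_def homD)
  qed
  show ?thesis
    unfolding nakayama_via_def
  proof (intro conjI ballI allI impI; (elim conjE)?)
    show "is_module t (Nk :: 'k rep)" by (rule N_module)
    fix j assume j: "j \<in> {1..t}"
    show "bij_betw (tau j) (carrier_vec (dimv (Nk :: 'k rep) j)) (dual_homs t (F :: 'k rep) (Ae t j))" by (rule bij[OF j])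
    fix h :: "'k hom" and v w :: "'k vec" and c :: 'k
    assume h: "h \<in> homs t F (Ae t j)" and v: "v \<in> carrier_vec (dimv (Nk :: 'k rep) j)"
    show "tau j (c \<cdot>\<^sub>v v) h = c * tau j v h" by (rule lin(2)[OF h v v])
    assume w: "w \<in> carrier_vec (dimv (Nk :: 'k rep) j)"
    show "tau j (v + w) h = tau j v h + tau j w h" by (rule lin(1)[OF h v w])
  next
    fix j and v :: "'k vec" and h :: "'k hom"
    assume j: "1 \<le> j" "j < t"
    {
      assume v: "v \<in> carrier_vec (dimv (Nk :: 'k rep) j)" and h: "h \<in> homs t F (Ae t (j + 1))"
      show "tau (j + 1) (arrA Nk j *\<^sub>v v) h = tau j v (rmultA t j \<circ>\<^sub>h h)" by (rule tA[OF j v h])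
    next
      assume v: "v \<in> carrier_vec (dimv (Nk :: 'k rep) (j + 1))" and h: "h \<in> homs t F (Ae t j)"
      show "tau j (arrB Nk j *\<^sub>v v) h = tau (j + 1) v (rmultB t j \<circ>\<^sub>h h)" by (rule tB[OF j v h])
    }
  qed
qed

end

text \<open>The maps \<open>\<tau>\<close> separate vectors, so compatibility with them alone forces
  \<open>D\<close> to commute with the arrows and to square to zero: both sides are compared after
  pairing with every \<open>h\<close>.\<close>

lemma nakayama_is_cpx:
  fixes P :: "'k::field cpx"
  assumes P: "is_cpx t P" and na: "\<And>n. nakayama_via t (obj P n) (N n) (\<tau> n)"
    and D: "\<And>n j. D n j \<in> carrier_mat (dimv (N (n + 1)) j) (dimv (N n) j)"
    and c: "\<And>n j v h. j \<in> {1..t} \<Longrightarrow> v \<in> carrier_vec (dimv (N n) j) \<Longrightarrow> h \<in> homs t (obj P (n + 1)) (Ae t j) \<Longrightarrow>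
      \<tau> (n + 1) j (D n j *\<^sub>v v) h = \<tau> n j v (h \<circ>\<^sub>h dif P n)"
    and bnd: "\<exists>a b. \<forall>n. n < a \<or> b < n \<longrightarrow> is_zero_rep (N n)"
  shows "nakayama_cpx t P \<lparr>obj = N, dif = D\<rparr>"
proof -
  have mN: "is_module t (N n)" for n using na by (simp add: nakayama_via_def)
  have mP: "is_module t (obj P n)" for n by (rule cpx_mod[OF P])
  have inj: "x = y" if "j \<in> {1..t}" "x \<in> carrier_vec (dimv (N n) j)" "y \<in> carrier_vec (dimv (N n) j)"
    "\<And>h. h \<in> homs t (obj P n) (Ae t j) \<Longrightarrow> \<tau> n j x h = \<tau> n j y h" for n j x y
  proof -
    have b: "bij_betw (\<tau> n j) (carrier_vec (dimv (N n) j)) (dual_homs t (obj P n) (Ae t j))"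
      using na that(1) by (simp add: nakayama_via_def)
    have "\<tau> n j x \<in> extensional (homs t (obj P n) (Ae t j))" "\<tau> n j y \<in> extensional (homs t (obj P n) (Ae t j))"
      using bij_betwE[OF b] that(2,3) by (auto simp: dual_homs_def)
    then have "\<tau> n j x = \<tau> n j y" using that(4) by (intro extensionalityI)
    then show ?thesis using bij_betw_imp_inj_on[OF b] that(2,3) by (simp add: inj_on_eq_iff)
  qed
  have NA: "arrA (N n) j \<in> carrier_mat (dimv (N n) (Suc j)) (dimv (N n) j)" 
    and NB: "arrB (N n) j \<in> carrier_mat (dimv (N n) j) (dimv (N n) (Suc j))" for n j
    using module_A[OF mN] module_B[OF mN] by auto
  have tA: "\<tau> n (Suc j) (arrA (N n) j *\<^sub>v v) h = \<tau> n j v (rmultA t j \<circ>\<^sub>h h)"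
    if "1 \<le> j" "j < t" "v \<in> carrier_vec (dimv (N n) j)" "h \<in> homs t (obj P n) (Ae t (Suc j))" for n j v h
    using na[of n] that by (simp add: nakayama_via_def)
  have tB: "\<tau> n j (arrB (N n) j *\<^sub>v v) h = \<tau> n (Suc j) v (rmultB t j \<circ>\<^sub>h h)"
    if "1 \<le> j" "j < t" "v \<in> carrier_vec (dimv (N n) (Suc j))" "h \<in> homs t (obj P n) (Ae t j)" for n j v h
    using na[of n] that by (simp add: nakayama_via_def)
  have hd: "h \<circ>\<^sub>h dif P n \<in> homs t (obj P n) (Ae t j)" if "j \<in> {1..t}" "h \<in> homs t (obj P (n + 1)) (Ae t j)" for n j h
    using that is_hom_comp[OF mP mP is_module_Ae cpx_dif[OF P], of j n h] by (simp add: homs_def)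
  have assoc: "g \<circ>\<^sub>h (h \<circ>\<^sub>h f) = (g \<circ>\<^sub>h h) \<circ>\<^sub>h f"
    if "is_hom t A1 A2 f" "is_hom t A2 A3 h" "is_hom t A3 A4 g" for A1 A2 A3 A4 :: "'k rep" and f g h
    using assoc_mult_mat[OF hom_c[OF that(3)] hom_c[OF that(2)] hom_c[OF that(1)]] by (simp add: hom_comp_def)
  have hom: "is_hom t (N n) (N (n + 1)) (D n)" for n
    unfolding is_hom_def
  proof (intro conjI allI impI; (elim conjE)?)
    fix j assume j: "1 \<le> j" "j < t"
    have mA: "is_module t (Ae t j :: 'k rep)" "is_module t (Ae t (Suc j) :: 'k rep)" using is_module_Ae j by auto
    note rA' = rA_hom[OF j, where 'a = 'k, folded rmultA_eq[OF j]] and rB' = rB_hom[OF j, where 'a = 'k, folded rmultB_eq[OF j]]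
    show "D n (j + 1) * arrA (N n) j = arrA (N (n + 1)) j * D n j"
    proof (rule mat_eq_unit)
      show "D n (j + 1) * arrA (N n) j \<in> carrier_mat (dimv (N (n + 1)) (Suc j)) (dimv (N n) j)"
        using mult_carrier_mat[OF D NA] by simp
      show "arrA (N (n + 1)) j * D n j \<in> carrier_mat (dimv (N (n + 1)) (Suc j)) (dimv (N n) j)"
        by (rule mult_carrier_mat[OF NA D])
      fix q
      let ?v = "unit_vec (dimv (N n) j) q :: 'k vec"
      have v: "?v \<in> carrier_vec (dimv (N n) j)" by simp
      note Av = mult_mat_vec_carrier[OF NA v] and Dv = mult_mat_vec_carrier[OF D v]
      have "D n (Suc j) *\<^sub>v (arrA (N n) j *\<^sub>v ?v) = arrA (N (n + 1)) j *\<^sub>v (D n j *\<^sub>v ?v)"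
      proof (rule inj[of "Suc j" _ "n + 1"])
        fix h assume h: "h \<in> homs t (obj P (n + 1)) (Ae t (Suc j))"
        then have h': "is_hom t (obj P (n + 1)) (Ae t (Suc j)) h" by (simp add: homs_def)
        have rh: "rmultA t j \<circ>\<^sub>h h \<in> homs t (obj P (n + 1)) (Ae t j)"
          using is_hom_comp[OF mP mA(2,1) h' rA'] by (simp add: homs_def)
        have "\<tau> (n + 1) (Suc j) (D n (Suc j) *\<^sub>v (arrA (N n) j *\<^sub>v ?v)) h = \<tau> n j ?v (rmultA t j \<circ>\<^sub>h (h \<circ>\<^sub>h dif P n))"
          using c[OF _ Av h] tA[OF j v hd[OF _ h]] j by simp
        also have "\<dots> = \<tau> (n + 1) (Suc j) (arrA (N (n + 1)) j *\<^sub>v (D n j *\<^sub>v ?v)) h"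
          unfolding assoc[OF cpx_dif[OF P] h' rA'] using tA[OF j Dv h] c[OF _ v rh] j by simp
        finally show "\<tau> (n + 1) (Suc j) (D n (Suc j) *\<^sub>v (arrA (N n) j *\<^sub>v ?v)) h =
            \<tau> (n + 1) (Suc j) (arrA (N (n + 1)) j *\<^sub>v (D n j *\<^sub>v ?v)) h" .
      qed (use j mult_mat_vec_carrier[OF D Av] mult_mat_vec_carrier[OF NA Dv] in auto)
      then show "D n (j + 1) * arrA (N n) j *\<^sub>v ?v = arrA (N (n + 1)) j * D n j *\<^sub>v ?v"
        using assoc_mult_mat_vec[OF D NA v] assoc_mult_mat_vec[OF NA D v] by simp
    qed
    show "D n j * arrB (N n) j = arrB (N (n + 1)) j * D n (j + 1)"
    proof (rule mat_eq_unit)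
      show "D n j * arrB (N n) j \<in> carrier_mat (dimv (N (n + 1)) j) (dimv (N n) (Suc j))"
        by (rule mult_carrier_mat[OF D NB])
      show "arrB (N (n + 1)) j * D n (j + 1) \<in> carrier_mat (dimv (N (n + 1)) j) (dimv (N n) (Suc j))"
        using mult_carrier_mat[OF NB D] by simp
      fix q
      let ?v = "unit_vec (dimv (N n) (Suc j)) q :: 'k vec"
      have v: "?v \<in> carrier_vec (dimv (N n) (Suc j))" by simp
      note Bv = mult_mat_vec_carrier[OF NB v] and Dv = mult_mat_vec_carrier[OF D v]
      have "D n j *\<^sub>v (arrB (N n) j *\<^sub>v ?v) = arrB (N (n + 1)) j *\<^sub>v (D n (Suc j) *\<^sub>v ?v)"
      proof (rule inj[of j _ "n + 1"])
        fix h assume h: "h \<in> homs t (obj P (n + 1)) (Ae t j)"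
        then have h': "is_hom t (obj P (n + 1)) (Ae t j) h" by (simp add: homs_def)
        have rh: "rmultB t j \<circ>\<^sub>h h \<in> homs t (obj P (n + 1)) (Ae t (Suc j))"
          using is_hom_comp[OF mP mA h' rB'] by (simp add: homs_def)
        have "\<tau> (n + 1) j (D n j *\<^sub>v (arrB (N n) j *\<^sub>v ?v)) h = \<tau> n (Suc j) ?v (rmultB t j \<circ>\<^sub>h (h \<circ>\<^sub>h dif P n))"
          using c[OF _ Bv h] tB[OF j v hd[OF _ h]] j by simp
        also have "\<dots> = \<tau> (n + 1) j (arrB (N (n + 1)) j *\<^sub>v (D n (Suc j) *\<^sub>v ?v)) h"
          unfolding assoc[OF cpx_dif[OF P] h' rB'] using tB[OF j Dv h] c[OF _ v rh] j by simp
        finally show "\<tau> (n + 1) j (D n j *\<^sub>v (arrB (N n) j *\<^sub>v ?v)) h =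
            \<tau> (n + 1) j (arrB (N (n + 1)) j *\<^sub>v (D n (Suc j) *\<^sub>v ?v)) h" .
      qed (use j mult_mat_vec_carrier[OF D Bv] mult_mat_vec_carrier[OF NB Dv] in auto)
      then show "D n j * arrB (N n) j *\<^sub>v ?v = arrB (N (n + 1)) j * D n (j + 1) *\<^sub>v ?v"
        using assoc_mult_mat_vec[OF D NB v] assoc_mult_mat_vec[OF NB D v] by simp
    qed
  qed (rule D)
  have DD: "mv (D (n + 1) j) (mv (D n j) x) = 0" for n j x
  proof (cases "j \<in> {1..t}")
    case False
    have "D n j \<in> carrier_mat (dimv (N (n + 1)) j) 0" using D[of n j] module_dim0[OF mN False] by simp
    then show ?thesis by (simp add: mv_zero_dim mv_lin)
  next
    case j: True
    let ?v = "vec (dimv (N n) j) x"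
    have v: "?v \<in> carrier_vec (dimv (N n) j)" by simp
    note Dv = mult_mat_vec_carrier[OF D v]
    note DDv = mult_mat_vec_carrier[OF D Dv]
    have "D (n + 1) j *\<^sub>v (D n j *\<^sub>v ?v) = 0\<^sub>v (dimv (N (n + 1 + 1)) j)"
    proof (rule inj[OF j DDv])
      fix h assume h: "h \<in> homs t (obj P (n + 1 + 1)) (Ae t j)"
      then have h': "is_hom t (obj P (n + 1 + 1)) (Ae t j) h" by (simp add: homs_def)
      have lin0: "\<tau> m j u (hom_zero (obj P m) (Ae t j)) = 0" if u: "u \<in> carrier_vec (dimv (N m) j)" for m u
      proof -
        have "bij_betw (\<tau> m j) (carrier_vec (dimv (N m) j)) (dual_homs t (obj P m) (Ae t j))"
          using na[of m] j by (simp add: nakayama_via_def)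
        then have dh: "\<tau> m j u \<in> dual_homs t (obj P m) (Ae t j)" using u by (auto dest: bij_betwE)
        have z: "hom_zero (obj P m) (Ae t j) \<in> homs t (obj P m) (Ae t j)"
          using is_hom_zero[OF mP is_module_Ae] j by (simp add: homs_def)
        have "\<tau> m j u (0 \<cdot>\<^sub>h hom_zero (obj P m) (Ae t j)) = 0 * \<tau> m j u (hom_zero (obj P m) (Ae t j))"
          using dh z unfolding dual_homs_def by blast
        moreover have "0 \<cdot>\<^sub>h hom_zero (obj P m) (Ae t j) = (hom_zero (obj P m) (Ae t j) :: 'k hom)"
          by (auto simp: hom_smult_def hom_zero_def)
        ultimately show ?thesis by simp
      qed
      have z: "(h \<circ>\<^sub>h dif P (n + 1)) \<circ>\<^sub>h dif P n = hom_zero (obj P n) (Ae t j)"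
        using hd[OF j hd[OF j h]] is_hom_zero[OF mP is_module_Ae] j
        by (intro hom_eqI[OF mP])
          (auto simp: homs_def mv_comp[OF cpx_dif[OF P] is_hom_comp[OF mP mP is_module_Ae cpx_dif[OF P] h']]
            mv_comp[OF cpx_dif[OF P] h'] cpx_dd[OF P] mv_lin)
      have zz: "\<tau> (n + 1 + 1) j (0\<^sub>v (dimv (N (n + 1 + 1)) j)) h = 0"
      proof -
        have "\<tau> (n + 1 + 1) j (0 \<cdot>\<^sub>v 0\<^sub>v (dimv (N (n + 1 + 1)) j)) h = 0 * \<tau> (n + 1 + 1) j (0\<^sub>v (dimv (N (n + 1 + 1)) j)) h"
          using na[of "n + 1 + 1"] j h by (simp add: nakayama_via_def)
        moreover have "0 \<cdot>\<^sub>v 0\<^sub>v (dimv (N (n + 1 + 1)) j) = (0\<^sub>v (dimv (N (n + 1 + 1)) j) :: 'k vec)" by auto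
        ultimately show ?thesis by simp
      qed
      show "\<tau> (n + 1 + 1) j (D (n + 1) j *\<^sub>v (D n j *\<^sub>v ?v)) h = \<tau> (n + 1 + 1) j (0\<^sub>v (dimv (N (n + 1 + 1)) j)) h"
        using c[OF j Dv h] c[OF j v hd[OF j h]] z lin0[OF v] zz by simp
    qed simp
    then have "mv (D (n + 1) j) (mv (D n j) (fv ?v)) = 0"
      using fv_mult[OF D Dv] fv_mult[OF D v] by simp
    moreover have "mv (D n j) (fv ?v) = mv (D n j) x"
      using mv_trunc[OF D[of n j], of x] by (simp add: fv_def cong: if_cong)
    ultimately show ?thesis by simp
  qed
  have h2: "is_hom t (N (n + 1)) (N (n + 2)) (D (n + 1))" for n using hom[of "n + 1"] by (simp only: add.assoc one_add_one)
  have "D (n + 1) \<circ>\<^sub>h D n = hom_zero (N n) (N (n + 2))" for n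
    by (rule hom_eqI[OF mN is_hom_comp[OF mN mN mN hom h2] is_hom_zero[OF mN mN]])
      (simp add: mv_comp[OF hom h2] DD)
  then have "is_cpx t \<lparr>obj = N, dif = D\<rparr>" using mN hom bnd by (simp add: is_cpx_def)
  then show ?thesis unfolding nakayama_cpx_def by (auto intro!: exI[of _ \<tau>] na c)
qed

text \<open>Each \<beta> of the descent is exchanged with the \<alpha> before it by one relation,
  until the initial \<alpha>_j has become the final \<alpha>_e.\<close>

lemma dnn_A: 
  assumes M: "is_module t M" and "e \<le> j" "j < t"
  shows "dnn M (Suc j) (mv (arrA M j) v) (j - e) = mv (arrA M e) (dnn M j v (j - e))"
  using assms(2)
proof (induction e rule: inc_induct)
  case (step e)
  have s: "j - e = Suc (j - Suc e)" "Suc j - Suc (j - Suc e) = Suc e" "j - Suc (j - Suc e) = e" using step by auto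
  have "dnn M (Suc j) (mv (arrA M j) v) (j - e) = mv (arrB M (Suc e)) (mv (arrA M (Suc e)) (dnn M j v (j - Suc e)))"
    using step.IH s by simp
  also have "\<dots> = mv (arrA M e) (mv (arrB M e) (dnn M j v (j - Suc e)))"
    using module_rel[OF M, of "Suc e"] step assms(3) by simp
  finally show ?case using s by simp
qed simp

lemma dnn_B: "n \<le> j \<Longrightarrow> dnn M j (mv (arrB M j) v) n = dnn M (Suc j) v (Suc n)"
  by (induction n) simp_all

lemma upn_A: "upn M (Suc e) (mv (arrA M e) v) n = upn M e v (Suc n)"
  by (induction n) simp_all

lemma upn_zero: "upn M j 0 n = 0"
  by (rule lin_zero[of "\<lambda>v. upn M j v n"]) (simp add: lin_def upn_lin)

text \<open>After the exchange the path turns at \<open>e\<close> instead of \<open>e + 1\<close>,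
  which is index \<open>e - 1\<close>; for \<open>e = 0\<close> it would pass through vertex
  0.\<close>

lemma pth_precomp_A:
  assumes M: "is_module t M" and "1 \<le> j" "j < t" "e \<le> j" "e < i"
  shows "pth M i e (Suc j) (mv (arrA M j) v) = (if e = 0 then 0 else pth M i (e - 1) j v)"
proof (cases e)
  case 0
  have "mv (arrA M 0) w = 0" for w
    using module_A[OF M, of 0] module_dim0[OF M, of 0] by (simp add: mv_zero_dim)
  then show ?thesis
    using dnn_A[OF M, of 0 j v] assms 0 upn_lin(2)[of M 1 0 0 "i - 1"] by (simp add: pth_def upn_zero)
next
  case (Suc e')
  then have "j - e = j - Suc e'" "i - e = Suc (i - Suc e)" "i - Suc e' = Suc (i - Suc e)" using assms by auto
  then show ?thesis using dnn_A[OF M, of e j v] assms Suc by (simp add: pth_def upn_A)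
qed

lemma pth_precomp_B:
  assumes "1 \<le> j" "e < j"
  shows "pth M i e j (mv (arrB M j) v) = pth M i e (Suc j) v"
  using dnn_B[of "j - Suc e" j M v] assms by (simp add: pth_def Suc_diff_Suc)

context std
begin

section \<open>The Serre functor on modules of rank zero\<close>

text \<open>The Nakayama functor turns right multiplication by an arrow into the transpose of left
  multiplication. Compared with \<open>p1\<close> the roles change: \<alpha> keeps the path index
  and \<beta> raises it.\<close>

definition q1 :: "(gidx \<times> nat \<Rightarrow> 'k) \<Rightarrow> gidx \<times> nat \<Rightarrow> 'k" where
  "q1 y = (\<lambda>((\<kappa>, i, r), e). if \<kappa> = 0 then
     (row y 1 i e - a (i - 1) (row y 1 (i - 1) e) + (if e = 0 then 0 else row y 2 (i - 1) (e - 1)) - b i (row y 2 i e)) r else 0)"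

definition q2 :: "(gidx \<times> nat \<Rightarrow> 'k) \<Rightarrow> gidx \<times> nat \<Rightarrow> 'k" where
  "q2 y = (\<lambda>((\<kappa>, i, r), e). if \<kappa> = 1 then ((if e = 0 then 0 else row y 0 i (e - 1)) - b i (row y 0 (Suc i) e)) r
     else if \<kappa> = 2 then (a i (row y 0 i e) - row y 0 (Suc i) e) r else 0)"

definition qop :: "int \<Rightarrow> (gidx \<times> nat \<Rightarrow> 'k) \<Rightarrow> gidx \<times> nat \<Rightarrow> 'k" where
  "qop n = (if n = -1 then q1 else if n = -2 then q2 else (\<lambda>y. 0))"

lemma row_q1: "row (q1 y) \<kappa> i e = (if \<kappa> = 0 then
     row y 1 i e - a (i - 1) (row y 1 (i - 1) e) + (if e = 0 then 0 else row y 2 (i - 1) (e - 1)) - b i (row y 2 i e) else 0)"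
  by (auto simp: row_def q1_def fun_eq_iff)

lemma row_q2: "row (q2 y) \<kappa> i e = (if \<kappa> = 1 then (if e = 0 then 0 else row y 0 i (e - 1)) - b i (row y 0 (Suc i) e)
     else if \<kappa> = 2 then a i (row y 0 i e) - row y 0 (Suc i) e else 0)"
  by (auto simp: row_def q2_def fun_eq_iff)

lemma lin_qop: "lin (qop n)"
proof -
  have "lin q1" unfolding lin_def
    by (intro conjI allI row_eqI) (simp_all add: row_q1 mv_lin fun_eq_iff algebra_simps)
  moreover have "lin q2" unfolding lin_def
    by (intro conjI allI row_eqI) (simp_all add: row_q2 mv_lin fun_eq_iff algebra_simps)
  moreover have "lin (\<lambda>y. 0)" by (auto simp: lin_def fun_eq_iff)
  ultimately show ?thesis by (auto simp: qop_def)
qed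

definition ND :: "int \<Rightarrow> 'k hom" where "ND n j = opm (Bs (n + 1) j) (Bs n j) (qop n)"
definition NN :: "'k cpx" where "NN = \<lparr>obj = (\<lambda>n. Nm t (Gs n) nu), dif = ND\<rparr>"

lemma mv_ND: "mv (ND n j) x = ci (Bs (n + 1) j) (qop n (co (Bs n j) x))"
  unfolding ND_def by (simp add: mv_opm[OF finB lin_qop])

abbreviation pr :: "int \<Rightarrow> nat \<Rightarrow> (gidx \<times> nat \<Rightarrow> 'k) \<Rightarrow> 'k hom \<Rightarrow> 'k" where
  "pr n \<equiv> gens.pair t (Gs n) nu"

lemmas pr_lin = gens.pair_lin[OF gens_Gs]

lemma pr_plc:
  assumes j: "j \<in> {1..t}" and o: "okg t n \<kappa> i" and v: "v \<in> fs {..<mlt \<kappa> i}"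
  shows "pr n j (plc \<kappa> i e v) h = et (vtx \<kappa> i) j (ev n h \<kappa> i v) e"
proof -
  have l1: "lin (\<lambda>v (_::unit). pr n j (plc \<kappa> i e v) h)"
    by (auto simp: lin_def lin_add[OF lin_plc] lin_scl[OF lin_plc] pr_lin fun_eq_iff)
  have l2: "lin (\<lambda>v (_::unit). et (vtx \<kappa> i) j (ev n h \<kappa> i v) e)"
    by (auto simp: lin_def lin_add[OF lin_ev] lin_scl[OF lin_ev] et_lin fun_eq_iff)
  have "(\<lambda>_::unit. pr n j (plc \<kappa> i e v) h) = (\<lambda>_. et (vtx \<kappa> i) j (ev n h \<kappa> i v) e)"
  proof (rule lin_eqI[OF l1 l2 _ _ v])
    fix r assume r: "r \<in> {..<mlt \<kappa> i}"
    have g: "(\<kappa>, i, r) \<in> Gs n" using o r by (simp add: Gs_def)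
    have E: "gens.En t (Gs n) nu j h ((\<kappa>, i, r), e) = et (vtx \<kappa> i) j (ev n h \<kappa> i (dlt r)) e"
      unfolding gens.En_def[OF gens_Gs] ev_def gen_def plc_dlt using g by (simp add: nu_def[abs_def])
    show "(\<lambda>_::unit. pr n j (plc \<kappa> i e (dlt r)) h) = (\<lambda>_. et (vtx \<kappa> i) j (ev n h \<kappa> i (dlt r)) e)"
    proof (cases "e < vtx \<kappa> i \<and> e < j")
      case True
      then have "((\<kappa>, i, r), e) \<in> Bs n j" using g j by (simp add: FB_def nu_def)
      then show ?thesis by (simp add: plc_dlt gens.pair_dlt[OF gens_Gs] E)
    next
      case False
      then have "((\<kappa>, i, r), e) \<notin> Bs n j" by (auto simp: FB_def nu_def)
      then have "pr n j (dlt ((\<kappa>, i, r), e)) h = 0"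
        unfolding gens.pair_def[OF gens_Gs] by (intro sum.neutral) (auto simp: dlt_def)
      then show ?thesis using False by (auto simp: plc_dlt et_def)
    qed
  qed simp
  then show ?thesis by (rule fun_cong)
qed

lemma pr_plc_out: "\<not> okg t n \<kappa> i \<Longrightarrow> pr n j (plc \<kappa> i e v) h = 0"
  unfolding gens.pair_def[OF gens_Gs] by (intro sum.neutral) (auto simp: plc_def FB_def Gs_def)

lemma q1_plc1: "1 \<le> i \<Longrightarrow> q1 (plc 1 i e v) = plc 0 i e v - plc 0 (Suc i) e (a i v)"
  by (rule row_eqI) (auto simp: row_q1 row_plc mv_lin)

lemma q1_plc2: "1 \<le> i \<Longrightarrow> q1 (plc 2 i e v) = plc 0 (Suc i) (Suc e) v - plc 0 i e (b i v)"
  by (rule row_eqI) (auto simp: row_q1 row_plc mv_lin)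

lemma q2_plc: "1 \<le> i \<Longrightarrow> q2 (plc 0 i e v) = plc 1 i (Suc e) v - plc 1 (i - 1) e (b (i - 1) v)
    + plc 2 i e (a i v) - plc 2 (i - 1) e v"
  by (rule row_eqI, cases i) (auto simp: row_q2 row_plc mv_lin)

text \<open>\<open>qop\<close> is the transpose of \<open>dop\<close> under the pairing. On basis
  vectors this reduces to the formulas for \<open>ev\<close> and the action of the arrows of
  \<open>Ae\<close> in socle indices (\<open>et_A\<close>, \<open>et_B\<close>).\<close>

lemma pr_dual:
  assumes j: "j \<in> {1..t}" and h: "is_hom t (obj PP (n + 1)) (Ae t j) h" and y: "y \<in> fs (Bs n j)"
  shows "pr (n + 1) j (qop n y) h = pr n j y (h \<circ>\<^sub>h dif PP n)"
proof -
  have N: "is_module t (Ae t j :: 'k rep)" and j': "1 \<le> j" "j \<le> t" using j is_module_Ae by auto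
  have l1: "lin (\<lambda>y (_::unit). pr (n + 1) j (qop n y) h)"
    by (auto simp: lin_def lin_add[OF lin_qop] lin_scl[OF lin_qop] pr_lin fun_eq_iff)
  have l2: "lin (\<lambda>y (_::unit). pr n j y (h \<circ>\<^sub>h dif PP n))"
    by (auto simp: lin_def pr_lin fun_eq_iff)
  have "(\<lambda>_::unit. pr (n + 1) j (qop n y) h) = (\<lambda>_. pr n j y (h \<circ>\<^sub>h dif PP n))"
  proof (rule lin_eqI[OF l1 l2 finB _ y])
    fix bb assume "bb \<in> Bs n j"
    then obtain \<kappa> i r e where bb: "bb = ((\<kappa>, i, r), e)" and o: "okg t n \<kappa> i" and r: "r < mlt \<kappa> i"
      by (auto simp: FB_def Gs_def)
    define v :: "nat \<Rightarrow> 'k" where "v = dlt r"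
    have v: "v \<in> fs {..<mlt \<kappa> i}" using r by (simp add: v_def fs_dlt)
    have R: "pr n j (plc \<kappa> i e v) (h \<circ>\<^sub>h dif PP n) = et (vtx \<kappa> i) j (ev n (h \<circ>\<^sub>h dif PP n) \<kappa> i v) e"
      by (rule pr_plc[OF j o v])
    have m: "mlt 0 i = d i" "mlt 1 i = d i" "mlt 2 i = d (Suc i)" for i by (auto simp: mlt_def)
    have vx: "vtx 0 i = i" "vtx 1 i = Suc i" "vtx 2 i = i" for i by (auto simp: vtx_def)
    have "pr (n + 1) j (qop n (plc \<kappa> i e v)) h = pr n j (plc \<kappa> i e v) (h \<circ>\<^sub>h dif PP n)"
    proof -
      consider "n = -1" "\<kappa> = 1" "1 \<le> i" "i < t" | "n = -1" "\<kappa> = 2" "1 \<le> i" "i < t" | "n = -2" "\<kappa> = 0" "1 \<le> i" "i < t" | "n = 0"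
        using o by (auto simp: okg_def)
      then show ?thesis
      proof cases
        case 1
        have h0: "is_hom t (obj PP 0) (Ae t j) h" using h 1(1) by simp
        have o': "okg t 0 0 i" "okg t 0 0 (Suc i)" using 1 by (auto simp: okg_def)
        have v': "v \<in> fs {..<d i}" using v 1(2) m by simp
        show ?thesis
          unfolding R unfolding 1(1,2) vx
          using pr_plc[OF j o'(1), of v e h] pr_plc[OF j o'(2), of "a i v" e h] v' a_fs[of i v]
            ev_d1(1)[OF N h0 1(3,4) v'] et_A[OF 1(3,4) j', of "ev 0 h 0 i v" e]
          by (simp add: qop_def q1_plc1[OF 1(3), unfolded One_nat_def] pr_lin m vx et_lin)
      next
        case 2
        have h0: "is_hom t (obj PP 0) (Ae t j) h" using h 2(1) by simp
        have o': "okg t 0 0 i" "okg t 0 0 (Suc i)" using 2 by (auto simp: okg_def)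
        have v': "v \<in> fs {..<d (Suc i)}" using v 2(2) m by simp
        show ?thesis
          unfolding R unfolding 2(1,2) vx
          using pr_plc[OF j o'(2), of v "Suc e" h] pr_plc[OF j o'(1), of "b i v" e h] v' b_fs[of i v]
            ev_d1(2)[OF N h0 2(3,4) v'] et_B[OF 2(3,4) j', of "ev 0 h 0 (Suc i) v" e]
          by (simp add: qop_def q1_plc2[OF 2(3)] pr_lin m vx et_lin)
      next
        case 3
        have h0: "is_hom t (obj PP (-1)) (Ae t j) h" using h 3(1) by simp
        have o': "okg t (-1) 1 i" "okg t (-1) 2 i" using 3 by (auto simp: okg_def)
        have v': "v \<in> fs {..<d i}" using v 3(2) m by simp
        have p1: "pr (-1) j (plc 1 i (Suc e) v) h = et (Suc i) j (ev (-1) h 1 i v) (Suc e)"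
          using pr_plc[OF j o'(1), of v "Suc e" h] v' unfolding m vx by simp
        have p2: "pr (-1) j (plc 2 i e (a i v)) h = et i j (ev (-1) h 2 i (a i v)) e"
          using pr_plc[OF j o'(2), of "a i v" e h] a_fs[of i v] unfolding m vx by simp
        have q: "pr (-1) j (q2 (plc 0 i e v)) h = pr (-1) j (plc 1 i (Suc e) v) h - pr (-1) j (plc 1 (i - 1) e (b (i - 1) v)) h
            + pr (-1) j (plc 2 i e (a i v)) h - pr (-1) j (plc 2 (i - 1) e v) h"
          unfolding q2_plc[OF 3(3)] pr_lin ..
        have L: "pr (n + 1) j (qop n (plc \<kappa> i e v)) h = pr (-1) j (q2 (plc 0 i e v)) h"
          using 3 by (simp add: qop_def)
        have eB: "et i j (mv (arrB (Ae t j) i) w) e = et (Suc i) j w (Suc e)" for w :: "nat \<Rightarrow> 'k"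
          by (rule et_B[OF 3(3,4) j'])
        show ?thesis
        proof (cases "i = 1")
          case True
          have z: "pr (-1) j (plc 1 (i - 1) e (b (i - 1) v)) h = 0" "pr (-1) j (plc 2 (i - 1) e v) h = 0"
            using True by (auto intro!: pr_plc_out simp: okg_def)
          have "ev (-2) (h \<circ>\<^sub>h dif PP (-2)) 0 i v = mv (arrB (Ae t j) i) (ev (-1) h 1 i v) + ev (-1) h 2 i (a i v)"
            using ev_d2[OF N h0 3(3,4) v'] True by simp
          then show ?thesis unfolding R L q z p1 p2 unfolding 3(1,2) vx by (simp add: et_lin eB)
        next
          case False
          then obtain l where l: "i = Suc l" "1 \<le> l" "l < t" using 3 by (cases i) auto
          have o'': "okg t (-1) 1 l" "okg t (-1) 2 l" using l by (auto simp: okg_def)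
          have p3: "pr (-1) j (plc 1 (i - 1) e (b (i - 1) v)) h = et i j (ev (-1) h 1 l (b l v)) e"
            using pr_plc[OF j o''(1), of "b l v" e h] b_fs[of l v] l unfolding m vx by simp
          have p4: "pr (-1) j (plc 2 (i - 1) e v) h = et l j (ev (-1) h 2 l v) e"
            using pr_plc[OF j o''(2), of v e h] v' l unfolding m vx by simp
          have "ev (-2) (h \<circ>\<^sub>h dif PP (-2)) 0 i v = mv (arrB (Ae t j) i) (ev (-1) h 1 i v) + ev (-1) h 2 i (a i v)
            - (ev (-1) h 1 l (b l v) + mv (arrA (Ae t j) l) (ev (-1) h 2 l v))"
            using ev_d2[OF N h0 3(3,4) v'] l by simp
          moreover have "et i j (mv (arrA (Ae t j) l) (ev (-1) h 2 l v)) e = et l j (ev (-1) h 2 l v) e"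
            unfolding l(1) by (rule et_A[OF l(2,3) j'])
          ultimately show ?thesis unfolding R L q p1 p2 p3 p4 unfolding 3(1,2) vx by (simp add: et_lin eB)
        qed
      next
        case 4
        have "mv (dif PP 0 i) x = 0" for i x by (simp add: mv_PP dop_def ci_lin)
        then have "ev 0 (h \<circ>\<^sub>h dif PP 0) \<kappa> i v = 0"
          using h 4 by (simp add: ev_def mv_comp[OF cpx_dif[OF cpx_PP]] mv_lin del: obj_PP)
        then show ?thesis unfolding R unfolding 4 by (simp add: qop_def pr_lin et_lin)
      qed
    qed
    then show "(\<lambda>_::unit. pr (n + 1) j (qop n (dlt bb)) h) = (\<lambda>_. pr n j (dlt bb) (h \<circ>\<^sub>h dif PP n))"
      by (simp add: bb v_def plc_dlt)
  qed
  then show ?thesis by (rule fun_cong)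
qed

lemma nak_NN: "nakayama_cpx t PP NN"
  unfolding NN_def
proof (rule nakayama_is_cpx[OF cpx_PP])
  show "nakayama_via t (obj PP n) (Nm t (Gs n) nu) (gens.tau t (Gs n) nu)" for n
    using gens.nakayama[OF gens_Gs] by simp
  show D: "ND n j \<in> carrier_mat (dimv (Nm t (Gs (n + 1)) nu :: 'k rep) j) (dimv (Nm t (Gs n) nu :: 'k rep) j)" for n j
    by (simp add: ND_def gens.dimF[OF gens_Gs] opm_carrier)
  show "gens.tau t (Gs (n + 1)) nu j (ND n j *\<^sub>v v) h = gens.tau t (Gs n) nu j v (h \<circ>\<^sub>h dif PP n)"
    if j: "j \<in> {1..t}" and v: "v \<in> carrier_vec (dimv (Nm t (Gs n) nu :: 'k rep) j)" and h: "h \<in> homs t (obj PP (n + 1)) (Ae t j)"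
    for n j v h
  proof -
    have h': "is_hom t (obj PP (n + 1)) (Ae t j) h" using h by (simp add: homs_def)
    have N: "is_module t (Ae t j :: 'k rep)" using j is_module_Ae by auto
    have hd: "h \<circ>\<^sub>h dif PP n \<in> homs t (obj PP n) (Ae t j)" using comp_dif[OF N h'] by (simp add: homs_def)
    have "co (Bs (n + 1) j) (fv (ND n j *\<^sub>v v)) = res (Bs (n + 1) j) (qop n (co (Bs n j) (fv v)))"
      using fv_mult[OF D v] by (simp add: mv_ND co_ci[OF finB])
    then show ?thesis
      using h hd pr_dual[OF j h' co_fs[OF finB]]
      by (simp add: gens.tau_def[OF gens_Gs] gens.pair_res[OF gens_Gs])
  qed
  have "is_zero_rep (Nm t (Gs n) nu :: 'k rep)" if "n < -2 \<or> 0 < n" for n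
  proof -
    have "Gs n = {}" using that by (auto simp: Gs_def okg_def)
    then show ?thesis by (simp add: is_zero_rep_def Nm_def FB_def)
  qed
  then show "\<exists>a b. \<forall>n. n < a \<or> b < n \<longrightarrow> is_zero_rep (Nm t (Gs n) nu :: 'k rep)" by blast
qed

lemma cpx_NN: "is_cpx t NN" using nak_NN by (simp add: nakayama_cpx_def)

end

lemma co_nat_res: "co {..<n::nat} x = (\<lambda>r. if r < n then x r else 0)"
proof -
  have "ci {..<n} x = (\<lambda>r. if r < n then x r else 0)" by (auto simp: ci_def fun_eq_iff lst_nat)
  moreover have "co {..<n} x = co {..<n} (ci {..<n} x)"
    unfolding co_def by (rule sum.cong) (auto simp: ci_def lst_nat)
  ultimately show ?thesis using co_ci[of "{..<n}" x] by (auto simp: res_def)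
qed

section \<open>The embedding of M into degree -2 of the Nakayama complex\<close>

context std
begin

text \<open>The canonical map from M_j to Hom(e_i A e_j, M_i), taking m to x \<mapsto> x m, in the
  coordinates dual to paths.\<close>

definition Iop :: "nat \<Rightarrow> (nat \<Rightarrow> 'k) \<Rightarrow> gidx \<times> nat \<Rightarrow> 'k" where
  "Iop j m = (\<lambda>((\<kappa>, i, r), e). if okr (-2) j \<kappa> i e then pth M i e j m r else 0)"

definition iot :: "'k hom" where
  "iot j = opm (Bs (-2) j) {..<d j} (Iop j)"

lemma row_Iop: "row (Iop j m) \<kappa> i e = (if okr (-2) j \<kappa> i e then pth M i e j m else 0)"
  by (auto simp: row_def Iop_def fun_eq_iff)

lemma lin_Iop: "lin (Iop j)"
  unfolding lin_def
  by (intro conjI allI row_eqI) (auto simp: row_Iop lin_add[OF lin_pth] lin_scl[OF lin_pth])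

lemma okr2: "okr (-2) j \<kappa> i e \<longleftrightarrow> \<kappa> = 0 \<and> 1 \<le> i \<and> i < t \<and> 1 \<le> j \<and> j \<le> t \<and> e < i \<and> e < j"
  and okr1: "okr (-1) j \<kappa> i e \<longleftrightarrow> (\<kappa> = 1 \<and> e \<le> i \<or> \<kappa> = 2 \<and> e < i) \<and> 1 \<le> i \<and> i < t \<and> 1 \<le> j \<and> j \<le> t \<and> e < j"
  and okr0: "okr 0 j \<kappa> i e \<longleftrightarrow> \<kappa> = 0 \<and> 1 \<le> i \<and> i \<le> t \<and> 1 \<le> j \<and> j \<le> t \<and> e < i \<and> e < j"
  by (auto simp: okr_def okg_def vtx_def)

lemma Iop_fs: "m \<in> fs {..<d j} \<Longrightarrow> Iop j m \<in> fs (Bs (-2) j)"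
  unfolding fsBs_iff row_Iop using pth_fs[OF M, of m j] by (auto simp: okr2 mlt_def)

lemma mv_iot:
  assumes m: "m \<in> fs {..<d j}"
  shows "mv (iot j) m = ci (Bs (-2) j) (Iop j m)"
  unfolding iot_def by (simp add: mv_opm[OF _ lin_Iop] co_nat[OF m])

lemma mv_iot': "mv (iot j) m = ci (Bs (-2) j) (Iop j (co {..<d j} m))"
  unfolding iot_def by (simp add: mv_opm[OF _ lin_Iop])

lemma ci_eqI:
  assumes "\<And>\<kappa> i e. okr n j \<kappa> i e \<Longrightarrow> row y \<kappa> i e = row z \<kappa> i e"
  shows "ci (Bs n j) y = ci (Bs n j) z"
proof -
  have "res (Bs n j) y = res (Bs n j) z"
  proof
    fix b
    show "res (Bs n j) y b = res (Bs n j) z b"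
    proof (cases "b \<in> Bs n j")
      case True
      then obtain \<kappa> i r e where b: "b = ((\<kappa>, i, r), e)" "okr n j \<kappa> i e"
        by (auto simp: FB_def Gs_def okr_def nu_def)
      then show ?thesis using fun_cong[OF assms[OF b(2)], of r] by (simp add: res_def row_def)
    qed (simp add: res_def)
  qed
  then show ?thesis using ci_res[OF finB, of n j y] ci_res[OF finB, of n j z] by simp
qed

text \<open>Applying an arrow to the vector first amounts to composing all paths with it on the
  right, and this is how the arrow acts on \<open>Nm\<close>.\<close>

lemma iot_hom: "is_hom t M (Nm t (Gs (-2)) nu) iot"
  unfolding is_hom_iff[OF M gens.N_module[OF gens_Gs]]
proof (intro conjI allI impI; (elim conjE)?)
  fix j show "iot j \<in> carrier_mat (dimv (Nm t (Gs (-2)) nu :: 'k rep) j) (d j)"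
    using opm_carrier[of "Bs (-2) j" "{..<d j}" "Iop j"] by (simp add: iot_def gens.dimF[OF gens_Gs])
next
  fix j and x :: "nat \<Rightarrow> 'k" assume j: "1 \<le> j" "j < t"
  define m where "m = co {..<d j} x"
  have m: "m \<in> fs {..<d j}" unfolding m_def by (rule co_fs) simp
  have ax: "a j x = a j m"
    unfolding m_def co_nat_res using mv_trunc[OF module_A[OF M, of j], of x] by simp
  have "row (Iop (Suc j) (a j m)) \<kappa> i e = row (sup1 (Iop j m)) \<kappa> i e" if o: "okr (-2) (Suc j) \<kappa> i e" for \<kappa> i e
    using pth_precomp_A[OF M j, of e i m] o j by (auto simp: row_Iop okr2)
  then have "ci (Bs (-2) (Suc j)) (Iop (Suc j) (a j m)) = ci (Bs (-2) (Suc j)) (sup1 (Iop j m))" by (rule ci_eqI)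
  then show "mv (iot (Suc j)) (a j x) = mv (arrA (Nm t (Gs (-2)) nu) j) (mv (iot j) x)"
    by (simp add: ax co_nat[OF a_fs] mv_iot' m_def[symmetric] gens.mvN[OF gens_Gs] co_ci[OF finB] res_id Iop_fs[OF m])
next
  fix j and x :: "nat \<Rightarrow> 'k" assume j: "1 \<le> j" "j < t"
  define m where "m = co {..<d (Suc j)} x"
  have m: "m \<in> fs {..<d (Suc j)}" unfolding m_def by (rule co_fs) simp
  have bx: "b j x = b j m"
    unfolding m_def co_nat_res using mv_trunc[OF module_B[OF M, of j], of x] by simp
  have "row (Iop j (b j m)) \<kappa> i e = row (Iop (Suc j) m) \<kappa> i e" if o: "okr (-2) j \<kappa> i e" for \<kappa> i e
    using pth_precomp_B[OF j(1), of e M i m] o j by (auto simp: row_Iop okr2)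
  then have "ci (Bs (-2) j) (Iop j (b j m)) = ci (Bs (-2) j) (Iop (Suc j) m)" by (rule ci_eqI)
  then show "mv (iot j) (b j x) = mv (arrB (Nm t (Gs (-2)) nu) j) (mv (iot (Suc j)) x)"
    by (simp add: bx co_nat[OF b_fs] mv_iot[OF b_fs] mv_iot' m_def[symmetric] gens.mvN[OF gens_Gs] co_ci[OF finB] res_id Iop_fs[OF m])
qed

section \<open>Cohomology of the Nakayama complex for modules vanishing at \<open>t\<close>\<close>

context
  assumes dt: "d t = 0"
begin

lemma Mt: "v \<in> fs {..<d t} \<Longrightarrow> v = 0" using dt by simp

text \<open>The equations say that the values of paths are compatible with \<alpha> and \<beta>.
  Degree -2 has no component at \<open>t\<close>, which is harmless because values of paths ending
  there lie in M_t = 0.\<close>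

lemma q2_Iop:
  assumes m: "m \<in> fs {..<d j}" and o: "okr (-1) j \<kappa> i e"
  shows "row (q2 (Iop j m)) \<kappa> i e = 0"
proof -
  have o': "1 \<le> i" "i < t" "1 \<le> j" "j \<le> t" "e < j" "e \<le> i" using o by (auto simp: okr1)
  have r: "row (Iop j m) 0 (Suc i) e = pth M (Suc i) e j m"
  proof (cases "Suc i < t")
    case False
    then have "Suc i = t" using o' by simp
    then have "pth M (Suc i) e j m = 0" using pth_fs[OF M m o'(5), of "Suc i"] o' Mt by simp
    then show ?thesis using False by (simp add: row_Iop okr2)
  qed (use o' in \<open>simp add: row_Iop okr2\<close>)
  consider "\<kappa> = 1" | "\<kappa> = 2" "e < i" using o by (auto simp: okr1)
  then show ?thesis
  proof cases
    case 1
    have "b i (pth M (Suc i) e j m) = (if e = 0 then 0 else pth M i (e - 1) j m)"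
      by (rule pth_B[OF M]) (use o' in auto)
    then show ?thesis using 1 o' r by (auto simp: row_q2 row_Iop okr2)
  next
    case 2
    have "a i (pth M i e j m) = pth M (Suc i) e j m" by (rule pth_A[OF 2(2)])
    then show ?thesis using 2 o' r by (auto simp: row_q2 row_Iop okr2)
  qed
qed

text \<open>A cocycle is determined by its value \<open>m\<close> at the trivial path: the
  components in \<alpha> summands propagate it down the diagonal \<open>i = e + 1\<close>, those in
  \<beta> summands from there upwards in \<open>i\<close>.\<close>

lemma q2_exact:
  assumes y: "y \<in> fs (Bs (-2) j)" and j: "j \<in> {1..t}" and 0: "\<And>\<kappa> i e. okr (-1) j \<kappa> i e \<Longrightarrow> row (q2 y) \<kappa> i e = 0"
  shows "\<exists>m\<in>fs {..<d j}. y = Iop j m"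
proof -
  define m where "m = row y 0 j (j - 1)"
  have m: "m \<in> fs {..<d j}" using row_fs[OF y, of 0 j "j - 1"] by (simp add: m_def mlt_def)
  have 1: "b i (row y 0 (Suc i) e) = (if e = 0 then 0 else row y 0 i (e - 1))"
    if "1 \<le> i" "i < t" "e \<le> i" "e < j" for i e
    using 0[of 1 i e] that j by (auto simp: okr1 row_q2)
  have 2: "row y 0 (Suc i) e = a i (row y 0 i e)" if "1 \<le> i" "i < t" "e < i" "e < j" for i e
    using 0[of 2 i e] that j by (auto simp: okr1 row_q2)
  have A: "row y 0 (Suc e) e = dnn M j m (j - Suc e)" if "Suc e \<le> j" for e
    using that
  proof (induction "j - Suc e" arbitrary: e)
    case 0
    then have "Suc e = j" by simp
    then show ?case by (auto simp: m_def)
  next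
    case (Suc n)
    then have n: "n = j - Suc (Suc e)" "Suc (Suc e) \<le> j" by auto
    have "row y 0 (Suc (Suc e)) (Suc e) = dnn M j m (j - Suc (Suc e))" by (rule Suc.hyps(1)[OF n])
    moreover have "b (Suc e) (row y 0 (Suc (Suc e)) (Suc e)) = row y 0 (Suc e) e"
      using 1[of "Suc e" "Suc e"] n j by simp
    moreover have "j - Suc e = Suc (j - Suc (Suc e))" "j - Suc (j - Suc (Suc e)) = Suc e" using n by auto
    ultimately show ?case by simp
  qed
  have Bb: "row y 0 i e = pth M i e j m" if "Suc e \<le> i" "i \<le> t" "e < j" for i e
    using that(1,2)
  proof (induction i rule: dec_induct)
    case base then show ?case using A[of e] that by (simp add: pth_def)
  next
    case (step i)
    then show ?case using 2[of i e] that pth_A[of e i M j m] by simp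
  qed
  have "y = Iop j m"
  proof (rule row_eqI)
    fix \<kappa> i e
    show "row y \<kappa> i e = row (Iop j m) \<kappa> i e"
      using Bb[of e i] row_0[OF y, of \<kappa> i e] by (cases "okr (-2) j \<kappa> i e") (auto simp: row_Iop okr2)
  qed
  then show ?thesis using m by blast
qed

text \<open>The preimage \<open>V\<close> is prescribed on the diagonal \<open>i = e + 1\<close> by
  the descending recursion \<open>Q\<close> and continued upwards in \<open>i\<close> by the \<beta>
  components. The \<alpha> components then follow from the cocycle condition, and M_t = 0 removes
  the value at \<open>t\<close>, for which degree -2 has no summand.\<close>

lemma q1_exact:
  assumes z: "z \<in> fs (Bs (-1) j)" and j: "j \<in> {1..t}" and 0: "\<And>\<kappa> i e. okr 0 j \<kappa> i e \<Longrightarrow> row (q1 z) \<kappa> i e = 0"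
  shows "\<exists>y\<in>fs (Bs (-2) j). \<forall>\<kappa> i e. okr (-1) j \<kappa> i e \<longrightarrow> row (q2 y) \<kappa> i e = row z \<kappa> i e"
proof -
  define Q where "Q e = dw M (\<lambda>i. row z 1 i i) j (Suc e)" for e
  define V where "V i e = upw M (\<lambda>k. if k = Suc e then Q e else if Suc e < k then - row z 2 (k - 1) e else 0) i" for i e
  have Qf: "Q e \<in> fs {..<d (Suc e)}" for e
  proof (cases "Suc e < j")
    case True
    then show ?thesis unfolding Q_def dw_unfold[OF True]
      using row_fs[OF z, of 1 "Suc e" "Suc e"] b_fs by (auto simp: mlt_def intro!: fs_add)
  qed (simp add: Q_def dw_top)
  have V0: "V i e = 0" if "i \<le> e" for i e
    using that
  proof (induction i)
    case (Suc i)
    then have "V i e = 0" by (simp add: fun_eq_iff)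
    then show ?case using Suc.prems by (simp add: V_def mv_lin)
  qed (simp add: V_def)
  have V1: "V (Suc e) e = Q e" for e using V0[of e e] by (simp add: V_def mv_lin)
  have V2: "V (Suc i) e = a i (V i e) - row z 2 i e" if "e < i" for i e using that by (simp add: V_def)
  have Vf: "V i e \<in> fs {..<d i}" for i e
  proof (cases i)
    case (Suc k)
    have "V (Suc k) e \<in> fs {..<d (Suc k)}"
    proof (cases "k = e \<or> k < e")
      case True then show ?thesis using V1 V0 Qf by auto
    next
      case False
      then show ?thesis using V2[of e k] a_fs row_fs[OF z, of 2 k e] by (auto simp: mlt_def intro!: fs_diff)
    qed
    then show ?thesis using Suc by simp
  qed (simp add: V0)
  have Vt: "V t e = 0" for e by (rule Mt[OF Vf])
  have cyc: "row z 1 i e = a (i - 1) (row z 1 (i - 1) e) - (if e = 0 then 0 else row z 2 (i - 1) (e - 1)) + b i (row z 2 i e)"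
    if "1 \<le> i" "i \<le> t" "e < i" "e < j" for i e
    using 0[of 0 i e] that j by (simp add: okr0 row_q1 algebra_simps split: if_splits)
  \<comment> \<open>The \<alpha> components: on the diagonal this is the recursion for
    \<open>Q\<close>; from \<open>i\<close> to \<open>Suc i\<close> it is carried by the cocycle
    condition and the relation of M.\<close>
  have U: "(if e = 0 then 0 else V i (e - 1)) - b i (V (Suc i) e) = row z 1 i e" if "e \<le> i" "i < t" "e < j" for i e
    using that(1,2)
  proof (induction i rule: dec_induct)
    case base
    show ?case
    proof (cases e)
      case 0
      then show ?thesis using row_0[OF z, of 1 0 0] by (simp add: okr1)
    next
      case (Suc e')
      have "Q e' = row z 1 e e + b e (Q e)"
        unfolding Q_def using Suc that(3) by (simp add: dw_unfold)
      then show ?thesis using Suc V1[of e'] V1[of e] by simp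
    qed
  next
    case (step i)
    have IH: "(if e = 0 then 0 else V i (e - 1)) - b i (V (Suc i) e) = row z 1 i e"
      using step.IH step.prems by (simp add: fun_eq_iff)
    have c: "row z 1 (Suc i) e = a i (row z 1 i e) - (if e = 0 then 0 else row z 2 i (e - 1)) + b (Suc i) (row z 2 (Suc i) e)"
      using cyc[of "Suc i" e] step that(3) by simp
    have w: "row z 2 i (e - 1) = a i (V i (e - 1)) - V (Suc i) (e - 1)" if "e \<noteq> 0"
      using V2[of "e - 1" i] that step by simp
    have w': "row z 2 (Suc i) e = a (Suc i) (V (Suc i) e) - V (Suc (Suc i)) e"
      using V2[of e "Suc i"] step by simp
    have r: "a i (b i (V (Suc i) e)) = b (Suc i) (a (Suc i) (V (Suc i) e))"
      using rel[of "Suc i" "V (Suc i) e"] step by simp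
    show ?case
      unfolding c IH[symmetric] w' using w r by (cases "e = 0") (simp_all add: mv_lin)
  qed
  define y where "y = (\<lambda>((\<kappa>, i, r), e). if okr (-2) j \<kappa> i e then V i e r else 0)"
  have ry: "row y \<kappa> i e = (if okr (-2) j \<kappa> i e then V i e else 0)" for \<kappa> i e
    by (auto simp: y_def row_def fun_eq_iff)
  have ry': "row y 0 i e = V i e" if "1 \<le> i" "i \<le> t" "e < i" "e < j" for i e
    using that j Vt[of e] by (cases "i = t") (auto simp: ry okr2)
  have "y \<in> fs (Bs (-2) j)" unfolding fsBs_iff ry using Vf by (auto simp: okr2 mlt_def)
  moreover have "row (q2 y) \<kappa> i e = row z \<kappa> i e" if o: "okr (-1) j \<kappa> i e" for \<kappa> i e
  proof -
    have o': "1 \<le> i" "i < t" "1 \<le> j" "j \<le> t" "e < j" "e \<le> i" using o by (auto simp: okr1)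
    consider "\<kappa> = 1" | "\<kappa> = 2" "e < i" using o by (auto simp: okr1)
    then show ?thesis
    proof cases
      case 1
      then show ?thesis using U[of e i] o' ry'[of "Suc i" e] ry'[of i "e - 1"] by (auto simp: row_q2)
    next
      case 2
      then show ?thesis using V2[of e i] o' ry'[of "Suc i" e] ry'[of i e] by (auto simp: row_q2)
    qed
  qed
  ultimately show ?thesis by blast
qed

text \<open>The \<alpha> summands suffice: \<open>U\<close> solves U_i - a_{i-1} U_{i-1} = x_i. At
  \<open>t\<close> there is no such summand, but all rows there lie in M_t = 0.\<close>

lemma q1_surj:
  assumes x: "x \<in> fs (Bs 0 j)" and j: "j \<in> {1..t}"
  shows "\<exists>z\<in>fs (Bs (-1) j). \<forall>\<kappa> i e. okr 0 j \<kappa> i e \<longrightarrow> row (q1 z) \<kappa> i e = row x \<kappa> i e"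
proof -
  define U where "U i e = upw M (\<lambda>k. if e < k then row x 0 k e else 0) i" for i e
  have U: "U (Suc i) e = row x 0 (Suc i) e + a i (U i e)" if "e < Suc i" for i e using that by (simp add: U_def)
  have Uf: "U i e \<in> fs {..<d i}" for i e
  proof (cases i)
    case (Suc k)
    then show ?thesis using row_fs[OF x, of 0 i e] a_fs[of k] by (auto simp: U_def mlt_def intro!: fs_add)
  qed (simp add: U_def)
  define z where "z = (\<lambda>((\<kappa>, i, r), e). if \<kappa> = 1 \<and> okr (-1) j \<kappa> i e then U i e r else 0)"
  have rz: "row z \<kappa> i e = (if \<kappa> = 1 \<and> okr (-1) j \<kappa> i e then U i e else 0)" for \<kappa> i e
    by (auto simp: z_def row_def fun_eq_iff)
  have "z \<in> fs (Bs (-1) j)" unfolding fsBs_iff rz using Uf by (auto simp: okr1 mlt_def)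
  moreover have "row (q1 z) \<kappa> i e = row x \<kappa> i e" if o: "okr 0 j \<kappa> i e" for \<kappa> i e
  proof (cases "i = t")
    case True
    have z': "z \<in> fs (Bs (-1) j)" by fact
    have "row (q1 z) \<kappa> i e \<in> fs {..<d t}"
      using o True row_fs[OF z', of 1 t e] row_fs[OF z', of 2 "t - 1" "e - 1"] a_fs[of "t - 1"] b_fs[of t]
      by (auto simp: row_q1 okr0 mlt_def intro!: fs_add fs_diff)
    moreover have "row x \<kappa> i e \<in> fs {..<d t}" using row_fs[OF x, of \<kappa> i e] o True by (auto simp: okr0 mlt_def)
    ultimately show ?thesis using Mt by metis
  next
    case False
    then have o': "\<kappa> = 0" "1 \<le> i" "i < t" "1 \<le> j" "j \<le> t" "e < j" "e < i" using o by (auto simp: okr0)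
    then obtain k where k: "i = Suc k" by (cases i) auto
    have "row z 1 k e = U k e \<or> k = 0" using o' k by (auto simp: rz okr1)
    moreover have "row z 1 i e = U i e" using o' by (auto simp: rz okr1)
    moreover have "row z 2 k (e - 1) = 0" "row z 2 i e = 0" by (auto simp: rz)
    ultimately show ?thesis using o' U[of e k] k by (auto simp: row_q1 mv_lin)
  qed
  ultimately show ?thesis by blast
qed

definition \<iota> :: "'k chom" where
  "\<iota> n = (if n = -2 then iot else hom_zero zero_rep (Nm t (Gs n) nu))"

lemma zero_rep_zero: "is_zero_rep zero_rep" by (simp add: is_zero_rep_def zero_rep_def)

lemma obj_NN: "obj NN n = Nm t (Gs n) nu" and dif_NN: "dif NN n = ND n" by (simp_all add: NN_def)

lemma dimNN: "dimv (obj NN n) j = card (Bs n j)" by (simp add: obj_NN gens.dimF[OF gens_Gs])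

lemma chom_\<iota>: "is_chom t (shift 2 (stalk M)) NN \<iota>"
  unfolding is_chom_iff[OF is_cpx_stalk[OF M] cpx_NN]
proof (intro conjI allI)
  fix n
  have mN: "is_module t (Nm t (Gs n) nu :: 'k rep)" using gens.N_module[OF gens_Gs] .
  show h: "is_hom t (obj (shift 2 (stalk M)) n) (obj NN n) (\<iota> n)"
    using iot_hom is_hom_zero[OF is_module_zero mN] by (simp add: obj_stalk obj_NN \<iota>_def)
  fix i x
  show "mv (\<iota> (n + 1) i) (mv (dif (shift 2 (stalk M)) n i) x) = mv (dif NN n i) (mv (\<iota> n i) x)"
  proof (cases "n = -2")
    case True
    define m where "m = co {..<d i} x"
    have m: "m \<in> fs {..<d i}" unfolding m_def by (rule co_fs) simp
    have "mv (dif NN n i) (mv (\<iota> n i) x) = ci (Bs (-1) i) (q2 (Iop i m))"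
      using True by (simp add: \<iota>_def dif_NN mv_ND mv_iot' m_def[symmetric] co_ci[OF finB] res_id Iop_fs[OF m] qop_def)
    also have "\<dots> = ci (Bs (-1) i) 0" by (rule ci_eqI) (simp add: q2_Iop[OF m])
    finally show ?thesis by (simp add: ci_lin mv_lin)
  next
    case False
    then have "is_hom t zero_rep (obj NN n) (\<iota> n)" using h by (simp add: obj_stalk)
    then show ?thesis by (simp add: zero_rep_mv[OF zero_rep_zero] mv_lin)
  qed
qed

lemma ND_zero_imp:
  assumes "mv (ND n j) (ci (Bs n j) y) = 0" "y \<in> fs (Bs n j)" "okr (n + 1) j \<kappa> i e" 
    "\<And>\<kappa> i e. okr (n + 1) j \<kappa> i e \<Longrightarrow> row (qop n y) \<kappa> i e \<in> fs {..<mlt \<kappa> i}"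
  shows "row (qop n y) \<kappa> i e = 0"
proof
  fix r
  have "ci (Bs (n + 1) j) (qop n y) = 0" using assms(1,2) by (simp add: mv_ND co_ci[OF finB] res_id)
  then have "res (Bs (n + 1) j) (qop n y) = 0" using co_ci[OF finB, of "n + 1" j "qop n y"] by (simp add: lin_zero[OF lin_co])
  then have "res (Bs (n + 1) j) (qop n y) ((\<kappa>, i, r), e) = 0" by simp
  moreover have "((\<kappa>, i, r), e) \<in> Bs (n + 1) j" if "r < mlt \<kappa> i"
    using assms(3) that by (auto simp: FB_def Gs_def okr_def nu_def)
  ultimately show "row (qop n y) \<kappa> i e r = 0 r"
    using assms(4)[OF assms(3)] by (cases "r < mlt \<kappa> i") (auto simp: res_def row_def fs_def)
qed

lemma q1_row_fs: "y \<in> fs (Bs (-1) j) \<Longrightarrow> okr 0 j \<kappa> i e \<Longrightarrow> row (q1 y) \<kappa> i e \<in> fs {..<mlt \<kappa> i}"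
  using row_fs[of y "-1" j 1 i e] row_fs[of y "-1" j 2 "i - 1" "e - 1"] a_fs[of "i - 1"] b_fs[of i]
  by (auto simp: row_q1 okr0 mlt_def intro!: fs_add fs_diff)

lemma q2_row_fs: "y \<in> fs (Bs (-2) j) \<Longrightarrow> okr (-1) j \<kappa> i e \<Longrightarrow> row (q2 y) \<kappa> i e \<in> fs {..<mlt \<kappa> i}"
  using row_fs[of y "-2" j 0 i "e - 1"] row_fs[of y "-2" j 0 "Suc i" e] a_fs[of i] b_fs[of i]
  by (auto simp: row_q2 okr1 mlt_def intro!: fs_add fs_diff fs_uminus)

lemma \<iota>_qi: "quasi_iso t (shift 2 (stalk M)) NN \<iota>"
  unfolding quasi_iso_iff[OF is_cpx_stalk[OF M] cpx_NN]
proof (intro conjI allI ballI impI chom_\<iota>)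
  fix n i x and y :: "nat \<Rightarrow> 'k"
  assume x: "x \<in> fs {..<dimv (obj (shift 2 (stalk M)) n) i}" and y: "y \<in> fs {..<dimv (obj NN (n - 1)) i}"
    and e: "mv (dif (shift 2 (stalk M)) n i) x = 0 \<and> mv (\<iota> n i) x = mv (dif NN (n - 1) i) y"
  have "x = 0"
  proof (cases "n = -2 \<and> i \<in> {1..t} \<and> i \<noteq> t")
    case True
    have xm: "x \<in> fs {..<d i}" using x True by (simp add: obj_stalk)
    have "Bs (-3) i = {}" by (auto simp: FB_def Gs_def okg_def)
    then have "y = 0" using y True by (simp add: dimNN)
    then have "ci (Bs (-2) i) (Iop i x) = ci (Bs (-2) i) 0" using e True by (simp add: \<iota>_def mv_iot[OF xm] mv_lin ci_lin)
    then have "Iop i x = 0" using ci_inj[OF finB Iop_fs[OF xm] fs_zero] by simp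
    \<comment> \<open>The trivial path at \<open>i\<close> recovers \<open>x\<close>; it is
      available because \<open>i < t\<close>.\<close>
    then have "row (Iop i x) 0 i (i - 1) = 0" by simp
    then show ?thesis using True pth_self[of i M x] by (auto simp: row_Iop okr2 split: if_splits)
  next
    case False
    then have "dimv (obj (shift 2 (stalk M)) n) i = 0" using d_out[of i] dt by (auto simp: obj_stalk zero_rep_def)
    then show ?thesis using x by simp
  qed
  then show "\<exists>z\<in>fs {..<dimv (obj (shift 2 (stalk M)) (n - 1)) i}. x = mv (dif (shift 2 (stalk M)) (n - 1) i) z"
    by (intro bexI[of _ 0]) auto
next
  fix n j and y :: "nat \<Rightarrow> 'k"
  assume y: "y \<in> fs {..<dimv (obj NN n) j}" and 0: "mv (dif NN n j) y = 0"
  define Y where "Y = co (Bs n j) y"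
  have Y: "Y \<in> fs (Bs n j)" unfolding Y_def by (rule co_fs[OF finB])
  have yY: "y = ci (Bs n j) Y" using y by (simp add: Y_def dimNN ci_co[OF finB])
  have z0: "mv (ND n j) (ci (Bs n j) Y) = 0" using 0 by (simp add: dif_NN yY)
  show "\<exists>x\<in>fs {..<dimv (obj (shift 2 (stalk M)) n) j}. \<exists>b\<in>fs {..<dimv (obj NN (n - 1)) j}.
           mv (dif (shift 2 (stalk M)) n j) x = 0 \<and> y = mv (\<iota> n j) x + mv (dif NN (n - 1) j) b"
  proof (cases "j \<in> {1..t} \<and> n \<in> {0, -1, -2}")
    case False
    then have "Bs n j = {}" by (auto simp: FB_def Gs_def okg_def)
    then have "y = 0" using y by (simp add: dimNN)
    then show ?thesis by (intro bexI[of _ 0]) (auto simp: mv_lin)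
  next
    case True
    then consider "n = -2" | "n = -1" | "n = 0" by auto
    then show ?thesis
    proof cases
      case 1
      have Y': "Y \<in> fs (Bs (-2) j)" using Y 1 by simp
      have "row (q2 Y) \<kappa> i e = 0" if "okr (-1) j \<kappa> i e" for \<kappa> i e
        using ND_zero_imp[OF z0 Y, of \<kappa> i e] that q2_row_fs[OF Y'] 1 by (simp add: qop_def)
      then obtain m where m: "m \<in> fs {..<d j}" "Y = Iop j m" using q2_exact[OF Y'] True by blast
      then have "y = mv (\<iota> n j) m" using 1 yY by (simp add: \<iota>_def mv_iot)
      then show ?thesis using m(1) 1 by (intro bexI[of _ m] bexI[of _ 0]) (auto simp: mv_lin obj_stalk)
    next
      case 2
      have Y': "Y \<in> fs (Bs (-1) j)" using Y 2 by simp
      have "row (q1 Y) \<kappa> i e = 0" if "okr 0 j \<kappa> i e" for \<kappa> i e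
        using ND_zero_imp[OF z0 Y, of \<kappa> i e] that q1_row_fs[OF Y'] 2 by (simp add: qop_def)
      then obtain z where z: "z \<in> fs (Bs (-2) j)" "\<And>\<kappa> i e. okr (-1) j \<kappa> i e \<Longrightarrow> row (q2 z) \<kappa> i e = row Y \<kappa> i e"
        using q1_exact[OF Y'] True by blast
      have "ci (Bs (-1) j) (q2 z) = ci (Bs (-1) j) Y" by (rule ci_eqI[OF z(2)])
      then have "y = mv (dif NN (n - 1) j) (ci (Bs (-2) j) z)"
        using 2 yY by (simp add: dif_NN mv_ND co_ci[OF finB] res_id z(1) qop_def)
      then show ?thesis using 2
        by (intro bexI[of _ 0] bexI[of _ "ci (Bs (-2) j) z"]) (auto simp: mv_lin dimNN ci_fs)
    next
      case 3
      have Y': "Y \<in> fs (Bs 0 j)" using Y 3 by simp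
      obtain z where z: "z \<in> fs (Bs (-1) j)" "\<And>\<kappa> i e. okr 0 j \<kappa> i e \<Longrightarrow> row (q1 z) \<kappa> i e = row Y \<kappa> i e"
        using q1_surj[OF Y'] True by blast
      have "ci (Bs 0 j) (q1 z) = ci (Bs 0 j) Y" by (rule ci_eqI[OF z(2)])
      then have "y = mv (dif NN (n - 1) j) (ci (Bs (-1) j) z)"
        using 3 yY by (simp add: dif_NN mv_ND co_ci[OF finB] res_id z(1) qop_def)
      then show ?thesis using 3
        by (intro bexI[of _ 0] bexI[of _ "ci (Bs (-1) j) z"]) (auto simp: mv_lin dimNN ci_fs)
    qed
  qed
qed

lemma serre: "is_serre t (stalk M) (shift 2 (stalk M))"
  unfolding is_serre_def
  using proj_res nak_NN D_iso_quasi_iso[OF cpx_NN is_cpx_stalk[OF M] \<iota>_qi] by blast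

end

end

section \<open>Bricks and indecomposable modules\<close>

definition brick :: "nat \<Rightarrow> 'k::field rep \<Rightarrow> bool" where
  "brick t M \<longleftrightarrow> \<not> is_zero_rep M \<and> (\<forall>f. is_hom t M M f \<longrightarrow> (\<exists>c. f = c \<cdot>\<^sub>h hom_id M))"

lemma diag_mult:
  assumes "A1 \<in> carrier_mat n1 m1" "A2 \<in> carrier_mat n2 m2" "B1 \<in> carrier_mat m1 l1" "B2 \<in> carrier_mat m2 l2"
  shows "four_block_mat A1 (0\<^sub>m n1 m2) (0\<^sub>m n2 m1) A2 * four_block_mat B1 (0\<^sub>m m1 l2) (0\<^sub>m m2 l1) B2
    = four_block_mat (A1 * B1) (0\<^sub>m n1 l2) (0\<^sub>m n2 l1) (A2 * (B2 :: 'k::field mat))"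
  by (subst mult_four_block_mat[OF assms(1) _ _ assms(2,3) _ _ assms(4)])
    (use assms in \<open>auto intro!: cong_four_block_mat\<close>)

lemma direct_sum_module:
  assumes "is_module t M1" "is_module t M2"
  shows "is_module t (direct_sum M1 M2 :: 'k::field rep)"
proof -
  note A = module_A[OF assms(1)] module_A[OF assms(2)] and B = module_B[OF assms(1)] module_B[OF assms(2)]
  have "arrB (direct_sum M1 M2) i * arrA (direct_sum M1 M2) i
     = four_block_mat (arrB M1 i * arrA M1 i) (0\<^sub>m (dimv M1 i) (dimv M2 i)) (0\<^sub>m (dimv M2 i) (dimv M1 i)) (arrB M2 i * arrA M2 i)" for i
    using diag_mult[OF B(1) B(2) A(1) A(2), of i i] by (simp add: direct_sum_def)
  moreover have "arrA (direct_sum M1 M2) (i - 1) * arrB (direct_sum M1 M2) (i - 1)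
     = four_block_mat (arrA M1 (i - 1) * arrB M1 (i - 1)) (0\<^sub>m (dimv M1 i) (dimv M2 i)) (0\<^sub>m (dimv M2 i) (dimv M1 i)) (arrA M2 (i - 1) * arrB M2 (i - 1))"
    if "2 \<le> i" for i
    using diag_mult[OF A(1) A(2) B(1) B(2), of "i - 1" "i - 1"] that by (simp add: direct_sum_def)
  ultimately show ?thesis
    using assms A B unfolding is_module_def by (auto simp: direct_sum_def)
qed

text \<open>The projection to a direct summand, transported to \<open>M\<close>, would be a scalar,
  yet its diagonal entries are 1 on one summand and 0 on the other.\<close>

lemma brick_indecomposable:
  assumes M: "is_module t M" and b: "brick t (M :: 'k::field rep)"
  shows "indecomposable t M"
  unfolding indecomposable_def
proof (intro conjI notI)
  show "is_zero_rep M \<Longrightarrow> False" using b by (simp add: brick_def)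
  assume "\<exists>M1 M2. is_module t M1 \<and> is_module t M2 \<and> \<not> is_zero_rep M1 \<and> \<not> is_zero_rep M2 \<and>
    rep_iso t M (direct_sum M1 M2)"
  then obtain M1 M2 where M1: "is_module t M1" and M2: "is_module t M2"
    and nz: "\<not> is_zero_rep M1" "\<not> is_zero_rep M2" and iso: "rep_iso t M (direct_sum M1 M2)" by blast
  let ?S = "direct_sum M1 M2"
  note S = direct_sum_module[OF M1 M2]
  obtain f g where f: "is_hom t M ?S f" and g: "is_hom t ?S M g" and fg: "f \<circ>\<^sub>h g = hom_id ?S"
    using iso unfolding rep_iso_def by blast
  note A = module_A[OF M1] module_A[OF M2] and B = module_B[OF M1] module_B[OF M2]
  define e where "e = (\<lambda>i. four_block_mat (1\<^sub>m (dimv M1 i)) (0\<^sub>m (dimv M1 i) (dimv M2 i))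
      (0\<^sub>m (dimv M2 i) (dimv M1 i)) (0\<^sub>m (dimv M2 i) (dimv M2 i)) :: 'k mat)"
  have e: "is_hom t ?S ?S e"
  proof -
    have 0: "1\<^sub>m n \<in> carrier_mat n n" "0\<^sub>m n n \<in> carrier_mat n n" for n by auto
    have "e (Suc i) * arrA ?S i = arrA ?S i * e i" for i
      using diag_mult[OF 0(1) 0(2) A(1) A(2), of i i] diag_mult[OF A(1) A(2) 0(1) 0(2), of i i] A[of i]
      by (simp add: direct_sum_def e_def)
    moreover have "e i * arrB ?S i = arrB ?S i * e (Suc i)" for i
      using diag_mult[OF 0(1) 0(2) B(1) B(2), of i i] diag_mult[OF B(1) B(2) 0(1) 0(2), of i i] B[of i]
      by (simp add: direct_sum_def e_def)
    ultimately show ?thesis by (simp add: is_hom_def e_def) (simp add: direct_sum_def)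
  qed
  obtain c where c: "g \<circ>\<^sub>h (e \<circ>\<^sub>h f) = c \<cdot>\<^sub>h hom_id M"
    using b is_hom_comp[OF M S M is_hom_comp[OF M S S f e] g] unfolding brick_def by blast
  have fg': "mv (f i) (mv (g i) x) = x" if "x \<in> fs {..<dimv ?S i}" for i x
    unfolding mv_comp[OF g f, symmetric] fg by (rule mv_hom_id[OF that])
  have ec: "mv (e i) x = scl c x" if x: "x \<in> fs {..<dimv ?S i}" for i x
  proof -
    have "mv (g i) (mv (e i) x) = mv (g i) (mv (e i) (mv (f i) (mv (g i) x)))" by (simp add: fg'[OF x])
    also have "\<dots> = mv ((g \<circ>\<^sub>h (e \<circ>\<^sub>h f)) i) (mv (g i) x)"
      by (simp add: mv_comp[OF is_hom_comp[OF M S S f e] g] mv_comp[OF f e])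
    also have "\<dots> = scl c (mv (g i) x)" unfolding c by (simp add: mv_hom_smult mv_hom_id hom_fs[OF g])
    finally have "mv (f i) (mv (g i) (mv (e i) x)) = mv (f i) (scl c (mv (g i) x))" by (rule arg_cong)
    then show ?thesis by (simp add: fg'[OF hom_fs[OF e]] fg'[OF x] mv_lin)
  qed
  have ed: "e i $$ (r, r) = c" if "r < dimv ?S i" for i r
    using mv_dlt[OF hom_c[OF e] that that] ec[OF fs_dlt, of r i] that by (simp add: dlt_def)
  obtain i1 i2 where "dimv M1 i1 \<noteq> 0" "dimv M2 i2 \<noteq> 0" using nz by (auto simp: is_zero_rep_def)
  then have "c = 1" "c = 0"
    using ed[of 0 i1] ed[of "dimv M1 i2" i2] by (simp_all add: e_def direct_sum_def)
  then show False by simp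
qed

text \<open>Entries of arrows that cross the boundary of \<open>S\<close> are simply dropped, so the
  relations may fail in general.\<close>

definition restr :: "'k::field rep \<Rightarrow> nat set \<Rightarrow> 'k rep" where
  "restr M S = (let d = (\<lambda>i. if i \<in> S then dimv M i else 0) in
     \<lparr>dimv = d, arrA = (\<lambda>i. mat (d (i + 1)) (d i) (\<lambda>p. arrA M i $$ p)),
      arrB = (\<lambda>i. mat (d i) (d (i + 1)) (\<lambda>p. arrB M i $$ p))\<rparr>)"

lemma mult_thin:
  fixes A B :: "'k::field mat"
  assumes "A \<in> carrier_mat n m" "B \<in> carrier_mat m n" "n \<le> 1" "m \<le> 1"
  shows "A * B = mat n n (\<lambda>p. if m = 1 then A $$ (0, 0) * B $$ (0, 0) else 0)"
proof -
  have "n = 0 \<or> n = 1" "m = 0 \<or> m = 1" using assms(3,4) by auto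
  then show ?thesis using assms(1,2) by (auto intro!: eq_matI simp: scalar_prod_def)
qed

text \<open>No nonzero arrow joins \<open>S\<close> to its complement, so dropping the crossing
  entries loses nothing. As each vertex belongs to one part only, the direct sum is equal to
  \<open>M\<close>, not merely isomorphic.\<close>

lemma thin_restr:
  assumes M: "is_module t (M :: 'k::field rep)" and th: "\<And>i. dimv M i \<le> 1"
    and van: "\<And>i. 1 \<le> i \<Longrightarrow> i < t \<Longrightarrow> dimv M i = 1 \<Longrightarrow> dimv M (Suc i) = 1 \<Longrightarrow> (i \<in> S) \<noteq> (Suc i \<in> S) \<Longrightarrow>
      arrA M i $$ (0, 0) = 0 \<and> arrB M i $$ (0, 0) = 0"
  shows "is_module t (restr M S)" "direct_sum (restr M S) (restr M (- S)) = M"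
proof -
  define R where "R = restr M S"
  have dR: "dimv R i = (if i \<in> S then dimv M i else 0)" for i by (simp add: R_def restr_def Let_def)
  have cA: "arrA R i \<in> carrier_mat (dimv R (Suc i)) (dimv R i)" and cB: "arrB R i \<in> carrier_mat (dimv R i) (dimv R (Suc i))" for i
    by (auto simp: R_def restr_def Let_def)
  have dR1: "dimv R i \<le> 1" for i using th by (simp add: dR)
  have eA: "arrA R i $$ (0, 0) = arrA M i $$ (0, 0)" and eB: "arrB R i $$ (0, 0) = arrB M i $$ (0, 0)"
    if "dimv R i = 1" "dimv R (Suc i) = 1" for i
    using that by (simp_all add: R_def restr_def Let_def split: if_splits)
  have BA: "arrB R i * arrA R i = arrB M i * arrA M i" if i: "i \<in> S" "1 \<le> i" "i < t" for i
    unfolding mult_thin[OF cB cA dR1 dR1] mult_thin[OF module_B[OF M] module_A[OF M] th th]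
    using i th[of i] th[of "Suc i"] van[of i] eA[of i] eB[of i] by (auto intro!: eq_matI simp: dR)
  have AB: "arrA R k * arrB R k = arrA M k * arrB M k" if i: "Suc k \<in> S" "1 \<le> k" "k < t" for k
    unfolding mult_thin[OF cA cB dR1 dR1] mult_thin[OF module_A[OF M] module_B[OF M] th th]
    using i th[of k] th[of "Suc k"] van[of k] eA[of k] eB[of k] by (auto intro!: eq_matI simp: dR)
  have z: "X = Y" if "X \<in> carrier_mat 0 0" "Y \<in> carrier_mat 0 0" for X Y :: "'k mat"
    using that by (intro eq_matI) auto
  have "arrB R 1 * arrA R 1 = 0\<^sub>m (dimv R 1) (dimv R 1)" if "2 \<le> t"
  proof (cases "1 \<in> S")
    case True
    then show ?thesis using BA[of 1] that M by (simp add: is_module_def dR)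
  next
    case False
    then show ?thesis using cA[of 1] cB[of 1] by (intro z) (auto simp: dR)
  qed
  moreover have "arrA R (i - 1) * arrB R (i - 1) = arrB R i * arrA R i" if i: "2 \<le> i" "i \<le> t - 1" for i
  proof (cases "i \<in> S")
    case True
    then show ?thesis using BA[of i] AB[of "i - 1"] i M by (simp add: is_module_def)
  next
    case False
    then show ?thesis using cA[of i] cB[of i] cA[of "i - 1"] cB[of "i - 1"] i by (intro z) (auto simp: dR)
  qed
  ultimately show "is_module t (restr M S)"
    using cA cB module_dim0[OF M] unfolding R_def[symmetric] is_module_def by (auto simp: dR)
  have r: "1 \<le> i \<and> i < t" if "dimv M i = 1" "dimv M (Suc i) = 1" for i
    using that module_dim0[OF M, of i] module_dim0[OF M, of "Suc i"] by (cases "i \<in> {1..t}"; cases "Suc i \<in> {1..t}") auto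
  have d01: "dimv M i = 0 \<or> dimv M i = 1" for i using th[of i] by auto
  show "direct_sum (restr M S) (restr M (- S)) = M"
  proof (rule rep.equality)
    show "arrA (direct_sum (restr M S) (restr M (- S))) = arrA M"
    proof
      fix i show "arrA (direct_sum (restr M S) (restr M (- S))) i = arrA M i"
        using d01[of i] d01[of "Suc i"] r[of i] van[of i] module_A[OF M, of i]
        by (intro eq_matI) (auto simp: direct_sum_def restr_def Let_def split: if_splits)
    qed
    show "arrB (direct_sum (restr M S) (restr M (- S))) = arrB M"
    proof
      fix i show "arrB (direct_sum (restr M S) (restr M (- S))) i = arrB M i"
        using d01[of i] d01[of "Suc i"] r[of i] van[of i] module_B[OF M, of i]
        by (intro eq_matI) (auto simp: direct_sum_def restr_def Let_def split: if_splits)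
    qed
  qed (auto simp: direct_sum_def restr_def Let_def fun_eq_iff)
qed

text \<open>An endomorphism is a scalar at each vertex, and an arrow between vertices with different
  scalars must vanish. The vertices sharing the scalar of \<open>i0\<close> therefore split off, and
  indecomposability leaves nothing else.\<close>

lemma thin_brick:
  assumes M: "is_module t (M :: 'k::field rep)" and th: "thin t M" and ind: "indecomposable t M"
  shows "brick t M"
  unfolding brick_def
proof (intro conjI allI impI)
  show nz: "\<not> is_zero_rep M" using ind by (simp add: indecomposable_def)
  fix f assume f: "is_hom t M M f"
  have th1: "dimv M i \<le> 1" for i
  proof (cases "i \<in> {1..t}")
    case True
    then have "dimv M i \<in> {0, 1}" using th unfolding thin_def by blast
    then show ?thesis by auto
  qed (simp add: module_dim0[OF M])
  obtain i0 where i0: "dimv M i0 \<noteq> 0" using nz by (auto simp: is_zero_rep_def)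
  \<comment> \<open>At a vertex with M_i = 0 the entry is meaningless, but it is immaterial for the
    restriction whether such a vertex belongs to \<open>S\<close>.\<close>
  define S where "S = {i. f i $$ (0, 0) = f i0 $$ (0, 0)}"
  have van: "arrA M i $$ (0, 0) = 0 \<and> arrB M i $$ (0, 0) = 0"
    if i: "1 \<le> i" "i < t" "dimv M i = 1" "dimv M (Suc i) = 1" "(i \<in> S) \<noteq> (Suc i \<in> S)" for i
  proof -
    have c: "f i \<in> carrier_mat 1 1" "f (Suc i) \<in> carrier_mat 1 1" "arrA M i \<in> carrier_mat 1 1" "arrB M i \<in> carrier_mat 1 1"
      using hom_c[OF f, of i] hom_c[OF f, of "Suc i"] module_A[OF M, of i] module_B[OF M, of i] i by auto
    have "f (Suc i) * arrA M i = arrA M i * f i" "f i * arrB M i = arrB M i * f (Suc i)"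
      using f i by (auto simp: is_hom_def)
    moreover have p: "(A * B) $$ (0, 0) = A $$ (0, 0) * B $$ (0, 0)" if "A \<in> carrier_mat 1 1" "B \<in> carrier_mat 1 1" for A B :: "'k mat"
      unfolding mult_thin[OF that order.refl order.refl] by simp
    ultimately have "(f (Suc i) * arrA M i) $$ (0, 0) = (arrA M i * f i) $$ (0, 0)"
      "(f i * arrB M i) $$ (0, 0) = (arrB M i * f (Suc i)) $$ (0, 0)" by simp_all
    then have "f (Suc i) $$ (0, 0) * arrA M i $$ (0, 0) = arrA M i $$ (0, 0) * f i $$ (0, 0)"
      "f i $$ (0, 0) * arrB M i $$ (0, 0) = arrB M i $$ (0, 0) * f (Suc i) $$ (0, 0)"
      unfolding p[OF c(2,3)] p[OF c(3,1)] p[OF c(1,4)] p[OF c(4,2)] by simp_all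
    moreover have "f i $$ (0, 0) \<noteq> f (Suc i) $$ (0, 0)" using i(5) by (auto simp: S_def)
    ultimately show ?thesis by (simp add: mult.commute)
  qed
  have van': "arrA M i $$ (0, 0) = 0 \<and> arrB M i $$ (0, 0) = 0"
    if "1 \<le> i" "i < t" "dimv M i = 1" "dimv M (Suc i) = 1" "(i \<in> - S) \<noteq> (Suc i \<in> - S)" for i
    using van[of i] that by auto
  have iso: "rep_iso t M M" unfolding rep_iso_def
    using is_hom_id[OF M] by (intro exI[of _ "hom_id M"]) (auto simp: hom_comp_def hom_id_def)
  have "\<not> is_zero_rep (restr M S)" using i0 by (auto simp: is_zero_rep_def restr_def S_def intro!: exI[of _ i0])
  moreover have "direct_sum (restr M S) (restr M (- S)) = M" by (rule thin_restr(2)[OF M th1]) (rule van)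
  then have "rep_iso t M (direct_sum (restr M S) (restr M (- S)))" using iso by simp
  moreover have "is_module t (restr M S)" by (rule thin_restr(1)[OF M th1]) (rule van)
  moreover have "is_module t (restr M (- S))" by (rule thin_restr(1)[OF M th1]) (rule van')
  ultimately have "is_zero_rep (restr M (- S))"
    using ind unfolding indecomposable_def by blast
  then have S: "f i $$ (0, 0) = f i0 $$ (0, 0)" if "dimv M i \<noteq> 0" for i
    using that by (auto simp: is_zero_rep_def restr_def Let_def S_def split: if_splits)
  have "f = (f i0 $$ (0, 0)) \<cdot>\<^sub>h hom_id M"
  proof
    fix i show "f i = ((f i0 $$ (0, 0)) \<cdot>\<^sub>h hom_id M) i"
    proof (rule eq_matI)
      fix r s assume "r < dim_row (((f i0 $$ (0, 0)) \<cdot>\<^sub>h hom_id M) i)" "s < dim_col (((f i0 $$ (0, 0)) \<cdot>\<^sub>h hom_id M) i)"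
      then have rs: "r < dimv M i" "s < dimv M i" by (simp_all add: hom_smult_def hom_id_def)
      then have "r = 0" "s = 0" using th1[of i] by linarith+
      then show "f i $$ (r, s) = ((f i0 $$ (0, 0)) \<cdot>\<^sub>h hom_id M) i $$ (r, s)"
        using S[of i] rs by (simp add: hom_smult_def hom_id_def)
    qed (use hom_c[OF f, of i] in \<open>auto simp: hom_smult_def hom_id_def\<close>)
  qed
  then show "\<exists>c. f = c \<cdot>\<^sub>h hom_id M" by blast
qed

lemma fdim_1_iff:
  fixes S :: "('b \<Rightarrow> 'k::field) set"
  assumes S: "fsub S"
  shows "fdim S = 1 \<longleftrightarrow> (\<exists>v. v \<noteq> 0 \<and> S = range (\<lambda>c. scl c v))"
proof
  assume 1: "fdim S = 1"
  obtain B where B: "B \<subseteq> S" "fnv.independent B" "S \<subseteq> fspan B" "card B = fdim S" by (rule fnv.basis_exists)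
  obtain v where v: "B = {v}" using card_1_singletonE[of B] B(4) 1 by auto
  have "fspan B \<subseteq> S" by (rule fnv.span_minimal[OF B(1) S])
  then have "S = range (\<lambda>c. scl c v)" using B(3) fnv.span_singleton[of v] v by auto
  moreover have "v \<noteq> 0" using B(2) v by simp
  ultimately show "\<exists>v. v \<noteq> 0 \<and> S = range (\<lambda>c. scl c v)" by blast
next
  assume "\<exists>v. v \<noteq> 0 \<and> S = range (\<lambda>c. scl c v)"
  then obtain v where v: "v \<noteq> 0" "S = range (\<lambda>c. scl c v)" by blast
  have s: "fspan {v} = S" using fnv.span_singleton[of v] v by simp
  have "fspan S = S" using S by (simp only: fnv.span_eq_iff)
  then have "fspan {v} = fspan S" unfolding s ..
  from fnv.dim_eq_card[OF this] v(1) show "fdim S = 1" by simp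
qed

context std
begin

section \<open>Endomorphisms\<close>

text \<open>Row and column are exchanged: in the cochain index the generator \<open>r\<close>, a
  basis vector of the source, comes first.\<close>

definition emat :: "(gidx \<times> nat \<Rightarrow> 'k) \<Rightarrow> 'k hom" where
  "emat z i = mat (d i) (d i) (\<lambda>(r', r). z ((0, i, r), r'))"

definition ecoc :: "'k hom \<Rightarrow> gidx \<times> nat \<Rightarrow> 'k" where
  "ecoc f = (\<lambda>((\<kappa>, i, r), r'). if ((\<kappa>, i, r), r') \<in> CI 0 then f i $$ (r', r) else 0)"

lemma CI0: "((\<kappa>, i, r), r') \<in> CI 0 \<longleftrightarrow> \<kappa> = 0 \<and> r < d i \<and> r' < d i"
  using d_out[of i] by (cases "i \<in> {1..t}") (auto simp: CI_def okg_def mlt_def vtx_def)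

lemma mv_emat: "v \<in> fs {..<d i} \<Longrightarrow> ev 0 h 0 i v = mv (emat z i) v"
  if "is_hom t (obj PP 0) M h" "cv 0 h = z" "1 \<le> i" "i \<le> t"
proof (rule ev_eq[OF M that(1) lin_mv])
  fix r assume r: "r < mlt 0 i"
  then have r': "r < d i" by (simp add: mlt_def)
  show "ev 0 h 0 i (dlt r) = mv (emat z i) (dlt r)"
  proof
    fix r'
    show "ev 0 h 0 i (dlt r) r' = mv (emat z i) (dlt r) r'"
    proof (cases "r' < d i")
      case True
      have "emat z i \<in> carrier_mat (d i) (d i)" by (simp add: emat_def)
      from mv_dlt[OF this True r'] have "mv (emat z i) (dlt r) r' = z ((0, i, r), r')" using True r' by (simp add: emat_def)
      then show ?thesis using that r unfolding that(2)[symmetric] by (simp add: cv_def okg_def)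
    next
      case False
      then show ?thesis using ev_fs[OF that(1), of 0 i "dlt r"] by (auto simp: fs_def mv_def emat_def vtx_def)
    qed
  qed
qed (simp_all add: mlt_def)

text \<open>By \<open>ev_d1\<close> the coboundary of a family of matrices is its commutator with
  the arrows.\<close>

lemma Zc0_iff:
  assumes z: "z \<in> fs (CI 0)"
  shows "z \<in> Zc 0 \<longleftrightarrow> is_hom t M M (emat z)"
proof -
  define h where "h = hm 0 z"
  have h: "is_hom t (obj PP 0) M h" unfolding h_def by (rule hm)
  have hz: "cv 0 h = z" unfolding h_def by (simp add: hm(2) res_id z)
  note e = mv_emat[OF h hz]
  have coc: "z \<in> Zc 0 \<longleftrightarrow> (\<forall>j x. mv (h j) (mv (dif PP (-1) j) x) = 0)"
    using cocycle_iff[of 0 h] h by (simp add: hz cocycle_hom_def del: obj_PP)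
  have c: "emat z i \<in> carrier_mat (d i) (d i)" for i by (simp add: emat_def)
  show ?thesis
  proof
    assume "z \<in> Zc 0"
    then have 0: "mv (h j) (mv (dif PP (-1) j) x) = 0" for j x using coc by blast
    have h': "is_hom t (obj PP (-1 + 1)) M h" using h by simp
    have z0: "ev (-1) (h \<circ>\<^sub>h dif PP (-1)) \<kappa> i v = 0" for \<kappa> i v
      unfolding ev_def mv_comp[OF cpx_dif[OF cpx_PP] h'] by (rule 0)
    show "is_hom t M M (emat z)"
      unfolding is_hom_iff[OF M M]
    proof (intro conjI allI impI c; elim conjE)
      fix i and x :: "nat \<Rightarrow> 'k" assume i: "1 \<le> i" "i < t"
      define m where "m = (\<lambda>r. if r < d i then x r else 0)"
      have m: "m \<in> fs {..<d i}" by (simp add: m_def fs_def)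
      have "mv (emat z (Suc i)) (a i m) = a i (mv (emat z i) m)"
        using ev_d1(1)[OF M h i m] e[of i m] e[of "Suc i" "a i m"] i m a_fs by (simp add: z0)
      then show "mv (emat z (Suc i)) (a i x) = a i (mv (emat z i) x)"
        unfolding m_def mv_trunc[OF module_A[OF M]] mv_trunc[OF c] .
    next
      fix i and x :: "nat \<Rightarrow> 'k" assume i: "1 \<le> i" "i < t"
      define m where "m = (\<lambda>r. if r < d (Suc i) then x r else 0)"
      have m: "m \<in> fs {..<d (Suc i)}" by (simp add: m_def fs_def)
      have "mv (emat z i) (b i m) = b i (mv (emat z (Suc i)) m)"
        using ev_d1(2)[OF M h i m] e[of "Suc i" m] e[of i "b i m"] i m b_fs by (simp add: z0)
      then show "mv (emat z i) (b i x) = b i (mv (emat z (Suc i)) x)"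
        unfolding m_def mv_trunc[OF module_B[OF M]] mv_trunc[OF c] .
    qed
  next
    assume E: "is_hom t M M (emat z)"
    have "mv (h j) (mv (dif PP (-1) j) x) = 0" for j x
      by (rule hom_d1_zero[OF M h]) (simp_all add: e a_fs b_fs hom_A[OF M M E] hom_B[OF M M E])
    then show "z \<in> Zc 0" using coc by blast
  qed
qed

lemma ecoc_emat: "z \<in> fs (CI 0) \<Longrightarrow> ecoc (emat z) = z"
  by (auto simp: ecoc_def emat_def CI0 fs_def fun_eq_iff)

lemma emat_ecoc: "is_hom t M M f \<Longrightarrow> emat (ecoc f) = f"
proof
  fix i assume f: "is_hom t M M f"
  show "emat (ecoc f) i = f i" using hom_c[OF f, of i] by (intro eq_matI) (auto simp: ecoc_def emat_def CI0)
qed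

lemma ecoc_fs: "ecoc f \<in> fs (CI 0)" by (auto simp: ecoc_def fs_def)

lemma ecoc_smult: "is_hom t M M f \<Longrightarrow> ecoc (c \<cdot>\<^sub>h f) = scl c (ecoc f)"
proof -
  assume f: "is_hom t M M f"
  have "dim_row (f i) = d i" "dim_col (f i) = d i" for i using hom_c[OF f, of i] by auto
  then show ?thesis by (auto simp: ecoc_def CI0 hom_smult_def fun_eq_iff)
qed

lemma ecoc_Zc: "is_hom t M M f \<Longrightarrow> ecoc f \<in> Zc 0"
  by (simp add: Zc0_iff[OF ecoc_fs] emat_ecoc)

text \<open>Degree-zero cocycles are the endomorphisms, and the identity is a nonzero one as soon as
  M is nonzero; dimension one means that it spans.\<close>

lemma brick_iff: "brick t M \<longleftrightarrow> fdim (Zc 0) = 1"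
proof -
  note id = is_hom_id[OF M]
  have id0: "ecoc (hom_id M) \<noteq> 0" if nz: "\<not> is_zero_rep M"
  proof
    assume e: "ecoc (hom_id M) = 0"
    obtain i where "d i \<noteq> 0" using nz by (auto simp: is_zero_rep_def)
    then show False using fun_cong[OF e, of "((0, i, 0), 0)"] by (simp add: ecoc_def CI0 hom_id_def)
  qed
  show ?thesis unfolding fdim_1_iff[OF fsub_Zc]
  proof
    assume b: "brick t M"
    let ?v = "ecoc (hom_id M)"
    have "Zc 0 = range (\<lambda>c. scl c ?v)"
    proof safe
      fix z assume z: "z \<in> Zc 0"
      then have zf: "z \<in> fs (CI 0)" using Zc_fs by blast
      then obtain c where "emat z = c \<cdot>\<^sub>h hom_id M" using b z Zc0_iff[OF zf] by (auto simp: brick_def)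
      then have "z = scl c ?v" using ecoc_emat[OF zf] ecoc_smult[OF id, of c] by simp
      then show "z \<in> range (\<lambda>c. scl c ?v)" by blast
    next
      fix c show "scl c ?v \<in> Zc 0" by (rule fnv.subspace_scale[OF fsub_Zc ecoc_Zc[OF id]])
    qed
    moreover have "?v \<noteq> 0" using b id0 by (simp add: brick_def)
    ultimately show "\<exists>v. v \<noteq> 0 \<and> Zc 0 = range (\<lambda>c. scl c v)" by blast
  next
    assume "\<exists>v. v \<noteq> 0 \<and> Zc 0 = range (\<lambda>c. scl c v)"
    then obtain v where v: "v \<noteq> 0" "Zc 0 = range (\<lambda>c. scl c v)" by blast
    have nz: "\<not> is_zero_rep M"
    proof
      assume "is_zero_rep M"
      then have "CI 0 = {}" by (auto simp: is_zero_rep_def CI0)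
      moreover have "scl 1 v \<in> Zc 0" unfolding v(2) by blast
      ultimately have "scl 1 v = 0" using Zc_fs[of 0] by auto
      then show False using v(1) by (simp add: fun_eq_iff)
    qed
    obtain c0 where c0: "ecoc (hom_id M) = scl c0 v" using ecoc_Zc[OF id] v(2) by blast
    then have c0n: "c0 \<noteq> 0" using id0[OF nz] by (auto simp: fun_eq_iff)
    have "\<exists>c. f = c \<cdot>\<^sub>h hom_id M" if f: "is_hom t M M f" for f
    proof -
      obtain c where "ecoc f = scl c v" using ecoc_Zc[OF f] v(2) by blast
      then have "ecoc f = scl (c / c0) (ecoc (hom_id M))" using c0 c0n by (simp add: fun_eq_iff)
      then have "emat (ecoc f) = emat (ecoc ((c / c0) \<cdot>\<^sub>h hom_id M))" by (simp add: ecoc_smult[OF id])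
      then show ?thesis using emat_ecoc[OF f] emat_ecoc[OF is_hom_smult[OF M M id]] by auto
    qed
    then show "brick t M" using nz by (simp add: brick_def)
  qed
qed

section \<open>Extensions of bricks\<close>

lemma Zc2: "Zc (-2) = fs (CI (-2))"
proof -
  have "Dc (-2) c = 0" for c using Dc_fs[of "-2" c] CI_empty[of "-3"] by simp
  then show ?thesis by (auto simp: Zc_def)
qed

lemma Bc2: "Bc (-2) \<subseteq> fs (CI (-2))" using Bc_Zc[of "-2"] Zc2 by simp

lemma CI2: "((\<kappa>, i, r), r') \<in> CI (-2) \<longleftrightarrow> \<kappa> = 0 \<and> 1 \<le> i \<and> i < t \<and> r < d i \<and> r' < d i"
  by (auto simp: CI_def okg_def mlt_def vtx_def)

text \<open>The sum of the traces of a degree-two cochain over the vertices i < t, valued in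
  functions on the one-point type so that rank-nullity for \<open>lin\<close> applies.\<close>

definition tr :: "(gidx \<times> nat \<Rightarrow> 'k) \<Rightarrow> unit \<Rightarrow> 'k" where
  "tr c = (\<lambda>_. \<Sum>b\<in>CI (-2). if snd (snd (fst b)) = snd b then c b else 0)"

lemma lin_tr: "lin tr"
  unfolding lin_def tr_def
  by (auto simp: fun_eq_iff sum.distrib[symmetric] sum_distrib_left intro!: sum.cong)

text \<open>A functional separating \<open>z\<close> from the boundaries is, by
  \<open>ext2_dual\<close>, an endomorphism vanishing at \<open>t\<close>, hence a scalar
  \<open>c\<close>, and its value at \<open>z\<close> is \<open>c\<close> times the trace. So
  \<open>c\<close> is nonzero, which makes the trace nonzero and forces M_t = 0.\<close>

lemma brick_separation:
  assumes b: "brick t M" and z: "z \<in> fs (CI (-2))" "z \<notin> Bc (-2)"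
  shows "d t = 0" "tr z \<noteq> 0"
proof -
  have "\<exists>w. (\<forall>u\<in>Bc (-2). (\<Sum>b\<in>CI (-2). w b * u b) = 0) \<and> (\<Sum>b\<in>CI (-2). w b * z b) \<noteq> 0"
    by (rule separation[OF finCI fsub_Bc Bc2 z]) blast
  then obtain w where w: "\<And>u. u \<in> Bc (-2) \<Longrightarrow> (\<Sum>b\<in>CI (-2). w b * u b) = 0" "(\<Sum>b\<in>CI (-2). w b * z b) \<noteq> 0"
    by blast
  define u where "u = (\<lambda>i. mat (d i) (d i) (\<lambda>(r, r'). if 1 \<le> i \<and> i < t then w ((0, i, r), r') else 0))"
  have "is_hom t M M u" unfolding u_def by (rule ext2_dual[OF w(1)])
  then obtain c where c: "u = c \<cdot>\<^sub>h hom_id M" using b by (auto simp: brick_def)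
  have wc: "w ((\<kappa>, i, r), r') = (if r = r' then c else 0)" if "((\<kappa>, i, r), r') \<in> CI (-2)" for \<kappa> i r r'
    using arg_cong[OF fun_cong[OF c, of i], of "\<lambda>A. A $$ (r, r')"] that by (simp add: u_def CI2 hom_smult_def hom_id_def)
  have "(\<Sum>b\<in>CI (-2). w b * z b) = (\<Sum>b\<in>CI (-2). c * (if snd (snd (fst b)) = snd b then z b else 0))"
    by (intro sum.cong refl) (auto simp: wc)
  also have "\<dots> = c * tr z ()" by (simp add: tr_def sum_distrib_left)
  finally have n: "c \<noteq> 0" "tr z () \<noteq> 0" using w(2) by auto
  show "tr z \<noteq> 0" using n(2) by (auto simp: fun_eq_iff)
  show "d t = 0"
  proof (rule ccontr)
    assume "d t \<noteq> 0"
    then show False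
      using arg_cong[OF fun_cong[OF c, of t], of "\<lambda>A. A $$ (0, 0)"] n(1) by (simp add: u_def hom_smult_def hom_id_def)
  qed
qed

lemma brick_ext2_zero: "brick t M \<Longrightarrow> d t \<noteq> 0 \<Longrightarrow> fdim (Zc (-2)) = fdim (Bc (-2))"
proof -
  assume b: "brick t M" and dt: "d t \<noteq> 0"
  have "Zc (-2) \<subseteq> Bc (-2)"
  proof
    fix z assume "z \<in> Zc (-2)"
    then show "z \<in> Bc (-2)" using brick_separation(1)[OF b, of z] dt by (auto simp: Zc2)
  qed
  then have "Zc (-2) = Bc (-2)" using Bc_Zc[of "-2"] by (rule subset_antisym)
  then show ?thesis by simp
qed

text \<open>Cochains of trace zero are boundaries, and they have codimension at most one.\<close>

lemma brick_ext2_le: 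
  assumes b: "brick t M"
  shows "fdim (Zc (-2)) \<le> fdim (Bc (-2)) + 1"
proof -
  have "{c \<in> fs (CI (-2)). tr c = 0} \<subseteq> Bc (-2)"
  proof
    fix z assume "z \<in> {c \<in> fs (CI (-2)). tr c = 0}"
    then show "z \<in> Bc (-2)" using brick_separation(2)[OF b, of z] by auto
  qed
  then have "fdim {c \<in> fs (CI (-2)). tr c = 0} \<le> fdim (Bc (-2))"
    by (rule fdim_mono[OF finCI fsub_Bc Bc2 fsub_ker[OF fsub_fs lin_tr]])
  moreover have "fdim (tr ` fs (CI (-2))) \<le> fdim (fs (UNIV :: unit set) :: (unit \<Rightarrow> 'k) set)"
    by (rule fdim_mono[OF finite _ _ fsub_image[OF fsub_fs lin_tr]]) (auto simp: fsub_fs fs_def)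
  moreover have "fdim (fs (UNIV :: unit set) :: (unit \<Rightarrow> 'k) set) = 1" by (simp add: fdim_fs)
  ultimately show ?thesis
    using rank_nullity[OF finCI[of "-2"] fsub_fs subset_refl lin_tr] unfolding Zc2 by linarith
qed

text \<open>Since |x| <= x^2 for integers, \<chi> bounds the total variation of the dimension vector
  started at d_0 = 0: at least d_i up to \<open>i\<close>, and at least |d_t - d_i| from
  \<open>i\<close> to \<open>t\<close>.\<close>

lemma chi_ge: "i \<le> t \<Longrightarrow> int (d i) + \<bar>int (d t) - int (d i)\<bar> \<le> \<chi>"
proof -
  assume i: "i \<le> t"
  have S: "\<bar>int (d (p + n)) - int (d p)\<bar> \<le> (\<Sum>k\<in>{p..<p + n}. (int (d (Suc k)) - int (d k))\<^sup>2)" for p n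
  proof (induction n)
    case (Suc n)
    have "\<bar>x\<bar> \<le> x\<^sup>2" for x :: int
      using mult_mono[of 1 "\<bar>x\<bar>" "\<bar>x\<bar>" "\<bar>x\<bar>"] by (cases "x = 0") (auto simp: power2_eq_square)
    from this[of "int (d (Suc (p + n))) - int (d (p + n))"] show ?case using Suc by simp
  qed simp
  have "\<chi> = (\<Sum>k\<in>{0..<i}. (int (d (Suc k)) - int (d k))\<^sup>2) + (\<Sum>k\<in>{i..<t}. (int (d (Suc k)) - int (d k))\<^sup>2)"
    using i by (simp add: \<chi>_def lessThan_atLeast0 sum.atLeastLessThan_concat)
  then show ?thesis using S[of 0 i] S[of i "t - i"] i d_out[of 0] by simp
qed

text \<open>\<open>e1\<close> is the dimension of Ext^1 as a natural number; the leading 1 is the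
  dimension of the endomorphism ring.\<close>

lemma euler_brick:
  assumes "brick t M"
  obtains e1 where "fdim (Zc (-1)) = fdim (Bc (-1)) + e1"
    "1 - int e1 + (int (fdim (Zc (-2))) - int (fdim (Bc (-2)))) = \<chi>"
proof -
  have "fdim (Bc (-1)) \<le> fdim (Zc (-1))" by (rule fdim_mono[OF finCI fsub_Zc Zc_fs fsub_Bc Bc_Zc])
  then have "fdim (Zc (-1)) = fdim (Bc (-1)) + (fdim (Zc (-1)) - fdim (Bc (-1)))" by simp
  moreover have "1 - int (fdim (Zc (-1)) - fdim (Bc (-1))) + (int (fdim (Zc (-2))) - int (fdim (Bc (-2)))) = \<chi>"
    using euler assms \<open>fdim (Bc (-1)) \<le> fdim (Zc (-1))\<close> by (simp add: brick_iff of_nat_diff)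
  ultimately show ?thesis by (rule that)
qed

lemma graded_Hom_iff:
  assumes "\<And>i. i \<noteq> 0 \<Longrightarrow> i \<noteq> 1 \<Longrightarrow> i \<noteq> 2 \<Longrightarrow> h i = 0"
  shows "graded_Hom_is t (stalk M) (stalk M) h \<longleftrightarrow>
    fdim (Zc 0) = h 0 \<and> fdim (Zc (-1)) = fdim (Bc (-1)) + h 1 \<and> fdim (Zc (-2)) = fdim (Bc (-2)) + h 2"
proof -
  have "fdim (Zc (- i)) = fdim (Bc (- i)) + h i" if "i \<noteq> 0" "i \<noteq> 1" "i \<noteq> 2" for i
    using that by (simp add: assms Zc_out Bc_top)
  then have "(\<forall>i. fdim (Zc (- i)) = fdim (Bc (- i)) + h i) \<longleftrightarrow>
      (\<forall>i\<in>{0, 1, 2}. fdim (Zc (- i)) = fdim (Bc (- i)) + h i)" by blast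
  also have "\<dots> \<longleftrightarrow> fdim (Zc 0) = h 0 \<and> fdim (Zc (-1)) = fdim (Bc (-1)) + h 1 \<and> fdim (Zc (-2)) = fdim (Bc (-2)) + h 2"
    by (simp add: Bc_top)
  finally show ?thesis unfolding graded_Hom_is_def ext_dim .
qed

theorem exceptional_iff: "exceptional t (stalk M) \<longleftrightarrow> indecomposable t M \<and> thin t M \<and> rk t M = 1"
proof -
  have ex: "exceptional t (stalk M) \<longleftrightarrow> brick t M \<and> fdim (Zc (-1)) = fdim (Bc (-1)) \<and> fdim (Zc (-2)) = fdim (Bc (-2))"
    unfolding exceptional_def brick_iff by (subst graded_Hom_iff) auto
  show ?thesis
  proof
    assume "exceptional t (stalk M)"
    then have b: "brick t M" and e: "fdim (Zc (-1)) = fdim (Bc (-1))" "fdim (Zc (-2)) = fdim (Bc (-2))" using ex by auto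
    have "\<chi> = 1" by (rule euler_brick[OF b]) (use e in simp)
    then have le: "int (d i) + \<bar>int (d t) - int (d i)\<bar> \<le> 1" if "i \<le> t" for i using chi_ge[OF that] by simp
    obtain i where "d i \<noteq> 0" using b by (auto simp: brick_def is_zero_rep_def)
    moreover have "i \<le> t" using calculation d_out[of i] by (cases "i \<le> t") auto
    \<comment> \<open>A nonzero d_i with d_i + |d_t - d_i| <= 1 forces d_i = d_t = 1.\<close>
    ultimately have "d t = 1" using le[of i] le[of t] by linarith
    moreover have "d i \<in> {0, 1}" if "i \<in> {1..t}" for i
    proof -
      have "int (d i) \<le> 1" using le[of i] that by simp
      then show ?thesis by auto
    qed
    ultimately show "indecomposable t M \<and> thin t M \<and> rk t M = 1"
      using brick_indecomposable[OF M b] by (simp add: thin_def rk_def)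
  next
    assume "indecomposable t M \<and> thin t M \<and> rk t M = 1"
    then have b: "brick t M" and dt: "d t = 1" using thin_brick[OF M] by (auto simp: rk_def)
    have e2: "fdim (Zc (-2)) = fdim (Bc (-2))" using brick_ext2_zero[OF b] dt by simp
    have "1 \<le> \<chi>" using chi_ge[of t] dt by simp
    \<comment> \<open>Ext^2 = 0 leaves \<chi> = 1 - \<open>e1\<close>, and \<chi> >= 1 forces
      \<open>e1\<close> to be zero.\<close>
    then have "fdim (Zc (-1)) = fdim (Bc (-1))" by (rule_tac euler_brick[OF b]) (use e2 in simp)
    then show "exceptional t (stalk M)" using ex b e2 by simp
  qed
qed

theorem spherical_iff: "spherical t 2 (stalk M) \<longleftrightarrow> indecomposable t M \<and> thin t M \<and> rk t M = 0"
proof -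
  have sp: "spherical t 2 (stalk M) \<longleftrightarrow> is_serre t (stalk M) (shift 2 (stalk M)) \<and>
      brick t M \<and> fdim (Zc (-1)) = fdim (Bc (-1)) \<and> fdim (Zc (-2)) = fdim (Bc (-2)) + 1"
    unfolding spherical_def brick_iff by (subst graded_Hom_iff) auto
  show ?thesis
  proof
    assume "spherical t 2 (stalk M)"
    then have b: "brick t M" and e: "fdim (Zc (-1)) = fdim (Bc (-1))" "fdim (Zc (-2)) = fdim (Bc (-2)) + 1" using sp by auto
    have "\<chi> = 2" by (rule euler_brick[OF b]) (use e in simp)
    then have le: "int (d i) + \<bar>int (d t) - int (d i)\<bar> \<le> 2" if "i \<le> t" for i using chi_ge[OF that] by simp
    \<comment> \<open>Otherwise Ext^2 would vanish.\<close>
    have dt: "d t = 0" using brick_ext2_zero[OF b] e(2) by auto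
    have "d i \<in> {0, 1}" if "i \<in> {1..t}" for i
    proof -
      \<comment> \<open>With d_t = 0 the bound reads 2 d_i <= 2.\<close>
      have "int (d i) \<le> 1" using le[of i] that dt by simp
      then show ?thesis by auto
    qed
    then show "indecomposable t M \<and> thin t M \<and> rk t M = 0"
      using brick_indecomposable[OF M b] dt by (simp add: thin_def rk_def)
  next
    assume "indecomposable t M \<and> thin t M \<and> rk t M = 0"
    then have b: "brick t M" and dt: "d t = 0" using thin_brick[OF M] by (auto simp: rk_def)
    obtain i where i: "d i \<noteq> 0" using b by (auto simp: brick_def is_zero_rep_def)
    then have "i \<le> t" using d_out[of i] by (cases "i \<le> t") auto
    then have "2 \<le> \<chi>" using chi_ge[of i] dt i by simp
    \<comment> \<open>\<chi> is 1 - \<open>e1\<close> plus the dimension of Ext^2, which is at most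
      1. Reaching 2 forces \<open>e1\<close> to be zero and Ext^2 to be one-dimensional.\<close>
    then have "fdim (Zc (-1)) = fdim (Bc (-1)) \<and> fdim (Zc (-2)) = fdim (Bc (-2)) + 1"
      by (rule_tac euler_brick[OF b]) (use brick_ext2_le[OF b] in linarith)
    then show "spherical t 2 (stalk M)" using sp b serre[OF dt] by simp
  qed
qed

end

theorem theorem2p2:
  fixes t :: nat and M :: "'k::alg_closed_field rep"
  assumes "1 \<le> t" and "is_module t M"
  shows "(exceptional t (stalk M) \<longleftrightarrow> indecomposable t M \<and> thin t M \<and> rk t M = 1) \<and>
         (spherical t 2 (stalk M) \<longleftrightarrow> indecomposable t M \<and> thin t M \<and> rk t M = 0)"
proof -
  interpret std t M by unfold_locales (rule assms(2))
  show ?thesis using exceptional_iff spherical_iff by blast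
qed

end
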